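(* Let $0<\alpha<\tfrac12$, let $L:\mathbb R\to(0,\infty)$ be slowly varying, and let $\mu$ be a probability measure on $\mathbb N$ with $\mu(\{n,n+1,\ldots\})\sim n^{-\alpha}L(n)$ as $n\to\infty$ and $\gcd\{n\in\mathbb N:\mu(\{n\})>0\}=1$. Let $Y$ be a real-valued random variable, and assume that one of the following conditions (A) or (B) holds: (A) $Y=\xi-(2p-1)$, where $\mathbf P(\xi=+1)=p$ and $\mathbf P(\xi=-1)=1-p$ for some $p\in(0,1)$. (B) The renewal weights $q_n$ of $\mu$ satisfy $q_n\sim\frac{1}{\Gamma(\alpha)\Gamma(1-\alpha)}\frac{n^{\alpha-1}}{L(n)}$ as $n\to\infty$, and $\mathbf E[Y]=0$, $0<\mathbf E[Y^4]<\infty$. Then the rescaled processes $S^{(n)}$ converge as $n\to\infty$, in the sense of finite dimensional distributions, to fractional Brownian motion with Hurst parameter $H=\tfrac12+\alpha$.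
   Context: Here $\mathbb N=\{1,2,\ldots\}$, and $f(n)\sim g(n)$ for real sequences means $f(n)/g(n)\to1$. Random graph: let $(R_i)_{i\in\mathbb Z}$ be i.i.d. with distribution $\mu$. $\mathcal G_\mu$ is the random directed graph with vertex set $\mathbb Z$ and edge set $\{(i,i-R_i):i\in\mathbb Z\}$; connected components are taken ignoring edge directions. Renewal weights: $q_n:=\mathbf P(\tilde R_1+\cdots+\tilde R_j=n\text{ for some }j\ge0)$, with $\tilde R_1,\tilde R_2,\ldots$ independent with distribution $\mu$. Colouring: each connected component of $\mathcal G_\mu$ is coloured by an independent copy of $Y$ (colours independent of each other and of $\mathcal G_\mu$); $Y_i$ is the colour of the component containing $i\in\mathbb Z$. Put $S_n:=\sum_{i=1}^nY_i$ ($S_0=0$) and $\sigma_n^2:=\mathbf{Var}[S_n]$. Rescaled process: for $n\in\mathbb N$, $S^{(n)}=(S^{(n)}(t))_{t\ge0}$ is the continuous process with $S^{(n)}(i/n)=S_i/\sigma_n$ for $i\in\mathbb N_0$, and linear on each interval $[\frac{i-1}n,\frac in]$, $i\in\mathbb N$. Fractional Brownian motion with Hurst parameter $H$ is the centered Gaussian process on $[0,\infty)$ with a.s. continuous paths and covariance function $\frac12\left(s^{2H}+t^{2H}-|t-s|^{2H}\right)$, $s,t\ge0$. *)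

theory Defs
  imports "HOL-Probability.Probability" "HOL-Library.Landau_Symbols"
begin

text \<open>
  Slow variation is meant at infinity. No measurability of \<open>L\<close> is required.
\<close>

definition slowly_varying :: "(real \<Rightarrow> real) \<Rightarrow> bool" where
  "slowly_varying L \<longleftrightarrow> (\<forall>c>0. ((\<lambda>x. L (c * x) / L x) \<longlongrightarrow> 1) at_top)"

text \<open>
  A realisation \<open>r\<close> of the jumps determines the directed graph on \<open>\<int>\<close> with edges
  \<open>(i, i - r i)\<close>. Its components are the classes of the equivalence relation generated by the
  edges.
\<close>

definition jump_edges :: "(int \<Rightarrow> nat) \<Rightarrow> (int \<times> int) set" where
  "jump_edges r = {(i, i - int (r i)) | i. True}"

definition component :: "(int \<Rightarrow> nat) \<Rightarrow> int \<Rightarrow> int set" where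
  "component r i = {j. (i, j) \<in> (jump_edges r \<union> (jump_edges r)\<inverse>)\<^sup>*}"

text \<open>
  The components form a random, countable family. To colour them by independent random variables,
  each component is named by one of its vertices, and the colour of a component is the variable
  with that index from an i.i.d. family \<open>(Z k)\<close> which is independent of the graph. The choice
  \<open>rep\<close> of the vertex is arbitrary, except that it has to depend measurably on the graph. Its
  choice does not affect the joint law of the jumps and the coloured integers.
\<close>

definition component_naming :: "(int set \<Rightarrow> int) \<Rightarrow> bool" where
  "component_naming rep \<longleftrightarrow>
     (\<forall>r i. rep (component r i) \<in> component r i) \<and>
     (\<forall>i. (\<lambda>r. rep (component r i)) \<in>
        measurable (Pi\<^sub>M UNIV (\<lambda>_. count_space UNIV)) (count_space UNIV))"

definition vertex_colour ::
  "(int set \<Rightarrow> int) \<Rightarrow> (int \<Rightarrow> 'a \<Rightarrow> nat) \<Rightarrow> (int \<Rightarrow> 'a \<Rightarrow> real) \<Rightarrow> int \<Rightarrow> 'a \<Rightarrow> real" where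
  "vertex_colour rep R Z i \<omega> = Z (rep (component (\<lambda>k. R k \<omega>) i)) \<omega>"

definition is_coloured_graph ::
  "'a measure \<Rightarrow> nat pmf \<Rightarrow> real measure \<Rightarrow> (int \<Rightarrow> 'a \<Rightarrow> nat) \<Rightarrow> (int \<Rightarrow> 'a \<Rightarrow> real) \<Rightarrow> bool" where
  "is_coloured_graph M \<mu> \<nu> R Z \<longleftrightarrow>
     prob_space M \<and>
     prob_space.indep_vars M (\<lambda>_. count_space UNIV) R UNIV \<and>
     (\<forall>i. distr M (count_space UNIV) (R i) = measure_pmf \<mu>) \<and>
     prob_space.indep_vars M (\<lambda>_. borel) Z UNIV \<and>
     (\<forall>k. distr M borel (Z k) = \<nu>) \<and>
     prob_space.indep_var M
       (Pi\<^sub>M UNIV (\<lambda>_. count_space UNIV)) (\<lambda>\<omega> i. R i \<omega>)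
       (Pi\<^sub>M UNIV (\<lambda>_. borel)) (\<lambda>\<omega> k. Z k \<omega>)"

definition renewal_weight :: "nat pmf \<Rightarrow> nat \<Rightarrow> real" where
  "renewal_weight \<mu> n =
     measure (Pi\<^sub>M UNIV (\<lambda>_::nat. measure_pmf \<mu>)) {w. \<exists>j. (\<Sum>i<j. w i) = n}"

definition partial_sum :: "(int \<Rightarrow> 'a \<Rightarrow> real) \<Rightarrow> nat \<Rightarrow> 'a \<Rightarrow> real" where
  "partial_sum X n \<omega> = (\<Sum>i = 1..n. X (int i) \<omega>)"

definition std_dev_sum :: "'a measure \<Rightarrow> (int \<Rightarrow> 'a \<Rightarrow> real) \<Rightarrow> nat \<Rightarrow> real" where
  "std_dev_sum M X n = sqrt (prob_space.variance M (partial_sum X n))"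

text \<open>
  The linear interpolation of \<open>i / n \<mapsto> S\<^sub>i / \<sigma>\<^sub>n\<close>. The two lemmas below state its
  characteristic properties.
\<close>

definition rescaled_process ::
  "'a measure \<Rightarrow> (int \<Rightarrow> 'a \<Rightarrow> real) \<Rightarrow> nat \<Rightarrow> real \<Rightarrow> 'a \<Rightarrow> real" where
  "rescaled_process M X n t \<omega> =
     (let i = nat \<lfloor>real n * t\<rfloor> in
       ((1 - frac (real n * t)) * partial_sum X i \<omega> + frac (real n * t) * partial_sum X (Suc i) \<omega>)
         / std_dev_sum M X n)"

lemma rescaled_process_grid:
  assumes "n > 0"
  shows "rescaled_process M X n (real i / real n) \<omega> = partial_sum X i \<omega> / std_dev_sum M X n"
  using assms by (simp add: rescaled_process_def frac_def)

lemma rescaled_process_linear: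
  assumes "n > 0" and "0 \<le> s" "s \<le> 1"
  shows "rescaled_process M X n ((real i + s) / real n) \<omega> =
    (1 - s) * rescaled_process M X n (real i / real n) \<omega> +
    s * rescaled_process M X n (real (Suc i) / real n) \<omega>"
proof (cases "s = 1")
  case True
  then show ?thesis by (simp add: add.commute)
next
  case False
  with assms have s: "0 \<le> s" "s < 1" by auto
  have fl: "\<lfloor>real i + s\<rfloor> = int i" using s by (simp add: floor_unique)
  have fr: "frac (real i + s) = s" unfolding frac_def fl by simp
  have "rescaled_process M X n ((real i + s) / real n) \<omega> =
      ((1 - s) * partial_sum X i \<omega> + s * partial_sum X (Suc i) \<omega>) / std_dev_sum M X n"
    using assms(1) by (simp add: rescaled_process_def fl fr)
  then show ?thesis
    by (simp only: rescaled_process_grid[OF assms(1)] add_divide_distrib times_divide_eq_right)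
qed

text \<open>
  Gaussian laws may be degenerate: the case \<open>s = 0\<close> gives the constants.
\<close>

definition gaussian_rv :: "'b measure \<Rightarrow> ('b \<Rightarrow> real) \<Rightarrow> bool" where
  "gaussian_rv N X \<longleftrightarrow> X \<in> borel_measurable N \<and>
     (\<exists>m s. distr N borel X = distr std_normal_distribution borel (\<lambda>x. m + s * x))"

definition gaussian_process :: "'b measure \<Rightarrow> real set \<Rightarrow> (real \<Rightarrow> 'b \<Rightarrow> real) \<Rightarrow> bool" where
  "gaussian_process N T B \<longleftrightarrow>
     (\<forall>F c. finite F \<and> F \<subseteq> T \<longrightarrow> gaussian_rv N (\<lambda>\<omega>. \<Sum>t\<in>F. c t * B t \<omega>))"

definition fractional_brownian_motion :: "real \<Rightarrow> 'b measure \<Rightarrow> (real \<Rightarrow> 'b \<Rightarrow> real) \<Rightarrow> bool" where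
  "fractional_brownian_motion H N B \<longleftrightarrow>
     prob_space N \<and>
     gaussian_process N {0..} B \<and>
     (\<forall>t\<ge>0. prob_space.expectation N (B t) = 0) \<and>
     (\<forall>s\<ge>0. \<forall>t\<ge>0. prob_space.expectation N (\<lambda>\<omega>. B s \<omega> * B t \<omega>) =
        (s powr (2 * H) + t powr (2 * H) - \<bar>t - s\<bar> powr (2 * H)) / 2) \<and>
     (AE \<omega> in N. continuous_on {0..} (\<lambda>t. B t \<omega>))"

text \<open>
  Weak convergence of Borel probability measures. The library's \<open>weak_conv_m\<close> covers only
  measures on the real line.
\<close>

definition weak_convergence ::
  "(nat \<Rightarrow> 'c::topological_space measure) \<Rightarrow> 'c measure \<Rightarrow> bool" where
  "weak_convergence \<mu>s \<mu> \<longleftrightarrow>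
     (\<forall>f :: 'c \<Rightarrow> real. continuous_on UNIV f \<and> bounded (range f) \<longrightarrow>
        (\<lambda>n. \<integral>x. f x \<partial>\<mu>s n) \<longlonglongrightarrow> (\<integral>x. f x \<partial>\<mu>))"

text \<open>
  Component namings exist, for instance the first vertex in an enumeration of \<open>\<int>\<close>.
\<close>

lemma component_naming_exists:
  "component_naming (\<lambda>K. from_nat (LEAST n. from_nat n \<in> K))"
proof -
  let ?P = "Pi\<^sub>M UNIV (\<lambda>_::int. count_space (UNIV :: nat set))"
  define U where "U r = jump_edges r \<union> (jump_edges r)\<inverse>" for r
  have refl: "i \<in> component r i" for r i
    by (simp add: component_def)
  have in_comp: "from_nat (LEAST n. from_nat n \<in> component r i) \<in> component r i" for r i
    by (rule LeastI_ex) (metis refl from_nat_to_nat)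
  have U_iff: "(k, j) \<in> U r \<longleftrightarrow> int (r k) = k - j \<or> int (r j) = j - k" for r k j
    by (auto simp: U_def jump_edges_def)
  have edge: "Measurable.pred ?P (\<lambda>r. (k, j) \<in> U r)" for k j
    unfolding U_iff by measurable
  have pow: "Measurable.pred ?P (\<lambda>r. (i, j) \<in> U r ^^ n)" for i j n
  proof (induction n arbitrary: j)
    case 0
    then show ?case by simp
  next
    case (Suc n)
    have "(\<lambda>r. (i, j) \<in> U r ^^ Suc n) = (\<lambda>r. \<exists>k. (i, k) \<in> U r ^^ n \<and> (k, j) \<in> U r)"
      by auto
    then show ?case using Suc edge by simp
  qed
  have "Measurable.pred ?P (\<lambda>r. j \<in> component r i)" for i j
  proof -
    have "(\<lambda>r. j \<in> component r i) = (\<lambda>r. \<exists>n. (i, j) \<in> U r ^^ n)"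
      by (auto simp: component_def U_def rtrancl_power)
    then show ?thesis using pow by simp
  qed
  then have "(\<lambda>r. LEAST n. from_nat n \<in> component r i) \<in> measurable ?P (count_space UNIV)" for i
    by (intro measurable_Least) auto
  then have "(\<lambda>r. from_nat (LEAST n. from_nat n \<in> component r i) :: int)
      \<in> measurable ?P (count_space UNIV)" for i
    by (rule measurable_compose) simp
  with in_comp show ?thesis
    by (simp add: component_naming_def)
qed

end

theory Submission
  imports Defs "HOL-Real_Asymp.Real_Asymp"
begin

text \<open>
  Write \<open>Y\<^sub>k\<close> for the colour of the vertex \<open>k\<close>, \<open>q\<close> for the renewal sequence of \<open>\<mu>\<close> (with
  \<open>q\<^sub>k = 0\<close> for \<open>k < 0\<close>) and \<open>F\<close> for the tail of \<open>\<mu>\<close>. Under (A) and under (B) the colours have mean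
  zero, positive variance and a finite fourth moment, and both cases are treated together.

  The process is linear. The jump at \<open>k\<close> is independent of the jumps to its left, and these
  decide which vertices to the left of \<open>k\<close> share a colour. Hence \<open>Y\<^sub>k\<close> and the average
  \<open>\<Sum>m. \<mu>(m) * Y\<^bsub>k-m\<^esub>\<close> have the same expectation against every function of the colours to the
  left of \<open>k\<close> (\<open>urn_identity\<close>), so their difference, the innovation \<open>D\<^sub>k\<close>, is a martingale
  difference. Solving the renewal equation gives \<open>Y\<^sub>j = \<Sum>k. q\<^bsub>j-k\<^esub> * D\<^sub>k\<close> in \<open>L\<^sup>2\<close>, and a linear
  combination of partial sums becomes \<open>\<Sum>k. b k * D\<^sub>k\<close> with explicit weights
  (\<open>combination_approximation\<close>).

  Such sums satisfy a central limit theorem (\<open>central_limit\<close>). The weights change slowly from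
  one \<open>k\<close> to the next, so that \<open>D\<^sub>k\<^sup>2\<close> may be replaced by its average over a long block. It then
  suffices that these averages converge to the variance \<open>\<kappa>\<close> of an innovation, uniformly in the
  position of the block. This holds because the products \<open>Y\<^bsub>i+p\<^esub> * Y\<^bsub>i+q\<^esub>\<close> for distant \<open>i\<close> are almost
  uncorrelated: whether two neighbouring ancestral lines meet soon is decided by the jumps in a
  finite block, and distant blocks are independent (\<open>innovation_sq_ergodic\<close>).

  It remains to identify the covariances. Two vertices at distance \<open>n\<close> are connected with
  probability \<open>g(n) / g(0)\<close>, where \<open>g(n) = \<Sum>k. q\<^sub>k * q\<^bsub>k+n\<^esub>\<close>, because both functions solve the same
  recursion and vanish at infinity (\<open>coalesce_prob_eq\<close>). The variance of \<open>S\<^sub>n\<close> is therefore \<open>\<kappa>\<close>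
  times the squared norm of the sequence with generating function
  \<open>(1 + z + \<dots> + z\<^bsup>n-1\<^esup>) / (1 - \<phi>(z))\<close>, where \<open>\<phi>\<close> generates \<open>\<mu>\<close>. Parseval's identity turns this
  into an integral over the circle. After the substitution \<open>\<theta> = u / n\<close>, regular variation of \<open>F\<close>
  makes \<open>(1 - \<phi>(e\<^bsup>iu/n\<^esup>)) / F(n)\<close> converge, and Potter's bound, with \<open>\<alpha> < 1/2\<close>, supplies an integrable
  majorant. So the variance is asymptotic to a constant times \<open>n / F(n)\<^sup>2\<close>
  (\<open>window_energy_asymptotics\<close>), which is regularly varying of index \<open>1 + 2 * \<alpha> = 2 * H\<close>; polarisation
  gives the covariance of fractional Brownian motion.

  Finally, bounded second moments reduce weak convergence in \<open>\<real>\<^sup>n\<close> to the convergence of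
  characteristic functions (\<open>weak_convergence_trigonometric\<close>).
\<close>

section \<open>Moment inequalities\<close>

lemma power_le_1_plus_4: "n \<le> 4 \<Longrightarrow> \<bar>x\<bar> ^ n \<le> 1 + (x::real) ^ 4"
proof (cases "\<bar>x\<bar> \<le> 1")
  case True
  then have "\<bar>x\<bar> ^ n \<le> 1" by (simp add: power_le_one)
  moreover have "0 \<le> x ^ 4" by simp
  ultimately show ?thesis by linarith
next
  case False
  assume "n \<le> 4"
  then have "\<bar>x\<bar> ^ n \<le> \<bar>x\<bar> ^ 4" using False by (intro power_increasing) auto
  then show ?thesis by (simp add: power_even_abs)
qed

lemma abs_mult_le_squares: "\<bar>x * y\<bar> \<le> (x\<^sup>2 + y\<^sup>2 :: real)"
proof -
  have "2 * (\<bar>x\<bar> * \<bar>y\<bar>) \<le> x\<^sup>2 + y\<^sup>2"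
    using sum_squares_bound[of "\<bar>x\<bar>" "\<bar>y\<bar>"] by (simp add: mult.assoc)
  moreover have "0 \<le> \<bar>x\<bar> * \<bar>y\<bar>" by simp
  ultimately show ?thesis unfolding abs_mult by linarith
qed

lemma iexp_difference_le: "cmod (iexp x - iexp y) \<le> \<bar>x - y\<bar>"
proof -
  have "iexp x - iexp y = iexp y * (iexp (x - y) - 1)"
    by (simp add: algebra_simps flip: exp_add)
  then have "cmod (iexp x - iexp y) = cmod (iexp (x - y) - 1)" by (simp add: norm_mult)
  then show ?thesis using iexp_approx1[of "x - y" 0] by simp
qed

context prob_space
begin

lemma second_moment_inequalities:
  fixes X :: "'a \<Rightarrow> real"
  assumes [measurable]: "X \<in> borel_measurable M" and i: "integrable M (\<lambda>\<omega>. (X \<omega>)\<^sup>2)"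
  shows "integrable M X" "(expectation (\<lambda>\<omega>. \<bar>X \<omega>\<bar>))\<^sup>2 \<le> expectation (\<lambda>\<omega>. (X \<omega>)\<^sup>2)"
    "(expectation X)\<^sup>2 \<le> expectation (\<lambda>\<omega>. (X \<omega>)\<^sup>2)"
proof -
  show X: "integrable M X"
  proof (rule Bochner_Integration.integrable_bound[where f="\<lambda>\<omega>. 1 + (X \<omega>)\<^sup>2"])
    have "\<bar>x\<bar> \<le> 1 + x\<^sup>2" for x :: real
      using sum_squares_bound[of "\<bar>x\<bar>" 1] zero_le_power2[of x] by simp
    then show "AE \<omega> in M. norm (X \<omega>) \<le> norm (1 + (X \<omega>)\<^sup>2)" by (simp add: add_nonneg_nonneg)
  qed (use i in auto)
  define c where "c = expectation (\<lambda>\<omega>. \<bar>X \<omega>\<bar>)"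
  have "0 \<le> expectation (\<lambda>\<omega>. (\<bar>X \<omega>\<bar> - c)\<^sup>2)" by simp
  also have "(\<lambda>\<omega>. (\<bar>X \<omega>\<bar> - c)\<^sup>2) = (\<lambda>\<omega>. (X \<omega>)\<^sup>2 - 2 * c * \<bar>X \<omega>\<bar> + c\<^sup>2)"
    by (simp add: power2_diff fun_eq_iff algebra_simps)
  also have "expectation (\<lambda>\<omega>. (X \<omega>)\<^sup>2 - 2 * c * \<bar>X \<omega>\<bar> + c\<^sup>2) = expectation (\<lambda>\<omega>. (X \<omega>)\<^sup>2) - c\<^sup>2"
    using i X by (simp add: c_def[symmetric] power2_eq_square prob_space)
  finally show le: "(expectation (\<lambda>\<omega>. \<bar>X \<omega>\<bar>))\<^sup>2 \<le> expectation (\<lambda>\<omega>. (X \<omega>)\<^sup>2)" by (simp add: c_def)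
  have "\<bar>expectation X\<bar>\<^sup>2 \<le> (expectation (\<lambda>\<omega>. \<bar>X \<omega>\<bar>))\<^sup>2"
    by (intro power_mono integral_abs_bound) simp
  then show "(expectation X)\<^sup>2 \<le> expectation (\<lambda>\<omega>. (X \<omega>)\<^sup>2)" using le by simp
qed

lemma fourth_moment_inequalities:
  fixes X :: "'a \<Rightarrow> real"
  assumes [measurable]: "X \<in> borel_measurable M" and i: "integrable M (\<lambda>\<omega>. X \<omega> ^ 4)"
  shows "integrable M X" "integrable M (\<lambda>\<omega>. (X \<omega>)\<^sup>2)"
    "(expectation X)\<^sup>2 \<le> expectation (\<lambda>\<omega>. (X \<omega>)\<^sup>2)" "(expectation X) ^ 4 \<le> expectation (\<lambda>\<omega>. X \<omega> ^ 4)"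
proof -
  have "integrable M (\<lambda>\<omega>. ((X \<omega>)\<^sup>2)\<^sup>2)" using i by (simp flip: power_mult)
  from second_moment_inequalities(1,3)[OF _ this]
  have 2: "integrable M (\<lambda>\<omega>. (X \<omega>)\<^sup>2)" "(expectation (\<lambda>\<omega>. (X \<omega>)\<^sup>2))\<^sup>2 \<le> expectation (\<lambda>\<omega>. X \<omega> ^ 4)"
    by (simp_all flip: power_mult)
  show "integrable M (\<lambda>\<omega>. (X \<omega>)\<^sup>2)" by (rule 2)
  show "integrable M X" and le: "(expectation X)\<^sup>2 \<le> expectation (\<lambda>\<omega>. (X \<omega>)\<^sup>2)"
    using second_moment_inequalities[OF assms(1) 2(1)] by auto
  have "((expectation X)\<^sup>2)\<^sup>2 \<le> (expectation (\<lambda>\<omega>. (X \<omega>)\<^sup>2))\<^sup>2" using le by (intro power_mono) auto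
  also note 2(2)
  finally show "(expectation X) ^ 4 \<le> expectation (\<lambda>\<omega>. X \<omega> ^ 4)" by (simp flip: power_mult)
qed

lemma characteristic_difference_le:
  assumes [measurable]: "X \<in> borel_measurable M" "X' \<in> borel_measurable M"
    and i: "integrable M (\<lambda>\<omega>. \<bar>X \<omega> - X' \<omega>\<bar>)"
  shows "cmod ((\<integral>\<omega>. iexp (X \<omega>) \<partial>M) - (\<integral>\<omega>. iexp (X' \<omega>) \<partial>M)) \<le> (\<integral>\<omega>. \<bar>X \<omega> - X' \<omega>\<bar> \<partial>M)"
proof -
  have ie: "integrable M (\<lambda>\<omega>. iexp (f \<omega>))" if [measurable]: "f \<in> borel_measurable M" for f
    by (intro integrable_const_bound[of _ 1]) auto
  have "cmod ((\<integral>\<omega>. iexp (X \<omega>) \<partial>M) - (\<integral>\<omega>. iexp (X' \<omega>) \<partial>M)) = cmod (\<integral>\<omega>. iexp (X \<omega>) - iexp (X' \<omega>) \<partial>M)"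
    using ie[OF assms(1)] ie[OF assms(2)] by (simp only: Bochner_Integration.integral_diff)
  also have "\<dots> \<le> (\<integral>\<omega>. \<bar>X \<omega> - X' \<omega>\<bar> \<partial>M)"
  proof (rule order.trans[OF integral_norm_bound integral_mono])
    show "integrable M (\<lambda>\<omega>. cmod (iexp (X \<omega>) - iexp (X' \<omega>)))"
      using ie[OF assms(1)] ie[OF assms(2)] by (intro integrable_norm Bochner_Integration.integrable_diff)
    fix \<omega>
    show "cmod (iexp (X \<omega>) - iexp (X' \<omega>)) \<le> \<bar>X \<omega> - X' \<omega>\<bar>"
      by (rule iexp_difference_le)
  qed (fact i)
  finally show ?thesis .
qed

end

section \<open>Weak convergence from trigonometric test functions\<close>

text \<open>
  The free phase covers sines as well, and makes products of waves sums of waves.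
\<close>

inductive trigonometric_polynomial :: "('a::real_inner \<Rightarrow> real) \<Rightarrow> bool" where
  wave: "trigonometric_polynomial (\<lambda>x. a * cos (u \<bullet> x + \<phi>))"
| add: "trigonometric_polynomial f \<Longrightarrow> trigonometric_polynomial g \<Longrightarrow>
    trigonometric_polynomial (\<lambda>x. f x + g x)"

lemma trigonometric_polynomial_mult:
  assumes "trigonometric_polynomial f" "trigonometric_polynomial g"
  shows "trigonometric_polynomial (\<lambda>x. f x * g x)"
  using assms(1)
proof induction
  case (wave a u \<phi>)
  show ?case
    using assms(2)
  proof induction
    case (wave b v \<psi>)
    have gen: "a * y * (b * z) = a * b / 2 * r + a * b / 2 * s" if "y * z = (r + s) / 2" for y z r s
    proof -
      have "a * y * (b * z) = a * b * (y * z)" by simp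
      then show ?thesis by (simp add: that algebra_simps add_divide_distrib)
    qed
    have "(\<lambda>x. a * cos (u \<bullet> x + \<phi>) * (b * cos (v \<bullet> x + \<psi>)))
      = (\<lambda>x. a * b / 2 * cos ((u - v) \<bullet> x + (\<phi> - \<psi>)) + a * b / 2 * cos ((u + v) \<bullet> x + (\<phi> + \<psi>)))"
    proof
      fix x
      have "cos (u \<bullet> x + \<phi>) * cos (v \<bullet> x + \<psi>)
        = (cos ((u - v) \<bullet> x + (\<phi> - \<psi>)) + cos ((u + v) \<bullet> x + (\<phi> + \<psi>))) / 2"
        by (simp add: cos_times_cos algebra_simps)
      then show "a * cos (u \<bullet> x + \<phi>) * (b * cos (v \<bullet> x + \<psi>)) =
        a * b / 2 * cos ((u - v) \<bullet> x + (\<phi> - \<psi>)) + a * b / 2 * cos ((u + v) \<bullet> x + (\<phi> + \<psi>))"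
        by (rule gen)
    qed
    then show ?case
      by (simp only: trigonometric_polynomial.intros)
  next
    case (add f g)
    then show ?case
      by (simp add: distrib_left trigonometric_polynomial.add)
  qed
next
  case (add f g)
  then show ?case
    by (simp add: distrib_right trigonometric_polynomial.add)
qed

lemma trigonometric_polynomial_const: "trigonometric_polynomial (\<lambda>x. c)"
  using trigonometric_polynomial.wave[of c 0 0] by simp

lemma trigonometric_polynomial_sum:
  "finite I \<Longrightarrow> (\<And>i. i \<in> I \<Longrightarrow> trigonometric_polynomial (f i)) \<Longrightarrow>
    trigonometric_polynomial (\<lambda>x. \<Sum>i\<in>I. f i x)"
  by (induction I rule: finite_induct)
    (auto simp: trigonometric_polynomial_const trigonometric_polynomial.add)

text \<open>
  Ordinary polynomials become trigonometric ones along this map, whose values stay in a compact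
  set.
\<close>

definition torus_map :: "real \<Rightarrow> real ^ 'n \<Rightarrow> (real ^ 'n) \<times> (real ^ 'n)" where
  "torus_map K x = (\<chi> j. cos (x $ j / K), \<chi> j. sin (x $ j / K))"

lemma trigonometric_polynomial_torus:
  assumes "real_polynomial_function g"
  shows "trigonometric_polynomial (\<lambda>x. g (torus_map K x))"
  using assms
proof induction
  case (linear f)
  interpret bounded_linear f by fact
  have c: "trigonometric_polynomial (\<lambda>x::real^'n. cos (x $ j / K))" for j
    using trigonometric_polynomial.wave[of 1 "axis j (1 / K)" 0]
    by (simp add: inner_axis' mult.commute)
  have s: "trigonometric_polynomial (\<lambda>x::real^'n. sin (x $ j / K))" for j
    using trigonometric_polynomial.wave[of 1 "axis j (1 / K)" "- pi / 2"]
    by (simp add: inner_axis' mult.commute cos_diff)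
  have "f (torus_map K x) = (\<Sum>b\<in>Basis. f b * (torus_map K x \<bullet> b))" for x
    by (subst euclidean_representation[of "torus_map K x", symmetric])
      (simp add: sum scaleR mult.commute del: euclidean_representation)
  moreover have "trigonometric_polynomial (\<lambda>x. f b * (torus_map K x \<bullet> b))" if "b \<in> Basis" for b
  proof (rule trigonometric_polynomial_mult[OF trigonometric_polynomial_const])
    from that consider j where "b = (axis j 1, 0)" | j where "b = (0, axis j 1)"
      by (auto simp: Basis_prod_def Basis_vec_def)
    then show "trigonometric_polynomial (\<lambda>x. torus_map K x \<bullet> b)"
      by cases (simp_all add: torus_map_def inner_axis c s)
  qed
  ultimately show ?case
    by (simp add: trigonometric_polynomial_sum)
next
  case (const c) then show ?case by (rule trigonometric_polynomial_const)
next
  case (add f g) show ?case using add.IH by (rule trigonometric_polynomial.add)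
next
  case (mult f g) show ?case using mult.IH by (rule trigonometric_polynomial_mult)
qed

text \<open>
  The function \<open>f\<close>, damped towards the faces of the cube of side \<open>pi * K\<close>, written in the
  coordinates of \<open>torus_map\<close>: there \<open>x $ j = K * arcsin (s $ j)\<close>, and the product of the positive
  parts of the cosines makes it continuous on the whole compact set.
\<close>

definition periodisation :: "real \<Rightarrow> (real ^ 'n \<Rightarrow> real) \<Rightarrow> (real ^ 'n) \<times> (real ^ 'n) \<Rightarrow> real" where
  "periodisation K f = (\<lambda>(c, s). f (\<chi> j. K * arcsin (s $ j)) * (\<Prod>j\<in>UNIV. max 0 (c $ j)))"

lemma continuous_on_periodisation:
  fixes f :: "real ^ 'n \<Rightarrow> real"
  assumes "continuous_on UNIV f"
  shows "continuous_on (cbox (-1, -1) (1, 1)) (periodisation K f)"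
proof -
  have *: "continuous_on (cbox (-1, -1) (1, 1)) (\<lambda>z::(real^'n)\<times>(real^'n). arcsin (snd z $ j))" for j
  proof (rule continuous_on_arcsin)
    show "continuous_on (cbox (-1, -1) (1, 1)) (\<lambda>z::(real^'n)\<times>(real^'n). snd z $ j)"
      by (intro continuous_intros)
    show "\<forall>z\<in>cbox (-1, -1) (1, 1). - 1 \<le> snd (z::(real^'n)\<times>(real^'n)) $ j \<and> snd z $ j \<le> 1"
      by (auto simp: cbox_Pair_eq mem_box_cart)
  qed
  have "continuous_on (cbox (-1, -1) (1, 1)) (\<lambda>z::(real^'n)\<times>(real^'n). f (\<chi> j. K * arcsin (snd z $ j)))"
    by (rule continuous_on_compose2[OF assms]) (auto intro!: continuous_intros *)
  then show ?thesis
    unfolding periodisation_def case_prod_beta by (intro continuous_intros)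
qed

lemma one_minus_cos_le: "1 - cos (x::real) \<le> x\<^sup>2 / 2"
  using cos_double_sin[of "x / 2"] power_mono[OF abs_sin_x_le_abs_x[of "x / 2"], of 2]
  by (simp add: power_divide)

lemma one_minus_prod_le_sum:
  "finite I \<Longrightarrow> (\<And>i. i \<in> I \<Longrightarrow> 0 \<le> a i \<and> a i \<le> (1::real)) \<Longrightarrow>
    1 - (\<Prod>i\<in>I. a i) \<le> (\<Sum>i\<in>I. 1 - a i)"
proof (induction I rule: finite_induct)
  case (insert x I)
  then have "0 \<le> prod a I" "prod a I \<le> 1" "1 - prod a I \<le> (\<Sum>i\<in>I. 1 - a i)" "0 \<le> a x" "a x \<le> 1"
    by (auto intro!: prod_nonneg prod_le_1)
  then have "1 - a x * prod a I \<le> (1 - a x) + (1 - prod a I)"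
    using mult_nonneg_nonneg[of "1 - a x" "1 - prod a I"] by (simp add: algebra_simps)
  then show ?case using insert \<open>1 - prod a I \<le> _\<close> by simp
qed simp

text \<open>
  In the ball of radius \<open>K\<close> only the damping factor matters, and it differs from 1 by at most
  \<open>(norm x / K)\<^sup>2\<close>. Outside, that quantity exceeds 1 and the bound \<open>C\<close> on both functions suffices.
  The error is quadratic in \<open>x\<close> because second moments are what is known.
\<close>

lemma periodisation_error:
  fixes f :: "real ^ 'n \<Rightarrow> real"
  assumes "K > 0" and f: "\<And>x. \<bar>f x\<bar> \<le> C"
  shows "\<bar>f x - periodisation K f (torus_map K x)\<bar> \<le> 2 * C * (norm x / K)\<^sup>2"
proof -
  have "0 \<le> C" using f[of 0] by linarith
  define \<psi> where "\<psi> = (\<Prod>j\<in>UNIV. max 0 (cos (x $ j / K)))"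
  have \<psi>: "0 \<le> \<psi>" "\<psi> \<le> 1" unfolding \<psi>_def by (auto intro!: prod_nonneg prod_le_1)
  show ?thesis
  proof (cases "norm x \<le> K")
    case True
    have small: "\<bar>x $ j / K\<bar> \<le> 1" for j
      using order.trans[OF component_le_norm_cart[of x j] True] assms(1) by simp
    have ball: "- (pi/2) \<le> x $ j / K" "x $ j / K \<le> pi/2" for j
      using small[of j] pi_gt3 by linarith+
    have "K * arcsin (sin (x $ j / K)) = x $ j" for j
      using ball[of j] assms(1) by (simp add: arcsin_sin)
    then have eq: "periodisation K f (torus_map K x) = f x * \<psi>"
      by (simp add: periodisation_def torus_map_def \<psi>_def vec_lambda_eta)
    have cn: "0 \<le> cos (x $ j / K)" for j
      using cos_ge_zero[OF ball] .
    have "1 - \<psi> \<le> (\<Sum>j\<in>UNIV. 1 - max 0 (cos (x $ j / K)))"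
      unfolding \<psi>_def by (rule one_minus_prod_le_sum) auto
    also have "\<dots> \<le> (\<Sum>j\<in>UNIV. (x $ j / K)\<^sup>2 / 2)"
      using cn one_minus_cos_le by (intro sum_mono) (simp only: max_absorb2)
    also have "\<dots> = (norm x / K)\<^sup>2 / 2"
      by (simp add: norm_vec_def L2_set_def power_divide sum_divide_distrib real_sqrt_pow2 sum_nonneg)
    finally have "1 - \<psi> \<le> (norm x / K)\<^sup>2" by (smt (verit) zero_le_power2 field_sum_of_halves)
    then have "\<bar>f x\<bar> * (1 - \<psi>) \<le> C * (norm x / K)\<^sup>2"
      using f \<psi> \<open>0 \<le> C\<close> by (intro mult_mono) auto
    moreover have "\<bar>f x - f x * \<psi>\<bar> = \<bar>f x\<bar> * (1 - \<psi>)"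
    proof -
      have "f x - f x * \<psi> = f x * (1 - \<psi>)" by (simp add: algebra_simps)
      then show ?thesis using \<psi> by (simp add: abs_mult)
    qed
    moreover have "0 \<le> C * (norm x / K)\<^sup>2" using \<open>0 \<le> C\<close> by simp
    ultimately show ?thesis unfolding eq by linarith
  next
    case False
    have "\<bar>periodisation K f (torus_map K x)\<bar> \<le> C * 1"
      unfolding periodisation_def torus_map_def case_prod_conv abs_mult
      using f \<psi> \<open>0 \<le> C\<close> by (intro mult_mono) (auto simp: \<psi>_def)
    then have "\<bar>f x - periodisation K f (torus_map K x)\<bar> \<le> 2 * C"
      using f[of x] by linarith
    also have "\<dots> \<le> 2 * C * (norm x / K)\<^sup>2"
    proof -
      have "1 \<le> (norm x / K)\<^sup>2" using False assms(1) by (intro one_le_power) simp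
      then show ?thesis using mult_left_mono[of 1 "(norm x / K)\<^sup>2" "2 * C"] \<open>0 \<le> C\<close> by simp
    qed
    finally show ?thesis .
  qed
qed

lemma borel_measurable_trigonometric_polynomial:
  fixes f :: "'a::euclidean_space \<Rightarrow> real"
  assumes "trigonometric_polynomial f" shows "f \<in> borel_measurable borel"
  using assms by induction auto

lemma trigonometric_polynomial_bounded:
  assumes "trigonometric_polynomial f" shows "\<exists>C. \<forall>x. \<bar>f x\<bar> \<le> C"
  using assms
proof induction
  case (wave a u \<phi>)
  show ?case by (rule exI[of _ "\<bar>a\<bar>"]) (auto simp: abs_mult intro!: mult_left_le)
next
  case (add f g)
  then obtain C D where "\<forall>x. \<bar>f x\<bar> \<le> C" "\<forall>x. \<bar>g x\<bar> \<le> D" by auto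
  then have "\<forall>x. \<bar>f x + g x\<bar> \<le> C + D" by (meson abs_triangle_ineq add_mono order_trans)
  then show ?case by blast
qed

lemma integrable_trigonometric_polynomial:
  fixes f :: "'b::euclidean_space \<Rightarrow> real"
  assumes "prob_space M" "X \<in> borel_measurable M" "trigonometric_polynomial f"
  shows "integrable M (\<lambda>\<omega>. f (X \<omega>))"
proof -
  interpret prob_space M by fact
  obtain C where "\<forall>x. \<bar>f x\<bar> \<le> C" using trigonometric_polynomial_bounded[OF assms(3)] by blast
  then show ?thesis
    using measurable_compose[OF assms(2) borel_measurable_trigonometric_polynomial[OF assms(3)]]
    by (intro integrable_const_bound[of _ C]) auto
qed

lemma expectation_difference_le:
  fixes W :: "'a \<Rightarrow> real ^ 'n" and f h :: "real ^ 'n \<Rightarrow> real"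
  assumes Q: "prob_space Q" and W: "W \<in> borel_measurable Q"
    and f: "f \<in> borel_measurable borel" "\<And>x. \<bar>f x\<bar> \<le> C" and h: "trigonometric_polynomial h"
    and pw: "\<And>x. \<bar>f x - h x\<bar> \<le> a + b * (norm x)\<^sup>2"
    and i: "integrable Q (\<lambda>\<omega>. (norm (W \<omega>))\<^sup>2)" and le: "(\<integral>\<omega>. (norm (W \<omega>))\<^sup>2 \<partial>Q) \<le> B" and "0 \<le> b"
  shows "\<bar>(\<integral>\<omega>. f (W \<omega>) \<partial>Q) - (\<integral>\<omega>. h (W \<omega>) \<partial>Q)\<bar> \<le> a + b * B"
proof -
  interpret prob_space Q by fact
  have fi: "integrable Q (\<lambda>\<omega>. f (W \<omega>))"
    using f(2) measurable_compose[OF W f(1)] by (intro integrable_const_bound[of _ C]) auto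
  note hi = integrable_trigonometric_polynomial[OF Q W h]
  have "\<bar>(\<integral>\<omega>. f (W \<omega>) \<partial>Q) - (\<integral>\<omega>. h (W \<omega>) \<partial>Q)\<bar> = \<bar>\<integral>\<omega>. f (W \<omega>) - h (W \<omega>) \<partial>Q\<bar>"
    using fi hi by simp
  also have "\<dots> \<le> (\<integral>\<omega>. \<bar>f (W \<omega>) - h (W \<omega>)\<bar> \<partial>Q)"
    by (rule integral_abs_bound)
  also have "\<dots> \<le> (\<integral>\<omega>. a + b * (norm (W \<omega>))\<^sup>2 \<partial>Q)"
    using fi hi i pw by (intro integral_mono) auto
  also have "\<dots> = a + b * (\<integral>\<omega>. (norm (W \<omega>))\<^sup>2 \<partial>Q)"
    using i by (simp add: prob_space)
  also have "\<dots> \<le> a + b * B"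
    using le \<open>0 \<le> b\<close> by (intro add_left_mono mult_left_mono) auto
  finally show ?thesis .
qed

text \<open>
  The bound on the second moments makes the periodisation error small uniformly in \<open>n\<close>; the
  periodised function is approximated by a polynomial on the torus, that is, by a
  trigonometric polynomial, for which convergence is assumed.
\<close>

lemma weak_convergence_trigonometric:
  fixes X :: "nat \<Rightarrow> 'a \<Rightarrow> real ^ 'n" and G :: "'b \<Rightarrow> real ^ 'n"
  assumes M: "prob_space M" and N: "prob_space N"
    and X: "\<And>n. X n \<in> borel_measurable M" and G: "G \<in> borel_measurable N"
    and X2: "\<And>n. integrable M (\<lambda>\<omega>. (norm (X n \<omega>))\<^sup>2)" "\<And>n. (\<integral>\<omega>. (norm (X n \<omega>))\<^sup>2 \<partial>M) \<le> B"
    and G2: "integrable N (\<lambda>\<omega>. (norm (G \<omega>))\<^sup>2)" "(\<integral>\<omega>. (norm (G \<omega>))\<^sup>2 \<partial>N) \<le> B"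
    and conv: "\<And>u \<phi>. (\<lambda>n. \<integral>\<omega>. cos (u \<bullet> X n \<omega> + \<phi>) \<partial>M) \<longlonglongrightarrow> (\<integral>\<omega>. cos (u \<bullet> G \<omega> + \<phi>) \<partial>N)"
  shows "weak_convergence (\<lambda>n. distr M borel (X n)) (distr N borel G)"
  unfolding weak_convergence_def
proof safe
  fix f :: "real ^ 'n \<Rightarrow> real"
  assume f: "continuous_on UNIV f" and bdd: "bounded (range f)"
  obtain C where C: "\<And>x. \<bar>f x\<bar> \<le> C" using bdd by (auto simp: bounded_iff)
  have "0 \<le> C" using C[of 0] by linarith
  have fm: "f \<in> borel_measurable borel" using f by (rule borel_measurable_continuous_onI)
  have poly: "(\<lambda>n. \<integral>\<omega>. h (X n \<omega>) \<partial>M) \<longlonglongrightarrow> (\<integral>\<omega>. h (G \<omega>) \<partial>N)"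
    if "trigonometric_polynomial h" for h
    using that
  proof induction
    case (wave a u \<phi>)
    then show ?case using tendsto_mult_left[OF conv, of a u \<phi>] by simp
  next
    case (add f g)
    then show ?case
      using integrable_trigonometric_polynomial[OF M X] integrable_trigonometric_polynomial[OF N G]
      by (simp add: tendsto_add)
  qed
  have approx: "\<exists>h. trigonometric_polynomial h \<and>
      (\<forall>n. \<bar>(\<integral>\<omega>. f (X n \<omega>) \<partial>M) - (\<integral>\<omega>. h (X n \<omega>) \<partial>M)\<bar> \<le> e) \<and>
      \<bar>(\<integral>\<omega>. f (G \<omega>) \<partial>N) - (\<integral>\<omega>. h (G \<omega>) \<partial>N)\<bar> \<le> e" if "e > 0" for e
  proof -
    \<comment> \<open>With this choice the quadratic term contributes at most \<open>e / 2\<close>; the added 1 keeps \<open>K\<close> positive.\<close>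
    define K where "K = sqrt (4 * C * \<bar>B\<bar> / e) + 1"
    have K: "K > 0" "4 * C * \<bar>B\<bar> / e \<le> K\<^sup>2"
    proof -
      have s: "0 \<le> sqrt (4 * C * \<bar>B\<bar> / e)" using \<open>0 \<le> C\<close> that by simp
      then show "K > 0" unfolding K_def by linarith
      have "4 * C * \<bar>B\<bar> / e = (sqrt (4 * C * \<bar>B\<bar> / e))\<^sup>2" using \<open>0 \<le> C\<close> that by simp
      also have "\<dots> \<le> K\<^sup>2" unfolding K_def using s by (intro power_mono) auto
      finally show "4 * C * \<bar>B\<bar> / e \<le> K\<^sup>2" .
    qed
    have CB: "2 * C * (\<bar>B\<bar> / K\<^sup>2) \<le> e / 2"
      using K that by (simp add: field_simps)
    obtain g where g: "real_polynomial_function g"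
      "\<And>z. z \<in> cbox (-1, -1) (1, 1) \<Longrightarrow> \<bar>periodisation K f z - g z\<bar> < e / 2"
      by (rule Stone_Weierstrass_real_polynomial_function[OF compact_cbox
            continuous_on_periodisation[OF f, of K] half_gt_zero[OF \<open>e > 0\<close>]]) blast
    define h where "h = (\<lambda>x. g (torus_map K x))"
    have h: "trigonometric_polynomial h"
      unfolding h_def by (rule trigonometric_polynomial_torus[OF g(1)])
    have "torus_map K x \<in> cbox (-1, -1) (1, 1)" for x :: "real ^ 'n"
      by (auto simp: torus_map_def cbox_Pair_eq mem_box_cart)
    then have pw: "\<bar>f x - h x\<bar> \<le> e / 2 + 2 * C / K\<^sup>2 * (norm x)\<^sup>2" for x
      using periodisation_error[of K f C x, OF K(1) C] g(2)[of "torus_map K x"]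
      unfolding h_def power_divide by (simp add: abs_if split: if_splits)
    have "0 \<le> 2 * C / K\<^sup>2" using \<open>0 \<le> C\<close> by simp
    then have le: "e / 2 + 2 * C / K\<^sup>2 * B \<le> e"
      using CB mult_left_mono[of B "\<bar>B\<bar>" "2 * C / K\<^sup>2"] by (simp add: field_simps) argo
    show ?thesis
      using h le order.trans[OF expectation_difference_le[OF M X fm C h pw X2 \<open>0 \<le> 2 * C / K\<^sup>2\<close>] le]
        order.trans[OF expectation_difference_le[OF N G fm C h pw G2 \<open>0 \<le> 2 * C / K\<^sup>2\<close>] le] by blast
  qed
  have "(\<lambda>n. \<integral>\<omega>. f (X n \<omega>) \<partial>M) \<longlonglongrightarrow> (\<integral>\<omega>. f (G \<omega>) \<partial>N)"
  proof (rule LIMSEQ_I)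
    fix r :: real assume "0 < r"
    then obtain h where h: "trigonometric_polynomial h"
      "\<And>n. \<bar>(\<integral>\<omega>. f (X n \<omega>) \<partial>M) - (\<integral>\<omega>. h (X n \<omega>) \<partial>M)\<bar> \<le> r / 3"
      "\<bar>(\<integral>\<omega>. f (G \<omega>) \<partial>N) - (\<integral>\<omega>. h (G \<omega>) \<partial>N)\<bar> \<le> r / 3"
      using approx[of "r / 3"] by auto
    obtain n0 where n0: "\<And>n. n \<ge> n0 \<Longrightarrow> \<bar>(\<integral>\<omega>. h (X n \<omega>) \<partial>M) - (\<integral>\<omega>. h (G \<omega>) \<partial>N)\<bar> < r / 3"
      using LIMSEQ_D[OF poly[OF h(1)], of "r / 3"] \<open>0 < r\<close> by auto
    have "norm ((\<integral>\<omega>. f (X n \<omega>) \<partial>M) - (\<integral>\<omega>. f (G \<omega>) \<partial>N)) < r" if "n \<ge> n0" for n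
      using h(2)[of n] h(3) n0[OF that] unfolding real_norm_def by linarith
    then show "\<exists>no. \<forall>n\<ge>no. norm ((\<integral>\<omega>. f (X n \<omega>) \<partial>M) - (\<integral>\<omega>. f (G \<omega>) \<partial>N)) < r"
      by blast
  qed
  then show "(\<lambda>n. \<integral>x. f x \<partial>distr M borel (X n)) \<longlonglongrightarrow> (\<integral>x. f x \<partial>distr N borel G)"
    using X G fm by (simp add: integral_distr)
qed

section \<open>A central limit theorem for martingale differences with smooth weights\<close>

lemma sum_int_telescope:
  fixes a :: "int \<Rightarrow> 'b::ab_group_add"
  assumes "lo - 1 \<le> hi"
  shows "(\<Sum>k=lo..hi. a k - a (k - 1)) = a hi - a (lo - 1)"
  using assms
proof (induction hi rule: int_ge_induct)
  case (step i)
  then have "{lo..i + 1} = insert (i + 1) {lo..i}" by auto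
  then show ?case using step by simp
qed simp

lemma sum_int_shift:
  fixes h :: "int \<Rightarrow> 'b::comm_monoid_add"
  assumes "\<And>k. k \<notin> {lo..hi} \<Longrightarrow> h k = 0" "a + r \<le> lo" "hi \<le> c + r"
  shows "(\<Sum>k=a..c. h (k + r)) = (\<Sum>k=lo..hi. h k)"
proof -
  have "(\<Sum>k=a..c. h (k + r)) = (\<Sum>k=a+r..c+r. h k)"
    by (rule sum.reindex_bij_witness[of _ "\<lambda>k. k - r" "\<lambda>k. k + r"]) auto
  also have "\<dots> = (\<Sum>k=lo..hi. h k)"
    using assms by (intro sum.mono_neutral_right) auto
  finally show ?thesis .
qed

lemma iexp_second_order: "cmod (iexp x - (1 + \<i> * x - x\<^sup>2 / 2)) \<le> \<bar>x\<bar> ^ 3 / 6"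
  using iexp_approx1[of x 2] by (simp add: numeral_2_eq_2 numeral_3_eq_3 power2_eq_square algebra_simps)

lemma exp_minus_second_order:
  assumes "0 \<le> (y::real)" shows "\<bar>exp (- y) - (1 - y)\<bar> \<le> y\<^sup>2 / 2"
proof -
  have "1 - y \<le> exp (- y)" using exp_ge_add_one_self[of "- y"] by simp
  moreover have "exp (- y) \<le> 1 - y + y\<^sup>2 / 2"
  proof -
    have "1 + y + y\<^sup>2 / 2 \<le> exp y" using exp_lower_Taylor_quadratic[OF assms] by simp
    moreover have "1 \<le> (1 - y + y\<^sup>2 / 2) * (1 + y + y\<^sup>2 / 2)"
    proof -
      have "(1 - y + y\<^sup>2 / 2) * (1 + y + y\<^sup>2 / 2) = 1 + y ^ 4 / 4"
        by (simp add: algebra_simps power2_eq_square power4_eq_xxxx)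
      then show ?thesis by simp
    qed
    moreover have "0 < 1 - y + y\<^sup>2 / 2"
    proof -
      have "1 - y + y\<^sup>2 / 2 = ((1 - y)\<^sup>2 + 1) / 2" by (simp add: power2_eq_square algebra_simps)
      moreover have "0 < ((1 - y)\<^sup>2 + 1) / 2" by (simp add: add_nonneg_pos)
      ultimately show ?thesis by (simp only:)
    qed
    ultimately have "1 \<le> (1 - y + y\<^sup>2 / 2) * exp y"
      by (meson mult_left_mono less_imp_le order_trans)
    then show ?thesis by (simp add: exp_minus field_simps)
  qed
  ultimately show ?thesis by linarith
qed

text \<open>
  The martingale property is stated for exponentials of the past, the only functions to which it
  is applied. Convergence of block averages of the squares, in \<open>L\<^sup>1\<close> and uniformly in the position
  \<open>k\<close>, takes the place of convergence of conditional variances.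
\<close>

locale ergodic_martingale_differences = prob_space M for M :: "'a measure" +
  fixes X :: "int \<Rightarrow> 'a \<Rightarrow> real" and \<kappa> C :: real and \<eta> :: "nat \<Rightarrow> real"
  assumes X_meas [measurable]: "\<And>k. X k \<in> borel_measurable M"
    and X4: "\<And>k. integrable M (\<lambda>\<omega>. X k \<omega> ^ 4)" "\<And>k. expectation (\<lambda>\<omega>. X k \<omega> ^ 4) \<le> C"
    and X2: "\<And>k. expectation (\<lambda>\<omega>. (X k \<omega>)\<^sup>2) = \<kappa>"
    and martingale: "\<And>k J c. finite J \<Longrightarrow> J \<subseteq> {..<k} \<Longrightarrow>
      (\<integral>\<omega>. iexp (\<Sum>j\<in>J. c j * X j \<omega>) * X k \<omega> \<partial>M) = 0"
    and ergodic: "\<And>k l. expectation (\<lambda>\<omega>. \<bar>\<Sum>r<l. (X (k + int r) \<omega>)\<^sup>2 - \<kappa>\<bar>) \<le> real l * \<eta> l"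
    and \<eta>: "\<eta> \<longlonglongrightarrow> 0"
begin

lemma integrable_powers: "integrable M (\<lambda>\<omega>. (X k \<omega>)\<^sup>2)" "integrable M (\<lambda>\<omega>. \<bar>X k \<omega>\<bar> ^ 3)"
    "integrable M (X k)"
  and abs3_le: "expectation (\<lambda>\<omega>. \<bar>X k \<omega>\<bar> ^ 3) \<le> 1 + C"
proof -
  have i: "integrable M (\<lambda>\<omega>. 1 + X k \<omega> ^ 4)" using X4 by simp
  show "integrable M (\<lambda>\<omega>. (X k \<omega>)\<^sup>2)" "integrable M (X k)"
    using fourth_moment_inequalities[OF X_meas X4(1)] by auto
  show 3: "integrable M (\<lambda>\<omega>. \<bar>X k \<omega>\<bar> ^ 3)"
    by (rule Bochner_Integration.integrable_bound[OF i]) (use power_le_1_plus_4[of 3] in auto)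
  have "expectation (\<lambda>\<omega>. \<bar>X k \<omega>\<bar> ^ 3) \<le> expectation (\<lambda>\<omega>. 1 + X k \<omega> ^ 4)"
    using 3 i power_le_1_plus_4[of 3] by (intro integral_mono) auto
  also have "\<dots> \<le> 1 + C" using X4 by (simp add: prob_space)
  finally show "expectation (\<lambda>\<omega>. \<bar>X k \<omega>\<bar> ^ 3) \<le> 1 + C" .
qed

definition Q :: "int \<Rightarrow> 'a \<Rightarrow> real" where "Q k \<omega> = (X k \<omega>)\<^sup>2 - \<kappa>"

lemma Q_meas [measurable]: "Q k \<in> borel_measurable M"
  unfolding Q_def by measurable

lemma integrable_Q: "integrable M (Q k)" "integrable M (\<lambda>\<omega>. (Q k \<omega>)\<^sup>2)"
  and Q_sq_le: "expectation (\<lambda>\<omega>. (Q k \<omega>)\<^sup>2) \<le> C"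
  and abs_Q_le: "expectation (\<lambda>\<omega>. \<bar>Q k \<omega>\<bar>) \<le> 2 * \<kappa>"
  and kappa_nonneg: "0 \<le> \<kappa>" and C_nonneg: "0 \<le> C"
proof -
  show k0: "0 \<le> \<kappa>" using X2[of k, symmetric] by simp
  have "0 \<le> expectation (\<lambda>\<omega>. X k \<omega> ^ 4)" by simp
  then show "0 \<le> C" using X4(2)[of k] by linarith
  show Q: "integrable M (Q k)"
    unfolding Q_def using integrable_powers by simp
  have eq: "(Q k \<omega>)\<^sup>2 = X k \<omega> ^ 4 - 2 * \<kappa> * (X k \<omega>)\<^sup>2 + \<kappa>\<^sup>2" for \<omega>
    by (simp add: Q_def power2_eq_square power4_eq_xxxx algebra_simps)
  show "integrable M (\<lambda>\<omega>. (Q k \<omega>)\<^sup>2)"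
    unfolding eq using integrable_powers X4 by simp
  have "expectation (\<lambda>\<omega>. (Q k \<omega>)\<^sup>2) = expectation (\<lambda>\<omega>. X k \<omega> ^ 4) - \<kappa>\<^sup>2"
    unfolding eq using integrable_powers X4 by (simp add: X2 prob_space) (simp add: power2_eq_square)
  then show "expectation (\<lambda>\<omega>. (Q k \<omega>)\<^sup>2) \<le> C" using X4(2)[of k] zero_le_power2[of \<kappa>] by linarith
  have "expectation (\<lambda>\<omega>. \<bar>Q k \<omega>\<bar>) \<le> expectation (\<lambda>\<omega>. (X k \<omega>)\<^sup>2 + \<kappa>)"
    using Q integrable_powers(1)[of k] k0 by (intro integral_mono) (auto simp: Q_def abs_le_iff)
  also have "\<dots> = 2 * \<kappa>" using integrable_powers(1)[of k] by (simp add: X2 prob_space)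
  finally show "expectation (\<lambda>\<omega>. \<bar>Q k \<omega>\<bar>) \<le> 2 * \<kappa>" .
qed

lemma integrable_abs_mult_Q: "integrable M (\<lambda>\<omega>. \<bar>X j \<omega>\<bar> * \<bar>Q k \<omega>\<bar>)"
  and expectation_abs_mult_Q: "expectation (\<lambda>\<omega>. \<bar>X j \<omega>\<bar> * \<bar>Q k \<omega>\<bar>) \<le> \<kappa> + C"
proof -
  have i: "integrable M (\<lambda>\<omega>. (X j \<omega>)\<^sup>2 + (Q k \<omega>)\<^sup>2)"
    using integrable_powers(1) integrable_Q(2) by simp
  note le = abs_mult_le_squares[unfolded abs_mult]
  show int: "integrable M (\<lambda>\<omega>. \<bar>X j \<omega>\<bar> * \<bar>Q k \<omega>\<bar>)"
    by (rule Bochner_Integration.integrable_bound[OF i]) (use le in \<open>auto simp: abs_mult\<close>)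
  have "expectation (\<lambda>\<omega>. \<bar>X j \<omega>\<bar> * \<bar>Q k \<omega>\<bar>) \<le> expectation (\<lambda>\<omega>. (X j \<omega>)\<^sup>2 + (Q k \<omega>)\<^sup>2)"
    using int i le by (intro integral_mono) auto
  also have "\<dots> \<le> \<kappa> + C"
    using integrable_powers(1)[of j] integrable_Q(2)[of k] Q_sq_le[of k] by (simp add: X2)
  finally show "expectation (\<lambda>\<omega>. \<bar>X j \<omega>\<bar> * \<bar>Q k \<omega>\<bar>) \<le> \<kappa> + C" .
qed

lemma integrable_iexp_mult:
  assumes [measurable]: "g \<in> borel_measurable M" and "integrable M h"
  shows "integrable M (\<lambda>\<omega>. iexp (g \<omega>) * complex_of_real (h \<omega>))"
proof (rule Bochner_Integration.integrable_bound[OF assms(2)])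
  show "(\<lambda>\<omega>. iexp (g \<omega>) * complex_of_real (h \<omega>)) \<in> borel_measurable M"
    using borel_measurable_integrable[OF assms(2)] by measurable
qed (simp add: norm_mult)

lemma norm_expectation_iexp_mult_le:
  assumes [measurable]: "g \<in> borel_measurable M" and "integrable M h"
  shows "cmod (\<integral>\<omega>. iexp (g \<omega>) * complex_of_real (h \<omega>) \<partial>M) \<le> expectation (\<lambda>\<omega>. \<bar>h \<omega>\<bar>)"
proof -
  have "cmod (\<integral>\<omega>. iexp (g \<omega>) * complex_of_real (h \<omega>) \<partial>M)
      \<le> (\<integral>\<omega>. cmod (iexp (g \<omega>) * complex_of_real (h \<omega>)) \<partial>M)"
    by (rule integral_norm_bound)
  then show ?thesis by (simp add: norm_mult)
qed

context
  fixes b :: "int \<Rightarrow> real" and lo hi :: int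
  assumes le: "lo \<le> hi" and supp: "\<And>k. k \<notin> {lo..hi} \<Longrightarrow> b k = 0"
begin

text \<open>
  The products \<open>w k * E (exp (i * T k))\<close> interpolate between the Gaussian value at \<open>k = lo - 1\<close> and the
  characteristic function of the whole sum at \<open>k = hi\<close>. The small parameter is \<open>D\<close>, the total
  variation of the squared weights. The term of second order left over in step \<open>k\<close> is \<open>\<beta> k * f k / 2\<close>.
\<close>

definition T where "T k \<omega> = (\<Sum>j=lo..k. b j * X j \<omega>)"
definition V where "V k = \<kappa> * (\<Sum>j=lo..k. (b j)\<^sup>2)"
definition w where "w k = exp (- (V hi - V k) / 2)"
definition \<beta> where "\<beta> k = w k * (b k)\<^sup>2"
definition S where "S = (\<Sum>k=lo..hi. (b k)\<^sup>2)"
definition D where "D = (\<Sum>k=lo-1..hi. \<bar>(b (k + 1))\<^sup>2 - (b k)\<^sup>2\<bar>)"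
definition f where "f k = (\<integral>\<omega>. iexp (T (k - 1) \<omega>) * complex_of_real (Q k \<omega>) \<partial>M)"

lemma T_meas [measurable]: "T k \<in> borel_measurable M"
  unfolding T_def by measurable

lemma range_split: "{lo..k} = (if lo \<le> k then insert k {lo..k - 1} else {})" for k :: int
  by auto

lemma T_step: "T k \<omega> = T (k - 1) \<omega> + b k * X k \<omega>"
  unfolding T_def by (subst range_split) (use supp[of k] in \<open>auto simp: add.commute\<close>)

lemma V_step: "V k = V (k - 1) + \<kappa> * (b k)\<^sup>2"
  unfolding V_def by (subst range_split) (use supp[of k] in \<open>auto simp: algebra_simps\<close>)

lemma V_mono: "V (k - 1) \<le> V k"
  using kappa_nonneg by (simp add: V_step[of k])

lemma w_pos: "0 < w k" by (simp add: w_def)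

lemma w_mono: "w (k - 1) \<le> w k"
  using V_mono by (simp add: w_def)

lemma w_le_1: "w k \<le> 1" if "k \<le> hi + 1"
proof -
  have "V k \<le> V hi"
  proof (cases "k = hi + 1")
    case True
    then show ?thesis using V_step[of "hi + 1"] supp[of "hi + 1"] by simp
  next
    case False
    then show ?thesis unfolding V_def using that kappa_nonneg
      by (intro mult_left_mono sum_mono2) auto
  qed
  then show ?thesis by (simp add: w_def)
qed

lemma D_nonneg: "0 \<le> D" by (simp add: D_def sum_nonneg)

lemma b_sq_le: "(b k)\<^sup>2 \<le> D"
proof (cases "k \<in> {lo..hi}")
  case True
  have "(b k)\<^sup>2 = (\<Sum>j=lo..k. (b j)\<^sup>2 - (b (j - 1))\<^sup>2)"
    using True supp[of "lo - 1"] by (subst sum_int_telescope) auto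
  also have "\<dots> \<le> (\<Sum>j=lo..k. \<bar>(b j)\<^sup>2 - (b (j - 1))\<^sup>2\<bar>)" by (intro sum_mono) auto
  also have "\<dots> = (\<Sum>j=lo-1..k-1. \<bar>(b (j + 1))\<^sup>2 - (b j)\<^sup>2\<bar>)"
    by (rule sum.reindex_bij_witness[of _ "\<lambda>j. j + 1" "\<lambda>j. j - 1"]) auto
  also have "\<dots> \<le> D" unfolding D_def using True by (intro sum_mono2) auto
  finally show ?thesis .
next
  case False
  then show ?thesis using supp[of k] D_nonneg by simp
qed

lemma abs_b_le: "\<bar>b k\<bar> \<le> sqrt D"
  using b_sq_le real_le_rsqrt by (simp add: real_le_rsqrt)

lemma beta_nonneg: "0 \<le> \<beta> k" using w_pos[of k] by (simp add: \<beta>_def)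

lemma beta_zero: "k \<notin> {lo..hi} \<Longrightarrow> \<beta> k = 0" by (simp add: \<beta>_def supp)

lemma beta_le: "\<beta> k \<le> (b k)\<^sup>2"
proof (cases "k \<in> {lo..hi}")
  case True
  then show ?thesis using mult_right_mono[OF w_le_1[of k], of "(b k)\<^sup>2"] by (simp add: \<beta>_def)
qed (simp add: \<beta>_def supp)

lemma sum_beta_le: "(\<Sum>k=lo..hi. \<beta> k) \<le> S"
  unfolding S_def by (intro sum_mono beta_le)

text \<open>
  The factor \<open>w\<close> is monotone with values in the unit interval and \<open>(b k)\<^sup>2 \<le> D\<close>, so it adds at most
  one more \<open>D\<close> to the variation of the squared weights.
\<close>

lemma beta_variation: "(\<Sum>k=lo-1..hi. \<bar>\<beta> (k + 1) - \<beta> k\<bar>) \<le> 2 * D"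
proof -
  have "\<bar>\<beta> (k + 1) - \<beta> k\<bar> \<le> \<bar>(b (k + 1))\<^sup>2 - (b k)\<^sup>2\<bar> + D * (w (k + 1) - w k)" if "k \<in> {lo-1..hi}" for k
  proof -
    have "\<beta> (k + 1) - \<beta> k = w (k + 1) * ((b (k + 1))\<^sup>2 - (b k)\<^sup>2) + (w (k + 1) - w k) * (b k)\<^sup>2"
      by (simp add: \<beta>_def algebra_simps)
    moreover have "\<bar>w (k + 1) * ((b (k + 1))\<^sup>2 - (b k)\<^sup>2)\<bar> \<le> 1 * \<bar>(b (k + 1))\<^sup>2 - (b k)\<^sup>2\<bar>"
      unfolding abs_mult using that w_le_1[of "k + 1"] w_pos[of "k + 1"] by (intro mult_right_mono) auto
    moreover have "\<bar>(w (k + 1) - w k) * (b k)\<^sup>2\<bar> \<le> (w (k + 1) - w k) * D"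
      unfolding abs_mult using w_mono[of "k + 1"] b_sq_le[of k] by (intro mult_mono) auto
    ultimately show ?thesis by (simp add: mult.commute)
  qed
  then have "(\<Sum>k=lo-1..hi. \<bar>\<beta> (k + 1) - \<beta> k\<bar>)
      \<le> (\<Sum>k=lo-1..hi. \<bar>(b (k + 1))\<^sup>2 - (b k)\<^sup>2\<bar> + D * (w (k + 1) - w k))"
    by (rule sum_mono)
  also have "\<dots> = D + D * (\<Sum>k=lo-1..hi. w (k + 1) - w k)"
    by (simp add: sum.distrib D_def sum_distrib_left)
  also have "(\<Sum>k=lo-1..hi. w (k + 1) - w k) = w (hi + 1) - w (lo - 1)"
    using sum_int_telescope[of "lo - 1" hi "\<lambda>k. w (k + 1)"] le by simp
  also have "D + D * \<dots> \<le> 2 * D"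
  proof -
    have "w (hi + 1) - w (lo - 1) \<le> 1" using w_le_1[of "hi + 1"] w_pos[of "lo - 1"] by simp
    from mult_left_mono[OF this D_nonneg] show ?thesis by simp
  qed
  finally show ?thesis .
qed

lemma beta_shift_variation: "(\<Sum>k=a..hi. \<bar>\<beta> (k + int r) - \<beta> k\<bar>) \<le> real r * (2 * D)"
proof (induction r)
  case (Suc r)
  have "(\<Sum>k=a..hi. \<bar>\<beta> (k + int (Suc r)) - \<beta> k\<bar>)
     \<le> (\<Sum>k=a..hi. \<bar>\<beta> (k + int r + 1) - \<beta> (k + int r)\<bar> + \<bar>\<beta> (k + int r) - \<beta> k\<bar>)"
    by (intro sum_mono) (simp add: add_ac)
  also have "\<dots> = (\<Sum>k=a..hi. \<bar>\<beta> (k + int r + 1) - \<beta> (k + int r)\<bar>) + (\<Sum>k=a..hi. \<bar>\<beta> (k + int r) - \<beta> k\<bar>)"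
    by (rule sum.distrib)
  also have "(\<Sum>k=a..hi. \<bar>\<beta> (k + int r + 1) - \<beta> (k + int r)\<bar>)
     = (\<Sum>k=a+int r..hi+int r. \<bar>\<beta> (k + 1) - \<beta> k\<bar>)"
    by (rule sum.reindex_bij_witness[of _ "\<lambda>k. k - int r" "\<lambda>k. k + int r"]) auto
  also have "\<dots> = (\<Sum>k\<in>{a+int r..hi+int r} \<inter> {lo-1..hi}. \<bar>\<beta> (k + 1) - \<beta> k\<bar>)"
    by (intro sum.mono_neutral_right) (auto simp: beta_zero)
  also have "\<dots> \<le> (\<Sum>k=lo-1..hi. \<bar>\<beta> (k + 1) - \<beta> k\<bar>)"
    by (intro sum_mono2) auto
  also have "\<dots> \<le> 2 * D" by (rule beta_variation)
  finally show ?case using Suc by (simp add: algebra_simps)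
qed simp

lemma norm_f_le: "cmod (f k) \<le> 2 * \<kappa>"
  unfolding f_def
  by (rule order.trans[OF norm_expectation_iexp_mult_le abs_Q_le]) (auto intro: integrable_Q)

lemma T_shift: "\<bar>T (k + int r - 1) \<omega> - T (k - 1) \<omega>\<bar> \<le> sqrt D * (\<Sum>i<r. \<bar>X (k + int i) \<omega>\<bar>)"
proof (induction r)
  case (Suc r)
  have "T (k + int (Suc r) - 1) \<omega> = T (k + int r - 1) \<omega> + b (k + int r) * X (k + int r) \<omega>"
    using T_step[of "k + int r"] by (simp add: add.commute)
  moreover have "\<bar>b (k + int r) * X (k + int r) \<omega>\<bar> \<le> sqrt D * \<bar>X (k + int r) \<omega>\<bar>"
    unfolding abs_mult using abs_b_le by (intro mult_right_mono) auto
  ultimately show ?case using Suc by (simp add: algebra_simps)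
qed simp

text \<open>
  Between the two exponents there are \<open>r\<close> terms, each with a weight of size at most \<open>sqrt D\<close>.
\<close>

lemma shift_error:
  "cmod ((\<integral>\<omega>. iexp (T (k + int r - 1) \<omega>) * complex_of_real (Q j \<omega>) \<partial>M)
      - (\<integral>\<omega>. iexp (T (k - 1) \<omega>) * complex_of_real (Q j \<omega>) \<partial>M)) \<le> sqrt D * (real r * (\<kappa> + C))"
proof -
  have pw: "cmod (iexp (T (k + int r - 1) \<omega>) * complex_of_real (Q j \<omega>)
        - iexp (T (k - 1) \<omega>) * complex_of_real (Q j \<omega>))
      \<le> sqrt D * (\<Sum>i<r. \<bar>X (k + int i) \<omega>\<bar> * \<bar>Q j \<omega>\<bar>)" for \<omega>
  proof -
    note iexp_difference_le[of "T (k + int r - 1) \<omega>" "T (k - 1) \<omega>"]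
    also note T_shift
    finally have "cmod (iexp (T (k + int r - 1) \<omega>) - iexp (T (k - 1) \<omega>)) * \<bar>Q j \<omega>\<bar>
        \<le> sqrt D * (\<Sum>i<r. \<bar>X (k + int i) \<omega>\<bar>) * \<bar>Q j \<omega>\<bar>"
      by (rule mult_right_mono) simp
    then show ?thesis
      by (simp add: norm_mult sum_distrib_right mult.assoc flip: left_diff_distrib)
  qed
  have i1: "integrable M (\<lambda>\<omega>. iexp (T k' \<omega>) * complex_of_real (Q j \<omega>))" for k'
    by (rule integrable_iexp_mult) (auto intro: integrable_Q)
  have "cmod ((\<integral>\<omega>. iexp (T (k + int r - 1) \<omega>) * complex_of_real (Q j \<omega>) \<partial>M)
      - (\<integral>\<omega>. iexp (T (k - 1) \<omega>) * complex_of_real (Q j \<omega>) \<partial>M))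
    = cmod (\<integral>\<omega>. iexp (T (k + int r - 1) \<omega>) * complex_of_real (Q j \<omega>)
        - iexp (T (k - 1) \<omega>) * complex_of_real (Q j \<omega>) \<partial>M)"
    using i1 by (simp only: Bochner_Integration.integral_diff)
  also have "\<dots> \<le> expectation (\<lambda>\<omega>. sqrt D * (\<Sum>i<r. \<bar>X (k + int i) \<omega>\<bar> * \<bar>Q j \<omega>\<bar>))"
    using i1 pw integrable_abs_mult_Q
    by (intro order.trans[OF integral_norm_bound] integral_mono)
      (auto intro!: integrable_norm Bochner_Integration.integrable_diff Bochner_Integration.integrable_sum)
  also have "\<dots> = sqrt D * (\<Sum>i<r. expectation (\<lambda>\<omega>. \<bar>X (k + int i) \<omega>\<bar> * \<bar>Q j \<omega>\<bar>))"
    using integrable_abs_mult_Q by simp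
  also have "\<dots> \<le> sqrt D * (\<Sum>i<r. \<kappa> + C)"
    using D_nonneg by (intro mult_left_mono sum_mono expectation_abs_mult_Q) auto
  finally show ?thesis by simp
qed

text \<open>
  The sum is compared with \<open>\<Sum>k. \<beta> k * G k r\<close>, where only \<open>Q\<close> has been moved by \<open>r\<close> places. The change of
  \<open>\<beta>\<close> costs its variation, the change of the exponential is \<open>shift_error\<close>. Averaging over \<open>r < l\<close> then
  produces block sums of \<open>Q\<close>, which the ergodic assumption controls. For fixed \<open>l\<close> the costs vanish
  with \<open>D\<close>.
\<close>

lemma weighted_quadratic_sum_le:
  assumes "0 < l"
  shows "cmod (\<Sum>k=lo..hi. \<beta> k * f k)
    \<le> S * \<bar>\<eta> l\<bar> + 4 * \<kappa> * real l * D + S * (sqrt D * (real l * (\<kappa> + C)))"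
proof -
  define G where "G k r = (\<integral>\<omega>. iexp (T (k - 1) \<omega>) * complex_of_real (Q (k + int r) \<omega>) \<partial>M)" for k r
  define A where "A = {lo - int l..hi}"
  have shift: "cmod ((\<Sum>k=lo..hi. \<beta> k * f k) - (\<Sum>k\<in>A. \<beta> k * G k r))
      \<le> 4 * \<kappa> * real l * D + S * (sqrt D * (real l * (\<kappa> + C)))" if "r < l" for r
  proof -
    have "(\<Sum>k=lo..hi. \<beta> k * f k) = (\<Sum>k\<in>A. \<beta> (k + int r) * f (k + int r))"
      unfolding A_def using that
      by (intro sum_int_shift[of lo hi "\<lambda>k. \<beta> k * f k" _ "int r", symmetric]) (auto simp: beta_zero)
    then have "cmod ((\<Sum>k=lo..hi. \<beta> k * f k) - (\<Sum>k\<in>A. \<beta> k * G k r))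
       = cmod (\<Sum>k\<in>A. (\<beta> (k + int r) - \<beta> k) * f (k + int r) + \<beta> k * (f (k + int r) - G k r))"
      by (simp add: algebra_simps flip: sum_subtractf)
    also have "\<dots> \<le> (\<Sum>k\<in>A. \<bar>\<beta> (k + int r) - \<beta> k\<bar> * (2 * \<kappa>) + \<beta> k * (sqrt D * (real l * (\<kappa> + C))))"
    proof (intro sum_norm_le)
      fix k
      have "cmod (complex_of_real (\<beta> (k + int r) - \<beta> k) * f (k + int r)) \<le> \<bar>\<beta> (k + int r) - \<beta> k\<bar> * (2 * \<kappa>)"
        unfolding norm_mult norm_of_real by (intro mult_left_mono norm_f_le) auto
      moreover have "cmod (f (k + int r) - G k r) \<le> sqrt D * (real l * (\<kappa> + C))"
        using shift_error[of k r "k + int r"] that D_nonneg kappa_nonneg C_nonneg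
        unfolding f_def G_def
        by (elim order.trans) (auto intro!: mult_left_mono mult_right_mono)
      then have "cmod (complex_of_real (\<beta> k) * (f (k + int r) - G k r)) \<le> \<beta> k * (sqrt D * (real l * (\<kappa> + C)))"
        unfolding norm_mult norm_of_real using beta_nonneg[of k] by (simp add: mult_left_mono)
      ultimately show "cmod (complex_of_real (\<beta> (k + int r) - \<beta> k) * f (k + int r) + complex_of_real (\<beta> k) * (f (k + int r) - G k r))
        \<le> \<bar>\<beta> (k + int r) - \<beta> k\<bar> * (2 * \<kappa>) + \<beta> k * (sqrt D * (real l * (\<kappa> + C)))"
        by (rule norm_triangle_le[OF add_mono])
    qed
    also have "\<dots> = (\<Sum>k\<in>A. \<bar>\<beta> (k + int r) - \<beta> k\<bar>) * (2 * \<kappa>) + (\<Sum>k\<in>A. \<beta> k) * (sqrt D * (real l * (\<kappa> + C)))"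
      by (simp add: sum.distrib sum_distrib_right)
    also have "(\<Sum>k\<in>A. \<beta> k) = (\<Sum>k=lo..hi. \<beta> k)"
      unfolding A_def by (intro sum.mono_neutral_right) (auto simp: beta_zero)
    also have "(\<Sum>k\<in>A. \<bar>\<beta> (k + int r) - \<beta> k\<bar>) * (2 * \<kappa>) + (\<Sum>k=lo..hi. \<beta> k) * (sqrt D * (real l * (\<kappa> + C)))
       \<le> (real l * (2 * D)) * (2 * \<kappa>) + S * (sqrt D * (real l * (\<kappa> + C)))"
    proof (intro add_mono mult_right_mono sum_beta_le)
      have "(\<Sum>k\<in>A. \<bar>\<beta> (k + int r) - \<beta> k\<bar>) \<le> real r * (2 * D)"
        unfolding A_def by (rule beta_shift_variation)
      also have "\<dots> \<le> real l * (2 * D)" using that D_nonneg by (intro mult_right_mono) auto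
      finally show "(\<Sum>k\<in>A. \<bar>\<beta> (k + int r) - \<beta> k\<bar>) \<le> real l * (2 * D)" .
    qed (use kappa_nonneg C_nonneg D_nonneg in auto)
    finally show ?thesis by (simp add: algebra_simps)
  qed
  have avg: "cmod (\<Sum>r<l. \<Sum>k\<in>A. \<beta> k * G k r) \<le> real l * (S * \<bar>\<eta> l\<bar>)"
  proof -
    have "cmod (\<Sum>r<l. G k r) \<le> real l * \<bar>\<eta> l\<bar>" for k
    proof -
      have "(\<Sum>r<l. G k r) = (\<integral>\<omega>. iexp (T (k - 1) \<omega>) * complex_of_real (\<Sum>r<l. Q (k + int r) \<omega>) \<partial>M)"
        unfolding G_def of_real_sum sum_distrib_left
        by (intro Bochner_Integration.integral_sum[symmetric] integrable_iexp_mult integrable_Q) auto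
      also have "cmod \<dots> \<le> expectation (\<lambda>\<omega>. \<bar>\<Sum>r<l. Q (k + int r) \<omega>\<bar>)"
        by (intro norm_expectation_iexp_mult_le Bochner_Integration.integrable_sum integrable_Q) auto
      also have "\<dots> \<le> real l * \<eta> l" using ergodic unfolding Q_def .
      also have "\<dots> \<le> real l * \<bar>\<eta> l\<bar>" by (intro mult_left_mono) auto
      finally show ?thesis .
    qed
    then have "cmod (\<Sum>k\<in>A. \<beta> k * (\<Sum>r<l. G k r)) \<le> (\<Sum>k\<in>A. \<beta> k * (real l * \<bar>\<eta> l\<bar>))"
      using beta_nonneg by (intro sum_norm_le) (simp add: norm_mult mult_left_mono)
    also have "\<dots> = (\<Sum>k=lo..hi. \<beta> k) * (real l * \<bar>\<eta> l\<bar>)"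
      unfolding A_def sum_distrib_right by (intro sum.mono_neutral_right) (auto simp: beta_zero)
    also have "\<dots> \<le> S * (real l * \<bar>\<eta> l\<bar>)" by (intro mult_right_mono sum_beta_le) auto
    finally have "cmod (\<Sum>k\<in>A. \<beta> k * (\<Sum>r<l. G k r)) \<le> S * (real l * \<bar>\<eta> l\<bar>)" .
    moreover have "(\<Sum>r<l. \<Sum>k\<in>A. \<beta> k * G k r) = (\<Sum>k\<in>A. \<beta> k * (\<Sum>r<l. G k r))"
      by (subst sum.swap) (simp add: sum_distrib_left)
    ultimately show ?thesis by (simp add: mult.left_commute)
  qed
  define E where "E = 4 * \<kappa> * real l * D + S * (sqrt D * (real l * (\<kappa> + C)))"
  have "real l * cmod (\<Sum>k=lo..hi. \<beta> k * f k) = cmod (\<Sum>r<l. \<Sum>k=lo..hi. \<beta> k * f k)"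
    by (simp add: norm_mult)
  also have "\<dots> = cmod ((\<Sum>r<l. (\<Sum>k=lo..hi. \<beta> k * f k) - (\<Sum>k\<in>A. \<beta> k * G k r)) + (\<Sum>r<l. \<Sum>k\<in>A. \<beta> k * G k r))"
    by (simp add: sum_subtractf)
  also have "\<dots> \<le> real l * E + real l * (S * \<bar>\<eta> l\<bar>)"
  proof (rule norm_triangle_le[OF add_mono[OF _ avg]])
    have "cmod (\<Sum>r<l. (\<Sum>k=lo..hi. \<beta> k * f k) - (\<Sum>k\<in>A. \<beta> k * G k r)) \<le> (\<Sum>r<l. E)"
      unfolding E_def using shift by (intro sum_norm_le) auto
    then show "cmod (\<Sum>r<l. (\<Sum>k=lo..hi. \<beta> k * f k) - (\<Sum>k\<in>A. \<beta> k * G k r)) \<le> real l * E" by simp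
  qed
  finally have "real l * cmod (\<Sum>k=lo..hi. \<beta> k * f k) \<le> real l * (E + S * \<bar>\<eta> l\<bar>)"
    by (simp add: algebra_simps)
  then show ?thesis using assms unfolding E_def by simp
qed

text \<open>
  Second order expansion of \<open>exp (i * b k * X k)\<close>. The linear term has expectation zero by the
  martingale property; in the quadratic term \<open>(X k)\<^sup>2\<close> is split into \<open>\<kappa>\<close>, which matches the
  exponential factor, and \<open>Q k\<close>.
\<close>

lemma one_step:
  "cmod ((\<integral>\<omega>. iexp (T k \<omega>) \<partial>M) - exp (- \<kappa> * (b k)\<^sup>2 / 2) * (\<integral>\<omega>. iexp (T (k - 1) \<omega>) \<partial>M)
      + (b k)\<^sup>2 / 2 * f k) \<le> (b k)\<^sup>2 * (sqrt D * (1 + C) / 6 + \<kappa>\<^sup>2 * D / 8)"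
proof -
  define y where "y = \<kappa> * (b k)\<^sup>2 / 2"
  have y0: "0 \<le> y" using kappa_nonneg by (simp add: y_def)
  define \<rho> where "\<rho> \<omega> = iexp (b k * X k \<omega>) - (1 + \<i> * (b k * X k \<omega>) - (b k * X k \<omega>)\<^sup>2 / 2)" for \<omega>
  have \<rho>_le: "cmod (\<rho> \<omega>) \<le> \<bar>b k\<bar> ^ 3 / 6 * \<bar>X k \<omega>\<bar> ^ 3" for \<omega>
    using iexp_second_order[of "b k * X k \<omega>"] by (simp add: \<rho>_def abs_mult power_mult_distrib)
  have [measurable]: "\<rho> \<in> borel_measurable M" unfolding \<rho>_def by measurable
  have \<rho>i: "integrable M (\<lambda>\<omega>. iexp (T (k - 1) \<omega>) * \<rho> \<omega>)"
  proof (rule Bochner_Integration.integrable_bound)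
    show "integrable M (\<lambda>\<omega>. \<bar>b k\<bar> ^ 3 / 6 * \<bar>X k \<omega>\<bar> ^ 3)"
      using integrable_powers(2) by simp
    show "AE \<omega> in M. cmod (iexp (T (k - 1) \<omega>) * \<rho> \<omega>) \<le> norm (\<bar>b k\<bar> ^ 3 / 6 * \<bar>X k \<omega>\<bar> ^ 3)"
      using \<rho>_le by (intro AE_I2) (simp add: norm_mult)
  qed measurable
  define e where "e = exp (- y) - (1 - y)"
  have e_le: "\<bar>e\<bar> \<le> y\<^sup>2 / 2" unfolding e_def by (rule exp_minus_second_order[OF y0])
  have pw: "iexp (T k \<omega>) = complex_of_real (1 - y) * iexp (T (k - 1) \<omega>)
      + \<i> * b k * (iexp (T (k - 1) \<omega>) * X k \<omega>) - (b k)\<^sup>2 / 2 * (iexp (T (k - 1) \<omega>) * Q k \<omega>)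
      + iexp (T (k - 1) \<omega>) * \<rho> \<omega>" for \<omega>
  proof -
    have r: "(b k * X k \<omega>)\<^sup>2 / 2 = (b k)\<^sup>2 / 2 * Q k \<omega> + y"
      by (simp add: Q_def y_def power_mult_distrib field_simps)
    have "iexp (T k \<omega>) = iexp (T (k - 1) \<omega>) * iexp (b k * X k \<omega>)"
      unfolding T_step[of k] by (simp add: distrib_left exp_add)
    also have "iexp (b k * X k \<omega>) = \<rho> \<omega> + (1 + \<i> * (b k * X k \<omega>) - complex_of_real ((b k)\<^sup>2 / 2 * Q k \<omega> + y))"
      unfolding \<rho>_def r[symmetric] by simp
    finally show ?thesis by (simp add: algebra_simps)
  qed
  have i0: "integrable M (\<lambda>\<omega>. iexp (T (k - 1) \<omega>))"
    by (intro integrable_const_bound[of _ 1]) auto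
  have iX: "integrable M (\<lambda>\<omega>. iexp (T (k - 1) \<omega>) * X k \<omega>)"
    by (rule integrable_iexp_mult) (auto intro: integrable_powers)
  have iQ: "integrable M (\<lambda>\<omega>. iexp (T (k - 1) \<omega>) * Q k \<omega>)"
    by (rule integrable_iexp_mult) (auto intro: integrable_Q)
  have mart: "(\<integral>\<omega>. iexp (T (k - 1) \<omega>) * X k \<omega> \<partial>M) = 0"
    unfolding T_def by (rule martingale) auto
  have "(\<integral>\<omega>. iexp (T k \<omega>) \<partial>M) = complex_of_real (1 - y) * (\<integral>\<omega>. iexp (T (k - 1) \<omega>) \<partial>M)
      - (b k)\<^sup>2 / 2 * f k + (\<integral>\<omega>. iexp (T (k - 1) \<omega>) * \<rho> \<omega> \<partial>M)"
    unfolding pw using i0 iX iQ \<rho>i by (simp add: mart f_def)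
  then have "(\<integral>\<omega>. iexp (T k \<omega>) \<partial>M) - exp (- y) * (\<integral>\<omega>. iexp (T (k - 1) \<omega>) \<partial>M) + (b k)\<^sup>2 / 2 * f k
      = (\<integral>\<omega>. iexp (T (k - 1) \<omega>) * \<rho> \<omega> \<partial>M) - e * (\<integral>\<omega>. iexp (T (k - 1) \<omega>) \<partial>M)"
    by (simp add: e_def algebra_simps)
  also have "cmod \<dots> \<le> \<bar>b k\<bar> ^ 3 / 6 * (1 + C) + y\<^sup>2 / 2 * 1"
  proof (intro norm_triangle_le_diff add_mono)
    have "cmod (\<integral>\<omega>. iexp (T (k - 1) \<omega>) * \<rho> \<omega> \<partial>M) \<le> expectation (\<lambda>\<omega>. \<bar>b k\<bar> ^ 3 / 6 * \<bar>X k \<omega>\<bar> ^ 3)"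
    proof (rule order.trans[OF integral_norm_bound])
      have "integrable M (\<lambda>\<omega>. cmod (\<rho> \<omega>))" using integrable_norm[OF \<rho>i] by (simp add: norm_mult)
      then have "expectation (\<lambda>\<omega>. cmod (\<rho> \<omega>)) \<le> expectation (\<lambda>\<omega>. \<bar>b k\<bar> ^ 3 / 6 * \<bar>X k \<omega>\<bar> ^ 3)"
        using \<rho>_le integrable_powers(2)[of k] by (intro integral_mono) simp_all
      then show "expectation (\<lambda>\<omega>. cmod (iexp (T (k - 1) \<omega>) * \<rho> \<omega>)) \<le> expectation (\<lambda>\<omega>. \<bar>b k\<bar> ^ 3 / 6 * \<bar>X k \<omega>\<bar> ^ 3)"
        by (simp add: norm_mult)
    qed
    also have "\<dots> = \<bar>b k\<bar> ^ 3 / 6 * expectation (\<lambda>\<omega>. \<bar>X k \<omega>\<bar> ^ 3)" by simp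
    also have "\<dots> \<le> \<bar>b k\<bar> ^ 3 / 6 * (1 + C)"
      using abs3_le[of k] by (rule mult_left_mono) simp
    finally show "cmod (\<integral>\<omega>. iexp (T (k - 1) \<omega>) * \<rho> \<omega> \<partial>M) \<le> \<bar>b k\<bar> ^ 3 / 6 * (1 + C)" .
    have "cmod (\<integral>\<omega>. iexp (T (k - 1) \<omega>) \<partial>M) \<le> 1"
      using order.trans[OF integral_norm_bound[of M "\<lambda>\<omega>. iexp (T (k - 1) \<omega>)"]] by (simp add: prob_space)
    then show "cmod (e * (\<integral>\<omega>. iexp (T (k - 1) \<omega>) \<partial>M)) \<le> y\<^sup>2 / 2 * 1"
      unfolding norm_mult norm_of_real using e_le by (intro mult_mono) auto
  qed
  also have "\<dots> \<le> (b k)\<^sup>2 * (sqrt D * (1 + C) / 6 + \<kappa>\<^sup>2 * D / 8)"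
  proof -
    have "\<bar>b k\<bar> ^ 3 \<le> (b k)\<^sup>2 * sqrt D"
      using mult_left_mono[OF abs_b_le[of k], of "(b k)\<^sup>2"] by (simp add: power3_eq_cube power2_eq_square abs_mult)
    then have "\<bar>b k\<bar> ^ 3 * (1 + C) \<le> (b k)\<^sup>2 * sqrt D * (1 + C)"
      using C_nonneg by (intro mult_right_mono) auto
    moreover have "y\<^sup>2 / 2 = (b k)\<^sup>2 * (\<kappa>\<^sup>2 * (b k)\<^sup>2 / 8)"
      by (simp add: y_def power2_eq_square)
    moreover have "(b k)\<^sup>2 * (\<kappa>\<^sup>2 * (b k)\<^sup>2 / 8) \<le> (b k)\<^sup>2 * (\<kappa>\<^sup>2 * D / 8)"
      using b_sq_le[of k] by (intro mult_left_mono divide_right_mono) auto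
    moreover have "(b k)\<^sup>2 * (sqrt D * (1 + C) / 6 + \<kappa>\<^sup>2 * D / 8)
        = (b k)\<^sup>2 * sqrt D * (1 + C) / 6 + (b k)\<^sup>2 * (\<kappa>\<^sup>2 * D / 8)"
      by (simp add: distrib_left mult.assoc)
    moreover have "\<bar>b k\<bar> ^ 3 / 6 * (1 + C) = \<bar>b k\<bar> ^ 3 * (1 + C) / 6" by simp
    ultimately show ?thesis by linarith
  qed
  finally have *: "cmod ((\<integral>\<omega>. iexp (T k \<omega>) \<partial>M) - exp (- y) * (\<integral>\<omega>. iexp (T (k - 1) \<omega>) \<partial>M)
      + (b k)\<^sup>2 / 2 * f k) \<le> (b k)\<^sup>2 * (sqrt D * (1 + C) / 6 + \<kappa>\<^sup>2 * D / 8)" .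
  have "- \<kappa> * (b k)\<^sup>2 / 2 = - y" by (simp add: y_def)
  then show ?thesis using * by (simp only:)
qed

text \<open>
  The difference telescopes along \<open>a k = w k * E (exp (i * T k))\<close>; \<open>one_step\<close> bounds the increments except
  for the terms \<open>\<beta> k * f k\<close>, which are small only after summation.
\<close>

lemma characteristic_function_bound:
  assumes "0 < l"
  shows "cmod ((\<integral>\<omega>. iexp (\<Sum>k=lo..hi. b k * X k \<omega>) \<partial>M) - exp (- \<kappa> * S / 2))
    \<le> S * \<bar>\<eta> l\<bar> + 4 * \<kappa> * real l * D + S * (sqrt D * (real l * (\<kappa> + C)))
      + S * (sqrt D * (1 + C) / 6 + \<kappa>\<^sup>2 * D / 8)"
proof -
  define \<phi> where "\<phi> k = (\<integral>\<omega>. iexp (T k \<omega>) \<partial>M)" for k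
  define a where "a k = w k * \<phi> k" for k
  have "V (lo - 1) = 0" "V hi = \<kappa> * S" by (simp_all add: V_def S_def)
  moreover have "\<phi> (lo - 1) = 1" by (simp add: \<phi>_def T_def prob_space)
  ultimately have ends: "a hi = (\<integral>\<omega>. iexp (\<Sum>k=lo..hi. b k * X k \<omega>) \<partial>M)" "a (lo - 1) = exp (- \<kappa> * S / 2)"
    by (simp_all add: a_def w_def \<phi>_def T_def exp_of_real)
  have step: "a k - a (k - 1) = w k * (\<phi> k - exp (- \<kappa> * (b k)\<^sup>2 / 2) * \<phi> (k - 1))" for k
  proof -
    have "w (k - 1) = w k * exp (- \<kappa> * (b k)\<^sup>2 / 2)"
      unfolding w_def V_step[of k] by (simp add: field_simps flip: exp_add)
    then show ?thesis by (simp add: a_def algebra_simps)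
  qed
  define \<Delta> where "\<Delta> k = \<phi> k - exp (- \<kappa> * (b k)\<^sup>2 / 2) * \<phi> (k - 1) + (b k)\<^sup>2 / 2 * f k" for k
  have "a hi - a (lo - 1) = (\<Sum>k=lo..hi. a k - a (k - 1))"
    using le by (simp add: sum_int_telescope)
  also have "\<dots> = (\<Sum>k=lo..hi. w k * \<Delta> k) - (\<Sum>k=lo..hi. \<beta> k * f k) / 2"
    unfolding step \<Delta>_def \<beta>_def
    by (simp add: algebra_simps sum.distrib sum_subtractf sum_divide_distrib)
  also have "cmod \<dots> \<le> S * (sqrt D * (1 + C) / 6 + \<kappa>\<^sup>2 * D / 8)
      + (S * \<bar>\<eta> l\<bar> + 4 * \<kappa> * real l * D + S * (sqrt D * (real l * (\<kappa> + C))))"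
  proof (intro norm_triangle_le_diff add_mono)
    have "cmod (\<Sum>k=lo..hi. w k * \<Delta> k) \<le> (\<Sum>k=lo..hi. (b k)\<^sup>2 * (sqrt D * (1 + C) / 6 + \<kappa>\<^sup>2 * D / 8))"
    proof (intro sum_norm_le)
      fix k assume "k \<in> {lo..hi}"
      then have "cmod (w k * \<Delta> k) \<le> 1 * cmod (\<Delta> k)"
        unfolding norm_mult norm_of_real using w_le_1[of k] w_pos[of k] by (intro mult_right_mono) auto
      then show "cmod (w k * \<Delta> k) \<le> (b k)\<^sup>2 * (sqrt D * (1 + C) / 6 + \<kappa>\<^sup>2 * D / 8)"
        using one_step[of k] unfolding \<Delta>_def \<phi>_def by linarith
    qed
    then show "cmod (\<Sum>k=lo..hi. w k * \<Delta> k) \<le> S * (sqrt D * (1 + C) / 6 + \<kappa>\<^sup>2 * D / 8)"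
      by (simp add: S_def sum_distrib_right)
    have "cmod ((\<Sum>k=lo..hi. \<beta> k * f k) / 2) \<le> cmod (\<Sum>k=lo..hi. \<beta> k * f k)"
      by (simp add: norm_divide)
    also note weighted_quadratic_sum_le[OF assms]
    finally show "cmod ((\<Sum>k=lo..hi. \<beta> k * f k) / 2) \<le> S * \<bar>\<eta> l\<bar> + 4 * \<kappa> * real l * D + S * (sqrt D * (real l * (\<kappa> + C)))" .
  qed
  finally show ?thesis unfolding ends by (simp add: algebra_simps)
qed

lemma square_variation_le: "D \<le> sqrt (\<Sum>k=lo-1..hi. (b (k + 1) - b k)\<^sup>2) * (2 * sqrt S)"
proof -
  have "D = (\<Sum>k=lo-1..hi. \<bar>b (k + 1) - b k\<bar> * \<bar>b (k + 1) + b k\<bar>)"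
    unfolding D_def by (simp add: power2_eq_square algebra_simps flip: abs_mult)
  also have "\<dots> \<le> L2_set (\<lambda>k. b (k + 1) - b k) {lo-1..hi} * L2_set (\<lambda>k. b (k + 1) + b k) {lo-1..hi}"
    by (rule L2_set_mult_ineq)
  also have "\<dots> \<le> sqrt (\<Sum>k=lo-1..hi. (b (k + 1) - b k)\<^sup>2) * (2 * sqrt S)"
  proof (rule mult_mono)
    have "L2_set (\<lambda>k. b (k + 1) + b k) {lo-1..hi} \<le> L2_set (\<lambda>k. b (k + 1)) {lo-1..hi} + L2_set b {lo-1..hi}"
      by (rule L2_set_triangle_ineq)
    also have "L2_set b {lo-1..hi} = sqrt S"
      unfolding L2_set_def S_def by (intro arg_cong[of _ _ sqrt] sum.mono_neutral_right) (auto simp: supp)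
    also have "L2_set (\<lambda>k. b (k + 1)) {lo-1..hi} = sqrt S"
      unfolding L2_set_def S_def
      by (intro arg_cong[of _ _ sqrt] sum_int_shift[of lo hi "\<lambda>k. (b k)\<^sup>2"]) (auto simp: supp)
    finally show "L2_set (\<lambda>k. b (k + 1) + b k) {lo-1..hi} \<le> 2 * sqrt S" by simp
  qed (auto simp: L2_set_def sum_nonneg)
  finally show ?thesis .
qed

end

text \<open>
  For a fixed block length \<open>l\<close> all terms of \<open>characteristic_function_bound\<close> but the first vanish as the
  weights become smooth, and the first tends to \<open>v / \<kappa> * \<bar>\<eta> l\<bar>\<close>, which is small for large \<open>l\<close>.
\<close>

theorem central_limit:
  fixes b :: "nat \<Rightarrow> int \<Rightarrow> real"
  assumes le: "\<And>n. lo n \<le> hi n" and supp: "\<And>n k. k \<notin> {lo n..hi n} \<Longrightarrow> b n k = 0"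
    and lim: "(\<lambda>n. \<kappa> * (\<Sum>k=lo n..hi n. (b n k)\<^sup>2)) \<longlonglongrightarrow> v" and "0 < \<kappa>"
    and smooth: "(\<lambda>n. \<Sum>k=lo n-1..hi n. (b n (k + 1) - b n k)\<^sup>2) \<longlonglongrightarrow> 0"
  shows "(\<lambda>n. \<integral>\<omega>. iexp (\<Sum>k=lo n..hi n. b n k * X k \<omega>) \<partial>M) \<longlonglongrightarrow> complex_of_real (exp (- v / 2))"
proof -
  define s where "s n = S (b n) (lo n) (hi n)" for n
  define d where "d n = D (b n) (lo n) (hi n)" for n
  define z where "z n = (\<integral>\<omega>. iexp (\<Sum>k=lo n..hi n. b n k * X k \<omega>) \<partial>M)" for n
  have s: "(\<lambda>n. \<kappa> * s n) \<longlonglongrightarrow> v"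
  proof -
    have "s n = (\<Sum>k=lo n..hi n. (b n k)\<^sup>2)" for n
      unfolding s_def by (rule S_def) (use le supp in auto)
    then show ?thesis using lim by simp
  qed
  then have s': "s \<longlonglongrightarrow> v / \<kappa>" using tendsto_divide[OF s tendsto_const[of \<kappa>]] \<open>0 < \<kappa>\<close> by simp
  have d: "d \<longlonglongrightarrow> 0"
  proof (rule tendsto_sandwich[OF _ _ tendsto_const])
    have "0 \<le> d n" for n
      unfolding d_def by (rule D_nonneg) (use le supp in auto)
    then show "\<forall>\<^sub>F n in sequentially. 0 \<le> d n" by simp
    have "d n \<le> sqrt (\<Sum>k=lo n-1..hi n. (b n (k + 1) - b n k)\<^sup>2) * (2 * sqrt (s n))" for n
      unfolding d_def s_def by (rule square_variation_le) (use le supp in auto)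
    then show "\<forall>\<^sub>F n in sequentially. d n \<le> sqrt (\<Sum>k=lo n-1..hi n. (b n (k + 1) - b n k)\<^sup>2) * (2 * sqrt (s n))"
      by simp
    show "(\<lambda>n. sqrt (\<Sum>k=lo n-1..hi n. (b n (k + 1) - b n k)\<^sup>2) * (2 * sqrt (s n))) \<longlonglongrightarrow> 0"
      using tendsto_mult[OF tendsto_real_sqrt[OF smooth] tendsto_mult[OF tendsto_const[of 2] tendsto_real_sqrt[OF s']]] by simp
  qed
  have bound: "cmod (z n - exp (- \<kappa> * s n / 2)) \<le> s n * \<bar>\<eta> l\<bar> + 4 * \<kappa> * real l * d n + s n * (sqrt (d n) * (real l * (\<kappa> + C)))
      + s n * (sqrt (d n) * (1 + C) / 6 + \<kappa>\<^sup>2 * d n / 8)" if "0 < l" for n l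
    unfolding s_def d_def z_def by (rule characteristic_function_bound) (use le supp that in auto)
  have "(\<lambda>n. z n - exp (- \<kappa> * s n / 2)) \<longlonglongrightarrow> 0"
  proof (rule LIMSEQ_I)
    fix \<epsilon> :: real assume "0 < \<epsilon>"
    have "(\<lambda>l. v / \<kappa> * \<bar>\<eta> l\<bar>) \<longlonglongrightarrow> 0"
      using tendsto_mult[OF tendsto_const[of "v / \<kappa>"] tendsto_rabs[OF \<eta>]] by simp
    then have "\<forall>\<^sub>F l in sequentially. v / \<kappa> * \<bar>\<eta> l\<bar> < \<epsilon>"
      using \<open>0 < \<epsilon>\<close> by (rule order_tendstoD)
    then obtain l where l: "0 < l" "v / \<kappa> * \<bar>\<eta> l\<bar> < \<epsilon>"
      using eventually_happens'[OF sequentially_bot eventually_conj[OF eventually_gt_at_top[of 0]]] by blast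
    have "(\<lambda>n. s n * \<bar>\<eta> l\<bar> + 4 * \<kappa> * real l * d n + s n * (sqrt (d n) * (real l * (\<kappa> + C)))
      + s n * (sqrt (d n) * (1 + C) / 6 + \<kappa>\<^sup>2 * d n / 8)) \<longlonglongrightarrow> v / \<kappa> * \<bar>\<eta> l\<bar> + 4 * \<kappa> * real l * 0
      + v / \<kappa> * (sqrt 0 * (real l * (\<kappa> + C))) + v / \<kappa> * (sqrt 0 * (1 + C) / 6 + \<kappa>\<^sup>2 * 0 / 8)"
      by (intro tendsto_intros s' d) auto
    then have "(\<lambda>n. s n * \<bar>\<eta> l\<bar> + 4 * \<kappa> * real l * d n + s n * (sqrt (d n) * (real l * (\<kappa> + C)))
      + s n * (sqrt (d n) * (1 + C) / 6 + \<kappa>\<^sup>2 * d n / 8)) \<longlonglongrightarrow> v / \<kappa> * \<bar>\<eta> l\<bar>" by simp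
    then have "\<forall>\<^sub>F n in sequentially. s n * \<bar>\<eta> l\<bar> + 4 * \<kappa> * real l * d n + s n * (sqrt (d n) * (real l * (\<kappa> + C)))
      + s n * (sqrt (d n) * (1 + C) / 6 + \<kappa>\<^sup>2 * d n / 8) < \<epsilon>"
      using l(2) by (rule order_tendstoD)
    then have "\<forall>\<^sub>F n in sequentially. norm (z n - exp (- \<kappa> * s n / 2) - 0) < \<epsilon>"
    proof eventually_elim
      case (elim n)
      then show ?case using bound[OF l(1), of n] by (simp only: diff_zero)
    qed
    then show "\<exists>no. \<forall>n\<ge>no. norm (z n - exp (- \<kappa> * s n / 2) - 0) < \<epsilon>"
      by (simp add: eventually_sequentially)
  qed
  moreover have "(\<lambda>n. complex_of_real (exp (- \<kappa> * s n / 2))) \<longlonglongrightarrow> complex_of_real (exp (- v / 2))"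
    using s by (intro tendsto_of_real tendsto_exp tendsto_divide) (auto dest: tendsto_minus)
  ultimately show ?thesis
    unfolding z_def[symmetric] using Lim_transform by blast
qed

end

section \<open>Regular variation of the tail\<close>

locale heavy_tailed_jumps =
  fixes \<mu> :: "nat pmf" and \<alpha> :: real and L :: "real \<Rightarrow> real"
  assumes alpha_pos: "0 < \<alpha>" and alpha_less: "\<alpha> < 1 / 2"
    and L_pos: "\<And>x. 0 < L x" and L_slow: "slowly_varying L"
    and positive_jumps: "0 \<notin> set_pmf \<mu>"
    and tail_asymp: "(\<lambda>n. measure_pmf.prob \<mu> {n..}) \<sim>[sequentially] (\<lambda>n. real n powr (- \<alpha>) * L (real n))"
    and aperiodic: "Gcd {n. 0 < pmf \<mu> n} = 1"
begin

definition tail :: "real \<Rightarrow> real" where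
  "tail x = measure_pmf.prob \<mu> {m. x \<le> real m}"

lemma tail_nonneg: "0 \<le> tail x" and tail_le_1: "tail x \<le> 1"
  by (simp_all add: tail_def)

lemma tail_antimono: "x \<le> y \<Longrightarrow> tail y \<le> tail x"
  unfolding tail_def by (intro measure_pmf.finite_measure_mono) auto

lemma tail_of_nat: "tail (real n) = measure_pmf.prob \<mu> {n..}"
  by (simp add: tail_def atLeast_def)

lemma tail_eq_1: "x \<le> 1 \<Longrightarrow> tail x = 1"
proof -
  assume "x \<le> 1"
  then have "set_pmf \<mu> \<subseteq> {m. x \<le> real m}"
    using positive_jumps by (auto simp: Suc_le_eq intro!: Nat.gr0I order.trans[of x 1])
  then show ?thesis unfolding tail_def
    by (simp add: measure_pmf.prob_eq_1 AE_measure_pmf_iff subset_iff)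
qed

lemma tail_ceiling: "0 \<le> x \<Longrightarrow> tail x = tail (real (nat \<lceil>x\<rceil>))"
proof -
  assume "0 \<le> x"
  then have "x \<le> real m \<longleftrightarrow> real (nat \<lceil>x\<rceil>) \<le> real m" for m
    unfolding of_nat_le_iff nat_le_iff by (simp only: ceiling_le_iff of_int_of_nat_eq)
  then have "{m. x \<le> real m} = {m. real (nat \<lceil>x\<rceil>) \<le> real m}" by simp
  then show ?thesis by (simp add: tail_def)
qed

lemma tail_ratio: "(\<lambda>n. tail (real n) / (real n powr (- \<alpha>) * L (real n))) \<longlonglongrightarrow> 1"
proof -
  have "(\<lambda>n. if tail (real n) = 0 \<and> real n powr (- \<alpha>) * L (real n) = 0 then 1
      else tail (real n) / (real n powr (- \<alpha>) * L (real n))) \<longlonglongrightarrow> 1"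
    using tail_asymp unfolding asymp_equiv_def tail_of_nat .
  moreover have "\<forall>\<^sub>F n in sequentially. (if tail (real n) = 0 \<and> real n powr (- \<alpha>) * L (real n) = 0 then 1
      else tail (real n) / (real n powr (- \<alpha>) * L (real n))) = tail (real n) / (real n powr (- \<alpha>) * L (real n))"
    using eventually_gt_at_top[of 0] by eventually_elim (use L_pos in \<open>auto simp: less_imp_neq[symmetric]\<close>)
  ultimately show ?thesis by (rule Lim_transform_eventually)
qed

lemma tail_pos: "0 < tail x"
proof -
  have "\<forall>\<^sub>F n in sequentially. 0 < tail (real n) / (real n powr (- \<alpha>) * L (real n))"
    using tail_ratio by (rule order_tendstoD) simp
  moreover have "\<forall>\<^sub>F n in sequentially. x \<le> real n"
    using filterlim_real_sequentially by (simp add: filterlim_at_top)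
  ultimately obtain n where "0 < tail (real n) / (real n powr (- \<alpha>) * L (real n))" "x \<le> real n"
    using eventually_happens'[OF sequentially_bot eventually_conj] by blast
  then have "0 < tail (real n)"
    using tail_nonneg[of "real n"] by (cases "tail (real n) = 0") auto
  then show ?thesis using tail_antimono[OF \<open>x \<le> real n\<close>] by linarith
qed

lemma tail_ratio_multiples:
  fixes a b :: nat
  assumes "0 < a" "0 < b"
  shows "(\<lambda>m. tail (real (a * m)) / tail (real (b * m))) \<longlonglongrightarrow> (real a / real b) powr (- \<alpha>)"
proof -
  have sub: "filterlim (\<lambda>m. k * m) sequentially sequentially" if "0 < k" for k :: nat
    using that by (simp add: filterlim_subseq strict_mono_def)
  note lim = filterlim_compose[OF tail_ratio sub]
  have "((\<lambda>x. L (real a / real b * x) / L x) \<longlongrightarrow> 1) at_top"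
    by (rule L_slow[unfolded slowly_varying_def, rule_format]) (use assms in simp)
  then have "(\<lambda>m. L (real a / real b * real (b * m)) / L (real (b * m))) \<longlonglongrightarrow> 1"
    by (rule filterlim_compose[OF _ filterlim_compose[OF filterlim_real_sequentially sub[OF assms(2)]]])
  moreover have "L (real a / real b * real (b * m)) / L (real (b * m)) = L (real (a * m)) / L (real (b * m))" for m
    using assms by simp
  ultimately have l: "(\<lambda>m. L (real (a * m)) / L (real (b * m))) \<longlonglongrightarrow> 1" by (simp only:)
  have "(\<lambda>m. (tail (real (a * m)) / (real (a * m) powr (- \<alpha>) * L (real (a * m))))
      / (tail (real (b * m)) / (real (b * m) powr (- \<alpha>) * L (real (b * m))))
      * (L (real (a * m)) / L (real (b * m))) * (real a / real b) powr (- \<alpha>))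
     \<longlonglongrightarrow> 1 / 1 * 1 * (real a / real b) powr (- \<alpha>)"
    by (intro tendsto_intros lim assms l) simp
  moreover have "\<forall>\<^sub>F m in sequentially. (tail (real (a * m)) / (real (a * m) powr (- \<alpha>) * L (real (a * m))))
      / (tail (real (b * m)) / (real (b * m) powr (- \<alpha>) * L (real (b * m))))
      * (L (real (a * m)) / L (real (b * m))) * (real a / real b) powr (- \<alpha>)
     = tail (real (a * m)) / tail (real (b * m))"
    using eventually_gt_at_top[of 0]
  proof eventually_elim
    case (elim m)
    have "tail (real (b * m)) \<noteq> 0" "L (real (a * m)) \<noteq> 0" "L (real (b * m)) \<noteq> 0"
      using tail_pos L_pos less_imp_neq[symmetric] by metis+
    moreover have "real (a * m) powr - \<alpha> = real a powr - \<alpha> * real m powr - \<alpha>"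
      "real (b * m) powr - \<alpha> = real b powr - \<alpha> * real m powr - \<alpha>"
      "(real a / real b) powr - \<alpha> = real a powr - \<alpha> / real b powr - \<alpha>"
      by (simp_all add: powr_mult powr_divide)
    moreover have "real m powr - \<alpha> \<noteq> 0" "real a powr - \<alpha> \<noteq> 0" "real b powr - \<alpha> \<noteq> 0"
      using elim assms by auto
    ultimately show ?case by (simp add: field_simps del: of_nat_mult)
  qed
  ultimately show ?thesis by (simp add: Lim_transform_eventually)
qed

text \<open>
  Rational dilations are covered by \<open>tail_ratio_multiples\<close>. For real \<open>c\<close>, the monotone tail at \<open>c * n\<close> is
  squeezed between its values at multiples of \<open>m = n div b\<close>, with a quotient \<open>a / b\<close> (or \<open>a / (b + 1)\<close>)
  close to \<open>c\<close>; the unit added or lost by rounding is harmless once \<open>m\<close> is large.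
\<close>

lemma tail_regularly_varying:
  assumes "0 < c"
  shows "(\<lambda>n. tail (c * real n) / tail (real n)) \<longlonglongrightarrow> c powr (- \<alpha>)"
proof (rule order_tendstoI)
  fix y assume y: "y < c powr - \<alpha>"
  have "(\<lambda>b. ((of_int \<lceil>c * real b\<rceil> + 1) / real b)) \<longlonglongrightarrow> c" using assms by real_asymp
  then have "(\<lambda>b. ((of_int \<lceil>c * real b\<rceil> + 1) / real b) powr (- \<alpha>)) \<longlonglongrightarrow> c powr (- \<alpha>)"
    using assms by (intro tendsto_powr tendsto_const) auto
  then have "\<forall>\<^sub>F b in sequentially. y < ((of_int \<lceil>c * real b\<rceil> + 1) / real b) powr (- \<alpha>)"
    using y by (rule order_tendstoD)
  then obtain b :: nat where b: "0 < b" "y < ((of_int \<lceil>c * real b\<rceil> + 1) / real b) powr (- \<alpha>)"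
    using eventually_happens'[OF sequentially_bot eventually_conj[OF eventually_gt_at_top[of 0]]] by blast
  define a where "a = nat \<lceil>c * real b\<rceil> + 1"
  have a: "0 < a" "c * real b \<le> real a - 1" "real a = of_int \<lceil>c * real b\<rceil> + 1"
    using assms b by (auto simp: a_def)
  have "\<forall>\<^sub>F m in sequentially. y < tail (real (a * m)) / tail (real (b * m))"
    using tail_ratio_multiples[OF a(1) b(1)] b(2) unfolding a(3) by (rule order_tendstoD)
  moreover have "\<forall>\<^sub>F m in sequentially. c * real b \<le> real m"
    using filterlim_real_sequentially by (simp add: filterlim_at_top)
  ultimately have "\<forall>\<^sub>F m in sequentially. y < tail (real (a * m)) / tail (real (b * m)) \<and> c * real b \<le> real m"
    by (rule eventually_conj)
  moreover have "filterlim (\<lambda>n. n div b) sequentially sequentially"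
    using b(1) by (rule filterlim_at_top_div_const_nat)
  ultimately have "\<forall>\<^sub>F n in sequentially. y < tail (real (a * (n div b))) / tail (real (b * (n div b)))
      \<and> c * real b \<le> real (n div b)"
    by (rule eventually_compose_filterlim)
  then show "\<forall>\<^sub>F n in sequentially. y < tail (c * real n) / tail (real n)"
  proof eventually_elim
    case (elim n)
    define m where "m = n div b"
    have n: "real b * real m \<le> real n" "real n \<le> real b * (real m + 1)"
      using b(1) times_div_less_eq_dividend[of b n] dividend_less_times_div[of b n]
      unfolding m_def of_nat_mult[symmetric] of_nat_Suc[symmetric] of_nat_add[symmetric] of_nat_le_iff
      by (auto simp: algebra_simps simp flip: of_nat_mult of_nat_add)
    have "c * real n \<le> c * (real b * (real m + 1))" using n assms by simp
    also have "\<dots> = c * real b * real m + c * real b" by (simp add: algebra_simps)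
    also have "\<dots> \<le> (real a - 1) * real m + real m"
      using elim a(2) by (intro add_mono mult_right_mono) (auto simp: m_def)
    also have "\<dots> = real (a * m)" by (simp add: algebra_simps)
    finally have "tail (real (a * m)) \<le> tail (c * real n)" by (rule tail_antimono)
    moreover have "tail (real n) \<le> tail (real (b * m))" using n by (intro tail_antimono) simp
    ultimately have "tail (real (a * m)) / tail (real (b * m)) \<le> tail (c * real n) / tail (real n)"
      using tail_pos tail_nonneg by (intro frac_le) auto
    then show ?case using elim by (simp add: m_def)
  qed
next
  fix y assume y: "c powr - \<alpha> < y"
  have "(\<lambda>b. (of_int \<lfloor>c * real b\<rfloor> / (real b + 1))) \<longlonglongrightarrow> c" using assms by real_asymp
  then have "(\<lambda>b. (of_int \<lfloor>c * real b\<rfloor> / (real b + 1)) powr (- \<alpha>)) \<longlonglongrightarrow> c powr (- \<alpha>)"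
    using assms by (intro tendsto_powr tendsto_const) auto
  then have "\<forall>\<^sub>F b in sequentially. (of_int \<lfloor>c * real b\<rfloor> / (real b + 1)) powr (- \<alpha>) < y"
    using y by (rule order_tendstoD)
  moreover have "\<forall>\<^sub>F b in sequentially. 1 / c \<le> real b"
    using filterlim_real_sequentially by (simp add: filterlim_at_top)
  ultimately have "\<forall>\<^sub>F b in sequentially. (of_int \<lfloor>c * real b\<rfloor> / (real b + 1)) powr (- \<alpha>) < y \<and> 1 / c \<le> real b"
    by (rule eventually_conj)
  then obtain b :: nat where b: "(of_int \<lfloor>c * real b\<rfloor> / (real b + 1)) powr (- \<alpha>) < y" "1 / c \<le> real b"
    using eventually_happens'[OF sequentially_bot] by blast
  have b0: "0 < b" using b(2) assms by (cases b) (auto simp: field_simps)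
  define a where "a = nat \<lfloor>c * real b\<rfloor>"
  have "1 \<le> c * real b" using b(2) assms by (simp add: field_simps)
  then have a: "0 < a" "real a \<le> c * real b" "real a = of_int \<lfloor>c * real b\<rfloor>"
    by (auto simp: a_def)
  have "(real a / real (b + 1)) powr (- \<alpha>) < y" using b(1) unfolding a(3) by (simp add: add.commute)
  then have "\<forall>\<^sub>F m in sequentially. tail (real (a * m)) / tail (real ((b + 1) * m)) < y"
    by (intro order_tendstoD[OF tail_ratio_multiples[OF a(1)]]) auto
  moreover have "\<forall>\<^sub>F m in sequentially. b \<le> m" by (rule eventually_ge_at_top)
  ultimately have "\<forall>\<^sub>F m in sequentially. tail (real (a * m)) / tail (real ((b + 1) * m)) < y \<and> b \<le> m"
    by (rule eventually_conj)
  moreover have "filterlim (\<lambda>n. n div b) sequentially sequentially"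
    using b0 by (rule filterlim_at_top_div_const_nat)
  ultimately have "\<forall>\<^sub>F n in sequentially. tail (real (a * (n div b))) / tail (real ((b + 1) * (n div b))) < y \<and> b \<le> n div b"
    by (rule eventually_compose_filterlim)
  then show "\<forall>\<^sub>F n in sequentially. tail (c * real n) / tail (real n) < y"
  proof eventually_elim
    case (elim n)
    define m where "m = n div b"
    have n: "b * m \<le> n" "n \<le> b * m + b"
      using b0 times_div_less_eq_dividend[of b n] dividend_less_times_div[of b n]
      unfolding m_def by auto
    have "real (a * m) \<le> c * real b * real m" using a(2) by (simp add: mult_right_mono)
    also have "\<dots> = c * real (b * m)" by simp
    also have "\<dots> \<le> c * real n" using n assms by (intro mult_left_mono) (auto simp del: of_nat_mult)
    finally have "tail (c * real n) \<le> tail (real (a * m))" by (rule tail_antimono)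
    moreover have "tail (real ((b + 1) * m)) \<le> tail (real n)"
      using n elim by (intro tail_antimono) (simp add: m_def flip: of_nat_mult of_nat_add)
    ultimately have "tail (c * real n) / tail (real n) \<le> tail (real (a * m)) / tail (real ((b + 1) * m))"
      using tail_pos tail_nonneg by (intro frac_le) auto
    then show ?case using elim by (simp add: m_def)
  qed
qed

lemma tail_tendsto_0: "(\<lambda>n. tail (real n)) \<longlonglongrightarrow> 0"
proof -
  have "(\<lambda>n. measure_pmf.prob \<mu> {n..}) \<longlonglongrightarrow> measure_pmf.prob \<mu> (\<Inter>n. {n..})"
    by (intro measure_pmf.finite_Lim_measure_decseq) (auto simp: decseq_def)
  moreover have "(\<Inter>n. {n..}) = ({} :: nat set)"
    using not_less_eq_eq by blast
  ultimately show ?thesis by (simp add: tail_of_nat)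
qed

text \<open>
  Strictly between \<open>\<alpha>\<close> and \<open>1 / 2\<close>: the first gap leaves room for Potter's bound, the second makes
  \<open>u powr (- 2 * \<gamma>)\<close> integrable at 0.
\<close>

definition \<gamma> :: real where "\<gamma> = (\<alpha> + 1 / 2) / 2"

lemma gamma: "\<alpha> < \<gamma>" "\<gamma> < 1 / 2" "0 < \<gamma>"
  using alpha_pos alpha_less by (auto simp: \<gamma>_def)

text \<open>
  As \<open>2 powr (- \<gamma>) < 2 powr (- \<alpha>)\<close>, one doubling of a large argument loses at most the factor
  \<open>2 powr \<gamma>\<close>; iterate. Finitely many small \<open>n\<close> only enlarge the constant.
\<close>

lemma potter_bound:
  obtains A where "1 \<le> A"
    "\<And>n r. 1 \<le> n \<Longrightarrow> 1 \<le> r \<Longrightarrow> tail (real n) \<le> A * r powr \<gamma> * tail (r * real n)"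
proof -
  have "2 powr (- \<gamma>) < 2 powr (- \<alpha>)" using gamma by simp
  then have "\<forall>\<^sub>F n in sequentially. 2 powr (- \<gamma>) < tail (2 * real n) / tail (real n)"
    using tail_regularly_varying[of 2] by (intro order_tendstoD) auto
  then obtain n0 where n0: "\<And>n. n0 \<le> n \<Longrightarrow> 2 powr (- \<gamma>) < tail (2 * real n) / tail (real n)"
    by (auto simp: eventually_sequentially)
  have dbl: "tail (real n) \<le> 2 powr \<gamma> * tail (2 * real n)" if "n0 \<le> n" for n
    using n0[OF that] tail_pos[of "real n"] by (simp add: powr_minus field_simps)
  have it: "tail (real n) \<le> 2 powr (\<gamma> * real k) * tail (2 ^ k * real n)" if "n0 \<le> n" for n k
  proof (induction k)
    case (Suc k)
    have "n \<le> 2 ^ k * n" by simp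
    then have "n0 \<le> 2 ^ k * n" using that by linarith
    from dbl[OF this] have "tail (2 ^ k * real n) \<le> 2 powr \<gamma> * tail (2 ^ Suc k * real n)"
      by (simp add: mult.assoc)
    then have "2 powr (\<gamma> * real k) * tail (2 ^ k * real n) \<le> 2 powr (\<gamma> * real k) * (2 powr \<gamma> * tail (2 ^ Suc k * real n))"
      by (intro mult_left_mono) auto
    also have "\<dots> = 2 powr (\<gamma> * real (Suc k)) * tail (2 ^ Suc k * real n)"
      by (simp add: powr_add distrib_left mult.commute)
    finally show ?case using Suc by linarith
  qed simp
  have large: "tail (real n) \<le> 2 powr \<gamma> * r powr \<gamma> * tail (r * real n)" if "n0 \<le> n" "1 \<le> r" for n r
  proof -
    define k where "k = nat \<lceil>log 2 r\<rceil>"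
    have l0: "0 \<le> log 2 r" using that by simp
    then have k: "log 2 r \<le> real k" "real k \<le> log 2 r + 1" unfolding k_def by linarith+
    have "r \<le> 2 ^ k" using k(1) that by (simp add: log_le_iff powr_realpow)
    then have "tail (2 ^ k * real n) \<le> tail (r * real n)" by (intro tail_antimono mult_right_mono) auto
    moreover have "2 powr (\<gamma> * real k) \<le> 2 powr (\<gamma> * (log 2 r + 1))"
      using k gamma by (intro powr_mono mult_left_mono) auto
    moreover have "2 powr (\<gamma> * (log 2 r + 1)) = 2 powr \<gamma> * r powr \<gamma>"
    proof -
      have "2 powr (\<gamma> * log 2 r) = r powr \<gamma>"
        using that by (subst mult.commute) (simp add: powr_powr[symmetric])
      then show ?thesis by (simp add: distrib_left powr_add mult.commute)
    qed
    ultimately have "2 powr (\<gamma> * real k) * tail (2 ^ k * real n) \<le> 2 powr \<gamma> * r powr \<gamma> * tail (r * real n)"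
      using tail_nonneg by (intro mult_mono) auto
    then show ?thesis using it[OF that(1), of k] by linarith
  qed
  define n1 where "n1 = max 1 n0"
  define A where "A = 2 powr \<gamma> / tail (real n1)"
  have A: "2 powr \<gamma> \<le> A"
    unfolding A_def using tail_pos[of "real n1"] tail_le_1[of "real n1"] by (simp add: field_simps)
  show ?thesis
  proof
    show "1 \<le> A" using A ge_one_powr_ge_zero[of 2 \<gamma>] gamma by linarith
    fix n :: nat and r :: real assume nr: "1 \<le> n" "1 \<le> r"
    show "tail (real n) \<le> A * r powr \<gamma> * tail (r * real n)"
    proof (cases "n0 \<le> n")
      case True
      have "2 powr \<gamma> * (r powr \<gamma> * tail (r * real n)) \<le> A * (r powr \<gamma> * tail (r * real n))"
        using A tail_nonneg by (intro mult_right_mono) auto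
      then show ?thesis using large[OF True nr(2)] by (simp add: mult.assoc)
    next
      case False
      have "tail (real n1) \<le> 2 powr \<gamma> * r powr \<gamma> * tail (r * real n1)"
        by (rule large) (use nr in \<open>auto simp: n1_def\<close>)
      also have "\<dots> \<le> 2 powr \<gamma> * r powr \<gamma> * tail (r * real n)"
        using False nr by (intro mult_left_mono tail_antimono) (auto simp: n1_def)
      finally have "1 \<le> A * r powr \<gamma> * tail (r * real n)"
        using tail_pos[of "real n1"] by (simp add: A_def field_simps)
      then show ?thesis using tail_le_1[of "real n"] by linarith
    qed
  qed
qed

definition potter_const :: real where
  "potter_const = (SOME A. 1 \<le> A \<and>
    (\<forall>n r. 1 \<le> n \<longrightarrow> 1 \<le> r \<longrightarrow> tail (real n) \<le> A * r powr \<gamma> * tail (r * real n)))"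

lemma potter: "1 \<le> potter_const"
  "1 \<le> n \<Longrightarrow> 1 \<le> r \<Longrightarrow> tail (real n) \<le> potter_const * r powr \<gamma> * tail (r * real n)"
proof -
  have "\<exists>A. 1 \<le> A \<and> (\<forall>n r. 1 \<le> n \<longrightarrow> 1 \<le> r \<longrightarrow> tail (real n) \<le> A * r powr \<gamma> * tail (r * real n))"
    using potter_bound by metis
  from someI_ex[OF this] show "1 \<le> potter_const"
    "1 \<le> n \<Longrightarrow> 1 \<le> r \<Longrightarrow> tail (real n) \<le> potter_const * r powr \<gamma> * tail (r * real n)"
    unfolding potter_const_def by auto
qed

text \<open>
  Potter's bound read from \<open>x * n\<close> up to \<open>n\<close>; the factor 2 pays for rounding \<open>x * n\<close> down.
\<close>

lemma potter_small:
  assumes "1 \<le> n" "0 < x" "x \<le> 1"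
  shows "tail (x * real n) \<le> potter_const * (2 / x) powr \<gamma> * tail (real n)"
proof (cases "1 \<le> x * real n")
  case True
  define m where "m = nat \<lfloor>x * real n\<rfloor>"
  have m: "1 \<le> m" "real m \<le> x * real n" "x * real n \<le> 2 * real m"
  proof -
    have f: "1 \<le> \<lfloor>x * real n\<rfloor>" using True by simp
    then have "real m = of_int \<lfloor>x * real n\<rfloor>" by (simp add: m_def)
    then show "1 \<le> m" "real m \<le> x * real n" "x * real n \<le> 2 * real m"
      using f unfolding m_def by linarith+
  qed
  have "real m \<le> real n" using m(2) mult_right_mono[OF assms(3), of "real n"] by linarith
  have "tail (x * real n) \<le> tail (real m)" using m by (intro tail_antimono)
  also have "\<dots> \<le> potter_const * (real n / real m) powr \<gamma> * tail (real n / real m * real m)"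
    using m \<open>real m \<le> real n\<close> by (intro potter) auto
  also have "\<dots> \<le> potter_const * (2 / x) powr \<gamma> * tail (real n)"
  proof -
    have "real n / real m \<le> 2 / x" using m assms by (simp add: field_simps)
    then have "(real n / real m) powr \<gamma> \<le> (2 / x) powr \<gamma>" using gamma by (intro powr_mono2) auto
    then show ?thesis using m potter(1) tail_nonneg by (simp add: mult_mono)
  qed
  finally show ?thesis .
next
  case False
  then have "real n \<le> 2 / x" using assms by (simp add: field_simps)
  then have "real n powr \<gamma> \<le> (2 / x) powr \<gamma>" using gamma by (intro powr_mono2) auto
  have "tail (x * real n) \<le> tail (real 1)" using tail_le_1 tail_eq_1[of 1] by simp
  also have "\<dots> \<le> potter_const * real n powr \<gamma> * tail (real n * real 1)"
    using assms by (intro potter) auto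
  also have "\<dots> \<le> potter_const * (2 / x) powr \<gamma> * tail (real n)"
    using \<open>real n powr \<gamma> \<le> (2 / x) powr \<gamma>\<close> potter(1) tail_nonneg by (simp add: mult_mono)
  finally show ?thesis .
qed

section \<open>The generating function near the unit circle\<close>

definition pgf :: "complex \<Rightarrow> complex" where
  "pgf z = (\<integral>m. z ^ m \<partial>measure_pmf \<mu>)"

lemma integrable_power: "cmod z \<le> 1 \<Longrightarrow> integrable (measure_pmf \<mu>) (\<lambda>m. z ^ m)"
  by (intro measure_pmf.integrable_const_bound[of _ 1]) (auto simp: norm_power power_le_one)

lemma continuous_on_pgf: "continuous_on (cball 0 1) pgf"
  unfolding continuous_on_sequentially o_def pgf_def
proof (intro allI impI ballI, elim conjE)
  fix z and x :: "nat \<Rightarrow> complex"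
  assume *: "\<forall>n. x n \<in> cball 0 1" "x \<longlonglongrightarrow> z"
  show "(\<lambda>n. \<integral>m. x n ^ m \<partial>measure_pmf \<mu>) \<longlonglongrightarrow> (\<integral>m. z ^ m \<partial>measure_pmf \<mu>)"
    by (rule integral_dominated_convergence[where w="\<lambda>_. 1"])
      (use * in \<open>auto simp: norm_power intro!: power_le_one tendsto_intros\<close>)
qed

lemma rcis_in_disc: "0 \<le> s \<Longrightarrow> s \<le> 1 \<Longrightarrow> cmod (of_real s * cis \<theta>) \<le> 1"
  by (simp add: norm_mult)

lemma Re_one_minus_pgf:
  assumes "0 \<le> s" "s \<le> 1"
  shows "Re (1 - pgf (of_real s * cis \<theta>)) = (\<integral>m. 1 - s ^ m * cos (real m * \<theta>) \<partial>measure_pmf \<mu>)"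
proof -
  note i = integrable_power[OF rcis_in_disc[OF assms, of \<theta>]]
  have "Re (1 - pgf (of_real s * cis \<theta>)) = (\<integral>m. Re (1 - (of_real s * cis \<theta>) ^ m) \<partial>measure_pmf \<mu>)"
    unfolding pgf_def using i by (simp add: integral_Re)
  moreover have "Re (1 - (of_real s * cis \<theta>) ^ m) = 1 - s ^ m * cos (real m * \<theta>)" for m
  proof -
    have "Re (1 - of_real r * cis x) = 1 - r * cos x" for r x by simp
    moreover have "(of_real s * cis \<theta>) ^ m = of_real (s ^ m) * cis (real m * \<theta>)"
      by (simp add: power_mult_distrib Complex.DeMoivre[of \<theta> m])
    ultimately show ?thesis by metis
  qed
  ultimately show ?thesis by simp
qed

lemma one_minus_cos_nonneg: "0 \<le> s \<Longrightarrow> s \<le> 1 \<Longrightarrow> 0 \<le> 1 - s ^ m * cos (x::real)"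
  using mult_mono[of "s ^ m" 1 "cos x" 1] power_le_one[of s m] zero_le_power[of s m]
  by (cases "0 \<le> cos x") (auto simp: mult_nonneg_nonpos intro: order.trans[of _ 0])

lemma integrable_one_minus_cos:
  assumes "0 \<le> s" "s \<le> 1"
  shows "integrable (measure_pmf \<mu>) (\<lambda>m. 1 - s ^ m * cos (real m * \<theta>))"
proof (rule measure_pmf.integrable_const_bound[of _ 2])
  show "AE m in measure_pmf \<mu>. norm (1 - s ^ m * cos (real m * \<theta>)) \<le> 2"
  proof (rule AE_I2)
    fix m
    have "\<bar>s ^ m * cos (real m * \<theta>)\<bar> \<le> 1 * 1"
      unfolding abs_mult using assms by (intro mult_mono) (auto simp: power_le_one)
    then show "norm (1 - s ^ m * cos (real m * \<theta>)) \<le> 2" by (simp add: abs_le_iff)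
  qed
qed simp

text \<open>
  The real part of \<open>1 - pgf\<close> is the mean of the nonnegative quantities \<open>1 - s ^ m * cos (m * \<theta>)\<close>, and these
  are at least 1 while \<open>m * \<theta>\<close> lies between \<open>pi / 2\<close> and \<open>3 * pi / 2\<close>.
\<close>

lemma pgf_near_1_lower:
  assumes s: "0 \<le> s" "s \<le> 1" and "0 < \<theta>"
  shows "tail (pi / 2 / \<theta>) - tail (3 * (pi / 2 / \<theta>)) \<le> cmod (1 - pgf (of_real s * cis \<theta>))"
proof -
  define x where "x = pi / 2 / \<theta>"
  have x: "0 < x" using assms by (simp add: x_def)
  have "tail x - tail (3 * x) = measure_pmf.prob \<mu> ({m. x \<le> real m} - {m. 3 * x \<le> real m})"
    unfolding tail_def using x by (subst measure_pmf.finite_measure_Diff) auto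
  also have "\<dots> = (\<integral>m. indicator ({m. x \<le> real m} - {m. 3 * x \<le> real m}) m \<partial>measure_pmf \<mu>)" by simp
  also have "\<dots> \<le> (\<integral>m. 1 - s ^ m * cos (real m * \<theta>) \<partial>measure_pmf \<mu>)"
  proof (rule integral_mono)
    show "integrable (measure_pmf \<mu>) (indicator ({m. x \<le> real m} - {m. 3 * x \<le> real m}) :: nat \<Rightarrow> real)"
      by (intro measure_pmf.integrable_const_bound[of _ 1]) (auto split: split_indicator)
    show "integrable (measure_pmf \<mu>) (\<lambda>m. 1 - s ^ m * cos (real m * \<theta>))"
      by (rule integrable_one_minus_cos[OF s])
    fix m
    have "cos (real m * \<theta>) \<le> 0" if "x \<le> real m" "real m < 3 * x"
    proof -
      have "pi / 2 \<le> real m * \<theta>" "real m * \<theta> < 3 * (pi / 2)"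
        using that assms by (simp_all add: x_def field_simps)
      then have "0 \<le> cos (real m * \<theta> - pi)" by (intro cos_ge_zero) auto
      then show ?thesis by (simp add: cos_diff)
    qed
    then show "indicator ({m. x \<le> real m} - {m. 3 * x \<le> real m}) m \<le> 1 - s ^ m * cos (real m * \<theta>)"
      using one_minus_cos_nonneg[OF s, of m "real m * \<theta>"] zero_le_power[OF s(1), of m]
      by (auto split: split_indicator simp: mult_nonneg_nonpos not_le)
  qed
  also have "\<dots> = Re (1 - pgf (of_real s * cis \<theta>))" using Re_one_minus_pgf[OF s] by simp
  also have "\<dots> \<le> cmod (1 - pgf (of_real s * cis \<theta>))" by (rule complex_Re_le_cmod)
  finally show ?thesis by (simp add: x_def)
qed

text \<open>
  The \<open>m\<close> for which \<open>m * \<theta>\<close> is a multiple of \<open>2 * pi\<close> are the multiples of the least positive one among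
  them, which therefore divides the greatest common divisor 1.
\<close>

lemma aperiodic_angle:
  assumes \<theta>: "0 < \<theta>" "\<theta> \<le> pi" and all: "\<And>m. 0 < pmf \<mu> m \<Longrightarrow> cos (real m * \<theta>) = 1"
  shows False
proof -
  define H where "H = {m::nat. \<exists>k::int. real m * \<theta> = 2 * pi * of_int k}"
  have supp: "{m. 0 < pmf \<mu> m} \<subseteq> H"
    using all by (fastforce simp: H_def cos_one_2pi_int mult_ac)
  obtain m1 where m1: "0 < pmf \<mu> m1" using set_pmf_not_empty[of \<mu>] pmf_positive[of _ \<mu>] by blast
  then have m1': "m1 \<noteq> 0" using positive_jumps by (auto simp: set_pmf_iff intro!: Nat.gr0I)
  define d where "d = (LEAST m. m \<in> H \<and> 0 < m)"
  have d: "d \<in> H" "0 < d"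
    using LeastI[of "\<lambda>m. m \<in> H \<and> 0 < m" m1] supp m1 m1' by (auto simp: d_def)
  have "d dvd m" if "m \<in> H" for m
  proof -
    from that obtain k where k: "real m * \<theta> = 2 * pi * of_int k" by (auto simp: H_def)
    from d obtain j where j: "real d * \<theta> = 2 * pi * of_int j" by (auto simp: H_def)
    have "real (m mod d) * \<theta> = real m * \<theta> - real (m div d) * (real d * \<theta>)"
      by (simp add: algebra_simps flip: of_nat_mult of_nat_add) (metis add.commute distrib_left mult.commute of_nat_add of_nat_mult mod_mult_div_eq)
    also have "\<dots> = 2 * pi * of_int (k - int (m div d) * j)"
      unfolding k j by (simp add: algebra_simps)
    finally have "m mod d \<in> H" unfolding H_def by blast
    then show ?thesis
      using not_less_Least[of "m mod d" "\<lambda>m. m \<in> H \<and> 0 < m"] d(2) mod_less_divisor[OF d(2), of m]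
      by (auto simp: d_def[symmetric] dvd_eq_mod_eq_0)
  qed
  then have "d dvd Gcd {m. 0 < pmf \<mu> m}" using supp by (intro Gcd_greatest) auto
  then have "d = 1" using aperiodic by simp
  then obtain k :: int where "\<theta> = 2 * pi * of_int k" using d by (auto simp: H_def)
  then have "0 < 2 * pi * of_int k" "2 * pi * of_int k \<le> pi * 1" using \<theta> by auto
  then have "0 < k" "2 * real_of_int k \<le> 1" by (auto simp: zero_less_mult_iff)
  then show False by linarith
qed

lemma pgf_ne_1:
  assumes s: "0 \<le> s" "s \<le> 1" and \<theta>: "0 < \<theta>" "\<theta> \<le> pi"
  shows "pgf (of_real s * cis \<theta>) \<noteq> 1"
proof
  assume "pgf (of_real s * cis \<theta>) = 1"
  then have "(\<integral>m. 1 - s ^ m * cos (real m * \<theta>) \<partial>measure_pmf \<mu>) = 0"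
    using Re_one_minus_pgf[OF s, of \<theta>] by simp
  then have "AE m in measure_pmf \<mu>. 1 - s ^ m * cos (real m * \<theta>) = 0"
    using integrable_one_minus_cos[OF s, of \<theta>] one_minus_cos_nonneg[OF s]
    by (subst (asm) integral_nonneg_eq_0_iff_AE) auto
  then have *: "s ^ m * cos (real m * \<theta>) = 1" if "m \<in> set_pmf \<mu>" for m
    using that by (auto simp: AE_measure_pmf_iff)
  show False
  proof (rule aperiodic_angle[OF \<theta>])
    fix m assume "0 < pmf \<mu> m"
    then have eq: "s ^ m * cos (real m * \<theta>) = 1" by (intro *) (simp add: set_pmf_iff)
    have "s ^ m \<le> 1" "0 \<le> s ^ m" using s by (auto simp: power_le_one)
    show "cos (real m * \<theta>) = 1"
    proof (rule antisym[OF cos_le_one])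
      have "0 \<le> cos (real m * \<theta>)"
        using eq \<open>0 \<le> s ^ m\<close> by (metis mult_nonneg_nonpos linear not_one_le_zero)
      then have "s ^ m * cos (real m * \<theta>) \<le> 1 * cos (real m * \<theta>)"
        using \<open>s ^ m \<le> 1\<close> by (intro mult_right_mono)
      then show "1 \<le> cos (real m * \<theta>)" using eq by simp
    qed
  qed
qed

text \<open>
  For small \<open>\<theta>\<close> this is \<open>pgf_near_1_lower\<close> together with \<open>tail (3 * x) \<le> a * tail x\<close> for some \<open>a < 1\<close>; for
  the other angles, compactness and \<open>pgf_ne_1\<close>. The bound is uniform in the radius \<open>s\<close>, as needed to
  let \<open>s\<close> tend to 1.
\<close>

lemma pgf_lower_bound:
  obtains c where "0 < c" "\<And>s \<theta>. 0 \<le> s \<Longrightarrow> s \<le> 1 \<Longrightarrow> 0 < \<theta> \<Longrightarrow> \<theta> \<le> pi \<Longrightarrow>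
    c * tail (2 / \<theta>) \<le> cmod (1 - pgf (of_real s * cis \<theta>))"
proof -
  have t2: "2 powr (- \<alpha>) < 1" using alpha_pos by (simp add: powr_minus field_simps)
  define a where "a = (2 powr (- \<alpha>) + 1) / 2"
  have a: "2 powr (- \<alpha>) < a" "a < 1" using t2 by (auto simp: a_def)
  have "\<forall>\<^sub>F n in sequentially. tail (2 * real n) / tail (real n) < a"
    using tail_regularly_varying[of 2] a by (intro order_tendstoD) auto
  then obtain n0 where n0: "\<And>n. n0 \<le> n \<Longrightarrow> tail (2 * real n) / tail (real n) < a"
    by (auto simp: eventually_sequentially)
  define \<theta>0 where "\<theta>0 = pi / 2 / (real n0 + 2)"
  have \<theta>0: "0 < \<theta>0" by (simp add: \<theta>0_def)
  have small: "(1 - a) * tail (2 / \<theta>) \<le> cmod (1 - pgf (of_real s * cis \<theta>))"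
    if "0 \<le> s" "s \<le> 1" "0 < \<theta>" "\<theta> \<le> \<theta>0" for s \<theta>
  proof -
    define x where "x = pi / 2 / \<theta>"
    have x: "real n0 + 2 \<le> x" using that \<theta>0 by (simp add: x_def \<theta>0_def field_simps)
    define n where "n = nat \<lceil>x\<rceil>"
    have n: "x \<le> real n" "real n \<le> x + 1" "n0 \<le> n" using x unfolding n_def by linarith+
    have "tail (3 * x) \<le> tail (2 * real n)" using n x by (intro tail_antimono) auto
    also have "\<dots> \<le> a * tail (real n)" using n0[OF n(3)] tail_pos[of "real n"] by (simp add: field_simps)
    also have "tail (real n) = tail x" using x tail_ceiling[of x] by (simp add: n_def)
    finally have "(1 - a) * tail x \<le> tail x - tail (3 * x)" by (simp add: algebra_simps)
    also have "\<dots> \<le> cmod (1 - pgf (of_real s * cis \<theta>))"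
      unfolding x_def by (rule pgf_near_1_lower) (use that in auto)
    finally have "(1 - a) * tail x \<le> cmod (1 - pgf (of_real s * cis \<theta>))" .
    moreover have "tail (2 / \<theta>) \<le> tail x"
      unfolding x_def using that pi_less_4 by (intro tail_antimono) (simp add: field_simps)
    then have "(1 - a) * tail (2 / \<theta>) \<le> (1 - a) * tail x" using a by (intro mult_left_mono) auto
    ultimately show ?thesis by linarith
  qed
  define K where "K = {0..1::real} \<times> {\<theta>0..pi}"
  have cont: "continuous_on K (\<lambda>(s, \<theta>). cmod (1 - pgf (of_real s * cis \<theta>)))"
    unfolding case_prod_beta cis_conv_exp
    by (intro continuous_intros continuous_on_compose2[OF continuous_on_pgf])
       (auto simp: K_def norm_mult)
  have "\<theta>0 \<le> pi" by (simp add: \<theta>0_def field_simps)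
  then have "K \<noteq> {}" "compact K" by (auto simp: K_def intro!: compact_Times)
  then obtain z where z: "z \<in> K" "\<And>y. y \<in> K \<Longrightarrow> (\<lambda>(s, \<theta>). cmod (1 - pgf (of_real s * cis \<theta>))) z
      \<le> (\<lambda>(s, \<theta>). cmod (1 - pgf (of_real s * cis \<theta>))) y"
    using continuous_attains_inf[OF _ _ cont] by metis
  define e where "e = (\<lambda>(s, \<theta>). cmod (1 - pgf (of_real s * cis \<theta>))) z"
  have "0 < e" using pgf_ne_1[of "fst z" "snd z"] z(1) \<theta>0
    by (auto simp: e_def K_def case_prod_beta)
  show ?thesis
  proof
    show "0 < min (1 - a) e" using a \<open>0 < e\<close> by simp
    fix s \<theta> :: real assume *: "0 \<le> s" "s \<le> 1" "0 < \<theta>" "\<theta> \<le> pi"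
    show "min (1 - a) e * tail (2 / \<theta>) \<le> cmod (1 - pgf (of_real s * cis \<theta>))"
    proof (cases "\<theta> \<le> \<theta>0")
      case True
      have "min (1 - a) e * tail (2 / \<theta>) \<le> (1 - a) * tail (2 / \<theta>)"
        using tail_nonneg by (intro mult_right_mono) auto
      then show ?thesis using small[OF *(1-3) True] by linarith
    next
      case False
      have "min (1 - a) e * tail (2 / \<theta>) \<le> e * 1"
        using \<open>0 < e\<close> tail_nonneg tail_le_1 by (intro mult_mono) auto
      also have "\<dots> \<le> cmod (1 - pgf (of_real s * cis \<theta>))"
        using z(2)[of "(s, \<theta>)"] * False by (auto simp: e_def K_def)
      finally show ?thesis .
    qed
  qed
qed

end

section \<open>The renewal sequence and its spectral representation\<close>

text \<open>
  The probability that some sum of independent jumps equals \<open>n\<close>, decomposed by the first jump.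
\<close>

fun renewal :: "nat pmf \<Rightarrow> nat \<Rightarrow> real" where
  "renewal \<mu> 0 = 1"
| "renewal \<mu> (Suc n) = (\<Sum>m\<le>n. pmf \<mu> (Suc m) * renewal \<mu> (n - m))"

declare renewal.simps(2) [simp del]

lemma sum_pmf_le_1: "finite A \<Longrightarrow> (\<Sum>m\<in>A. pmf \<mu> m) \<le> 1"
  by (simp flip: measure_measure_pmf_finite)

lemma renewal_bounds: "0 \<le> renewal \<mu> n \<and> renewal \<mu> n \<le> 1"
proof (induction n rule: less_induct)
  case (less n)
  show ?case
  proof (cases n)
    case (Suc k)
    have "renewal \<mu> n \<le> (\<Sum>m\<le>k. pmf \<mu> (Suc m) * 1)"
      unfolding Suc renewal.simps using less Suc by (intro sum_mono mult_left_mono) auto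
    also have "\<dots> = (\<Sum>m\<in>Suc ` {..k}. pmf \<mu> m)" by (subst sum.reindex) auto
    also have "\<dots> \<le> 1" by (rule sum_pmf_le_1) simp
    finally show ?thesis
      unfolding Suc renewal.simps using less Suc by (auto intro!: sum_nonneg)
  qed simp
qed

lemma renewal_nonneg: "0 \<le> renewal \<mu> n" and renewal_le_1: "renewal \<mu> n \<le> 1"
  using renewal_bounds by auto

definition renewal_int :: "nat pmf \<Rightarrow> int \<Rightarrow> real" where
  "renewal_int \<mu> k = (if k < 0 then 0 else renewal \<mu> (nat k))"

lemma renewal_int_bounds: "0 \<le> renewal_int \<mu> k" "renewal_int \<mu> k \<le> 1"
  by (auto simp: renewal_int_def renewal_nonneg renewal_le_1)

lemma renewal_int_of_nat [simp]: "renewal_int \<mu> (int n) = renewal \<mu> n"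
  by (simp add: renewal_int_def)

lemma renewal_int_neg [simp]: "k < 0 \<Longrightarrow> renewal_int \<mu> k = 0"
  by (simp add: renewal_int_def)

text \<open>
  All integrands are even in \<open>\<theta>\<close>, so half of the circle suffices. The point 0, where \<open>1 - pgf\<close> vanishes,
  is left out.
\<close>

definition half_circle_integral :: "(real \<Rightarrow> real) \<Rightarrow> real" where
  "half_circle_integral g = (\<integral>\<theta>. indicator {0<..pi} \<theta> * g \<theta> \<partial>lborel)"

lemma parseval_half_circle:
  fixes d :: "nat \<Rightarrow> real"
  assumes "summable (\<lambda>l. \<bar>d l\<bar>)"
  shows "summable (\<lambda>l. (d l)\<^sup>2)"
    and "half_circle_integral (\<lambda>\<theta>. (cmod (\<Sum>l. d l * cis (real l * \<theta>)))\<^sup>2) = pi * (\<Sum>l. (d l)\<^sup>2)"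
proof -
  define C where "C = (\<Sum>l. \<bar>d l\<bar>)"
  define P where "P N \<theta> = (\<Sum>l<N. complex_of_real (d l) * cis (real l * \<theta>))" for N \<theta>
  have sm: "summable (\<lambda>l. norm (complex_of_real (d l) * cis (real l * \<theta>)))" for \<theta>
    using assms by (simp add: norm_mult)
  have lim: "(\<lambda>N. P N \<theta>) \<longlonglongrightarrow> (\<Sum>l. d l * cis (real l * \<theta>))" for \<theta>
    unfolding P_def by (rule summable_LIMSEQ[OF summable_norm_cancel[OF sm]])
  have PC: "cmod (P N \<theta>) \<le> C" for N \<theta>
  proof -
    have "cmod (P N \<theta>) \<le> (\<Sum>l<N. \<bar>d l\<bar>)"
      unfolding P_def by (rule sum_norm_le) (simp add: norm_mult)
    also have "\<dots> \<le> C" unfolding C_def using assms by (intro sum_le_suminf) auto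
    finally show ?thesis .
  qed
  have trig: "has_bochner_integral lborel (\<lambda>\<theta>. cos (j * \<theta>) * indicator {0..pi} \<theta>) (if j = 0 then pi else 0)"
    if "j = real l - real k" for j l k
  proof (cases "j = 0")
    case True
    then show ?thesis
      using has_bochner_integral_FTC_Icc_real[of 0 pi "\<lambda>x. x" "\<lambda>_. 1"] by simp
  next
    case False
    have "sin (j * pi) = 0"
      using that sin_npi_int[of "int l - int k"] by (simp add: mult.commute)
    moreover have "has_bochner_integral lborel (\<lambda>x. cos (j * x) * indicat_real {0..pi} x)
        (sin (j * pi) / j - sin (j * 0) / j)"
      using False
      by (intro has_bochner_integral_FTC_Icc_real) (auto intro!: derivative_eq_intros continuous_intros)
    ultimately show ?thesis using False by simp
  qed
  have sq: "(cmod (P N \<theta>))\<^sup>2 = (\<Sum>l<N. \<Sum>k<N. d l * d k * cos ((real l - real k) * \<theta>))" for N \<theta>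
  proof -
    have "(cmod (P N \<theta>))\<^sup>2 = (\<Sum>l<N. d l * cos (real l * \<theta>))\<^sup>2 + (\<Sum>l<N. d l * sin (real l * \<theta>))\<^sup>2"
      unfolding cmod_power2 by (simp add: P_def)
    also have "\<dots> = (\<Sum>l<N. \<Sum>k<N. d l * cos (real l * \<theta>) * (d k * cos (real k * \<theta>))
        + d l * sin (real l * \<theta>) * (d k * sin (real k * \<theta>)))"
      by (simp add: power2_eq_square sum_product sum.distrib)
    also have "\<dots> = (\<Sum>l<N. \<Sum>k<N. d l * d k * cos ((real l - real k) * \<theta>))"
      by (simp add: left_diff_distrib cos_diff algebra_simps)
    finally show ?thesis .
  qed
  have fin: "(\<integral>\<theta>. indicator {0..pi} \<theta> * (cmod (P N \<theta>))\<^sup>2 \<partial>lborel) = pi * (\<Sum>l<N. (d l)\<^sup>2)" for N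
  proof -
    have "has_bochner_integral lborel (\<lambda>\<theta>. \<Sum>l<N. \<Sum>k<N. d l * d k * (cos ((real l - real k) * \<theta>) * indicator {0..pi} \<theta>))
       (\<Sum>l<N. \<Sum>k<N. d l * d k * (if real l - real k = 0 then pi else 0))"
      by (intro has_bochner_integral_sum has_bochner_integral_mult_right trig[OF refl])
    then have "(\<integral>\<theta>. (\<Sum>l<N. \<Sum>k<N. d l * d k * (cos ((real l - real k) * \<theta>) * indicator {0..pi} \<theta>)) \<partial>lborel)
      = (\<Sum>l<N. \<Sum>k<N. d l * d k * (if real l - real k = 0 then pi else 0))"
      by (rule has_bochner_integral_integral_eq)
    moreover have "(\<Sum>l<N. \<Sum>k<N. d l * d k * (if real l - real k = 0 then pi else 0)) = pi * (\<Sum>l<N. (d l)\<^sup>2)"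
      by (simp add: sum_distrib_left power2_eq_square mult_ac if_distrib[of "\<lambda>x. _ * x"] cong: if_cong)
    ultimately show ?thesis
      unfolding sq by (simp add: sum_distrib_left mult_ac)
  qed
  have meas: "(\<lambda>\<theta>. \<Sum>l. complex_of_real (d l) * cis (real l * \<theta>)) \<in> borel_measurable borel"
    by (intro borel_measurable_LIMSEQ_metric[OF _ lim]) (simp add: P_def cis_conv_exp)
  have "(\<lambda>N. \<integral>\<theta>. indicator {0..pi} \<theta> * (cmod (P N \<theta>))\<^sup>2 \<partial>lborel)
      \<longlonglongrightarrow> (\<integral>\<theta>. indicator {0..pi} \<theta> * (cmod (\<Sum>l. d l * cis (real l * \<theta>)))\<^sup>2 \<partial>lborel)"
  proof (rule integral_dominated_convergence[where w="\<lambda>\<theta>. indicator {0..pi} \<theta> * C\<^sup>2"])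
    show "(\<lambda>\<theta>. indicator {0..pi} \<theta> * (cmod (\<Sum>l. complex_of_real (d l) * cis (real l * \<theta>)))\<^sup>2) \<in> borel_measurable lborel"
      using meas by simp
    show "(\<lambda>\<theta>. indicator {0..pi} \<theta> * (cmod (P N \<theta>))\<^sup>2) \<in> borel_measurable lborel" for N
      by (simp add: P_def cis_conv_exp)
    show "integrable lborel (\<lambda>\<theta>. indicator {0..pi} \<theta> * C\<^sup>2)" by simp
    show "AE x in lborel. norm (indicator {0..pi} x * (cmod (P N x))\<^sup>2) \<le> indicator {0..pi} x * C\<^sup>2" for N
      using PC[of N] by (intro AE_I2) (simp add: abs_mult power_mono mult_left_mono)
  qed (intro AE_I2 tendsto_intros lim)
  then have "(\<lambda>N. pi * (\<Sum>l<N. (d l)\<^sup>2)) \<longlonglongrightarrow> (\<integral>\<theta>. indicator {0..pi} \<theta> * (cmod (\<Sum>l. d l * cis (real l * \<theta>)))\<^sup>2 \<partial>lborel)"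
    unfolding fin .
  from tendsto_mult[OF tendsto_const[of "1 / pi"] this]
  have "(\<lambda>l. (d l)\<^sup>2) sums (1 / pi * (\<integral>\<theta>. indicator {0..pi} \<theta> * (cmod (\<Sum>l. d l * cis (real l * \<theta>)))\<^sup>2 \<partial>lborel))"
    unfolding sums_def by simp
  moreover have "(\<integral>\<theta>. indicator {0..pi} \<theta> * (cmod (\<Sum>l. d l * cis (real l * \<theta>)))\<^sup>2 \<partial>lborel)
     = half_circle_integral (\<lambda>\<theta>. (cmod (\<Sum>l. d l * cis (real l * \<theta>)))\<^sup>2)"
    unfolding half_circle_integral_def
  proof (rule integral_cong_AE)
    show "AE x in lborel. indicator {0..pi} x * (cmod (\<Sum>l. d l * cis (real l * x)))\<^sup>2
        = indicator {0<..pi} x * (cmod (\<Sum>l. d l * cis (real l * x)))\<^sup>2"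
      using AE_lborel_singleton[of 0] by eventually_elim (auto split: split_indicator)
  qed (use meas in simp_all)
  ultimately have "(\<lambda>l. (d l)\<^sup>2) sums (1 / pi * half_circle_integral (\<lambda>\<theta>. (cmod (\<Sum>l. d l * cis (real l * \<theta>)))\<^sup>2))"
    by simp
  then show "summable (\<lambda>l. (d l)\<^sup>2)"
    "half_circle_integral (\<lambda>\<theta>. (cmod (\<Sum>l. d l * cis (real l * \<theta>)))\<^sup>2) = pi * (\<Sum>l. (d l)\<^sup>2)"
    by (auto simp: sums_iff)
qed

lemma integrable_lborel_powr_near_0:
  fixes a c :: real
  assumes "-1 < a" "0 \<le> c"
  shows "integrable lborel (\<lambda>x. indicator {0<..c} x * x powr a)"
proof -
  have "(\<lambda>x. x powr a) absolutely_integrable_on {0<..c}"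
    using integrable_on_powr_from_0'[OF assms] by (rule nonnegative_absolutely_integrable_1) simp
  then show ?thesis
    unfolding set_integrable_def by (subst (asm) integrable_completion) auto
qed

lemma integrable_lborel_powr_near_infinity:
  fixes a c :: real
  assumes "a < -1" "0 < c"
  shows "integrable lborel (\<lambda>x. indicator {c..} x * x powr a)"
proof -
  have "(\<lambda>x. x powr a) integrable_on {c..}"
    using has_integral_powr_to_inf[OF assms] by (rule has_integral_integrable)
  then have "(\<lambda>x. x powr a) absolutely_integrable_on {c..}"
    by (rule nonnegative_absolutely_integrable_1) simp
  then show ?thesis
    unfolding set_integrable_def by (subst (asm) integrable_completion) auto
qed

lemma cmod_cis_minus_1: "(cmod (cis x - 1))\<^sup>2 = 2 - 2 * cos x"
proof -
  have "(cmod (cis x - 1))\<^sup>2 = (cos x - 1)\<^sup>2 + (sin x)\<^sup>2" by (simp add: cmod_power2)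
  also have "\<dots> = 2 - 2 * cos x"
    using sin_cos_squared_add[of x] by (simp add: power2_eq_square algebra_simps)
  finally show ?thesis .
qed

text \<open>
  The constant 3 comes from \<open>x - x ^ 3 / 6 \<ge> x / 3\<close> for \<open>0 \<le> x \<le> 2\<close>, applied to \<open>x = \<theta> / 2\<close>.
\<close>

lemma chord_lower_bound:
  assumes "0 < \<theta>" "\<theta> \<le> pi"
  shows "\<theta> / 3 \<le> cmod (cis \<theta> - 1)"
proof -
  define x where "x = \<theta> / 2"
  have x: "0 < x" "x \<le> 2" using assms pi_less_4 by (auto simp: x_def)
  have "\<bar>sin x - (\<Sum>m<3. sin_coeff m * x ^ m)\<bar> \<le> inverse (fact 3) * \<bar>x\<bar> ^ 3"
    by (rule Maclaurin_sin_bound)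
  moreover have "(\<Sum>m<3. sin_coeff m * x ^ m) = x"
    by (simp add: sin_coeff_def numeral_3_eq_3)
  moreover have "inverse (fact 3) * \<bar>x\<bar> ^ 3 = x ^ 3 / 6"
  proof -
    have "inverse (fact 3 :: real) = 1 / 6" by (simp add: fact_numeral)
    then show ?thesis using x by simp
  qed
  ultimately have "\<bar>sin x - x\<bar> \<le> x ^ 3 / 6" by simp
  then have "x - x ^ 3 / 6 \<le> sin x" by linarith
  moreover have "x ^ 3 \<le> 4 * x"
  proof -
    have "x * x \<le> 2 * 2" using x by (intro mult_mono) auto
    then have "x * x * x \<le> 4 * x" using x by (intro mult_right_mono) auto
    then show ?thesis by (simp add: power3_eq_cube)
  qed
  ultimately have s: "x / 3 \<le> sin x" by simp
  have "(cmod (cis \<theta> - 1))\<^sup>2 = (2 * sin x)\<^sup>2"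
    using cos_double_sin[of x] by (simp add: cmod_cis_minus_1 x_def power_mult_distrib)
  moreover have "0 \<le> 2 * sin x" using s x by linarith
  ultimately have "cmod (cis \<theta> - 1) = 2 * sin x"
    by (metis abs_of_nonneg norm_ge_zero power2_eq_iff_nonneg)
  then show ?thesis using s by (simp add: x_def)
qed

definition dirichlet_kernel :: "nat \<Rightarrow> complex \<Rightarrow> complex" where
  "dirichlet_kernel n z = (\<Sum>j<n. z ^ j)"

lemma dirichlet_kernel_le: "cmod z \<le> 1 \<Longrightarrow> cmod (dirichlet_kernel n z) \<le> real n"
  unfolding dirichlet_kernel_def
  by (rule order.trans[OF sum_norm_le[where g="\<lambda>_. 1"]]) (auto simp: norm_power power_le_one)

lemma dirichlet_kernel_cis_le:
  assumes "0 < \<theta>" "\<theta> \<le> pi"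
  shows "cmod (dirichlet_kernel n (cis \<theta>)) \<le> 6 / \<theta>"
proof -
  have c: "0 < \<theta> / 3" "\<theta> / 3 \<le> cmod (cis \<theta> - 1)" using chord_lower_bound[OF assms] assms by auto
  then have "cis \<theta> \<noteq> 1" by auto
  then have "cmod (dirichlet_kernel n (cis \<theta>)) = cmod (cis \<theta> ^ n - 1) / cmod (cis \<theta> - 1)"
    unfolding dirichlet_kernel_def by (simp add: geometric_sum norm_divide)
  also have "\<dots> \<le> 2 / (\<theta> / 3)"
  proof (rule frac_le[OF _ _ c])
    show "cmod (cis \<theta> ^ n - 1) \<le> 2"
      using norm_triangle_ineq4[of "cis \<theta> ^ n" 1] by (simp add: norm_power)
  qed simp
  finally show ?thesis by simp
qed

text \<open>
  Up to a reflection of the index, these are the weights of the innovations in a sum of \<open>n\<close>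
  consecutive colours.
\<close>

definition window_sum :: "nat pmf \<Rightarrow> nat \<Rightarrow> nat \<Rightarrow> real" where
  "window_sum \<mu> n l = (\<Sum>j<n. renewal_int \<mu> (int l - int j))"

lemma window_sum_bounds: "0 \<le> window_sum \<mu> n l" "window_sum \<mu> n l \<le> real n"
proof -
  show "0 \<le> window_sum \<mu> n l" by (simp add: window_sum_def sum_nonneg renewal_int_bounds)
  have "window_sum \<mu> n l \<le> (\<Sum>j<n. 1)"
    unfolding window_sum_def by (intro sum_mono renewal_int_bounds)
  then show "window_sum \<mu> n l \<le> real n" by simp
qed

definition window_energy :: "nat pmf \<Rightarrow> nat \<Rightarrow> real" where
  "window_energy \<mu> n = (\<Sum>l. (window_sum \<mu> n l)\<^sup>2)"

context heavy_tailed_jumps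
begin

lemma pmf_0 [simp]: "pmf \<mu> 0 = 0"
  using positive_jumps by (simp add: set_pmf_iff)

lemma pgf_sums:
  assumes "cmod z \<le> 1" shows "(\<lambda>m. complex_of_real (pmf \<mu> m) * z ^ m) sums pgf z"
proof -
  have i: "integrable (density (count_space UNIV) (\<lambda>m. ennreal (pmf \<mu> m))) (\<lambda>m. z ^ m)"
    using integrable_power[OF assms] by (simp add: measure_pmf_eq_density)
  then have "integrable (count_space UNIV) (\<lambda>m. pmf \<mu> m *\<^sub>R z ^ m)"
    by (subst (asm) integrable_density) auto
  from sums_integral_count_space_nat[OF this]
  show ?thesis
    unfolding pgf_def measure_pmf_eq_density by (simp add: integral_density scaleR_conv_of_real)
qed

lemma renewal_pgf_sums:
  assumes z: "cmod z < 1"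
  shows "(\<lambda>l. complex_of_real (renewal \<mu> l) * z ^ l) sums (1 / (1 - pgf z))"
proof -
  have bound: "summable (\<lambda>l. norm (complex_of_real (c l) * z ^ l))" if "\<And>l. 0 \<le> c l \<and> c l \<le> 1" for c
  proof (rule summable_comparison_test'[of "\<lambda>l. cmod z ^ l" 0])
    show "summable (\<lambda>l. cmod z ^ l)" using z by (simp add: summable_geometric)
    show "norm (norm (complex_of_real (c l) * z ^ l)) \<le> cmod z ^ l" for l
      using that[of l] mult_right_mono[of "c l" 1 "cmod z ^ l"] by (simp add: norm_mult norm_power)
  qed
  have sp: "summable (\<lambda>l. norm (complex_of_real (pmf \<mu> l) * z ^ l))"
    by (rule bound) (simp add: pmf_le_1)
  have sq: "summable (\<lambda>l. norm (complex_of_real (renewal \<mu> l) * z ^ l))"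
    by (rule bound) (rule renewal_bounds)
  define Q where "Q = (\<Sum>l. complex_of_real (renewal \<mu> l) * z ^ l)"
  have Q: "(\<lambda>l. complex_of_real (renewal \<mu> l) * z ^ l) sums Q"
    unfolding Q_def using summable_norm_cancel[OF sq] by (rule summable_sums)
  have P: "(\<Sum>l. complex_of_real (pmf \<mu> l) * z ^ l) = pgf z"
    using pgf_sums z by (simp add: sums_iff)
  have conv: "(\<Sum>i\<le>k. (complex_of_real (pmf \<mu> i) * z ^ i) * (complex_of_real (renewal \<mu> (k - i)) * z ^ (k - i)))
     = complex_of_real (renewal \<mu> k) * z ^ k - (if k = 0 then 1 else 0)" for k
  proof (cases k)
    case (Suc n)
    have "(\<Sum>i\<le>k. (complex_of_real (pmf \<mu> i) * z ^ i) * (complex_of_real (renewal \<mu> (k - i)) * z ^ (k - i)))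
      = (\<Sum>i\<le>k. complex_of_real (pmf \<mu> i * renewal \<mu> (k - i)) * z ^ k)"
      by (intro sum.cong refl) (simp add: mult_ac flip: power_add)
    also have "\<dots> = complex_of_real (\<Sum>i\<le>k. pmf \<mu> i * renewal \<mu> (k - i)) * z ^ k"
      by (simp add: sum_distrib_right)
    also have "(\<Sum>i\<le>k. pmf \<mu> i * renewal \<mu> (k - i)) = renewal \<mu> k"
      unfolding Suc by (subst sum.atMost_Suc_shift) (simp add: renewal.simps)
    finally show ?thesis using Suc by simp
  qed simp
  have "(\<lambda>k. complex_of_real (renewal \<mu> k) * z ^ k - (if k = 0 then 1 else 0)) sums (pgf z * Q)"
    using Cauchy_product_sums[OF sp sq] unfolding conv P Q_def .
  moreover have "(\<lambda>k. complex_of_real (renewal \<mu> k) * z ^ k - (if k = 0 then 1 else 0)) sums (Q - 1)"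
    using sums_diff[OF Q sums_single[of 0 "\<lambda>_. 1"]] by simp
  ultimately have "pgf z * Q = Q - 1" by (rule sums_unique2)
  then have "Q * (1 - pgf z) = 1" by (simp add: algebra_simps)
  then have "Q = 1 / (1 - pgf z)" by (metis eq_divide_imp mult_zero_right zero_neq_one)
  then show ?thesis using Q by simp
qed

lemma window_sum_sums:
  assumes z: "cmod z < 1"
  shows "(\<lambda>l. complex_of_real (window_sum \<mu> n l) * z ^ l) sums (dirichlet_kernel n z / (1 - pgf z))"
proof -
  have "(\<lambda>l. complex_of_real (renewal_int \<mu> (int l - int j)) * z ^ l) sums (z ^ j * (1 / (1 - pgf z)))" for j
  proof -
    have "(\<lambda>l. z ^ j * (complex_of_real (renewal \<mu> l) * z ^ l)) sums (z ^ j * (1 / (1 - pgf z)))"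
      by (intro sums_mult renewal_pgf_sums z)
    then have "(\<lambda>l. complex_of_real (renewal_int \<mu> (int (l + j) - int j)) * z ^ (l + j)) sums (z ^ j * (1 / (1 - pgf z)))"
      by (simp add: power_add mult_ac)
    then show ?thesis by (subst (asm) sums_zero_iff_shift) auto
  qed
  then have "(\<lambda>l. \<Sum>j<n. complex_of_real (renewal_int \<mu> (int l - int j)) * z ^ l) sums (\<Sum>j<n. z ^ j * (1 / (1 - pgf z)))"
    by (rule sums_sum)
  then show ?thesis
    by (simp add: window_sum_def dirichlet_kernel_def sum_distrib_right sum_divide_distrib)
qed

definition spectral_integrand :: "nat \<Rightarrow> real \<Rightarrow> real \<Rightarrow> real" where
  "spectral_integrand n s \<theta> =
     (cmod (dirichlet_kernel n (of_real s * cis \<theta>)) / cmod (1 - pgf (of_real s * cis \<theta>)))\<^sup>2"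

lemma spectral_identity_inside:
  assumes s: "0 \<le> s" "s < 1"
  shows "summable (\<lambda>l. (window_sum \<mu> n l * s ^ l)\<^sup>2)"
    "half_circle_integral (spectral_integrand n s) = pi * (\<Sum>l. (window_sum \<mu> n l * s ^ l)\<^sup>2)"
proof -
  have sm: "summable (\<lambda>l. \<bar>window_sum \<mu> n l * s ^ l\<bar>)"
  proof (rule summable_comparison_test'[of "\<lambda>l. real n * s ^ l" 0])
    show "summable (\<lambda>l. real n * s ^ l)" using s by (intro summable_mult summable_geometric) simp
    show "norm \<bar>window_sum \<mu> n l * s ^ l\<bar> \<le> real n * s ^ l" for l
      using s window_sum_bounds[where \<mu>=\<mu> and n=n and l=l] by (simp add: abs_mult mult_right_mono)
  qed
  have "(\<Sum>l. complex_of_real (window_sum \<mu> n l * s ^ l) * cis (real l * \<theta>))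
      = dirichlet_kernel n (of_real s * cis \<theta>) / (1 - pgf (of_real s * cis \<theta>))" for \<theta>
  proof -
    have "cmod (of_real s * cis \<theta>) < 1" using s by (simp add: norm_mult)
    from window_sum_sums[OF this, of n] show ?thesis
      by (simp add: sums_iff power_mult_distrib Complex.DeMoivre mult.assoc)
  qed
  then have eq: "spectral_integrand n s = (\<lambda>\<theta>. (cmod (\<Sum>l. complex_of_real (window_sum \<mu> n l * s ^ l) * cis (real l * \<theta>)))\<^sup>2)"
    by (simp add: fun_eq_iff spectral_integrand_def norm_divide)
  show "summable (\<lambda>l. (window_sum \<mu> n l * s ^ l)\<^sup>2)"
    "half_circle_integral (spectral_integrand n s) = pi * (\<Sum>l. (window_sum \<mu> n l * s ^ l)\<^sup>2)"
    unfolding eq by (rule parseval_half_circle[OF sm])+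
qed

lemma continuous_on_spectral:
  assumes "0 \<le> s" "s \<le> 1"
  shows "continuous_on {0<..pi} (spectral_integrand n s)"
  unfolding spectral_integrand_def dirichlet_kernel_def cis_conv_exp
  by (intro continuous_intros continuous_on_compose2[OF continuous_on_pgf])
    (use assms pgf_ne_1[OF assms] in \<open>auto simp: norm_mult cis_conv_exp\<close>)

lemma measurable_spectral:
  assumes "0 \<le> s" "s \<le> 1"
  shows "(\<lambda>\<theta>. indicator {0<..pi} \<theta> * spectral_integrand n s \<theta>) \<in> borel_measurable borel"
proof -
  have "(\<lambda>\<theta>. indicator {0<..pi} \<theta> *\<^sub>R spectral_integrand n s \<theta>) \<in> borel_measurable borel"
    by (intro borel_measurable_continuous_on_indicator continuous_on_spectral assms) simp
  then show ?thesis by simp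
qed

text \<open>
  Choosing the constants of \<open>pgf_lower_bound\<close> and \<open>potter_bound\<close> once and for all allows the majorant
  to be a definition.
\<close>

definition pgf_const :: real where
  "pgf_const = (SOME c. 0 < c \<and> (\<forall>s \<theta>. 0 \<le> s \<longrightarrow> s \<le> 1 \<longrightarrow> 0 < \<theta> \<longrightarrow> \<theta> \<le> pi \<longrightarrow>
    c * tail (2 / \<theta>) \<le> cmod (1 - pgf (of_real s * cis \<theta>))))"

lemma pgf_const: "0 < pgf_const"
  "0 \<le> s \<Longrightarrow> s \<le> 1 \<Longrightarrow> 0 < \<theta> \<Longrightarrow> \<theta> \<le> pi \<Longrightarrow>
    pgf_const * tail (2 / \<theta>) \<le> cmod (1 - pgf (of_real s * cis \<theta>))"
proof -
  have "\<exists>c. 0 < c \<and> (\<forall>s \<theta>. 0 \<le> s \<longrightarrow> s \<le> 1 \<longrightarrow> 0 < \<theta> \<longrightarrow> \<theta> \<le> pi \<longrightarrow>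
    c * tail (2 / \<theta>) \<le> cmod (1 - pgf (of_real s * cis \<theta>)))"
    using pgf_lower_bound by metis
  from someI_ex[OF this] show "0 < pgf_const" "0 \<le> s \<Longrightarrow> s \<le> 1 \<Longrightarrow> 0 < \<theta> \<Longrightarrow> \<theta> \<le> pi \<Longrightarrow>
    pgf_const * tail (2 / \<theta>) \<le> cmod (1 - pgf (of_real s * cis \<theta>))"
    unfolding pgf_const_def by blast+
qed

lemma tail_over_pgf:
  assumes "1 \<le> n" and s: "0 \<le> s" "s \<le> 1" and u: "0 < u" "u \<le> pi * real n"
  shows "tail (real n) / cmod (1 - pgf (of_real s * cis (u / real n)))
    \<le> potter_const / pgf_const * max 1 ((2 / u) powr \<gamma>)"
proof -
  have n: "0 < real n" using assms by simp
  have th: "0 < u / real n" "u / real n \<le> pi" using u n by (auto simp: field_simps)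
  have lb: "pgf_const * tail (2 / u * real n) \<le> cmod (1 - pgf (of_real s * cis (u / real n)))"
    using pgf_const(2)[OF s th] n by (simp add: field_simps)
  have "tail (real n) \<le> potter_const * max 1 ((2 / u) powr \<gamma>) * tail (2 / u * real n)"
  proof (cases "u \<le> 2")
    case True
    then have "tail (real n) \<le> potter_const * (2 / u) powr \<gamma> * tail (2 / u * real n)"
      using assms by (intro potter) auto
    also have "\<dots> \<le> potter_const * max 1 ((2 / u) powr \<gamma>) * tail (2 / u * real n)"
      using potter(1) tail_nonneg by (intro mult_right_mono mult_left_mono) auto
    finally show ?thesis .
  next
    case False
    then have "2 / u * real n \<le> real n" using n by (simp add: field_simps)
    then have "tail (real n) \<le> 1 * 1 * tail (2 / u * real n)" by (simp add: tail_antimono)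
    also have "\<dots> \<le> potter_const * max 1 ((2 / u) powr \<gamma>) * tail (2 / u * real n)"
      using potter(1) tail_nonneg by (intro mult_right_mono mult_mono) auto
    finally show ?thesis .
  qed
  moreover have "0 < pgf_const * tail (2 / u * real n)"
    using pgf_const(1) tail_pos by simp
  ultimately have "tail (real n) / cmod (1 - pgf (of_real s * cis (u / real n)))
      \<le> potter_const * max 1 ((2 / u) powr \<gamma>) * tail (2 / u * real n) / (pgf_const * tail (2 / u * real n))"
    using lb tail_nonneg potter(1) by (intro frac_le mult_nonneg_nonneg) auto
  also have "\<dots> = potter_const / pgf_const * max 1 ((2 / u) powr \<gamma>)"
    using tail_pos[of "2 / u * real n"] by simp
  finally show ?thesis .
qed

text \<open>
  Up to 2 the kernel is bounded trivially and Potter's bound contributes \<open>u powr (- 2 * \<gamma>)\<close>. Beyond 2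
  the quotient of tails is bounded and the kernel contributes \<open>(6 / u)\<^sup>2\<close>.
\<close>

definition majorant :: "real \<Rightarrow> real" where
  "majorant u = (potter_const / pgf_const)\<^sup>2 *
     (indicator {0<..2} u * (2 powr (2 * \<gamma>) * u powr (- 2 * \<gamma>)) + indicator {2..} u * (36 * u powr (- 2)))"

lemma integrable_majorant: "integrable lborel majorant"
proof -
  have "integrable lborel (\<lambda>u. 2 powr (2 * \<gamma>) * (indicator {0<..2} u * u powr (- 2 * \<gamma>)))"
    by (intro integrable_mult_right integrable_lborel_powr_near_0) (use gamma in auto)
  moreover have "integrable lborel (\<lambda>u::real. 36 * (indicator {2..} u * u powr (- 2)))"
    by (intro integrable_mult_right integrable_lborel_powr_near_infinity) auto
  ultimately show ?thesis
    unfolding majorant_def by (intro integrable_mult_right Bochner_Integration.integrable_add) (simp_all add: mult_ac)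
qed

lemma majorant_nonneg: "0 \<le> majorant u"
  by (auto simp: majorant_def)

lemma scaled_spectral_le:
  assumes n: "1 \<le> n" and s: "0 \<le> s" "s \<le> 1" and u: "0 < u" "u \<le> pi * real n"
    and D: "u > 2 \<Longrightarrow> cmod (dirichlet_kernel n (of_real s * cis (u / real n))) \<le> 6 * real n / u"
  shows "(tail (real n) / real n)\<^sup>2 * spectral_integrand n s (u / real n) \<le> majorant u"
proof -
  define z where "z = of_real s * cis (u / real n)"
  have eq: "(tail (real n) / real n)\<^sup>2 * spectral_integrand n s (u / real n)
     = (tail (real n) / cmod (1 - pgf z))\<^sup>2 * (cmod (dirichlet_kernel n z) / real n)\<^sup>2"
    by (simp add: spectral_integrand_def z_def power_divide)
  have t: "0 \<le> tail (real n) / cmod (1 - pgf z)"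
    "tail (real n) / cmod (1 - pgf z) \<le> potter_const / pgf_const * max 1 ((2 / u) powr \<gamma>)"
    using tail_over_pgf[OF n s u] tail_nonneg by (auto simp: z_def)
  have k1: "cmod (dirichlet_kernel n z) / real n \<le> 1"
    using dirichlet_kernel_le[of z n] s n by (simp add: z_def norm_mult)
  show ?thesis
  proof (cases "u \<le> 2")
    case True
    have "1 \<le> (2 / u) powr \<gamma>" using True u gamma by (intro ge_one_powr_ge_zero) auto
    then have "(tail (real n) / cmod (1 - pgf z))\<^sup>2 \<le> (potter_const / pgf_const * (2 / u) powr \<gamma>)\<^sup>2"
      using t by (intro power_mono) (auto simp: max_absorb2)
    also have "\<dots> = (potter_const / pgf_const)\<^sup>2 * (2 powr (2 * \<gamma>) * u powr (- 2 * \<gamma>))"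
      using u by (simp add: power_mult_distrib powr_divide powr_minus power_divide powr_power field_simps)
    also have "\<dots> \<le> majorant u"
      using True u by (simp add: majorant_def mult_left_mono)
    finally have "(tail (real n) / cmod (1 - pgf z))\<^sup>2 \<le> majorant u" .
    moreover have "(cmod (dirichlet_kernel n z) / real n)\<^sup>2 \<le> 1"
      using k1 by (intro power_le_one) auto
    ultimately show ?thesis
      unfolding eq using mult_mono[of "(tail (real n) / cmod (1 - pgf z))\<^sup>2" "majorant u" "(cmod (dirichlet_kernel n z) / real n)\<^sup>2" 1]
      by (simp add: majorant_nonneg)
  next
    case False
    have "(2 / u) powr \<gamma> \<le> 1" using False gamma by (intro powr_le1) auto
    then have "(tail (real n) / cmod (1 - pgf z))\<^sup>2 \<le> (potter_const / pgf_const)\<^sup>2"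
      using t by (intro power_mono) (auto simp: max_absorb1)
    moreover have "(cmod (dirichlet_kernel n z) / real n)\<^sup>2 \<le> (6 / u)\<^sup>2"
      using D False n by (intro power_mono) (auto simp: z_def field_simps)
    ultimately have "(tail (real n) / cmod (1 - pgf z))\<^sup>2 * (cmod (dirichlet_kernel n z) / real n)\<^sup>2
        \<le> (potter_const / pgf_const)\<^sup>2 * (6 / u)\<^sup>2"
      by (intro mult_mono) auto
    also have "\<dots> \<le> majorant u"
      using False u by (simp add: majorant_def power_divide powr_minus powr_numeral divide_inverse power_inverse)
    finally show ?thesis unfolding eq .
  qed
qed

lemma integrable_indicator_majorant:
  "integrable lborel (\<lambda>u. indicator {0<..a} u * majorant u)"
  using integrable_majorant
  by (rule Bochner_Integration.integrable_bound)
    (auto simp: majorant_nonneg majorant_def split: split_indicator)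

text \<open>
  The case \<open>n = 1\<close> of \<open>scaled_spectral_le\<close>, with the trivial bound \<open>n\<close> for the kernel. It is uniform in \<open>s\<close>.
\<close>

lemma spectral_bound:
  assumes n: "1 \<le> n" and s: "0 \<le> s" "s \<le> 1" and \<theta>: "0 < \<theta>" "\<theta> \<le> pi"
  shows "spectral_integrand n s \<theta> \<le> (real n)\<^sup>2 * (4 * majorant \<theta>)"
proof -
  define z where "z = of_real s * cis \<theta>"
  have k: "cmod (dirichlet_kernel n z) \<le> real n"
    using dirichlet_kernel_le[of z n] s by (simp add: z_def norm_mult)
  have "spectral_integrand n s \<theta> = (cmod (dirichlet_kernel n z))\<^sup>2 * (spectral_integrand 1 s \<theta>)"
    by (simp add: spectral_integrand_def z_def power_divide dirichlet_kernel_def)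
  also have "\<dots> \<le> (real n)\<^sup>2 * (4 * majorant \<theta>)"
  proof (intro mult_mono power_mono k)
    have "(tail (real 1) / real 1)\<^sup>2 * spectral_integrand 1 s (\<theta> / real 1) \<le> majorant \<theta>"
    proof (rule scaled_spectral_le)
      show "cmod (dirichlet_kernel 1 (of_real s * cis (\<theta> / real 1))) \<le> 6 * real 1 / \<theta>"
        using \<theta> pi_less_4 by (simp add: dirichlet_kernel_def)
    qed (use s \<theta> in auto)
    then show "spectral_integrand 1 s \<theta> \<le> 4 * majorant \<theta>"
      using tail_eq_1[of 1] majorant_nonneg[of \<theta>] by simp
  qed (auto simp: spectral_integrand_def)
  finally show ?thesis .
qed

text \<open>
  Parseval's identity holds for the coefficients damped by \<open>s ^ l\<close>, \<open>s < 1\<close>. As \<open>s\<close> tends to 1 the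
  integrals converge by \<open>spectral_bound\<close>, and the sums increase to the undamped one.
\<close>

lemma summable_window_sum: "summable (\<lambda>l. (window_sum \<mu> n l)\<^sup>2)"
  and spectral_identity: "half_circle_integral (spectral_integrand n 1) = pi * window_energy \<mu> n"
proof -
  have "summable (\<lambda>l. (window_sum \<mu> n l)\<^sup>2) \<and> half_circle_integral (spectral_integrand n 1) = pi * window_energy \<mu> n"
  proof (cases "n = 0")
    case True
    then show ?thesis
      by (simp add: window_sum_def window_energy_def spectral_integrand_def dirichlet_kernel_def half_circle_integral_def)
  next
    case False
    then have n: "1 \<le> n" by simp
    define s where "s k = 1 - 1 / real (k + 2)" for k
    have s: "0 \<le> s k" "s k < 1" "s k \<le> 1" for k by (auto simp: s_def field_simps)
    have s1: "s \<longlonglongrightarrow> 1" unfolding s_def by real_asymp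
    have lim: "(\<lambda>k. half_circle_integral (spectral_integrand n (s k))) \<longlonglongrightarrow> half_circle_integral (spectral_integrand n 1)"
      unfolding half_circle_integral_def
    proof (rule integral_dominated_convergence[where w="\<lambda>\<theta>. (real n)\<^sup>2 * 4 * (indicator {0<..pi} \<theta> * majorant \<theta>)"])
      show "integrable lborel (\<lambda>\<theta>. (real n)\<^sup>2 * 4 * (indicator {0<..pi} \<theta> * majorant \<theta>))"
        by (intro integrable_mult_right integrable_indicator_majorant)
      show "AE \<theta> in lborel. norm (indicator {0<..pi} \<theta> * spectral_integrand n (s k) \<theta>) \<le> (real n)\<^sup>2 * 4 * (indicator {0<..pi} \<theta> * majorant \<theta>)" for k
        using spectral_bound[OF n s(1,3)] by (intro AE_I2) (auto simp: spectral_integrand_def mult.assoc split: split_indicator)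
      show "AE \<theta> in lborel. (\<lambda>k. indicator {0<..pi} \<theta> * spectral_integrand n (s k) \<theta>) \<longlonglongrightarrow> indicator {0<..pi} \<theta> * spectral_integrand n 1 \<theta>"
      proof (rule AE_I2)
        fix \<theta> :: real
        show "(\<lambda>k. indicator {0<..pi} \<theta> * spectral_integrand n (s k) \<theta>) \<longlonglongrightarrow> indicator {0<..pi} \<theta> * spectral_integrand n 1 \<theta>"
        proof (cases "\<theta> \<in> {0<..pi}")
          case True
          have z: "(\<lambda>k. complex_of_real (s k) * cis \<theta>) \<longlonglongrightarrow> of_real 1 * cis \<theta>"
            by (intro tendsto_intros s1)
          have "(\<lambda>k. pgf (complex_of_real (s k) * cis \<theta>)) \<longlonglongrightarrow> pgf (of_real 1 * cis \<theta>)"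
            using continuous_on_pgf z s unfolding continuous_on_sequentially o_def
            by (auto simp: norm_mult)
          moreover have "(\<lambda>k. dirichlet_kernel n (complex_of_real (s k) * cis \<theta>)) \<longlonglongrightarrow> dirichlet_kernel n (of_real 1 * cis \<theta>)"
            unfolding dirichlet_kernel_def by (intro tendsto_intros s1)
          ultimately show ?thesis
            unfolding spectral_integrand_def using pgf_ne_1[of 1 \<theta>] True
            by (intro tendsto_intros) auto
        qed simp
      qed
    qed (use measurable_spectral s in simp_all)
    have part: "pi * (\<Sum>l<N. (window_sum \<mu> n l)\<^sup>2) \<le> half_circle_integral (spectral_integrand n 1)" for N
    proof (rule tendsto_le[OF sequentially_bot lim])
      show "(\<lambda>k. pi * (\<Sum>l<N. (window_sum \<mu> n l * s k ^ l)\<^sup>2)) \<longlonglongrightarrow> pi * (\<Sum>l<N. (window_sum \<mu> n l)\<^sup>2)"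
        using s1 by (auto intro!: tendsto_eq_intros)
      show "\<forall>\<^sub>F k in sequentially. pi * (\<Sum>l<N. (window_sum \<mu> n l * s k ^ l)\<^sup>2) \<le> half_circle_integral (spectral_integrand n (s k))"
        using s by (auto simp: spectral_identity_inside intro!: always_eventually mult_left_mono sum_le_suminf spectral_identity_inside(1))
    qed
    have sm: "summable (\<lambda>l. (window_sum \<mu> n l)\<^sup>2)"
    proof (rule summableI_nonneg_bounded)
      fix N show "(\<Sum>l<N. (window_sum \<mu> n l)\<^sup>2) \<le> half_circle_integral (spectral_integrand n 1) / pi"
        using part[of N] by (simp add: field_simps)
    qed simp
    have "half_circle_integral (spectral_integrand n 1) \<le> pi * window_energy \<mu> n"
    proof (rule tendsto_upperbound[OF lim _ sequentially_bot])
      have "half_circle_integral (spectral_integrand n (s k)) \<le> pi * window_energy \<mu> n" for k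
        unfolding window_energy_def spectral_identity_inside(2)[OF s(1,2)]
      proof (intro mult_left_mono suminf_le spectral_identity_inside(1) s sm)
        fix l
        have "window_sum \<mu> n l * s k ^ l \<le> window_sum \<mu> n l"
          using window_sum_bounds(1)[of \<mu> n l] s[of k] by (intro mult_left_le) (auto simp: power_le_one)
        then show "(window_sum \<mu> n l * s k ^ l)\<^sup>2 \<le> (window_sum \<mu> n l)\<^sup>2"
          using window_sum_bounds(1)[of \<mu> n l] s(1)[of k] by (intro power_mono) auto
      qed simp
      then show "\<forall>\<^sub>F k in sequentially. half_circle_integral (spectral_integrand n (s k)) \<le> pi * window_energy \<mu> n" by simp
    qed
    moreover have "pi * window_energy \<mu> n \<le> half_circle_integral (spectral_integrand n 1)"
    proof -
      have "window_energy \<mu> n \<le> half_circle_integral (spectral_integrand n 1) / pi"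
        unfolding window_energy_def using part by (intro suminf_le_const sm) (simp add: field_simps)
      then show ?thesis by (simp add: field_simps)
    qed
    ultimately show ?thesis using sm by simp
  qed
  then show "summable (\<lambda>l. (window_sum \<mu> n l)\<^sup>2)" "half_circle_integral (spectral_integrand n 1) = pi * window_energy \<mu> n"
    by auto
qed

lemma summable_renewal_sq: "summable (\<lambda>l. (renewal \<mu> l)\<^sup>2)"
  using summable_window_sum[of 1] by (simp add: window_sum_def)

end

section \<open>Asymptotics of the window energy\<close>

lemma has_bochner_integral_cis:
  fixes u y :: real
  assumes "0 \<le> y"
  shows "has_bochner_integral lborel (\<lambda>x. indicator {0..y} x *\<^sub>R (- (\<i> * u * cis (u * x)))) (1 - cis (u * y))"
proof -
  have "has_bochner_integral lborel (\<lambda>x. indicator {0..y} x *\<^sub>R (- (\<i> * u * cis (u * x))))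
      ((\<lambda>x. - cis (u * x)) y - (\<lambda>x. - cis (u * x)) 0)"
  proof (rule has_bochner_integral_FTC_Icc[OF assms])
    show "((\<lambda>x. - cis (u * x)) has_vector_derivative - (\<i> * u * cis (u * x))) (at x within {0..y})" for x
    proof -
      have "((\<lambda>z. - exp (\<i> * u * z)) has_field_derivative - (\<i> * u * exp (\<i> * u * x))) (at (complex_of_real x))"
        by (auto intro!: derivative_eq_intros)
      from has_vector_derivative_real_field[OF this] show ?thesis
        unfolding cis_conv_exp by (simp add: mult.assoc)
    qed
    show "continuous_on {0..y} (\<lambda>x. - (\<i> * u * cis (u * x)))"
      unfolding cis_conv_exp by (intro continuous_intros)
  qed
  then show ?thesis by simp
qed

lemma convergent_if_approximable:
  fixes z :: "nat \<Rightarrow> complex"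
  assumes "\<And>e. 0 < e \<Longrightarrow> \<exists>w. \<forall>\<^sub>F n in sequentially. cmod (z n - w) < e"
  shows "convergent z"
proof (rule Cauchy_convergent, rule metric_CauchyI)
  fix e :: real assume "0 < e"
  then obtain w N where "\<And>n. N \<le> n \<Longrightarrow> cmod (z n - w) < e / 2"
    using assms[of "e / 2"] by (auto simp: eventually_sequentially)
  then show "\<exists>M. \<forall>m\<ge>M. \<forall>n\<ge>M. dist (z m) (z n) < e"
    by (intro exI[of _ N]) (metis dist_norm dist_triangle_half_l)
qed

context heavy_tailed_jumps
begin

text \<open>
  Integration by parts: the integrand on the left is the integral of a derivative over
  \<open>{0..min (m / n) A}\<close>, and exchanging the integrals leaves the probability that \<open>m \<ge> x * n\<close>.
\<close>

lemma truncated_characteristic_integral: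
  assumes "1 \<le> n" "0 \<le> A"
  shows "(\<integral>m. 1 - cis (u * min (real m / real n) A) \<partial>measure_pmf \<mu>)
    = (\<integral>x. indicator {0..A} x *\<^sub>R (- (\<i> * u * cis (u * x)) * tail (x * real n)) \<partial>lborel)"
proof -
  interpret pair_sigma_finite "measure_pmf \<mu>" "lborel :: real measure"
    by (intro pair_sigma_finite.intro) (unfold_locales)
  define g where "g x = - (\<i> * u * cis (u * x))" for x
  have [measurable]: "g \<in> borel_measurable borel"
    unfolding g_def cis_conv_exp by measurable
  have g_norm: "cmod (g x) = \<bar>u\<bar>" for x by (simp add: g_def norm_mult)
  define f where "f m x = indicator {0..A} x *\<^sub>R ((if x * real n \<le> real m then 1 else 0) * g x)" for m :: nat and x
  have f_eq: "f m x = indicator {0..min (real m / real n) A} x *\<^sub>R g x" for m x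
    using assms by (auto simp: f_def field_simps split: split_indicator)
  have bound: "cmod (f m x) \<le> indicator {0..A} x * \<bar>u\<bar>" for m x
    by (auto simp: f_def g_norm split: split_indicator)
  have [measurable]: "f m \<in> borel_measurable lborel" for m
    unfolding f_def by measurable
  have [measurable]: "case_prod f \<in> borel_measurable (measure_pmf \<mu> \<Otimes>\<^sub>M lborel)"
    unfolding f_def case_prod_beta by measurable
  have ind: "integrable lborel (\<lambda>x. indicator {0..A} x * \<bar>u\<bar>)"
    by (intro integrable_mult_left integrable_real_indicator) (auto simp: emeasure_lborel_Icc_eq)
  have int_x: "integrable lborel (f m)" for m
    by (rule Bochner_Integration.integrable_bound[OF ind]) (use bound in auto)
  have int: "integrable (measure_pmf \<mu> \<Otimes>\<^sub>M lborel) (case_prod f)"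
  proof (rule Fubini_integrable)
    show "integrable (measure_pmf \<mu>) (\<lambda>m. \<integral>x. cmod (case_prod f (m, x)) \<partial>lborel)"
    proof (rule measure_pmf.integrable_const_bound[of _ "A * \<bar>u\<bar>"])
      show "AE m in measure_pmf \<mu>. norm (\<integral>x. cmod (case_prod f (m, x)) \<partial>lborel) \<le> A * \<bar>u\<bar>"
      proof (rule AE_I2)
        fix m
        have "(\<integral>x. cmod (f m x) \<partial>lborel) \<le> (\<integral>x. indicator {0..A} x * \<bar>u\<bar> \<partial>lborel)"
          using int_x ind bound by (intro integral_mono) auto
        then show "norm (\<integral>x. cmod (case_prod f (m, x)) \<partial>lborel) \<le> A * \<bar>u\<bar>"
          using assms by simp
      qed
    qed simp
    show "AE m in measure_pmf \<mu>. integrable lborel (\<lambda>x. case_prod f (m, x))"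
      using int_x by simp
  qed simp
  have "(\<integral>m. 1 - cis (u * min (real m / real n) A) \<partial>measure_pmf \<mu>) = (\<integral>m. (\<integral>x. f m x \<partial>lborel) \<partial>measure_pmf \<mu>)"
    unfolding f_eq g_def using assms
    by (intro Bochner_Integration.integral_cong refl has_bochner_integral_integral_eq[symmetric] has_bochner_integral_cis) auto
  also have "\<dots> = (\<integral>x. (\<integral>m. f m x \<partial>measure_pmf \<mu>) \<partial>lborel)"
    using Fubini_integral[OF int] by simp
  also have "\<dots> = (\<integral>x. indicator {0..A} x *\<^sub>R (g x * tail (x * real n)) \<partial>lborel)"
  proof (intro Bochner_Integration.integral_cong refl)
    fix x
    have "(\<integral>m. f m x \<partial>measure_pmf \<mu>) = (\<integral>m. indicator {m. x * real n \<le> real m} m *\<^sub>R (indicator {0..A} x *\<^sub>R g x) \<partial>measure_pmf \<mu>)"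
      by (intro Bochner_Integration.integral_cong) (auto simp: f_def split: split_indicator)
    also have "\<dots> = tail (x * real n) *\<^sub>R (indicator {0..A} x *\<^sub>R g x)"
      by (subst integral_scaleR_left) (auto simp: tail_def intro!: measure_pmf.integrable_const_bound[of _ 1] split: split_indicator)
    finally show "(\<integral>m. f m x \<partial>measure_pmf \<mu>) = indicator {0..A} x *\<^sub>R (g x * tail (x * real n))"
      by (simp add: scaleR_conv_of_real mult_ac)
  qed
  finally show ?thesis by (simp add: g_def)
qed

lemma truncation_error:
  assumes "1 \<le> n"
  shows "cmod ((1 - pgf (cis (u / real n))) - (\<integral>m. 1 - cis (u * min (real m / real n) A) \<partial>measure_pmf \<mu>))
    \<le> 2 * tail (A * real n)"
proof -
  have i1: "integrable (measure_pmf \<mu>) (\<lambda>m. cis (u / real n) ^ m)"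
    by (rule integrable_power) simp
  have i2: "integrable (measure_pmf \<mu>) (\<lambda>m. cis (u * min (real m / real n) A))"
    by (intro measure_pmf.integrable_const_bound[of _ 1]) auto
  have i3: "integrable (measure_pmf \<mu>) (indicator {m. A * real n \<le> real m} :: nat \<Rightarrow> real)"
    by (intro measure_pmf.integrable_const_bound[of _ 1]) (auto split: split_indicator)
  have "(1 - pgf (cis (u / real n))) - (\<integral>m. 1 - cis (u * min (real m / real n) A) \<partial>measure_pmf \<mu>)
    = (\<integral>m. cis (u * min (real m / real n) A) - cis (u / real n) ^ m \<partial>measure_pmf \<mu>)"
    unfolding pgf_def using i1 i2 by simp
  also have "cmod \<dots> \<le> (\<integral>m. 2 * indicator {m. A * real n \<le> real m} m \<partial>measure_pmf \<mu>)"
  proof (rule order.trans[OF integral_norm_bound integral_mono])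
    show "integrable (measure_pmf \<mu>) (\<lambda>m. cmod (cis (u * min (real m / real n) A) - cis (u / real n) ^ m))"
      using i1 i2 by (intro integrable_norm Bochner_Integration.integrable_diff)
    show "integrable (measure_pmf \<mu>) (\<lambda>m. 2 * indicator {m. A * real n \<le> real m} m :: real)"
      using i3 by simp
    fix m
    have p: "cis (u / real n) ^ m = cis (u * (real m / real n))"
      by (simp add: Complex.DeMoivre[of "u / real n" m] mult.commute)
    show "cmod (cis (u * min (real m / real n) A) - cis (u / real n) ^ m) \<le> 2 * indicator {m. A * real n \<le> real m} m"
    proof (cases "A * real n \<le> real m")
      case True
      then show ?thesis
        using norm_triangle_ineq4[of "cis (u * min (real m / real n) A)" "cis (u / real n) ^ m"]
        by (simp add: norm_power)
    next
      case False
      then have "min (real m / real n) A = real m / real n" using assms by (simp add: field_simps min_def)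
      then show ?thesis using False by (simp add: p)
    qed
  qed
  also have "\<dots> = 2 * tail (A * real n)" by (simp add: tail_def)
  finally show ?thesis .
qed

lemma tail_measurable: "tail \<in> borel_measurable borel"
proof -
  have "mono (\<lambda>x. - tail x)" by (simp add: mono_def tail_antimono)
  then have "(\<lambda>x. - (- tail x)) \<in> borel_measurable borel"
    by (intro borel_measurable_uminus borel_measurable_mono)
  then show ?thesis by simp
qed

lemma integral_dominated_convergence_eventually:
  fixes f :: "'x \<Rightarrow> 'b::{banach, second_countable_topology}" and w :: "'x \<Rightarrow> real"
  assumes "f \<in> borel_measurable N" "\<And>i. s i \<in> borel_measurable N" "integrable N w"
    and "AE x in N. (\<lambda>i. s i x) \<longlonglongrightarrow> f x"
    and "\<forall>\<^sub>F i in sequentially. AE x in N. norm (s i x) \<le> w x"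
  shows "(\<lambda>i. integral\<^sup>L N (s i)) \<longlonglongrightarrow> integral\<^sup>L N f"
proof -
  obtain k where k: "\<And>i. k \<le> i \<Longrightarrow> AE x in N. norm (s i x) \<le> w x"
    using assms(5) by (auto simp: eventually_sequentially)
  have "(\<lambda>i. integral\<^sup>L N (s (i + k))) \<longlonglongrightarrow> integral\<^sup>L N f"
  proof (rule integral_dominated_convergence[OF assms(1) assms(2) assms(3)])
    show "AE x in N. (\<lambda>i. s (i + k) x) \<longlonglongrightarrow> f x"
      using assms(4) by eventually_elim (rule LIMSEQ_ignore_initial_segment)
  qed (use k in auto)
  then show ?thesis by (rule LIMSEQ_offset)
qed

text \<open>
  The quotient of the tails tends to \<open>x powr (- \<alpha>)\<close> and is bounded by a multiple of \<open>x powr (- \<gamma>)\<close> near 0.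
\<close>

lemma truncated_limit:
  assumes A: "1 \<le> A"
  shows "\<exists>w. (\<lambda>n. (\<integral>m. 1 - cis (u * min (real m / real n) A) \<partial>measure_pmf \<mu>) / tail (real n)) \<longlonglongrightarrow> w"
proof -
  define g where "g x = - (\<i> * u * cis (u * x))" for x
  have [measurable]: "g \<in> borel_measurable borel"
    unfolding g_def cis_conv_exp by measurable
  have g_norm: "cmod (g x) = \<bar>u\<bar>" for x by (simp add: g_def norm_mult)
  note tail_measurable [measurable]
  have small: "tail (x * real n) / tail (real n) \<le> potter_const * (2 / x) powr \<gamma> + 1" if "1 \<le> n" "0 < x" for n x
  proof (cases "x \<le> 1")
    case True
    then show ?thesis
      using potter_small[OF that True] tail_pos[of "real n"] by (simp add: divide_le_eq algebra_simps)
  next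
    case False
    then have "real n \<le> x * real n" using mult_right_mono[of 1 x "real n"] by simp
    then have "tail (x * real n) / tail (real n) \<le> 1"
      using tail_antimono tail_pos[of "real n"] by (simp add: divide_le_eq)
    moreover have "0 \<le> potter_const * (2 / x) powr \<gamma>" using potter(1) by simp
    ultimately show ?thesis by linarith
  qed
  have lim: "(\<lambda>n. \<integral>x. indicator {0<..A} x *\<^sub>R (g x * (tail (x * real n) / tail (real n))) \<partial>lborel)
      \<longlonglongrightarrow> (\<integral>x. indicator {0<..A} x *\<^sub>R (g x * (x powr - \<alpha>)) \<partial>lborel)"
  proof (rule integral_dominated_convergence_eventually[where
        w="\<lambda>x. \<bar>u\<bar> * (potter_const * 2 powr \<gamma> * (indicator {0<..A} x * x powr (- \<gamma>)) + indicator {0<..A} x)"])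
    show "integrable lborel (\<lambda>x. \<bar>u\<bar> * (potter_const * 2 powr \<gamma> * (indicator {0<..A} x * x powr (- \<gamma>)) + indicator {0<..A} x))"
      using gamma A
      by (intro integrable_mult_right Bochner_Integration.integrable_add integrable_lborel_powr_near_0 integrable_real_indicator)
        (auto simp: emeasure_lborel_Ioc)
    show "\<forall>\<^sub>F n in sequentially. AE x in lborel. norm (indicator {0<..A} x *\<^sub>R (g x * (tail (x * real n) / tail (real n))))
      \<le> \<bar>u\<bar> * (potter_const * 2 powr \<gamma> * (indicator {0<..A} x * x powr (- \<gamma>)) + indicator {0<..A} x)"
      using eventually_ge_at_top[of 1]
    proof eventually_elim
      case (elim n)
      have "cmod (g x * (tail (x * real n) / tail (real n))) \<le> \<bar>u\<bar> * (potter_const * 2 powr \<gamma> * x powr (- \<gamma>) + 1)"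
        if "0 < x" for x
      proof -
        have "(2 / x) powr \<gamma> = 2 powr \<gamma> * x powr (- \<gamma>)" using that by (simp add: powr_divide powr_minus_divide)
        then have "tail (x * real n) / tail (real n) \<le> potter_const * 2 powr \<gamma> * x powr (- \<gamma>) + 1"
          using small[OF elim that] by simp
        then show ?thesis
          unfolding norm_mult g_norm using tail_nonneg by (intro mult_left_mono) (auto simp: norm_divide)
      qed
      then show ?case by (intro AE_I2) (auto split: split_indicator)
    qed
    show "AE x in lborel. (\<lambda>n. indicator {0<..A} x *\<^sub>R (g x * (tail (x * real n) / tail (real n))))
        \<longlonglongrightarrow> indicator {0<..A} x *\<^sub>R (g x * (x powr - \<alpha>))"
    proof (rule AE_I2)
      fix x
      show "(\<lambda>n. indicator {0<..A} x *\<^sub>R (g x * (tail (x * real n) / tail (real n))))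
        \<longlonglongrightarrow> indicator {0<..A} x *\<^sub>R (g x * (x powr - \<alpha>))"
      proof (cases "0 < x")
        case True
        have "(\<lambda>n. complex_of_real (tail (x * real n) / tail (real n))) \<longlonglongrightarrow> complex_of_real (x powr - \<alpha>)"
          by (intro tendsto_of_real tail_regularly_varying True)
        from tendsto_scaleR[OF tendsto_const tendsto_mult[OF tendsto_const this]] show ?thesis .
      qed simp
    qed
  qed measurable
  have ev: "\<forall>\<^sub>F n in sequentially. (\<integral>x. indicator {0<..A} x *\<^sub>R (g x * (tail (x * real n) / tail (real n))) \<partial>lborel)
     = (\<integral>m. 1 - cis (u * min (real m / real n) A) \<partial>measure_pmf \<mu>) / tail (real n)"
    using eventually_ge_at_top[of 1]
  proof eventually_elim
    case (elim n)
    have "(\<integral>x. indicator {0<..A} x *\<^sub>R (g x * (tail (x * real n) / tail (real n))) \<partial>lborel)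
      = (\<integral>x. (indicator {0..A} x *\<^sub>R (g x * tail (x * real n))) / complex_of_real (tail (real n)) \<partial>lborel)"
    proof (rule integral_cong_AE)
      show "AE x in lborel. indicator {0<..A} x *\<^sub>R (g x * (tail (x * real n) / tail (real n)))
        = (indicator {0..A} x *\<^sub>R (g x * tail (x * real n))) / complex_of_real (tail (real n))"
        using AE_lborel_singleton[of 0] by eventually_elim (auto split: split_indicator)
    qed measurable
    then show ?case
      using truncated_characteristic_integral[OF elim, of A u] A by (simp add: g_def)
  qed
  show ?thesis using Lim_transform_eventually[OF lim ev] by blast
qed

text \<open>
  Truncation at level \<open>A\<close> costs about \<open>2 * A powr (- \<alpha>)\<close>, uniformly in large \<open>n\<close>, so the sequence is within
  any \<open>e\<close> of a convergent one.
\<close>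

lemma scaled_pgf_convergent:
  assumes "0 < u"
  shows "convergent (\<lambda>n. (1 - pgf (cis (u / real n))) / complex_of_real (tail (real n)))"
proof (rule convergent_if_approximable)
  fix e :: real assume "0 < e"
  have "((\<lambda>A. 2 * A powr - \<alpha>) \<longlongrightarrow> 0) at_top"
    using alpha_pos by (auto intro!: tendsto_mult_right_zero tendsto_neg_powr filterlim_ident)
  then have "\<forall>\<^sub>F A in at_top. 2 * A powr - \<alpha> < e / 2"
    using \<open>0 < e\<close> by (intro order_tendstoD) auto
  then obtain A :: real where A: "1 \<le> A" "2 * A powr - \<alpha> < e / 2"
    using eventually_happens'[OF trivial_limit_at_top_linorder eventually_conj[OF eventually_ge_at_top[of 1]]] by blast
  define z where "z n = (1 - pgf (cis (u / real n))) / complex_of_real (tail (real n))" for n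
  define y where "y n = (\<integral>m. 1 - cis (u * min (real m / real n) A) \<partial>measure_pmf \<mu>) / complex_of_real (tail (real n))" for n
  obtain w where w: "y \<longlonglongrightarrow> w" using truncated_limit[OF A(1), of u] unfolding y_def by blast
  have "(\<lambda>n. 2 * (tail (A * real n) / tail (real n))) \<longlonglongrightarrow> 2 * A powr - \<alpha>"
    using A by (intro tendsto_intros tail_regularly_varying) auto
  then have "\<forall>\<^sub>F n in sequentially. 2 * (tail (A * real n) / tail (real n)) < e / 2"
    using A by (intro order_tendstoD) auto
  moreover have "\<forall>\<^sub>F n in sequentially. cmod (y n - w) < e / 2"
    using tendstoD[OF w, of "e / 2"] \<open>0 < e\<close> by (simp add: dist_norm)
  ultimately have "\<forall>\<^sub>F n in sequentially. cmod (z n - w) < e"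
    using eventually_ge_at_top[of 1]
  proof eventually_elim
    case (elim n)
    have "cmod (z n - y n) = cmod ((1 - pgf (cis (u / real n))) - (\<integral>m. 1 - cis (u * min (real m / real n) A) \<partial>measure_pmf \<mu>)) / tail (real n)"
      unfolding z_def y_def using tail_pos[of "real n"]
      by (simp add: norm_divide flip: diff_divide_distrib)
    also have "\<dots> \<le> 2 * (tail (A * real n) / tail (real n))"
      using truncation_error[OF elim(3), of u A] tail_pos[of "real n"] by (simp add: divide_right_mono)
    finally have "cmod (z n - y n) < e / 2" using elim by linarith
    then show ?case using elim(2) norm_triangle_ineq[of "z n - y n" "y n - w"] by simp
  qed
  then show "\<exists>w. \<forall>\<^sub>F n in sequentially. cmod ((1 - pgf (cis (u / real n))) / complex_of_real (tail (real n)) - w) < e"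
    unfolding z_def by blast
qed

text \<open>
  A constant multiple of \<open>u powr \<alpha>\<close>. Its value does not enter, since variances are only compared with
  each other; what counts is that it exists and is not zero.
\<close>

definition exponent_limit :: "real \<Rightarrow> complex" where
  "exponent_limit u = lim (\<lambda>n. (1 - pgf (cis (u / real n))) / complex_of_real (tail (real n)))"

lemma exponent_limit:
  "0 < u \<Longrightarrow> (\<lambda>n. (1 - pgf (cis (u / real n))) / complex_of_real (tail (real n))) \<longlonglongrightarrow> exponent_limit u"
  using scaled_pgf_convergent unfolding exponent_limit_def by (simp add: convergent_LIMSEQ_iff)

lemma eventually_le_pi_times: "\<forall>\<^sub>F n in sequentially. u \<le> pi * real n"
proof -
  have "filterlim (\<lambda>n. pi * real n) at_top sequentially"
    by (intro filterlim_tendsto_pos_mult_at_top[OF tendsto_const] filterlim_real_sequentially) simp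
  then show ?thesis by (simp add: filterlim_at_top)
qed

lemma exponent_limit_nonzero:
  assumes "0 < u"
  shows "exponent_limit u \<noteq> 0"
proof
  assume 0: "exponent_limit u = 0"
  define K where "K = potter_const / pgf_const * max 1 ((2 / u) powr \<gamma>)"
  have K: "0 < K" unfolding K_def using potter(1) pgf_const(1)
    by (intro mult_pos_pos divide_pos_pos) auto
  have "(\<lambda>n. cmod ((1 - pgf (cis (u / real n))) / complex_of_real (tail (real n)))) \<longlonglongrightarrow> 0"
    using tendsto_norm[OF exponent_limit[OF assms]] 0 by simp
  then have "\<forall>\<^sub>F n in sequentially. cmod ((1 - pgf (cis (u / real n))) / complex_of_real (tail (real n))) < 1 / K"
    using K by (intro order_tendstoD) auto
  then have "\<forall>\<^sub>F n in sequentially. False"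
    using eventually_ge_at_top[of 1] eventually_le_pi_times[of u]
  proof eventually_elim
    case (elim n)
    define p where "p = cmod (1 - pgf (cis (u / real n)))"
    have "tail (real n) / p \<le> K"
      using tail_over_pgf[of n 1 u] elim assms by (simp add: p_def K_def)
    moreover have "p / tail (real n) < 1 / K"
      using elim tail_nonneg by (simp add: p_def norm_divide)
    moreover have "p \<noteq> 0"
      using pgf_ne_1[of 1 "u / real n"] elim assms by (simp add: p_def field_simps)
    then have "0 < p" by (simp add: p_def)
    ultimately show False using tail_pos[of "real n"] K by (simp add: field_simps)
  qed
  then show False by simp
qed

definition limit_density :: "real \<Rightarrow> real" where
  "limit_density u = indicator {0<..} u * ((2 - 2 * cos u) / u\<^sup>2 / (cmod (exponent_limit u))\<^sup>2)"

text \<open>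
  The integrand of \<open>spectral_identity\<close> after the substitution \<open>\<theta> = u / n\<close>, normalised to have a limit.
\<close>

definition scaled_spectral :: "nat \<Rightarrow> real \<Rightarrow> real" where
  "scaled_spectral n u = indicator {0<..pi * real n} u * ((tail (real n) / real n)\<^sup>2 * spectral_integrand n 1 (u / real n))"

lemma scaled_spectral_tendsto:
  "(\<lambda>n. scaled_spectral n u) \<longlonglongrightarrow> limit_density u"
proof (cases "0 < u")
  case True
  have "(\<lambda>n. (real n)\<^sup>2 * (2 - 2 * cos (u / real n))) \<longlonglongrightarrow> u\<^sup>2"
  proof -
    have "(\<lambda>n. (real n)\<^sup>2 * (2 - 2 * cos (u / real n))) \<longlonglongrightarrow> u * u"
      using True by real_asymp
    then show ?thesis by (simp add: power2_eq_square)
  qed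
  then have "(\<lambda>n. (2 - 2 * cos u) / ((real n)\<^sup>2 * (2 - 2 * cos (u / real n)))
      / (cmod ((1 - pgf (cis (u / real n))) / complex_of_real (tail (real n))))\<^sup>2)
     \<longlonglongrightarrow> (2 - 2 * cos u) / u\<^sup>2 / (cmod (exponent_limit u))\<^sup>2"
    using True exponent_limit_nonzero by (intro tendsto_intros exponent_limit) auto
  moreover have "\<forall>\<^sub>F n in sequentially. (2 - 2 * cos u) / ((real n)\<^sup>2 * (2 - 2 * cos (u / real n)))
      / (cmod ((1 - pgf (cis (u / real n))) / complex_of_real (tail (real n))))\<^sup>2
     = scaled_spectral n u"
    using eventually_ge_at_top[of 1] eventually_le_pi_times[of u]
  proof eventually_elim
    case (elim n)
    have th: "0 < u / real n" "u / real n \<le> pi" using elim True by (auto simp: field_simps)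
    then have "cis (u / real n) \<noteq> 1" using chord_lower_bound[OF th] by auto
    moreover have "cis (u / real n) ^ n = cis u"
      using elim by (simp add: Complex.DeMoivre[of "u / real n" n])
    ultimately have "(cmod (dirichlet_kernel n (cis (u / real n))))\<^sup>2 = (2 - 2 * cos u) / (2 - 2 * cos (u / real n))"
      unfolding dirichlet_kernel_def
      by (simp add: geometric_sum norm_divide power_divide cmod_cis_minus_1)
    then have eq: "spectral_integrand n 1 (u / real n)
        = (2 - 2 * cos u) / (2 - 2 * cos (u / real n)) / (cmod (1 - pgf (cis (u / real n))))\<^sup>2"
      by (simp add: spectral_integrand_def power_divide)
    have "cmod (complex_of_real (tail (real n))) = tail (real n)" using tail_nonneg by simp
    then show ?case
      unfolding scaled_spectral_def eq norm_divide using True elim by (simp add: power_divide mult_ac)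
  qed
  ultimately have "(\<lambda>n. scaled_spectral n u)
     \<longlonglongrightarrow> (2 - 2 * cos u) / u\<^sup>2 / (cmod (exponent_limit u))\<^sup>2"
    by (rule Lim_transform_eventually)
  then show ?thesis using True by (simp add: limit_density_def)
qed (simp add: limit_density_def scaled_spectral_def)

lemma measurable_scaled_spectral:
  "scaled_spectral n \<in> borel_measurable borel"
proof (cases "n = 0")
  case False
  have [measurable]: "(\<lambda>\<theta>. indicator {0<..pi} \<theta> * spectral_integrand n 1 \<theta>) \<in> borel_measurable borel"
    by (rule measurable_spectral) auto
  have "(\<lambda>u. (tail (real n) / real n)\<^sup>2 * (\<lambda>\<theta>. indicator {0<..pi} \<theta> * spectral_integrand n 1 \<theta>) (u / real n)) \<in> borel_measurable borel"
    by measurable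
  moreover have "(tail (real n) / real n)\<^sup>2 * (indicator {0<..pi} (u / real n) * spectral_integrand n 1 (u / real n))
    = scaled_spectral n u" for u
    using False by (auto simp: scaled_spectral_def field_simps split: split_indicator)
  ultimately show ?thesis by simp
qed (simp add: scaled_spectral_def[abs_def])

lemma scaled_spectral_integral:
  assumes "1 \<le> n"
  shows "(\<integral>u. scaled_spectral n u \<partial>lborel)
    = pi * (window_energy \<mu> n * (tail (real n))\<^sup>2 / real n)"
proof -
  have n: "0 < real n" using assms by simp
  have "pi * window_energy \<mu> n = \<bar>1 / real n\<bar> *\<^sub>R
      (\<integral>u. indicator {0<..pi} (0 + 1 / real n * u) * spectral_integrand n 1 (0 + 1 / real n * u) \<partial>lborel)"
    unfolding spectral_identity[symmetric] half_circle_integral_def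
    by (rule lborel_integral_real_affine) (use n in simp)
  also have "\<dots> = 1 / real n * (\<integral>u. indicator {0<..pi * real n} u * spectral_integrand n 1 (u / real n) \<partial>lborel)"
  proof -
    have "indicator {0<..pi} (0 + 1 / real n * u) = (indicator {0<..pi * real n} u :: real)" for u
      using n by (auto simp: field_simps split: split_indicator)
    then show ?thesis using n by simp
  qed
  finally have "(\<integral>u. indicator {0<..pi * real n} u * spectral_integrand n 1 (u / real n) \<partial>lborel) = pi * window_energy \<mu> n * real n"
    using n by (simp add: field_simps)
  moreover have "(\<integral>u. scaled_spectral n u \<partial>lborel)
    = (tail (real n) / real n)\<^sup>2 * (\<integral>u. indicator {0<..pi * real n} u * spectral_integrand n 1 (u / real n) \<partial>lborel)"
    unfolding scaled_spectral_def by (subst integral_mult_right_zero[symmetric]) (simp add: mult_ac)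
  ultimately show ?thesis using n by (simp add: power2_eq_square)
qed

definition energy_const :: real where
  "energy_const = (\<integral>u. limit_density u \<partial>lborel) / pi"

lemma energy_dominated:
  "AE u in lborel. norm (scaled_spectral n u) \<le> majorant u"
proof (rule AE_I2)
  fix u
  show "norm (scaled_spectral n u) \<le> majorant u"
  proof (cases "u \<in> {0<..pi * real n}")
    case True
    then have n: "1 \<le> n" by (cases n) auto
    have "cmod (dirichlet_kernel n (of_real 1 * cis (u / real n))) \<le> 6 * real n / u"
      using dirichlet_kernel_cis_le[of "u / real n" n] True n by (simp add: field_simps)
    then show ?thesis
      using scaled_spectral_le[OF n, of 1 u] True by (simp add: scaled_spectral_def spectral_integrand_def)
  qed (simp add: majorant_nonneg scaled_spectral_def)
qed

lemma integrable_limit_density: "integrable lborel limit_density"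
  and energy_integral_tendsto: "(\<lambda>n. \<integral>u. scaled_spectral n u \<partial>lborel)
     \<longlonglongrightarrow> (\<integral>u. limit_density u \<partial>lborel)"
proof -
  have m: "scaled_spectral n \<in> borel_measurable lborel" for n
    using measurable_scaled_spectral[of n] by simp
  have l: "limit_density \<in> borel_measurable lborel"
    by (rule borel_measurable_LIMSEQ_real[OF scaled_spectral_tendsto m])
  show "integrable lborel limit_density"
    by (rule integrable_dominated_convergence[where s=scaled_spectral, OF l m integrable_majorant _ energy_dominated])
      (intro AE_I2 scaled_spectral_tendsto)
  show "(\<lambda>n. \<integral>u. scaled_spectral n u \<partial>lborel) \<longlonglongrightarrow> (\<integral>u. limit_density u \<partial>lborel)"
    by (rule integral_dominated_convergence[where s=scaled_spectral, OF l m integrable_majorant _ energy_dominated])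
      (intro AE_I2 scaled_spectral_tendsto)
qed

lemma window_energy_asymptotics: "(\<lambda>n. window_energy \<mu> n * (tail (real n))\<^sup>2 / real n) \<longlonglongrightarrow> energy_const"
proof -
  have ev: "\<forall>\<^sub>F n in sequentially. (\<integral>u. scaled_spectral n u \<partial>lborel) / pi
     = window_energy \<mu> n * (tail (real n))\<^sup>2 / real n"
    using eventually_ge_at_top[of 1] by eventually_elim (simp add: scaled_spectral_integral)
  have "(\<lambda>n. (\<integral>u. scaled_spectral n u \<partial>lborel) / pi)
      \<longlonglongrightarrow> energy_const"
    unfolding energy_const_def by (intro tendsto_intros energy_integral_tendsto) simp
  from Lim_transform_eventually[OF this ev] show ?thesis .
qed

lemma energy_const_pos: "0 < energy_const"
proof -
  have nn: "0 \<le> limit_density u" for u by (simp add: limit_density_def)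
  have "(\<integral>u. limit_density u \<partial>lborel) \<noteq> 0"
  proof
    assume "(\<integral>u. limit_density u \<partial>lborel) = 0"
    then have "AE u in lborel. limit_density u = 0"
      using integral_nonneg_eq_0_iff_AE[OF integrable_limit_density] nn by simp
    then have "AE u in lborel. u \<notin> {0<..<1::real}"
    proof eventually_elim
      case (elim u)
      show ?case
      proof
        assume u: "u \<in> {0<..<1::real}"
        then have "cos u < cos 0" using pi_gt3 by (intro cos_monotone_0_pi) auto
        then show False
          using elim u exponent_limit_nonzero[of u] by (simp add: limit_density_def)
      qed
    qed
    then have "emeasure lborel {0<..<1::real} = 0"
      by (subst (asm) AE_iff_measurable[where N="{0<..<1}"]) auto
    then show False by simp
  qed
  moreover have "0 \<le> (\<integral>u. limit_density u \<partial>lborel)" using nn by simp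
  ultimately show ?thesis by (simp add: energy_const_def)
qed

text \<open>
  Monotonicity of the tail allows the ratio \<open>m n / n\<close> to be replaced by a constant slightly larger or
  smaller than its limit.
\<close>

lemma tail_ratio_tendsto:
  assumes m: "(\<lambda>n. real (m n) / real n) \<longlonglongrightarrow> \<tau>" and "0 < \<tau>"
  shows "(\<lambda>n. tail (real (m n)) / tail (real n)) \<longlonglongrightarrow> \<tau> powr (- \<alpha>)"
proof (rule order_tendstoI)
  have cont: "((\<lambda>c. c powr (- \<alpha>)) \<longlongrightarrow> \<tau> powr (- \<alpha>)) (at \<tau>)"
    using assms(2) by (intro tendsto_intros) auto
  fix y assume "y < \<tau> powr (- \<alpha>)"
  then have "\<forall>\<^sub>F c in at \<tau>. y < c powr (- \<alpha>)" by (rule order_tendstoD(1)[OF cont])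
  then have "\<forall>\<^sub>F c in at_right \<tau>. y < c powr (- \<alpha>)" by (simp add: eventually_at_split)
  then obtain c where c: "\<tau> < c" "y < c powr (- \<alpha>)"
    using eventually_happens'[OF trivial_limit_at_right_real eventually_conj[OF eventually_at_right_less]] by blast
  have "\<forall>\<^sub>F n in sequentially. real (m n) / real n < c" using m c(1) by (rule order_tendstoD)
  moreover have "\<forall>\<^sub>F n in sequentially. y < tail (c * real n) / tail (real n)"
    using c assms(2) by (intro order_tendstoD(1)[OF tail_regularly_varying]) auto
  ultimately show "\<forall>\<^sub>F n in sequentially. y < tail (real (m n)) / tail (real n)"
    using eventually_ge_at_top[of 1]
  proof eventually_elim
    case (elim n)
    then have "tail (c * real n) \<le> tail (real (m n))" by (intro tail_antimono) (simp add: field_simps)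
    then have "tail (c * real n) / tail (real n) \<le> tail (real (m n)) / tail (real n)"
      using tail_nonneg by (rule divide_right_mono)
    then show ?case using elim by linarith
  qed
next
  have cont: "((\<lambda>c. c powr (- \<alpha>)) \<longlongrightarrow> \<tau> powr (- \<alpha>)) (at \<tau>)"
    using assms(2) by (intro tendsto_intros) auto
  fix y assume "\<tau> powr (- \<alpha>) < y"
  then have "\<forall>\<^sub>F c in at \<tau>. c powr (- \<alpha>) < y" by (rule order_tendstoD(2)[OF cont])
  then have "\<forall>\<^sub>F c in at_left \<tau>. c powr (- \<alpha>) < y" by (simp add: eventually_at_split)
  moreover have "\<forall>\<^sub>F c in at_left \<tau>. c \<in> {0<..<\<tau>}" by (rule eventually_at_leftI[of 0]) (use assms in auto)
  ultimately have "\<forall>\<^sub>F c in at_left \<tau>. c powr (- \<alpha>) < y \<and> c \<in> {0<..<\<tau>}" by (rule eventually_conj)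
  then obtain c where c: "0 < c" "c < \<tau>" "c powr (- \<alpha>) < y"
    using eventually_happens'[OF trivial_limit_at_left_real] by auto
  have "\<forall>\<^sub>F n in sequentially. c < real (m n) / real n" using m c(2) by (rule order_tendstoD)
  moreover have "\<forall>\<^sub>F n in sequentially. tail (c * real n) / tail (real n) < y"
    using c by (intro order_tendstoD(2)[OF tail_regularly_varying]) auto
  ultimately show "\<forall>\<^sub>F n in sequentially. tail (real (m n)) / tail (real n) < y"
    using eventually_ge_at_top[of 1]
  proof eventually_elim
    case (elim n)
    then have "tail (real (m n)) \<le> tail (c * real n)" by (intro tail_antimono) (simp add: field_simps)
    then have "tail (real (m n)) / tail (real n) \<le> tail (c * real n) / tail (real n)"
      using tail_nonneg by (rule divide_right_mono)
    then show ?case using elim by linarith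
  qed
qed

lemma window_energy_mono: "m \<le> n \<Longrightarrow> window_energy \<mu> m \<le> window_energy \<mu> n"
  unfolding window_energy_def
proof (intro suminf_le summable_window_sum power_mono window_sum_bounds)
  fix l assume "m \<le> n"
  then show "window_sum \<mu> m l \<le> window_sum \<mu> n l"
    unfolding window_sum_def by (intro sum_mono2) (auto simp: renewal_int_bounds)
qed

lemma window_energy_nonneg: "0 \<le> window_energy \<mu> n"
  unfolding window_energy_def by (intro suminf_nonneg summable_window_sum) simp

lemma window_energy_ratio_pos:
  assumes m: "(\<lambda>n. real (m n) / real n) \<longlonglongrightarrow> \<tau>" and "0 < \<tau>"
  shows "(\<lambda>n. window_energy \<mu> (m n) / window_energy \<mu> n) \<longlonglongrightarrow> \<tau> powr (1 + 2 * \<alpha>)"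
proof -
  define C where "C n = window_energy \<mu> n * (tail (real n))\<^sup>2 / real n" for n
  have C: "C \<longlonglongrightarrow> energy_const" unfolding C_def by (rule window_energy_asymptotics)
  have "filterlim (\<lambda>n. real (m n) / real n * real n) at_top sequentially"
    by (rule filterlim_tendsto_pos_mult_at_top[OF m assms(2) filterlim_real_sequentially])
  moreover have "\<forall>\<^sub>F n in sequentially. real (m n) / real n * real n = real (m n)"
    using eventually_ge_at_top[of 1] by eventually_elim simp
  ultimately have mr: "filterlim (\<lambda>n. real (m n)) at_top sequentially"
    by (rule filterlim_cong[OF refl refl, THEN iffD1, rotated])
  then have mt: "filterlim m at_top sequentially"
    using filterlim_sequentially_iff_filterlim_real by blast
  have lim: "(\<lambda>n. C (m n) / C n * (real (m n) / real n) / (tail (real (m n)) / tail (real n))\<^sup>2)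
     \<longlonglongrightarrow> energy_const / energy_const * \<tau> / (\<tau> powr (- \<alpha>))\<^sup>2"
    using energy_const_pos assms(2)
    by (intro tendsto_intros filterlim_compose[OF C mt] C m tail_ratio_tendsto[OF m]) auto
  have eq: "energy_const / energy_const * \<tau> / (\<tau> powr (- \<alpha>))\<^sup>2 = \<tau> powr (1 + 2 * \<alpha>)"
  proof -
    have "(\<tau> powr (- \<alpha>))\<^sup>2 = 1 / \<tau> powr (2 * \<alpha>)"
      by (simp add: power2_eq_square powr_minus_divide flip: powr_add)
    then show ?thesis using energy_const_pos assms(2) by (simp add: powr_add)
  qed
  have "\<forall>\<^sub>F n in sequentially. C (m n) / C n * (real (m n) / real n) / (tail (real (m n)) / tail (real n))\<^sup>2
     = window_energy \<mu> (m n) / window_energy \<mu> n"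
    using eventually_ge_at_top[of 1] filterlim_at_top[THEN iffD1, OF mt, rule_format, of 1]
      order_tendstoD(1)[OF C energy_const_pos]
  proof eventually_elim
    case (elim n)
    have "window_energy \<mu> n \<noteq> 0" using elim(3) by (auto simp: C_def)
    then show ?case
      using elim tail_pos[of "real n"] tail_pos[of "real (m n)"]
      by (simp add: C_def power_divide)
  qed
  from Lim_transform_eventually[OF lim this] show ?thesis unfolding eq .
qed

lemma window_energy_at_top: "filterlim (window_energy \<mu>) at_top sequentially"
proof -
  have "filterlim (\<lambda>n. window_energy \<mu> n * (tail (real n))\<^sup>2 / real n * real n) at_top sequentially"
    by (rule filterlim_tendsto_pos_mult_at_top[OF window_energy_asymptotics energy_const_pos filterlim_real_sequentially])
  then show ?thesis
  proof (rule filterlim_at_top_mono)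
    show "\<forall>\<^sub>F n in sequentially. window_energy \<mu> n * (tail (real n))\<^sup>2 / real n * real n \<le> window_energy \<mu> n"
      using eventually_ge_at_top[of 1]
    proof eventually_elim
      case (elim n)
      have "(tail (real n))\<^sup>2 \<le> 1" using tail_nonneg tail_le_1 by (intro power_le_one)
      then show ?case using elim window_energy_nonneg[of n] by (simp add: mult_left_le)
    qed
  qed
qed

lemma window_energy_ratio:
  assumes m: "(\<lambda>n. real (m n) / real n) \<longlonglongrightarrow> \<tau>" and "0 \<le> \<tau>"
  shows "(\<lambda>n. window_energy \<mu> (m n) / window_energy \<mu> n) \<longlonglongrightarrow> \<tau> powr (1 + 2 * \<alpha>)"
proof (cases "\<tau> = 0")
  case False
  then show ?thesis using assms by (intro window_energy_ratio_pos) auto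
next
  case True
  have "(\<lambda>n. window_energy \<mu> (m n) / window_energy \<mu> n) \<longlonglongrightarrow> 0"
  proof (rule LIMSEQ_I)
    fix e :: real assume "0 < e"
    \<comment> \<open>The energy is monotone, so it is enough to compare with a window of length \<open>c * n\<close> for small \<open>c\<close>.\<close>
    have "((\<lambda>c. c powr (1 + 2 * \<alpha>)) \<longlongrightarrow> 0) (at_right 0)"
      using alpha_pos by real_asymp
    then have "\<forall>\<^sub>F c in at_right 0. c powr (1 + 2 * \<alpha>) < e" using \<open>0 < e\<close> by (intro order_tendstoD)
    then obtain c where c: "0 < c" "c powr (1 + 2 * \<alpha>) < e"
      using eventually_happens'[OF trivial_limit_at_right_real eventually_conj[OF eventually_at_right_less]] by blast
    define k where "k n = nat \<lceil>c * real n\<rceil>" for n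
    have "(\<lambda>n. real (k n) / real n) \<longlonglongrightarrow> c"
    proof -
      have "real (k n) = of_int \<lceil>c * real n\<rceil>" for n using c by (simp add: k_def)
      then show ?thesis using c by simp real_asymp
    qed
    then have "(\<lambda>n. window_energy \<mu> (k n) / window_energy \<mu> n) \<longlonglongrightarrow> c powr (1 + 2 * \<alpha>)"
      using c by (intro window_energy_ratio_pos)
    then have "\<forall>\<^sub>F n in sequentially. window_energy \<mu> (k n) / window_energy \<mu> n < e"
      using c by (intro order_tendstoD)
    moreover have "\<forall>\<^sub>F n in sequentially. real (m n) / real n < c"
      using m c True by (intro order_tendstoD) auto
    ultimately have "\<forall>\<^sub>F n in sequentially. norm (window_energy \<mu> (m n) / window_energy \<mu> n - 0) < e"
      using eventually_ge_at_top[of 1]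
    proof eventually_elim
      case (elim n)
      then have "real (m n) \<le> c * real n" by (simp add: field_simps)
      then have "m n \<le> k n" unfolding k_def by linarith
      then have "window_energy \<mu> (m n) / window_energy \<mu> n \<le> window_energy \<mu> (k n) / window_energy \<mu> n"
        using window_energy_nonneg by (intro divide_right_mono window_energy_mono)
      then show ?case using elim window_energy_nonneg by simp
    qed
    then show "\<exists>no. \<forall>n\<ge>no. norm (window_energy \<mu> (m n) / window_energy \<mu> n - 0) < e"
      by (simp add: eventually_sequentially)
  qed
  then show ?thesis using True by simp
qed

end

section \<open>Ancestral lines and coalescence\<close>

definition jump :: "(int \<Rightarrow> nat) \<Rightarrow> int \<Rightarrow> int" where
  "jump r i = i - int (r i)"

definition ancestral_line :: "(int \<Rightarrow> nat) \<Rightarrow> int \<Rightarrow> int set" where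
  "ancestral_line r i = range (\<lambda>n. (jump r ^^ n) i)"

lemma ancestral_line_unfold: "ancestral_line r i = insert i (ancestral_line r (jump r i))"
proof -
  have "ancestral_line r i = (\<lambda>n. (jump r ^^ n) i) ` (insert 0 (range Suc))"
    unfolding ancestral_line_def by (subst UNIV_nat_eq) simp
  also have "\<dots> = insert i (ancestral_line r (jump r i))"
    by (simp add: ancestral_line_def image_image funpow_Suc_right del: funpow.simps(2))
  finally show ?thesis .
qed

lemma jump_le: "jump r i \<le> i" by (simp add: jump_def)

lemma jump_pow_le: "(jump r ^^ n) i \<le> i"
  by (induction n) (auto intro: order.trans[OF jump_le])

lemma ancestral_line_le: "k \<in> ancestral_line r i \<Longrightarrow> k \<le> i"
  by (auto simp: ancestral_line_def jump_pow_le)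

lemma ancestral_line_self: "i \<in> ancestral_line r i"
  by (subst ancestral_line_unfold) simp

lemma jump_pow_cong:
  assumes "\<And>k. a \<le> k \<Longrightarrow> k \<le> i \<Longrightarrow> r k = r' k" "a \<le> (jump r ^^ n) i"
  shows "(jump r' ^^ n) i = (jump r ^^ n) i"
  using assms(2)
proof (induction n)
  case (Suc n)
  then have "a \<le> (jump r ^^ n) i" using jump_le[of r "(jump r ^^ n) i"] by simp
  then show ?case using Suc assms(1)[of "(jump r ^^ n) i"] jump_pow_le[of n r i] by (simp add: jump_def[of _ "(jump r ^^ n) i"])
qed simp

lemma ancestral_line_cong:
  assumes "\<And>k. a \<le> k \<Longrightarrow> k \<le> i \<Longrightarrow> r k = r' k" "a \<le> j"
  shows "j \<in> ancestral_line r i \<longleftrightarrow> j \<in> ancestral_line r' i"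
proof -
  have "j \<in> ancestral_line s' i"
    if eq: "\<And>k. a \<le> k \<Longrightarrow> k \<le> i \<Longrightarrow> s k = s' k" and j: "j \<in> ancestral_line s i" for s s' :: "int \<Rightarrow> nat"
  proof -
    obtain n where "j = (jump s ^^ n) i" using j by (auto simp: ancestral_line_def)
    then have "(jump s' ^^ n) i = j" using jump_pow_cong[of a i s s' n, OF eq] assms(2) by blast
    then show ?thesis by (auto simp: ancestral_line_def)
  qed
  from this[of r r'] this[of r' r] show ?thesis using assms(1) by auto
qed

text \<open>
  A meeting at or above the level \<open>a\<close> is decided by the jumps between \<open>a\<close> and the two starting points.
  Coalescence is the limit \<open>a \<rightarrow> -\<infinity>\<close> of these local events.
\<close>

definition meet_above :: "int \<Rightarrow> (int \<Rightarrow> nat) \<Rightarrow> int \<Rightarrow> int \<Rightarrow> bool" where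
  "meet_above a r i j \<longleftrightarrow> (\<exists>k\<ge>a. k \<in> ancestral_line r i \<and> k \<in> ancestral_line r j)"

definition coalesce :: "(int \<Rightarrow> nat) \<Rightarrow> int \<Rightarrow> int \<Rightarrow> bool" where
  "coalesce r i j \<longleftrightarrow> ancestral_line r i \<inter> ancestral_line r j \<noteq> {}"

lemma meet_above_cong:
  assumes "\<And>k. a \<le> k \<Longrightarrow> k \<le> max i j \<Longrightarrow> r k = r' k"
  shows "meet_above a r i j \<longleftrightarrow> meet_above a r' i j"
proof -
  have "k \<in> ancestral_line r i \<longleftrightarrow> k \<in> ancestral_line r' i" "k \<in> ancestral_line r j \<longleftrightarrow> k \<in> ancestral_line r' j"
    if "a \<le> k" for k
    using assms that by (auto intro!: ancestral_line_cong[of a])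
  then show ?thesis unfolding meet_above_def by blast
qed

lemma meet_above_commute: "meet_above a r i j \<longleftrightarrow> meet_above a r j i"
  by (auto simp: meet_above_def)

lemma meet_above_refl: "a \<le> i \<Longrightarrow> meet_above a r i i"
  using ancestral_line_self by (auto simp: meet_above_def)

lemma meet_above_below: "i < a \<or> j < a \<Longrightarrow> \<not> meet_above a r i j"
  using ancestral_line_le by (fastforce simp: meet_above_def)

text \<open>
  The line of the smaller point never visits the larger one, which may therefore take its jump.
\<close>

lemma meet_above_jump: "j < i \<Longrightarrow> meet_above a r i j \<longleftrightarrow> meet_above a r (jump r i) j"
  unfolding meet_above_def using ancestral_line_unfold[of r i] ancestral_line_le[of i r j] by auto

lemma coalesce_iff_meet_above: "coalesce r i j \<longleftrightarrow> (\<exists>h::nat. meet_above (- int h) r i j)"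
proof
  assume "coalesce r i j"
  then obtain k where "k \<in> ancestral_line r i" "k \<in> ancestral_line r j" by (auto simp: coalesce_def)
  then have "meet_above (- int (nat \<bar>k\<bar>)) r i j" by (auto simp: meet_above_def intro!: exI[of _ k])
  then show "\<exists>h::nat. meet_above (- int h) r i j" by blast
qed (auto simp: coalesce_def meet_above_def)

lemma meet_above_mono: "a \<le> b \<Longrightarrow> meet_above b r i j \<Longrightarrow> meet_above a r i j"
  unfolding meet_above_def using order.trans by blast

lemma ancestral_line_nested:
  assumes "k \<in> ancestral_line r i" shows "ancestral_line r k \<subseteq> ancestral_line r i"
  using assms by (auto simp: ancestral_line_def simp flip: funpow_add comp_apply[of "_ ^^ _"])

text \<open>
  Each vertex has a single outgoing edge. Along a path, coalescence with \<open>i\<close> is preserved whether an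
  edge is followed or reversed.
\<close>

lemma component_iff_coalesce: "j \<in> component r i \<longleftrightarrow> coalesce r i j"
proof
  define E where "E = jump_edges r \<union> (jump_edges r)\<inverse>"
  assume "j \<in> component r i"
  then have "(i, j) \<in> E\<^sup>*" by (simp add: component_def E_def)
  then show "coalesce r i j"
  proof induction
    case base
    then show ?case using ancestral_line_self by (auto simp: coalesce_def)
  next
    case (step y z)
    then obtain k where k: "k \<in> ancestral_line r i" "k \<in> ancestral_line r y" by (auto simp: coalesce_def)
    from step(2) consider "z = jump r y" | "y = jump r z"
      by (auto simp: E_def jump_edges_def jump_def)
    then show ?case
    proof cases
      case 1
      show ?thesis
      proof (cases "k = y")
        case True
        have "z \<in> ancestral_line r y" unfolding 1 by (subst ancestral_line_unfold) (simp add: ancestral_line_self)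
        then have "z \<in> ancestral_line r i" using ancestral_line_nested[OF k(1)] True by auto
        then show ?thesis using ancestral_line_self by (auto simp: coalesce_def)
      next
        case False
        then have "k \<in> ancestral_line r z" using k(2) ancestral_line_unfold[of r y] 1 by auto
        then show ?thesis using k(1) by (auto simp: coalesce_def)
      qed
    next
      case 2
      then have "k \<in> ancestral_line r z" using k(2) ancestral_line_unfold[of r z] by auto
      then show ?thesis using k(1) by (auto simp: coalesce_def)
    qed
  qed
next
  define E where "E = jump_edges r \<union> (jump_edges r)\<inverse>"
  have jE: "(k, jump r k) \<in> E" "(jump r k, k) \<in> E" for k
    by (auto simp: E_def jump_edges_def jump_def)
  have path: "(i, (jump r ^^ n) i) \<in> E\<^sup>* \<and> ((jump r ^^ n) i, i) \<in> E\<^sup>*" for n i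
  proof (induction n)
    case (Suc n)
    then show ?case using jE[of "(jump r ^^ n) i"]
      by (auto intro: rtrancl_into_rtrancl converse_rtrancl_into_rtrancl)
  qed simp
  assume "coalesce r i j"
  then obtain m n where "(jump r ^^ m) i = (jump r ^^ n) j" by (auto simp: coalesce_def ancestral_line_def)
  then have "(i, j) \<in> E\<^sup>*" using path[of i m] path[of j n] by (metis rtrancl_trans)
  then show "j \<in> component r i" by (simp add: component_def E_def)
qed

lemma component_eq_iff: "component r i = component r j \<longleftrightarrow> coalesce r i j"
proof
  assume "component r i = component r j"
  then show "coalesce r i j"
    using component_iff_coalesce[of j r i] component_iff_coalesce[of j r j] ancestral_line_self[of j r]
    by (auto simp: coalesce_def)
next
  define E where "E = jump_edges r \<union> (jump_edges r)\<inverse>"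
  have "sym E" by (auto simp: E_def sym_def)
  then have symE: "sym (E\<^sup>*)" by (rule sym_rtrancl)
  assume "coalesce r i j"
  then have "(i, j) \<in> E\<^sup>*" using component_iff_coalesce[of j r i] by (simp add: component_def E_def)
  moreover then have "(j, i) \<in> E\<^sup>*" using symE by (meson symD)
  ultimately show "component r i = component r j"
    unfolding component_def E_def[symmetric] by (auto intro: rtrancl_trans)
qed

abbreviation jump_space :: "(int \<Rightarrow> nat) measure" where
  "jump_space \<equiv> Pi\<^sub>M UNIV (\<lambda>_. count_space UNIV)"

lemma measurable_jump_pow: "Measurable.pred jump_space (\<lambda>r. (jump r ^^ n) i = k)"
proof (induction n arbitrary: k)
  case (Suc n)
  have "(\<lambda>r. (jump r ^^ Suc n) i = k) = (\<lambda>r. \<exists>y. (jump r ^^ n) i = y \<and> int (r y) = y - k)"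
    by (auto simp: jump_def)
  moreover have "Measurable.pred jump_space (\<lambda>r. \<exists>y. (jump r ^^ n) i = y \<and> int (r y) = y - k)"
    using Suc.IH by measurable
  ultimately show ?case by (simp only:)
qed simp

lemma measurable_ancestral_line: "Measurable.pred jump_space (\<lambda>r. k \<in> ancestral_line r i)"
proof -
  have "(\<lambda>r. k \<in> ancestral_line r i) = (\<lambda>r. \<exists>n. (jump r ^^ n) i = k)"
    by (auto simp: ancestral_line_def)
  then show ?thesis using measurable_jump_pow by simp
qed

lemma measurable_meet_above [measurable]: "Measurable.pred jump_space (\<lambda>r. meet_above a r i j)"
  unfolding meet_above_def using measurable_ancestral_line by simp

lemma measurable_coalesce [measurable]: "Measurable.pred jump_space (\<lambda>r. coalesce r i j)"
  unfolding coalesce_iff_meet_above by simp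

text \<open>
  The expected number of common points of two independent ancestral lines started at distance \<open>n\<close>.
\<close>

definition overlap :: "nat pmf \<Rightarrow> int \<Rightarrow> real" where
  "overlap \<mu> n = (\<Sum>k. renewal \<mu> k * renewal_int \<mu> (int k + n))"

locale jump_family = heavy_tailed_jumps \<mu> \<alpha> L + prob_space M
  for \<mu> \<alpha> L and M :: "'a measure" +
  fixes R :: "int \<Rightarrow> 'a \<Rightarrow> nat"
  assumes R_indep: "indep_vars (\<lambda>_. count_space UNIV) R UNIV"
    and R_distr: "\<And>i. distr M (count_space UNIV) (R i) = measure_pmf \<mu>"
begin

lemma R_measurable [measurable]: "R i \<in> measurable M (count_space UNIV)"
  using R_indep by (auto simp: indep_vars_def2)

definition jumps :: "'a \<Rightarrow> int \<Rightarrow> nat" where "jumps \<omega> k = R k \<omega>"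

lemma jumps_measurable [measurable]: "jumps \<in> measurable M jump_space"
  by (rule measurable_PiM_single') (auto simp: jumps_def)

text \<open>
  The jumps to the left of \<open>x\<close>; the value elsewhere is a placeholder.
\<close>

definition cut :: "int \<Rightarrow> (int \<Rightarrow> nat) \<Rightarrow> int \<Rightarrow> nat" where
  "cut x r k = (if k < x then r k else 1)"

lemma cut_measurable [measurable]: "cut x \<in> measurable jump_space jump_space"
  unfolding cut_def[abs_def] by (rule measurable_PiM_single') auto

text \<open>
  Fubini's theorem for the jump at \<open>x\<close> and the jumps to its left, which are independent.
\<close>

lemma integral_over_jump:
  fixes \<Phi> :: "nat \<Rightarrow> (int \<Rightarrow> nat) \<Rightarrow> 'c::{banach, second_countable_topology}"
  assumes meas: "\<And>m. \<Phi> m \<in> borel_measurable jump_space"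
    and int: "integrable M (\<lambda>\<omega>. \<Phi> (R x \<omega>) (cut x (jumps \<omega>)))"
  shows "(\<integral>\<omega>. \<Phi> (R x \<omega>) (cut x (jumps \<omega>)) \<partial>M) = (\<integral>m. (\<integral>\<omega>. \<Phi> m (cut x (jumps \<omega>)) \<partial>M) \<partial>measure_pmf \<mu>)"
proof -
  define S where "S = PiM {x} (\<lambda>_. count_space (UNIV :: nat set))"
  define T where "T = PiM {..<x} (\<lambda>_. count_space (UNIV :: nat set))"
  define X where "X \<omega> = restrict (\<lambda>i. R i \<omega>) {x}" for \<omega>
  define Y where "Y \<omega> = restrict (\<lambda>i. R i \<omega>) {..<x}" for \<omega>
  have "indep_var S X T Y"
    unfolding S_def T_def X_def[abs_def] Y_def[abs_def] by (rule indep_var_restrict[OF R_indep]) auto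
  then have [measurable]: "X \<in> measurable M S" "Y \<in> measurable M T"
    and ind: "distr M S X \<Otimes>\<^sub>M distr M T Y = distr M (S \<Otimes>\<^sub>M T) (\<lambda>\<omega>. (X \<omega>, Y \<omega>))"
    unfolding indep_var_distribution_eq by auto
  have ev: "(\<lambda>f. f x) \<in> measurable S (count_space UNIV)"
    unfolding S_def by (rule measurable_component_singleton) simp
  have ct: "cut x \<in> measurable T jump_space"
  proof (rule measurable_PiM_single')
    fix k show "(\<lambda>r. cut x r k) \<in> measurable T (count_space UNIV)"
      unfolding cut_def T_def by (cases "k < x") auto
  qed auto
  have X_eq: "X \<omega> x = R x \<omega>" and Y_eq: "cut x (Y \<omega>) = cut x (jumps \<omega>)" for \<omega>
    by (auto simp: X_def Y_def fun_eq_iff cut_def jumps_def)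
  define D where "D = distr M T Y"
  define E where "E = distr M S X"
  interpret D: prob_space D unfolding D_def by (rule prob_space_distr) simp
  interpret E: prob_space E unfolding E_def by (rule prob_space_distr) simp
  interpret pair_sigma_finite E D by (intro pair_sigma_finite.intro) (unfold_locales)
  define \<Psi> where "\<Psi> z = \<Phi> (fst z x) (cut x (snd z))" for z
  have "case_prod \<Phi> \<in> borel_measurable (count_space UNIV \<Otimes>\<^sub>M jump_space)"
    by (rule measurable_pair_measure_countable1) (auto simp: meas)
  moreover have "(\<lambda>z. (fst z x, cut x (snd z))) \<in> measurable (S \<Otimes>\<^sub>M T) (count_space UNIV \<Otimes>\<^sub>M jump_space)"
    by (intro measurable_Pair measurable_compose[OF measurable_fst ev] measurable_compose[OF measurable_snd ct])
  ultimately have m: "\<Psi> \<in> borel_measurable (S \<Otimes>\<^sub>M T)"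
    unfolding \<Psi>_def[abs_def] using measurable_compose by fastforce
  have ED: "E \<Otimes>\<^sub>M D = distr M (S \<Otimes>\<^sub>M T) (\<lambda>\<omega>. (X \<omega>, Y \<omega>))"
    unfolding E_def D_def by (rule ind)
  have "integrable (E \<Otimes>\<^sub>M D) \<Psi>"
    unfolding ED using int m by (subst integrable_distr_eq) (auto simp: \<Psi>_def X_eq Y_eq)
  then have "(\<integral>f. (\<integral>g. \<Psi> (f, g) \<partial>D) \<partial>E) = integral\<^sup>L (E \<Otimes>\<^sub>M D) \<Psi>"
    by (rule integral_fst')
  also have "\<dots> = (\<integral>\<omega>. \<Phi> (R x \<omega>) (cut x (jumps \<omega>)) \<partial>M)"
    unfolding ED using m by (subst integral_distr) (auto simp: \<Psi>_def X_eq Y_eq)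
  finally have "(\<integral>\<omega>. \<Phi> (R x \<omega>) (cut x (jumps \<omega>)) \<partial>M) = (\<integral>f. (\<integral>g. \<Psi> (f, g) \<partial>D) \<partial>E)" ..
  also have "\<dots> = (\<integral>f. (\<integral>\<omega>. \<Phi> (f x) (cut x (jumps \<omega>)) \<partial>M) \<partial>E)"
  proof (intro Bochner_Integration.integral_cong refl)
    fix f
    show "(\<integral>g. \<Psi> (f, g) \<partial>D) = (\<integral>\<omega>. \<Phi> (f x) (cut x (jumps \<omega>)) \<partial>M)"
      unfolding D_def \<Psi>_def using measurable_compose[OF ct meas[of "f x"]]
      by (subst integral_distr) (auto simp: Y_eq)
  qed
  also have "\<dots> = (\<integral>\<omega>'. (\<integral>\<omega>. \<Phi> (R x \<omega>') (cut x (jumps \<omega>)) \<partial>M) \<partial>M)"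
    unfolding E_def using measurable_compose[OF ev, of "\<lambda>m. \<integral>\<omega>. \<Phi> m (cut x (jumps \<omega>)) \<partial>M" borel]
    by (subst integral_distr) (auto simp: X_eq)
  also have "\<dots> = (\<integral>m. (\<integral>\<omega>. \<Phi> m (cut x (jumps \<omega>)) \<partial>M) \<partial>measure_pmf \<mu>)"
    unfolding R_distr[of x, symmetric] by (subst integral_distr) auto
  finally show ?thesis .
qed

lemma AE_R_pos: "AE \<omega> in M. 1 \<le> R x \<omega>"
proof -
  have "AE m in distr M (count_space UNIV) (R x). 1 \<le> m"
    unfolding R_distr using positive_jumps by (auto simp: AE_measure_pmf_iff Suc_le_eq intro!: Nat.gr0I)
  then show ?thesis by (subst (asm) AE_distr_iff) auto
qed

lemma AE_pmf_pos: "AE m in measure_pmf \<mu>. 1 \<le> m"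
  using positive_jumps by (auto simp: AE_measure_pmf_iff Suc_le_eq intro!: Nat.gr0I)

definition meet_prob :: "int \<Rightarrow> int \<Rightarrow> int \<Rightarrow> real" where
  "meet_prob a i j = prob {\<omega> \<in> space M. meet_above a (jumps \<omega>) i j}"

definition coalesce_prob :: "int \<Rightarrow> int \<Rightarrow> real" where
  "coalesce_prob i j = prob {\<omega> \<in> space M. coalesce (jumps \<omega>) i j}"

lemma meet_prob_step:
  assumes "y < x"
  shows "meet_prob a x y = (\<integral>m. meet_prob a (x - int m) y \<partial>measure_pmf \<mu>)"
proof -
  define \<Phi> where "\<Phi> m r = (if meet_above a r (x - int m) y then 1 else 0 :: real)" for m r
  have m: "\<Phi> m \<in> borel_measurable jump_space" for m unfolding \<Phi>_def by measurable
  have m': "case_prod \<Phi> \<in> borel_measurable (count_space UNIV \<Otimes>\<^sub>M jump_space)"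
    by (rule measurable_pair_measure_countable1) (auto simp: m)
  have cut: "meet_above a (cut x r) (x - int m) y \<longleftrightarrow> meet_above a r (x - int m) y" if "1 \<le> m" for m r
    using assms that by (intro meet_above_cong) (auto simp: cut_def)
  have mm: "(\<lambda>\<omega>. \<Phi> (R x \<omega>) (cut x (jumps \<omega>))) \<in> borel_measurable M"
    using measurable_compose[OF _ m', of "\<lambda>\<omega>. (R x \<omega>, cut x (jumps \<omega>))" M] by simp
  have E: "prob {\<omega> \<in> space M. P \<omega>} = (\<integral>\<omega>. (if P \<omega> then 1 else 0) \<partial>M)" if "Measurable.pred M P" for P
  proof -
    have "(\<integral>\<omega>. (if P \<omega> then 1 else 0) \<partial>M) = (\<integral>\<omega>. indicator {\<omega> \<in> space M. P \<omega>} \<omega> \<partial>M)"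
      by (intro Bochner_Integration.integral_cong) (auto split: split_indicator)
    moreover have "{\<omega> \<in> space M. P \<omega>} \<inter> space M = {\<omega> \<in> space M. P \<omega>}" by auto
    ultimately show ?thesis using Bochner_Integration.integral_indicator[of M "{\<omega> \<in> space M. P \<omega>}"] by metis
  qed
  have "meet_prob a x y = (\<integral>\<omega>. (if meet_above a (jumps \<omega>) x y then 1 else 0) \<partial>M)"
    unfolding meet_prob_def by (rule E) simp
  also have "\<dots> = (\<integral>\<omega>. \<Phi> (R x \<omega>) (cut x (jumps \<omega>)) \<partial>M)"
  proof (rule integral_cong_AE)
    show "AE \<omega> in M. (if meet_above a (jumps \<omega>) x y then 1 else 0) = \<Phi> (R x \<omega>) (cut x (jumps \<omega>))"
      using AE_R_pos[of x]
      by eventually_elim (simp add: \<Phi>_def cut meet_above_jump[OF assms] jump_def jumps_def)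
  qed (use mm in simp_all)
  also have "\<dots> = (\<integral>m. (\<integral>\<omega>. \<Phi> m (cut x (jumps \<omega>)) \<partial>M) \<partial>measure_pmf \<mu>)"
    by (rule integral_over_jump[OF m integrable_const_bound[of _ 1]]) (auto simp: \<Phi>_def mm[unfolded \<Phi>_def])
  also have "\<dots> = (\<integral>m. meet_prob a (x - int m) y \<partial>measure_pmf \<mu>)"
  proof (rule integral_cong_AE)
    show "AE m in measure_pmf \<mu>. (\<integral>\<omega>. \<Phi> m (cut x (jumps \<omega>)) \<partial>M) = meet_prob a (x - int m) y"
      using AE_pmf_pos by eventually_elim (simp add: \<Phi>_def cut meet_prob_def E)
  qed simp_all
  finally show ?thesis .
qed

lemma meet_prob_commute: "meet_prob a x y = meet_prob a y x"
  by (simp add: meet_prob_def meet_above_commute)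

lemma meet_prob_bounds: "0 \<le> meet_prob a x y" "meet_prob a x y \<le> 1"
  by (simp_all add: meet_prob_def)

lemma meet_prob_refl: "a \<le> x \<Longrightarrow> meet_prob a x x = 1"
  by (simp add: meet_prob_def meet_above_refl prob_space)

lemma meet_prob_below: "x < a \<or> y < a \<Longrightarrow> meet_prob a x y = 0"
  using meet_above_below by (simp add: meet_prob_def)

text \<open>
  Letting the larger point jump gives the same recursion for both sides, and each jump brings the
  points closer to the level.
\<close>

lemma meet_prob_shift: "meet_prob (a + c) (x + c) (y + c) = meet_prob a x y"
proof (induction "nat (x - a) + nat (y - a)" arbitrary: x y rule: less_induct)
  case less
  have main: "meet_prob (a + c) (x + c) (y + c) = meet_prob a x y"
    if xy: "y < x" "a \<le> y" and IH: "\<And>m. 1 \<le> m \<Longrightarrow> meet_prob (a + c) (x - int m + c) (y + c) = meet_prob a (x - int m) y" for x y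
  proof -
    have "meet_prob (a + c) (x + c) (y + c) = (\<integral>m. meet_prob (a + c) (x + c - int m) (y + c) \<partial>measure_pmf \<mu>)"
      using xy by (intro meet_prob_step) simp
    also have "\<dots> = (\<integral>m. meet_prob a (x - int m) y \<partial>measure_pmf \<mu>)"
    proof (rule integral_cong_AE)
      show "AE m in measure_pmf \<mu>. meet_prob (a + c) (x + c - int m) (y + c) = meet_prob a (x - int m) y"
        using AE_pmf_pos
      proof eventually_elim
        case (elim m)
        show ?case using IH[OF elim] by (simp add: algebra_simps)
      qed
    qed simp_all
    finally show ?thesis using meet_prob_step[OF xy(1), of a] by simp
  qed
  consider "x < a \<or> y < a" | "a \<le> x" "x = y" | "y < x" "a \<le> y" | "x < y" "a \<le> x" by linarith
  then show ?case
  proof cases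
    case 1
    then show ?thesis by (simp add: meet_prob_below)
  next
    case 2
    then show ?thesis by (simp add: meet_prob_refl)
  next
    case 3
    show ?thesis
    proof (rule main[OF 3])
      fix m :: nat assume "1 \<le> m"
      then show "meet_prob (a + c) (x - int m + c) (y + c) = meet_prob a (x - int m) y"
        using 3 by (intro less) auto
    qed
  next
    case 4
    have "meet_prob (a + c) (y + c) (x + c) = meet_prob a y x"
    proof (rule main[OF 4])
      fix m :: nat assume "1 \<le> m"
      then have "meet_prob (a + c) (x + c) (y - int m + c) = meet_prob a x (y - int m)"
        using 4 by (intro less) auto
      then show "meet_prob (a + c) (y - int m + c) (x + c) = meet_prob a (y - int m) x"
        by (simp add: meet_prob_commute)
    qed
    then show ?thesis by (simp add: meet_prob_commute)
  qed
qed

lemma renewal_int_recursion: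
  "(\<integral>m. renewal_int \<mu> (k - int m) \<partial>measure_pmf \<mu>) = renewal_int \<mu> k - (if k = 0 then 1 else 0)"
proof -
  have "(\<integral>m. renewal_int \<mu> (k - int m) \<partial>measure_pmf \<mu>) = (\<Sum>m\<in>{1..nat k}. renewal_int \<mu> (k - int m) * pmf \<mu> m)"
  proof (rule integral_measure_pmf_real)
    fix m assume "m \<in> set_pmf \<mu>" "renewal_int \<mu> (k - int m) \<noteq> 0"
    then have "m \<noteq> 0" "0 \<le> k - int m" using positive_jumps renewal_int_neg by (metis, meson not_le)
    then show "m \<in> {1..nat k}" by auto
  qed simp
  also have "\<dots> = renewal_int \<mu> k - (if k = 0 then 1 else 0)"
  proof (cases "0 < k")
    case True
    define n where "n = nat k - 1"
    have k: "k = int (Suc n)" using True by (simp add: n_def)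
    have "(\<Sum>m\<in>{1..nat k}. renewal_int \<mu> (k - int m) * pmf \<mu> m) = (\<Sum>m\<le>n. renewal_int \<mu> (k - int (Suc m)) * pmf \<mu> (Suc m))"
      unfolding k by (rule sum.reindex_bij_witness[of _ Suc "\<lambda>m. m - 1"]) auto
    also have "\<dots> = (\<Sum>m\<le>n. pmf \<mu> (Suc m) * renewal \<mu> (n - m))"
    proof (intro sum.cong refl)
      fix m assume "m \<in> {..n}"
      then have "k - int (Suc m) = int (n - m)" by (simp add: k)
      then show "renewal_int \<mu> (k - int (Suc m)) * pmf \<mu> (Suc m) = pmf \<mu> (Suc m) * renewal \<mu> (n - m)"
        by (simp only: renewal_int_of_nat mult.commute)
    qed
    also have "\<dots> = renewal_int \<mu> k" unfolding k renewal_int_of_nat renewal.simps ..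
    finally show ?thesis using True by simp
  next
    case False
    then show ?thesis by (auto simp: renewal_int_def)
  qed
  finally show ?thesis .
qed

lemma integrable_bounded_pmf: "(\<And>m. \<bar>f m\<bar> \<le> (C::real)) \<Longrightarrow> integrable (measure_pmf \<mu>) f"
  by (rule measure_pmf.integrable_const_bound[of _ C]) auto

lemma integrable_renewal_int: "integrable (measure_pmf \<mu>) (\<lambda>m. renewal_int \<mu> (k - int m))"
  by (rule integrable_bounded_pmf[of _ 1]) (simp add: renewal_int_bounds)

lemma integrable_renewal_int': "integrable (measure_pmf \<mu>) (\<lambda>m. renewal_int \<mu> (x - int m - j))"
  using integrable_renewal_int[of "x - j"] by (simp add: algebra_simps)

text \<open>
  Until they meet, two lines are driven by different jumps and behave like independent ones, so the
  probability of meeting is at most the expected number of common points of independent lines.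
  The right-hand side satisfies the recursion of \<open>meet_prob_step\<close> exactly.
\<close>

lemma meet_prob_le:
  assumes "x \<le> N" "y \<le> N"
  shows "meet_prob a x y \<le> (\<Sum>j=a..N. renewal_int \<mu> (x - j) * renewal_int \<mu> (y - j))"
  using assms
proof (induction "nat (x - a) + nat (y - a)" arbitrary: x y rule: less_induct)
  case less
  define G where "G x y = (\<Sum>j=a..N. renewal_int \<mu> (x - j) * renewal_int \<mu> (y - j))" for x y
  have Gnn: "0 \<le> G x y" for x y by (simp add: G_def sum_nonneg renewal_int_bounds)
  have Gstep: "(\<integral>m. G (x - int m) y \<partial>measure_pmf \<mu>) = G x y" if "y < x" for x y
  proof -
    have "(\<integral>m. G (x - int m) y \<partial>measure_pmf \<mu>) = (\<Sum>j=a..N. (\<integral>m. renewal_int \<mu> (x - int m - j) \<partial>measure_pmf \<mu>) * renewal_int \<mu> (y - j))"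
      unfolding G_def using integrable_renewal_int'
      by (subst Bochner_Integration.integral_sum) auto
    also have "\<dots> = (\<Sum>j=a..N. (\<integral>m. renewal_int \<mu> (x - j - int m) \<partial>measure_pmf \<mu>) * renewal_int \<mu> (y - j))"
      by (simp add: algebra_simps)
    also have "\<dots> = G x y"
      unfolding G_def renewal_int_recursion using that by (intro sum.cong refl) auto
    finally show ?thesis .
  qed
  have main: "meet_prob a x y \<le> G x y"
    if xy: "y < x" and IH: "\<And>m. 1 \<le> m \<Longrightarrow> meet_prob a (x - int m) y \<le> G (x - int m) y" for x y
  proof -
    have "meet_prob a x y = (\<integral>m. meet_prob a (x - int m) y \<partial>measure_pmf \<mu>)"
      using xy by (intro meet_prob_step) simp
    also have "\<dots> \<le> (\<integral>m. G (x - int m) y \<partial>measure_pmf \<mu>)"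
    proof (rule integral_mono_AE)
      show "integrable (measure_pmf \<mu>) (\<lambda>m. meet_prob a (x - int m) y)"
        by (rule integrable_bounded_pmf[of _ 1]) (simp add: meet_prob_bounds)
      show "integrable (measure_pmf \<mu>) (\<lambda>m. G (x - int m) y)"
        unfolding G_def by (intro Bochner_Integration.integrable_sum integrable_mult_left integrable_renewal_int')
      show "AE m in measure_pmf \<mu>. meet_prob a (x - int m) y \<le> G (x - int m) y"
        using AE_pmf_pos by eventually_elim (rule IH)
    qed
    finally show ?thesis using Gstep[OF xy] by simp
  qed
  consider "x < a \<or> y < a" | "a \<le> x" "x = y" | "y < x" "a \<le> y" | "x < y" "a \<le> x" by linarith
  then have "meet_prob a x y \<le> G x y"
  proof cases
    case 1
    then show ?thesis by (simp add: meet_prob_below Gnn)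
  next
    case 2
    have "renewal_int \<mu> (x - x) * renewal_int \<mu> (x - x) \<le> G x x"
      unfolding G_def using 2 less.prems
      by (intro member_le_sum[of x "{a..N}" "\<lambda>j. renewal_int \<mu> (x - j) * renewal_int \<mu> (x - j)"]) (auto simp: renewal_int_bounds)
    then show ?thesis using 2 by (simp add: meet_prob_refl renewal_int_def)
  next
    case 3
    show ?thesis
    proof (rule main[OF 3(1)])
      fix m :: nat assume "1 \<le> m"
      then show "meet_prob a (x - int m) y \<le> G (x - int m) y"
        unfolding G_def using 3 less.prems by (intro less) auto
    qed
  next
    case 4
    have "meet_prob a y x \<le> G y x"
    proof (rule main[OF 4(1)])
      fix m :: nat assume "1 \<le> m"
      then have "meet_prob a x (y - int m) \<le> G x (y - int m)"
        unfolding G_def using 4 less.prems by (intro less) auto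
      then show "meet_prob a (y - int m) x \<le> G (y - int m) x"
        by (simp add: meet_prob_commute G_def mult.commute)
    qed
    then show ?thesis by (simp add: meet_prob_commute G_def mult.commute)
  qed
  then show ?case by (simp add: G_def)
qed

lemma summable_overlap: "summable (\<lambda>k. renewal \<mu> k * renewal_int \<mu> (int k + n))"
proof -
  have sq: "summable (\<lambda>k. (renewal_int \<mu> (int k + n))\<^sup>2)"
  proof (cases "0 \<le> n")
    case True
    then have "(\<lambda>k. (renewal_int \<mu> (int k + n))\<^sup>2) = (\<lambda>k. (renewal \<mu> (k + nat n))\<^sup>2)"
      by (auto simp: renewal_int_def nat_add_distrib)
    then show ?thesis using summable_ignore_initial_segment[OF summable_renewal_sq] by simp
  next
    case False
    have "(\<lambda>k. (renewal_int \<mu> (int (k + nat (- n)) + n))\<^sup>2) = (\<lambda>k. (renewal \<mu> k)\<^sup>2)"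
      using False by simp
    then have "summable (\<lambda>k. (renewal_int \<mu> (int (k + nat (- n)) + n))\<^sup>2)"
      using summable_renewal_sq by (simp only:)
    then show ?thesis
      by (rule summable_iff_shift[of "\<lambda>k. (renewal_int \<mu> (int k + n))\<^sup>2", THEN iffD1])
  qed
  have "summable (\<lambda>k. ((renewal \<mu> k)\<^sup>2 + (renewal_int \<mu> (int k + n))\<^sup>2))"
    by (intro summable_add summable_renewal_sq sq)
  then show ?thesis
  proof (rule summable_comparison_test')
    fix k
    have "2 * (renewal \<mu> k * renewal_int \<mu> (int k + n)) \<le> (renewal \<mu> k)\<^sup>2 + (renewal_int \<mu> (int k + n))\<^sup>2"
      using sum_squares_bound[of "renewal \<mu> k" "renewal_int \<mu> (int k + n)"] by (simp add: mult.assoc)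
    moreover have "0 \<le> renewal \<mu> k * renewal_int \<mu> (int k + n)"
      by (simp add: renewal_nonneg renewal_int_bounds)
    ultimately show "norm (renewal \<mu> k * renewal_int \<mu> (int k + n)) \<le> (renewal \<mu> k)\<^sup>2 + (renewal_int \<mu> (int k + n))\<^sup>2"
      by simp
  qed
qed

lemma overlap_term_nonneg: "0 \<le> renewal \<mu> k * renewal_int \<mu> n"
  by (simp add: renewal_nonneg renewal_int_bounds)

lemma overlap_nonneg: "0 \<le> overlap \<mu> n"
  unfolding overlap_def by (intro suminf_nonneg summable_overlap overlap_term_nonneg)

lemma overlap_uminus: "overlap \<mu> (- n) = overlap \<mu> n"
proof -
  have *: "overlap \<mu> (- int k) = overlap \<mu> (int k)" for k
  proof -
    have "(\<lambda>l. renewal \<mu> (l + k) * renewal_int \<mu> (int (l + k) - int k)) sums overlap \<mu> (int k)"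
    proof -
      have "renewal \<mu> (l + k) * renewal_int \<mu> (int (l + k) - int k) = renewal \<mu> l * renewal_int \<mu> (int l + int k)" for l
      proof -
        have "int (l + k) - int k = int l" "int l + int k = int (l + k)" by simp_all
        then show ?thesis by (simp only: renewal_int_of_nat mult.commute)
      qed
      then show ?thesis
        using summable_sums[OF summable_overlap[of "int k"]] by (simp only: overlap_def)
    qed
    then have "(\<lambda>l. renewal \<mu> l * renewal_int \<mu> (int l - int k)) sums overlap \<mu> (int k)"
      by (subst (asm) sums_zero_iff_shift) auto
    then show ?thesis by (simp add: overlap_def sums_iff)
  qed
  show ?thesis
    using *[of "nat n"] *[of "nat (- n)"] by (cases "0 \<le> n") simp_all
qed

lemma overlap_0_ge_1: "1 \<le> overlap \<mu> 0"
proof -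
  have "(\<Sum>k<1. renewal \<mu> k * renewal_int \<mu> (int k + 0)) \<le> overlap \<mu> 0"
    unfolding overlap_def by (intro sum_le_suminf summable_overlap) (auto intro: overlap_term_nonneg)
  then show ?thesis by (simp add: renewal_int_def)
qed

text \<open>
  The renewal equation for the second factor; the defect comes from its inhomogeneity at 0 and
  vanishes for \<open>n > 0\<close>.
\<close>

lemma overlap_recursion:
  "(\<integral>m. overlap \<mu> (n - int m) \<partial>measure_pmf \<mu>) = overlap \<mu> n - renewal_int \<mu> (- n)"
proof -
  have t: "(\<integral>m. renewal \<mu> k * renewal_int \<mu> (int k + (n - int m)) \<partial>measure_pmf \<mu>)
    = renewal \<mu> k * renewal_int \<mu> (int k + n) - (if int k + n = 0 then renewal \<mu> k else 0)" for k
    using renewal_int_recursion[of "int k + n"] by (simp add: add_diff_eq right_diff_distrib)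
  have int: "integrable (measure_pmf \<mu>) (\<lambda>m. renewal \<mu> k * renewal_int \<mu> (int k + (n - int m)))" for k
    using integrable_renewal_int[of "int k + n"] by (simp add: algebra_simps)
  have s1: "(\<lambda>k. if int k + n = 0 then renewal \<mu> k else 0) sums renewal_int \<mu> (- n)"
  proof (cases "n \<le> 0")
    case True
    have "(\<lambda>k. if k = nat (- n) then renewal \<mu> k else 0) sums renewal \<mu> (nat (- n))"
      by (rule sums_single)
    moreover have "(int k + n = 0) = (k = nat (- n))" for k using True by auto
    ultimately show ?thesis using True by (simp add: renewal_int_def)
  qed (auto simp: renewal_int_def intro: sums_zero[THEN sums_cong[THEN iffD1, rotated]])
  have s: "(\<lambda>k. renewal \<mu> k * renewal_int \<mu> (int k + n) - (if int k + n = 0 then renewal \<mu> k else 0))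
     sums (overlap \<mu> n - renewal_int \<mu> (- n))"
    using s1 summable_sums[OF summable_overlap] unfolding overlap_def by (intro sums_diff)
  have "(\<integral>m. (\<Sum>k. renewal \<mu> k * renewal_int \<mu> (int k + (n - int m))) \<partial>measure_pmf \<mu>)
    = (\<Sum>k. \<integral>m. renewal \<mu> k * renewal_int \<mu> (int k + (n - int m)) \<partial>measure_pmf \<mu>)"
  proof (rule integral_suminf[OF int])
    show "AE m in measure_pmf \<mu>. summable (\<lambda>k. norm (renewal \<mu> k * renewal_int \<mu> (int k + (n - int m))))"
      using summable_overlap overlap_term_nonneg by (intro AE_I2) simp
    show "summable (\<lambda>k. \<integral>m. norm (renewal \<mu> k * renewal_int \<mu> (int k + (n - int m))) \<partial>measure_pmf \<mu>)"
    proof -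
      have "(\<integral>m. norm (renewal \<mu> k * renewal_int \<mu> (int k + (n - int m))) \<partial>measure_pmf \<mu>)
          = (\<integral>m. renewal \<mu> k * renewal_int \<mu> (int k + (n - int m)) \<partial>measure_pmf \<mu>)" for k
        by (intro Bochner_Integration.integral_cong refl) (simp only: real_norm_def abs_of_nonneg overlap_term_nonneg)
      then show ?thesis using sums_summable[OF s] by (simp only: t)
    qed
  qed
  then show ?thesis using sums_unique[OF s] unfolding t by (simp only: overlap_def)
qed

lemma overlap_le:
  assumes "0 < e"
  shows "overlap \<mu> (int n) \<le> e * overlap \<mu> 0 + (\<Sum>k. (renewal \<mu> (k + n))\<^sup>2) / e"
proof -
  have s2: "summable (\<lambda>k. (renewal \<mu> (k + n))\<^sup>2)"
    using summable_ignore_initial_segment[OF summable_renewal_sq] by simp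
  have o0: "overlap \<mu> 0 = (\<Sum>k. (renewal \<mu> k)\<^sup>2)"
    by (simp add: overlap_def power2_eq_square)
  have "overlap \<mu> (int n) \<le> (\<Sum>k. e * (renewal \<mu> k)\<^sup>2 + (renewal \<mu> (k + n))\<^sup>2 / e)"
    unfolding overlap_def
  proof (intro suminf_le summable_overlap summable_add summable_mult summable_divide summable_renewal_sq s2)
    fix k
    define a b where "a = sqrt e * renewal \<mu> k" and "b = renewal \<mu> (k + n) / sqrt e"
    have "2 * a * b \<le> a\<^sup>2 + b\<^sup>2" by (rule sum_squares_bound)
    moreover have "0 \<le> a * b" using assms by (simp add: a_def b_def renewal_nonneg)
    ultimately have "a * b \<le> a\<^sup>2 + b\<^sup>2" by simp
    moreover have "a * b = renewal \<mu> k * renewal \<mu> (k + n)" "a\<^sup>2 = e * (renewal \<mu> k)\<^sup>2" "b\<^sup>2 = (renewal \<mu> (k + n))\<^sup>2 / e"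
      using assms by (simp_all add: a_def b_def power_mult_distrib power_divide)
    ultimately show "renewal \<mu> k * renewal_int \<mu> (int k + int n) \<le> e * (renewal \<mu> k)\<^sup>2 + (renewal \<mu> (k + n))\<^sup>2 / e"
      by (simp flip: of_nat_add)
  qed
  also have "\<dots> = e * overlap \<mu> 0 + (\<Sum>k. (renewal \<mu> (k + n))\<^sup>2) / e"
    unfolding o0 using summable_renewal_sq s2
    by (simp add: suminf_add[symmetric] summable_mult summable_divide suminf_mult suminf_divide)
  finally show ?thesis .
qed

lemma overlap_tendsto_0: "(\<lambda>n. overlap \<mu> (int n)) \<longlonglongrightarrow> 0"
proof (rule LIMSEQ_I)
  fix r :: real assume r: "0 < r"
  define e where "e = r / (2 * overlap \<mu> 0)"
  have e: "0 < e" "e * overlap \<mu> 0 = r / 2" using r overlap_0_ge_1 by (auto simp: e_def)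
  have "(\<lambda>n. (\<Sum>k. (renewal \<mu> (k + n))\<^sup>2) / e) \<longlonglongrightarrow> 0 / e"
    by (intro tendsto_divide suminf_exist_split2 summable_renewal_sq tendsto_const) (use e in simp)
  then have "\<forall>\<^sub>F n in sequentially. (\<Sum>k. (renewal \<mu> (k + n))\<^sup>2) / e < r / 2"
    using r by (intro order_tendstoD) auto
  then have "\<forall>\<^sub>F n in sequentially. norm (overlap \<mu> (int n) - 0) < r"
  proof eventually_elim
    case (elim n)
    then show ?case using overlap_le[OF e(1), of n] e(2) overlap_nonneg[of "int n"]
      unfolding real_norm_def by linarith
  qed
  then show "\<exists>no. \<forall>n\<ge>no. norm (overlap \<mu> (int n) - 0) < r" by (simp add: eventually_sequentially)
qed

lemma meet_prob_le_overlap: "meet_prob a x y \<le> overlap \<mu> (x - y)"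
proof -
  have main: "meet_prob a x y \<le> overlap \<mu> (x - y)" if "y \<le> x" for x y
  proof -
    have "meet_prob a x y \<le> (\<Sum>j=a..x. renewal_int \<mu> (x - j) * renewal_int \<mu> (y - j))"
      using that by (intro meet_prob_le) auto
    also have "\<dots> = (\<Sum>j=a..y. renewal_int \<mu> (y - j) * renewal_int \<mu> (x - j))"
      using that by (intro sum.mono_neutral_cong_right) (auto simp: mult.commute)
    also have "\<dots> = (\<Sum>k\<in>nat ` (\<lambda>j. y - j) ` {a..y}. renewal \<mu> k * renewal_int \<mu> (int k + (x - y)))"
      unfolding image_image
      by (subst sum.reindex) (auto simp: inj_on_def renewal_int_def intro!: sum.cong)
    also have "\<dots> \<le> overlap \<mu> (x - y)"
      unfolding overlap_def
      by (intro sum_le_suminf summable_overlap) (auto intro: overlap_term_nonneg)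
    finally show ?thesis .
  qed
  show ?thesis
    using main[of y x] main[of x y] overlap_uminus[of "x - y"] meet_prob_commute[of a x y]
    by (cases "y \<le> x") auto
qed

lemma meet_prob_tendsto: "(\<lambda>h. meet_prob (- int h) x y) \<longlonglongrightarrow> coalesce_prob x y"
proof -
  define A where "A h = {\<omega> \<in> space M. meet_above (- int h) (jumps \<omega>) x y}" for h
  have "(\<lambda>h. prob (A h)) \<longlonglongrightarrow> prob (\<Union>h. A h)"
    by (intro finite_Lim_measure_incseq) (auto simp: A_def incseq_def intro: meet_above_mono[rotated])
  moreover have "(\<Union>h. A h) = {\<omega> \<in> space M. coalesce (jumps \<omega>) x y}"
    by (auto simp: A_def coalesce_iff_meet_above)
  ultimately show ?thesis by (simp add: meet_prob_def coalesce_prob_def A_def)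
qed

lemma coalesce_prob_bounds: "0 \<le> coalesce_prob x y" "coalesce_prob x y \<le> 1"
  by (simp_all add: coalesce_prob_def)

lemma coalesce_prob_le_overlap: "coalesce_prob x y \<le> overlap \<mu> (x - y)"
  by (rule tendsto_upperbound[OF meet_prob_tendsto]) (auto simp: meet_prob_le_overlap)

lemma coalesce_prob_step:
  assumes "y < x"
  shows "coalesce_prob x y = (\<integral>m. coalesce_prob (x - int m) y \<partial>measure_pmf \<mu>)"
proof -
  have "(\<lambda>h. \<integral>m. meet_prob (- int h) (x - int m) y \<partial>measure_pmf \<mu>) \<longlonglongrightarrow> (\<integral>m. coalesce_prob (x - int m) y \<partial>measure_pmf \<mu>)"
    by (rule integral_dominated_convergence[where w="\<lambda>_. 1"])
      (auto simp: meet_prob_bounds intro!: meet_prob_tendsto)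
  then show ?thesis
    unfolding meet_prob_step[OF assms, symmetric] using meet_prob_tendsto LIMSEQ_unique by blast
qed

lemma coalesce_prob_refl: "coalesce_prob x x = 1"
proof -
  have "coalesce r x x" for r using ancestral_line_self by (auto simp: coalesce_def)
  then show ?thesis by (simp add: coalesce_prob_def prob_space)
qed

lemma coalesce_prob_commute: "coalesce_prob x y = coalesce_prob y x"
  by (simp add: coalesce_prob_def coalesce_def Int_commute)

text \<open>
  A maximum principle. Both sides are 1 on the diagonal, satisfy the same recursion off it, and are
  small for distant points. If the largest difference \<open>s\<close> were positive, then from any pair of
  close points a jump of length at least \<open>2 * n0\<close>, which has a fixed positive probability, would
  lead to a pair where the difference is at most \<open>s / 2\<close>; so all differences would be bounded by some
  \<open>s' < s\<close>.
\<close>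

theorem coalesce_prob_eq: "coalesce_prob x y = overlap \<mu> (x - y) / overlap \<mu> 0"
proof -
  define d where "d x y = \<bar>coalesce_prob x y - overlap \<mu> (x - y) / overlap \<mu> 0\<bar>" for x y
  have o0: "1 \<le> overlap \<mu> 0" by (rule overlap_0_ge_1)
  have abs_eq: "overlap \<mu> n = overlap \<mu> (int (nat \<bar>n\<bar>))" for n
    using overlap_uminus[of n] by (cases "0 \<le> n") auto
  have small: "d x y \<le> overlap \<mu> (int (nat \<bar>x - y\<bar>))" for x y
  proof -
    have "overlap \<mu> (x - y) / overlap \<mu> 0 \<le> overlap \<mu> (x - y) / 1"
      using o0 overlap_nonneg by (intro divide_left_mono) auto
    moreover have "0 \<le> overlap \<mu> (x - y) / overlap \<mu> 0" using o0 overlap_nonneg by simp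
    ultimately show ?thesis
      using coalesce_prob_bounds(1)[of x y] coalesce_prob_le_overlap[of x y] abs_eq[of "x - y"] unfolding d_def by linarith
  qed
  have overlap_le_0: "overlap \<mu> (int n) \<le> 2 * overlap \<mu> 0" for n
  proof -
    have "(\<Sum>k. (renewal \<mu> (k + n))\<^sup>2) \<le> (\<Sum>k. (renewal \<mu> k)\<^sup>2)"
      using suminf_split_initial_segment[OF summable_renewal_sq, of n] sum_nonneg[of "{..<n}" "\<lambda>k. (renewal \<mu> k)\<^sup>2"] by simp
    then show ?thesis using overlap_le[of 1 n] by (simp add: overlap_def power2_eq_square)
  qed
  have bdd: "d x y \<le> 2 * overlap \<mu> 0" for x y using small[of x y] overlap_le_0 order.trans by blast
  define s where "s = (SUP z. d (fst z) (snd z))"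
  have bA: "bdd_above (range (\<lambda>z. d (fst z) (snd z)))" using bdd by (intro bdd_aboveI2)
  have ds: "d x y \<le> s" for x y unfolding s_def using cSUP_upper[OF _ bA, of "(x, y)"] by simp
  have d0: "0 \<le> d x y" for x y by (simp add: d_def)
  have "s \<le> 0"
  proof (rule ccontr)
    assume "\<not> s \<le> 0"
    then have s: "0 < s" by simp
    then obtain n0 where n0: "\<And>n. n0 \<le> n \<Longrightarrow> overlap \<mu> (int n) < s / 2"
      using order_tendstoD(2)[OF overlap_tendsto_0, of "s / 2"] by (auto simp: eventually_sequentially)
    define s' where "s' = s - s / 2 * tail (real (2 * n0))"
    have s': "s / 2 \<le> s'" "s' < s"
      using s tail_le_1[of "real (2 * n0)"] tail_pos[of "real (2 * n0)"] mult_left_mono[of "tail (real (2 * n0))" 1 "s / 2"]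
      by (auto simp: s'_def)
    have main: "d x y \<le> s'" if "y < x" for x y
    proof (cases "n0 \<le> nat \<bar>x - y\<bar>")
      case True
      then show ?thesis using small[of x y] n0[OF True] s' by linarith
    next
      case False
      have int_o: "integrable (measure_pmf \<mu>) (\<lambda>m. overlap \<mu> (x - y - int m))"
      proof (rule integrable_bounded_pmf)
        show "\<bar>overlap \<mu> (x - y - int m)\<bar> \<le> 2 * overlap \<mu> 0" for m
          using overlap_nonneg[of "x - y - int m"] overlap_le_0 unfolding abs_eq[of "x - y - int m"]
          by (simp only: abs_of_nonneg)
      qed
      have int_c: "integrable (measure_pmf \<mu>) (\<lambda>m. coalesce_prob (x - int m) y)"
        by (intro integrable_bounded_pmf[of _ 1]) (simp add: coalesce_prob_bounds)
      have "coalesce_prob x y - overlap \<mu> (x - y) / overlap \<mu> 0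
         = (\<integral>m. coalesce_prob (x - int m) y - overlap \<mu> (x - int m - y) / overlap \<mu> 0 \<partial>measure_pmf \<mu>)"
        using coalesce_prob_step[OF that] overlap_recursion[of "x - y"] that int_o int_c
        by (simp add: algebra_simps)
      then have "d x y \<le> (\<integral>m. d (x - int m) y \<partial>measure_pmf \<mu>)"
        unfolding d_def by (simp add: integral_abs_bound)
      also have "\<dots> \<le> (\<integral>m. s - s / 2 * indicator {2 * n0..} m \<partial>measure_pmf \<mu>)"
      proof (rule integral_mono)
        show "integrable (measure_pmf \<mu>) (\<lambda>m. d (x - int m) y)"
          using d0 bdd by (intro integrable_bounded_pmf) simp
        show "integrable (measure_pmf \<mu>) (\<lambda>m. s - s / 2 * indicator {2 * n0..} m)"
          using s by (intro integrable_bounded_pmf[of _ s]) (auto split: split_indicator)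
        fix m
        show "d (x - int m) y \<le> s - s / 2 * indicator {2 * n0..} m"
        proof (cases "2 * n0 \<le> m")
          case True
          have "n0 \<le> nat \<bar>x - int m - y\<bar>" using True False by linarith
          then show ?thesis using small[of "x - int m" y] n0[of "nat \<bar>x - int m - y\<bar>"] True by simp
        qed (simp add: ds)
      qed
      also have "\<dots> = s'"
      proof -
        have "integrable (measure_pmf \<mu>) (indicator {2 * n0..} :: nat \<Rightarrow> real)"
          by (intro integrable_bounded_pmf[of _ 1]) (auto split: split_indicator)
        then have "(\<integral>m. s - s / 2 * indicator {2 * n0..} m \<partial>measure_pmf \<mu>) = s - s / 2 * measure_pmf.prob \<mu> {2 * n0..}"
          by simp
        then show ?thesis unfolding s'_def tail_of_nat .
      qed
      finally show ?thesis .
    qed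
    have "d x y \<le> s'" for x y
    proof -
      consider "y < x" | "x < y" | "x = y" by linarith
      then show ?thesis
      proof cases
        case 2
        have "d x y = d y x" unfolding d_def using overlap_uminus[of "x - y"] by (simp add: coalesce_prob_commute)
        then show ?thesis using main[OF 2] by simp
      next
        case 3
        then show ?thesis using s s' o0 by (simp add: d_def coalesce_prob_refl)
      qed (rule main)
    qed
    then have "s \<le> s'" unfolding s_def by (intro cSUP_least) auto
    then show False using s' by simp
  qed
  then have "d x y = 0" using ds[of x y] d0[of x y] by linarith
  then show ?thesis by (simp add: d_def)
qed

end

section \<open>The coloured process\<close>

abbreviation colour_space :: "(int \<Rightarrow> real) measure" where
  "colour_space \<equiv> Pi\<^sub>M UNIV (\<lambda>_. borel)"

text \<open>
  The jumps appear as real numbers in the independence assumption because \<open>indep_var\<close> gives both of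
  its variables the same value type.
\<close>

locale coloured_graph = jump_family \<mu> \<alpha> L M R
  for \<mu> \<alpha> L and M :: "'a measure" and R +
  fixes Z :: "int \<Rightarrow> 'a \<Rightarrow> real" and \<nu> :: "real measure" and rep :: "int set \<Rightarrow> int"
  assumes Z_indep: "indep_vars (\<lambda>_. borel) Z UNIV"
    and Z_distr: "\<And>k. distr M borel (Z k) = \<nu>"
    and RZ_indep: "indep_var (Pi\<^sub>M UNIV (\<lambda>_. count_space UNIV)) (\<lambda>\<omega> i. real (R i \<omega>))
       (Pi\<^sub>M UNIV (\<lambda>_. borel)) (\<lambda>\<omega> k. Z k \<omega>)"
    and naming: "component_naming rep"
    and nu_4: "integrable \<nu> (\<lambda>x. x ^ 4)"
    and nu_mean: "(\<integral>x. x \<partial>\<nu>) = 0"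
    and nu_var: "0 < (\<integral>x. x\<^sup>2 \<partial>\<nu>)"
begin

lemma Z_measurable [measurable]: "Z k \<in> borel_measurable M"
  using Z_indep by (auto simp: indep_vars_def2)

lemma sets_nu [measurable_cong, simp]: "sets \<nu> = sets borel"
  by (subst Z_distr[of 0, symmetric]) simp

lemma space_nu [simp]: "space \<nu> = UNIV"
  by (subst Z_distr[of 0, symmetric]) simp

lemma prob_space_nu: "prob_space \<nu>"
  by (subst Z_distr[of 0, symmetric]) (rule prob_space_distr, simp)

definition colours :: "'a \<Rightarrow> int \<Rightarrow> real" where "colours \<omega> k = Z k \<omega>"

lemma colours_measurable [measurable]: "colours \<in> measurable M colour_space"
  by (rule measurable_PiM_single') (auto simp: colours_def)

definition colour_law :: "(int \<Rightarrow> real) measure" where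
  "colour_law = distr M colour_space colours"

lemma sets_colour_law [measurable_cong, simp]: "sets colour_law = sets colour_space"
  by (simp add: colour_law_def)

lemma prob_space_colour_law: "prob_space colour_law"
  unfolding colour_law_def by (rule prob_space_distr) simp

lemma colour_law_PiM: "colour_law = Pi\<^sub>M UNIV (\<lambda>_. \<nu>)"
proof -
  have "distr M (\<Pi>\<^sub>M i\<in>UNIV. borel) (\<lambda>x. \<lambda>i\<in>UNIV. Z i x) = (\<Pi>\<^sub>M i\<in>UNIV. distr M borel (Z i))"
    using Z_indep by (subst (asm) indep_vars_iff_distr_eq_PiM) auto
  then show ?thesis by (simp add: colour_law_def colours_def[abs_def] Z_distr restrict_def)
qed

lemma integral_over_colours:
  fixes \<Phi> :: "(int \<Rightarrow> nat) \<Rightarrow> (int \<Rightarrow> real) \<Rightarrow> 'c::{banach, second_countable_topology}"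
  assumes m: "case_prod \<Phi> \<in> borel_measurable (jump_space \<Otimes>\<^sub>M colour_space)"
    and int: "integrable M (\<lambda>\<omega>. \<Phi> (jumps \<omega>) (colours \<omega>))"
  shows "(\<integral>\<omega>. \<Phi> (jumps \<omega>) (colours \<omega>) \<partial>M) = (\<integral>\<omega>. (\<integral>z. \<Phi> (jumps \<omega>) z \<partial>colour_law) \<partial>M)"
proof -
  define S where "S = PiM (UNIV :: int set) (\<lambda>_. count_space (UNIV :: real set))"
  define X where "X \<omega> i = real (R i \<omega>)" for \<omega> i
  have "indep_var S X colour_space colours"
    using RZ_indep unfolding S_def X_def[abs_def] colours_def[abs_def] .
  then have [measurable]: "X \<in> measurable M S"
    and ind: "distr M S X \<Otimes>\<^sub>M colour_law = distr M (S \<Otimes>\<^sub>M colour_space) (\<lambda>\<omega>. (X \<omega>, colours \<omega>))"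
    unfolding indep_var_distribution_eq colour_law_def by auto
  define flr where "flr f i = nat \<lfloor>f i\<rfloor>" for f :: "int \<Rightarrow> real" and i
  have fl: "flr \<in> measurable S jump_space"
  proof (rule measurable_PiM_single')
    fix k show "(\<lambda>f. flr f k) \<in> measurable S (count_space UNIV)"
      unfolding flr_def S_def by (rule measurable_compose[OF measurable_component_singleton]) auto
  qed auto
  have X_eq: "flr (X \<omega>) = jumps \<omega>" for \<omega>
    by (auto simp: flr_def X_def jumps_def)
  define E where "E = distr M S X"
  interpret E: prob_space E unfolding E_def by (rule prob_space_distr) simp
  interpret D: prob_space colour_law by (rule prob_space_colour_law)
  interpret pair_sigma_finite E colour_law by (intro pair_sigma_finite.intro) (unfold_locales)
  define \<Psi> where "\<Psi> z = \<Phi> (flr (fst z)) (snd z)" for z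
  have "(\<lambda>z. (flr (fst z), snd z)) \<in> measurable (S \<Otimes>\<^sub>M colour_space) (jump_space \<Otimes>\<^sub>M colour_space)"
    by (intro measurable_Pair measurable_compose[OF measurable_fst fl] measurable_snd)
  from measurable_compose[OF this m] have m': "\<Psi> \<in> borel_measurable (S \<Otimes>\<^sub>M colour_space)"
    unfolding \<Psi>_def[abs_def] by simp
  have ED: "E \<Otimes>\<^sub>M colour_law = distr M (S \<Otimes>\<^sub>M colour_space) (\<lambda>\<omega>. (X \<omega>, colours \<omega>))"
    unfolding E_def by (rule ind)
  have "integrable (E \<Otimes>\<^sub>M colour_law) \<Psi>"
    unfolding ED using int m' by (subst integrable_distr_eq) (auto simp: \<Psi>_def X_eq)
  then have "(\<integral>f. (\<integral>g. \<Psi> (f, g) \<partial>colour_law) \<partial>E) = integral\<^sup>L (E \<Otimes>\<^sub>M colour_law) \<Psi>"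
    by (rule integral_fst')
  also have "\<dots> = (\<integral>\<omega>. \<Phi> (jumps \<omega>) (colours \<omega>) \<partial>M)"
    unfolding ED using m' by (subst integral_distr) (auto simp: \<Psi>_def X_eq)
  finally have "(\<integral>\<omega>. \<Phi> (jumps \<omega>) (colours \<omega>) \<partial>M) = (\<integral>f. (\<integral>g. \<Psi> (f, g) \<partial>colour_law) \<partial>E)" ..
  also have "\<dots> = (\<integral>\<omega>. (\<integral>z. \<Phi> (jumps \<omega>) z \<partial>colour_law) \<partial>M)"
  proof -
    have "(\<lambda>f. \<integral>g. \<Psi> (f, g) \<partial>colour_law) \<in> borel_measurable S"
      by (rule D.borel_measurable_lebesgue_integral)
        (use m' in \<open>simp add: measurable_cong_sets[OF sets_pair_measure_cong[OF refl sets_colour_law] refl]\<close>)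
    then show ?thesis
      unfolding E_def by (subst integral_distr) (auto simp: \<Psi>_def X_eq)
  qed
  finally show ?thesis .
qed

text \<open>
  Independent and identically distributed colours, read along a naming of the vertices, have a law
  that depends only on which vertices share a name.
\<close>

lemma colour_integral_cong:
  fixes \<Phi> :: "(int \<Rightarrow> real) \<Rightarrow> 'c::{banach, second_countable_topology}"
  assumes m: "\<Phi> \<in> borel_measurable colour_space"
    and dep: "\<And>y y'. (\<And>i. i \<in> A \<Longrightarrow> y i = y' i) \<Longrightarrow> \<Phi> y = \<Phi> y'"
    and ker: "\<And>i j. i \<in> A \<Longrightarrow> j \<in> A \<Longrightarrow> n i = n j \<longleftrightarrow> n' i = n' j"
  shows "(\<integral>z. \<Phi> (\<lambda>i. z (n i)) \<partial>colour_law) = (\<integral>z. \<Phi> (\<lambda>i. z (n' i)) \<partial>colour_law)"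
proof -
  define J where "J = n' ` A"
  define g where "g s = n (SOME i. i \<in> A \<and> n' i = s)" for s
  have some: "(SOME i'. i' \<in> A \<and> n' i' = n' i) \<in> A \<and> n' (SOME i'. i' \<in> A \<and> n' i' = n' i) = n' i" if "i \<in> A" for i
    by (rule someI[of _ i]) (use that in auto)
  have g: "g (n' i) = n i" if "i \<in> A" for i
    unfolding g_def using some[OF that] ker[of _ i] that by auto
  have inj: "inj_on g J"
    unfolding J_def inj_on_def using g ker by auto
  define Q where "Q = PiM J (\<lambda>_. \<nu>)"
  define \<Psi> where "\<Psi> w = \<Phi> (\<lambda>i. if i \<in> A then w (n' i) else 0)" for w
  have \<Psi>m: "\<Psi> \<in> borel_measurable Q"
  proof -
    have "(\<lambda>w i. if i \<in> A then w (n' i) else 0) \<in> measurable Q colour_space"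
    proof (rule measurable_PiM_single')
      fix i show "(\<lambda>w. if i \<in> A then w (n' i) else 0) \<in> borel_measurable Q"
      proof (cases "i \<in> A")
        case True
        then have "(\<lambda>w. w (n' i)) \<in> measurable Q \<nu>"
          unfolding Q_def J_def by (intro measurable_component_singleton) auto
        then show ?thesis using True by (simp add: measurable_cong_sets[OF refl sets_nu])
      qed simp
    qed auto
    from measurable_compose[OF this m] show ?thesis by (simp add: \<Psi>_def[abs_def])
  qed
  have law: "distr colour_law Q (\<lambda>\<omega>. \<lambda>s\<in>J. \<omega> (f s)) = Q" if "inj_on f J" for f
    unfolding Q_def colour_law_PiM using that
    by (intro distr_PiM_reindex[where M="\<lambda>_. \<nu>"] prob_space_nu) auto
  have meas: "(\<lambda>\<omega>. \<lambda>s\<in>J. \<omega> (f s)) \<in> measurable colour_law Q" for f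
    unfolding Q_def colour_law_PiM by (intro measurable_restrict measurable_component_singleton) auto
  have "(\<integral>z. \<Phi> (\<lambda>i. z (n i)) \<partial>colour_law) = (\<integral>z. \<Psi> (\<lambda>s\<in>J. z (g s)) \<partial>colour_law)"
    unfolding \<Psi>_def by (intro Bochner_Integration.integral_cong refl dep) (auto simp: J_def g)
  also have "\<dots> = integral\<^sup>L Q \<Psi>"
    using integral_distr[OF meas \<Psi>m, of g] law[OF inj] by simp
  also have "\<dots> = (\<integral>z. \<Psi> (\<lambda>s\<in>J. z s) \<partial>colour_law)"
    using integral_distr[OF meas \<Psi>m, of "\<lambda>s. s"] law[of "\<lambda>s. s"] by simp
  also have "\<dots> = (\<integral>z. \<Phi> (\<lambda>i. z (n' i)) \<partial>colour_law)"
    unfolding \<Psi>_def by (intro Bochner_Integration.integral_cong refl dep) (auto simp: J_def)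
  finally show ?thesis .
qed

definition name :: "(int \<Rightarrow> nat) \<Rightarrow> int \<Rightarrow> int" where
  "name r i = rep (component r i)"

lemma name_eq_iff: "name r i = name r j \<longleftrightarrow> coalesce r i j"
proof
  assume eq: "name r i = name r j"
  have "rep (component r i) \<in> component r i" "rep (component r j) \<in> component r j"
    using naming by (auto simp: component_naming_def)
  then have "name r i \<in> component r i" "name r i \<in> component r j"
    unfolding name_def[symmetric] eq by (auto simp: name_def eq[unfolded name_def])
  then have "component r i = component r (name r i)" "component r j = component r (name r i)"
    by (simp_all add: component_eq_iff component_iff_coalesce)
  then show "coalesce r i j" by (simp add: component_eq_iff[symmetric])
qed (simp add: name_def component_eq_iff[symmetric])

lemma name_measurable [measurable]: "(\<lambda>r. name r i) \<in> measurable jump_space (count_space UNIV)"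
  using naming by (simp add: component_naming_def name_def)

definition painted :: "(int \<Rightarrow> nat) \<Rightarrow> (int \<Rightarrow> real) \<Rightarrow> int \<Rightarrow> real" where
  "painted r z i = z (name r i)"

lemma painted_component_measurable:
  "(\<lambda>(r, z). painted r z i) \<in> borel_measurable (jump_space \<Otimes>\<^sub>M colour_space)"
proof -
  have "(\<lambda>p. snd p (name (fst p) i)) \<in> borel_measurable (jump_space \<Otimes>\<^sub>M colour_space)"
    by (rule measurable_compose_countable[where f="\<lambda>k p. snd p k" and g="\<lambda>p. name (fst p) i"]) simp_all
  then show ?thesis by (simp add: painted_def case_prod_beta)
qed

lemma painted_measurable [measurable]:
  "(\<lambda>p. painted (fst p) (snd p)) \<in> measurable (jump_space \<Otimes>\<^sub>M colour_space) colour_space"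
proof (rule measurable_PiM_single')
  fix i show "(\<lambda>p. painted (fst p) (snd p) i) \<in> borel_measurable (jump_space \<Otimes>\<^sub>M colour_space)"
    using painted_component_measurable[of i] by (simp add: case_prod_beta)
qed auto

definition Y :: "int \<Rightarrow> 'a \<Rightarrow> real" where "Y i \<omega> = vertex_colour rep R Z i \<omega>"

definition process :: "'a \<Rightarrow> int \<Rightarrow> real" where "process \<omega> i = Y i \<omega>"

lemma process_eq: "process \<omega> = painted (jumps \<omega>) (colours \<omega>)"
  by (auto simp: process_def Y_def vertex_colour_def painted_def name_def colours_def jumps_def[abs_def])

lemma process_measurable [measurable]: "process \<in> measurable M colour_space"
proof -
  have "(\<lambda>\<omega>. (jumps \<omega>, colours \<omega>)) \<in> measurable M (jump_space \<Otimes>\<^sub>M colour_space)" by measurable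
  from measurable_compose[OF this painted_measurable] show ?thesis
    by (simp add: process_eq[abs_def])
qed

lemma Y_measurable [measurable]: "Y i \<in> borel_measurable M"
proof -
  have "(\<lambda>\<omega>. process \<omega> i) \<in> borel_measurable M"
    by (rule measurable_compose[OF process_measurable]) simp
  then show ?thesis by (simp add: process_def)
qed

lemma integral_process:
  fixes \<Phi> :: "(int \<Rightarrow> real) \<Rightarrow> 'c::{banach, second_countable_topology}"
  assumes m: "\<Phi> \<in> borel_measurable colour_space" and int: "integrable M (\<lambda>\<omega>. \<Phi> (process \<omega>))"
  shows "(\<integral>\<omega>. \<Phi> (process \<omega>) \<partial>M) = (\<integral>\<omega>. (\<integral>z. \<Phi> (painted (jumps \<omega>) z) \<partial>colour_law) \<partial>M)"
proof -
  have "(\<lambda>p. \<Phi> (painted (fst p) (snd p))) \<in> borel_measurable (jump_space \<Otimes>\<^sub>M colour_space)"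
    by (rule measurable_compose[OF painted_measurable m])
  then show ?thesis
    using int unfolding process_eq
    by (intro integral_over_colours[where \<Phi>="\<lambda>r z. \<Phi> (painted r z)"]) (auto simp: case_prod_beta')
qed

lemma colour_law_component: "distr colour_law borel (\<lambda>z. z k) = \<nu>"
proof -
  have "distr colour_law borel (\<lambda>z. z k) = distr M borel (\<lambda>\<omega>. colours \<omega> k)"
    unfolding colour_law_def by (subst distr_distr) (auto simp: comp_def)
  then show ?thesis by (simp add: colours_def Z_distr)
qed

lemma distr_Y: "distr M borel (Y i) = \<nu>"
proof (rule measure_eqI)
  fix A assume "A \<in> sets (distr M borel (Y i))"
  then have A[measurable]: "A \<in> sets borel" by simp
  interpret D: prob_space colour_law by (rule prob_space_colour_law)
  interpret N: prob_space \<nu> by (rule prob_space_nu)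
  interpret DY: prob_space "distr M borel (Y i)" by (rule prob_space_distr) simp
  have in1: "(\<integral>z. indicator A (z k) \<partial>colour_law) = measure \<nu> A" for k
  proof -
    have "(\<lambda>z. z k) \<in> measurable colour_law borel" by simp
    from integral_distr[OF this, of "indicator A :: real \<Rightarrow> real"]
    show ?thesis by (simp add: colour_law_component)
  qed
  have "measure (distr M borel (Y i)) A = (\<integral>x. indicator A x \<partial>distr M borel (Y i))" by simp
  also have "\<dots> = (\<integral>\<omega>. indicator A (process \<omega> i) \<partial>M)"
    by (subst integral_distr) (auto simp: process_def)
  also have "\<dots> = (\<integral>\<omega>. (\<integral>z. indicator A (painted (jumps \<omega>) z i) \<partial>colour_law) \<partial>M)"
    by (rule integral_process[where \<Phi>="\<lambda>y. indicator A (y i)"])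
      (auto intro!: integrable_const_bound[of _ 1] simp: process_def split: split_indicator)
  also have "\<dots> = measure \<nu> A" by (simp add: painted_def in1 prob_space)
  finally show "emeasure (distr M borel (Y i)) A = emeasure \<nu> A"
    by (simp add: DY.emeasure_eq_measure N.emeasure_eq_measure)
qed simp

definition m4 :: real where "m4 = (\<integral>x. x ^ 4 \<partial>\<nu>)"
definition \<sigma>2 :: real where "\<sigma>2 = (\<integral>x. x\<^sup>2 \<partial>\<nu>)"

lemma sigma2_pos: "0 < \<sigma>2" using nu_var by (simp add: \<sigma>2_def)
lemma m4_nonneg: "0 \<le> m4" by (simp add: m4_def)

lemma nu_moments: "integrable \<nu> (\<lambda>x. x ^ n)" if "n \<le> 4"
proof -
  interpret N: prob_space \<nu> by (rule prob_space_nu)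
  show ?thesis
  proof (rule Bochner_Integration.integrable_bound[where f="\<lambda>x. 1 + x ^ 4"])
    show "AE x in \<nu>. norm (x ^ n) \<le> norm (1 + x ^ 4)"
      using power_le_1_plus_4[OF that] by (intro AE_I2) (simp add: power_abs)
  qed (use nu_4 in \<open>auto simp: measurable_cong_sets[OF sets_nu refl]\<close>)
qed

lemma moment_transfer:
  assumes W: "W \<in> borel_measurable Q" and d: "distr Q borel W = \<nu>" and "n \<le> 4"
  shows "integrable Q (\<lambda>\<omega>. W \<omega> ^ n)" "(\<integral>\<omega>. W \<omega> ^ n \<partial>Q) = (\<integral>x. x ^ n \<partial>\<nu>)"
proof -
  have "integrable (distr Q borel W) (\<lambda>x. x ^ n)" using nu_moments[OF assms(3)] d by simp
  then show "integrable Q (\<lambda>\<omega>. W \<omega> ^ n)" using W by (simp add: integrable_distr_eq)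
  show "(\<integral>\<omega>. W \<omega> ^ n \<partial>Q) = (\<integral>x. x ^ n \<partial>\<nu>)"
    unfolding d[symmetric] using W by (simp add: integral_distr)
qed

lemma Y_moments: "n \<le> 4 \<Longrightarrow> integrable M (\<lambda>\<omega>. Y i \<omega> ^ n)" "n \<le> 4 \<Longrightarrow> (\<integral>\<omega>. Y i \<omega> ^ n \<partial>M) = (\<integral>x. x ^ n \<partial>\<nu>)"
  using moment_transfer[OF Y_measurable distr_Y] by auto

lemma Z_moments: "n \<le> 4 \<Longrightarrow> integrable M (\<lambda>\<omega>. Z i \<omega> ^ n)" "n \<le> 4 \<Longrightarrow> (\<integral>\<omega>. Z i \<omega> ^ n \<partial>M) = (\<integral>x. x ^ n \<partial>\<nu>)"
  using moment_transfer[OF Z_measurable Z_distr] by auto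

lemma Y_integrable: "integrable M (Y i)" "integrable M (\<lambda>\<omega>. (Y i \<omega>)\<^sup>2)" "integrable M (\<lambda>\<omega>. Y i \<omega> ^ 4)"
  and Y_mean: "(\<integral>\<omega>. Y i \<omega> \<partial>M) = 0" and Y_sq: "(\<integral>\<omega>. (Y i \<omega>)\<^sup>2 \<partial>M) = \<sigma>2" and Y_4: "(\<integral>\<omega>. Y i \<omega> ^ 4 \<partial>M) = m4"
  using Y_moments[of 1 i] Y_moments[of 2 i] Y_moments[of 4 i] nu_mean by (auto simp: \<sigma>2_def m4_def)

lemma Z_integrable: "integrable M (Z i)" "integrable M (\<lambda>\<omega>. (Z i \<omega>)\<^sup>2)" "integrable M (\<lambda>\<omega>. Z i \<omega> ^ 4)"
  and Z_mean: "(\<integral>\<omega>. Z i \<omega> \<partial>M) = 0" and Z_sq: "(\<integral>\<omega>. (Z i \<omega>)\<^sup>2 \<partial>M) = \<sigma>2" and Z_4: "(\<integral>\<omega>. Z i \<omega> ^ 4 \<partial>M) = m4"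
  using Z_moments[of 1 i] Z_moments[of 2 i] Z_moments[of 4 i] nu_mean by (auto simp: \<sigma>2_def m4_def)

lemma abs_mult4_le: "\<bar>a * b * (c * d)\<bar> \<le> (a ^ 4 + b ^ 4 + c ^ 4 + d ^ 4 :: real) / 4"
proof -
  have h: "\<bar>x * y\<bar> \<le> (x\<^sup>2 + y\<^sup>2) / 2" for x y :: real
    using sum_squares_bound[of "\<bar>x\<bar>" "\<bar>y\<bar>"] by (simp add: abs_mult)
  have "\<bar>a * b * (c * d)\<bar> \<le> ((a * b)\<^sup>2 + (c * d)\<^sup>2) / 2" by (rule h)
  also have "(a * b)\<^sup>2 \<le> (a ^ 4 + b ^ 4) / 2"
    using h[of "a\<^sup>2" "b\<^sup>2"] by (simp add: power_mult_distrib flip: power_mult)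
  also have "(c * d)\<^sup>2 \<le> (c ^ 4 + d ^ 4) / 2"
    using h[of "c\<^sup>2" "d\<^sup>2"] by (simp add: power_mult_distrib flip: power_mult)
  finally show ?thesis by (simp add: field_simps)
qed

lemma integrable_mult4:
  assumes "\<And>W. W \<in> {a, b, c, d} \<Longrightarrow> W \<in> borel_measurable Q \<and> integrable Q (\<lambda>\<omega>. W \<omega> ^ 4)"
  shows "integrable Q (\<lambda>\<omega>. a \<omega> * b \<omega> * (c \<omega> * d \<omega>) :: real)"
proof (rule Bochner_Integration.integrable_bound)
  show "integrable Q (\<lambda>\<omega>. (a \<omega> ^ 4 + b \<omega> ^ 4 + c \<omega> ^ 4 + d \<omega> ^ 4) / 4)"
    using assms by simp
  show "AE \<omega> in Q. norm (a \<omega> * b \<omega> * (c \<omega> * d \<omega>)) \<le> norm ((a \<omega> ^ 4 + b \<omega> ^ 4 + c \<omega> ^ 4 + d \<omega> ^ 4) / 4)"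
    using abs_mult4_le by (intro AE_I2) (simp add: order.trans[OF _ abs_ge_self])
  have [measurable]: "a \<in> borel_measurable Q" "b \<in> borel_measurable Q" "c \<in> borel_measurable Q" "d \<in> borel_measurable Q"
    using assms by auto
  show "(\<lambda>\<omega>. a \<omega> * b \<omega> * (c \<omega> * d \<omega>)) \<in> borel_measurable Q" by measurable
qed

lemma integrable_mult2:
  assumes [measurable]: "a \<in> borel_measurable Q" "b \<in> borel_measurable Q"
    and "integrable Q (\<lambda>\<omega>. (a \<omega>)\<^sup>2)" "integrable Q (\<lambda>\<omega>. (b \<omega>)\<^sup>2)"
  shows "integrable Q (\<lambda>\<omega>. a \<omega> * b \<omega> :: real)"
proof (rule Bochner_Integration.integrable_bound)
  show "integrable Q (\<lambda>\<omega>. (a \<omega>)\<^sup>2 + (b \<omega>)\<^sup>2)" using assms by simp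
  show "AE \<omega> in Q. norm (a \<omega> * b \<omega>) \<le> norm ((a \<omega>)\<^sup>2 + (b \<omega>)\<^sup>2)"
    using abs_mult_le_squares by (intro AE_I2) (simp add: order.trans[OF _ abs_ge_self])
qed simp

lemma integrable_YY: "integrable M (\<lambda>\<omega>. Y i \<omega> * Y j \<omega>)"
  by (intro integrable_mult2 Y_integrable) auto

lemma integrable_YYYY: "integrable M (\<lambda>\<omega>. Y i \<omega> * Y j \<omega> * (Y k \<omega> * Y l \<omega>))"
  by (intro integrable_mult4) (auto simp: Y_integrable)

lemma integrable_ZZ: "integrable M (\<lambda>\<omega>. Z i \<omega> * Z j \<omega>)"
  by (intro integrable_mult2 Z_integrable) auto

lemma Z_groups_independent:
  assumes "{a, b} \<inter> {c, d} = {}"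
  shows "(\<integral>\<omega>. Z a \<omega> * Z b \<omega> * (Z c \<omega> * Z d \<omega>) \<partial>M) = (\<integral>\<omega>. Z a \<omega> * Z b \<omega> \<partial>M) * (\<integral>\<omega>. Z c \<omega> * Z d \<omega> \<partial>M)"
proof -
  have "indep_var (PiM {a, b} (\<lambda>_. borel)) (\<lambda>\<omega>. restrict (\<lambda>i. Z i \<omega>) {a, b})
     (PiM {c, d} (\<lambda>_. borel)) (\<lambda>\<omega>. restrict (\<lambda>i. Z i \<omega>) {c, d})"
    by (rule indep_var_restrict[OF Z_indep assms]) auto
  then have "indep_var borel ((\<lambda>f. f a * f b) \<circ> (\<lambda>\<omega>. restrict (\<lambda>i. Z i \<omega>) {a, b}))
     borel ((\<lambda>f. f c * f d) \<circ> (\<lambda>\<omega>. restrict (\<lambda>i. Z i \<omega>) {c, d}))"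
    by (rule indep_var_compose) (auto intro!: borel_measurable_times measurable_component_singleton)
  moreover have "(\<lambda>f. f a * f b) \<circ> (\<lambda>\<omega>. restrict (\<lambda>i. Z i \<omega>) {a, b}) = (\<lambda>\<omega>. Z a \<omega> * Z b \<omega>)"
    "(\<lambda>f. f c * f d) \<circ> (\<lambda>\<omega>. restrict (\<lambda>i. Z i \<omega>) {c, d}) = (\<lambda>\<omega>. Z c \<omega> * Z d \<omega>)" by auto
  ultimately show ?thesis
    using indep_var_lebesgue_integral[OF _ integrable_ZZ integrable_ZZ] by simp
qed

lemma Z_covariance: "(\<integral>\<omega>. Z a \<omega> * Z b \<omega> \<partial>M) = (if a = b then \<sigma>2 else 0)"
proof (cases "a = b")
  case True
  then show ?thesis using Z_sq[of b] by (simp add: power2_eq_square)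
next
  case False
  have "indep_var borel (Z a) borel (Z b)"
  proof -
    have "indep_var (PiM {a} (\<lambda>_. borel)) (\<lambda>\<omega>. restrict (\<lambda>i. Z i \<omega>) {a}) (PiM {b} (\<lambda>_. borel)) (\<lambda>\<omega>. restrict (\<lambda>i. Z i \<omega>) {b})"
      by (rule indep_var_restrict[OF Z_indep]) (use False in auto)
    then have "indep_var borel ((\<lambda>f. f a) \<circ> (\<lambda>\<omega>. restrict (\<lambda>i. Z i \<omega>) {a})) borel ((\<lambda>f. f b) \<circ> (\<lambda>\<omega>. restrict (\<lambda>i. Z i \<omega>) {b}))"
      by (rule indep_var_compose) (auto intro!: measurable_component_singleton)
    then show ?thesis by (simp add: comp_def)
  qed
  then show ?thesis
    using indep_var_lebesgue_integral[OF _ Z_integrable(1) Z_integrable(1)] False by (simp add: Z_mean)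
qed

lemma colour_integral_Z:
  fixes \<Phi> :: "(int \<Rightarrow> real) \<Rightarrow> real"
  assumes "\<Phi> \<in> borel_measurable colour_space"
  shows "(\<integral>z. \<Phi> z \<partial>colour_law) = (\<integral>\<omega>. \<Phi> (colours \<omega>) \<partial>M)"
  unfolding colour_law_def using assms by (simp add: integral_distr)

lemma Y_covariance: "(\<integral>\<omega>. Y i \<omega> * Y j \<omega> \<partial>M) = \<sigma>2 * coalesce_prob i j"
proof -
  have "(\<integral>\<omega>. Y i \<omega> * Y j \<omega> \<partial>M) = (\<integral>\<omega>. (\<integral>z. painted (jumps \<omega>) z i * painted (jumps \<omega>) z j \<partial>colour_law) \<partial>M)"
    using integral_process[of "\<lambda>y. y i * y j"] integrable_YY[of i j] by (simp add: process_def)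
  also have "\<dots> = (\<integral>\<omega>. \<sigma>2 * indicator {\<omega> \<in> space M. coalesce (jumps \<omega>) i j} \<omega> \<partial>M)"
  proof (intro Bochner_Integration.integral_cong refl)
    fix \<omega> assume "\<omega> \<in> space M"
    have "(\<integral>z. painted (jumps \<omega>) z i * painted (jumps \<omega>) z j \<partial>colour_law)
       = (if name (jumps \<omega>) i = name (jumps \<omega>) j then \<sigma>2 else 0)"
      unfolding painted_def
      by (subst colour_integral_Z) (simp_all add: colours_def Z_covariance)
    then show "(\<integral>z. painted (jumps \<omega>) z i * painted (jumps \<omega>) z j \<partial>colour_law)
       = \<sigma>2 * indicator {\<omega> \<in> space M. coalesce (jumps \<omega>) i j} \<omega>"
      using \<open>\<omega> \<in> space M\<close> by (simp add: name_eq_iff)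
  qed
  also have "\<dots> = \<sigma>2 * coalesce_prob i j"
    by (simp add: coalesce_prob_def Int_absorb2)
  finally show ?thesis .
qed

text \<open>
  If neither line of the first pair meets a line of the second, the two products involve disjoint
  sets of colours and are independent given the graph. The right-hand side bounds the
  probability of the opposite event, up to a constant factor.
\<close>

lemma fourfold_correlation:
  "\<bar>(\<integral>\<omega>. Y i \<omega> * Y j \<omega> * (Y k \<omega> * Y l \<omega>) \<partial>M) - \<sigma>2\<^sup>2 * prob {\<omega> \<in> space M. coalesce (jumps \<omega>) i j \<and> coalesce (jumps \<omega>) k l}\<bar>
    \<le> (m4 + \<sigma>2\<^sup>2) * (coalesce_prob i k + coalesce_prob i l + coalesce_prob j k + coalesce_prob j l)"
proof -
  define P where "P \<omega> \<longleftrightarrow> coalesce (jumps \<omega>) i j \<and> coalesce (jumps \<omega>) k l" for \<omega>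
  define h where "h \<omega> = (\<integral>z. painted (jumps \<omega>) z i * painted (jumps \<omega>) z j * (painted (jumps \<omega>) z k * painted (jumps \<omega>) z l) \<partial>colour_law)" for \<omega>
  define I where "I x y \<omega> = (indicator {\<omega> \<in> space M. coalesce (jumps \<omega>) x y} \<omega> :: real)" for x y \<omega>
  have Iint: "integrable M (I x y)" for x y
    unfolding I_def[abs_def] by (intro integrable_const_bound[of _ 1]) (auto split: split_indicator)
  have [measurable]: "Measurable.pred M P" unfolding P_def by measurable
  have hZ: "h \<omega> = (\<integral>\<omega>'. Z (name (jumps \<omega>) i) \<omega>' * Z (name (jumps \<omega>) j) \<omega>' * (Z (name (jumps \<omega>) k) \<omega>' * Z (name (jumps \<omega>) l) \<omega>') \<partial>M)" for \<omega>
    unfolding h_def painted_def by (subst colour_integral_Z) (simp_all add: colours_def)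
  have E: "(\<integral>\<omega>. Y i \<omega> * Y j \<omega> * (Y k \<omega> * Y l \<omega>) \<partial>M) = (\<integral>\<omega>. h \<omega> \<partial>M)"
    unfolding h_def using integral_process[of "\<lambda>y. y i * y j * (y k * y l)"] integrable_YYYY[of i j k l]
    by (simp add: process_def)
  have Z4: "\<bar>(\<integral>\<omega>. Z a \<omega> * Z b \<omega> * (Z c \<omega> * Z d \<omega>) \<partial>M)\<bar> \<le> m4" for a b c d
  proof -
    have i: "integrable M (\<lambda>\<omega>. Z a \<omega> * Z b \<omega> * (Z c \<omega> * Z d \<omega>))"
      by (intro integrable_mult4) (auto simp: Z_integrable)
    have "\<bar>(\<integral>\<omega>. Z a \<omega> * Z b \<omega> * (Z c \<omega> * Z d \<omega>) \<partial>M)\<bar> \<le> (\<integral>\<omega>. (Z a \<omega> ^ 4 + Z b \<omega> ^ 4 + Z c \<omega> ^ 4 + Z d \<omega> ^ 4) / 4 \<partial>M)"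
      using i abs_mult4_le
      by (intro order.trans[OF integral_abs_bound integral_mono]) (auto simp: Z_integrable)
    also have "\<dots> = m4" by (simp add: Z_integrable Z_4)
    finally show ?thesis .
  qed
  have pw: "\<bar>h \<omega> - \<sigma>2\<^sup>2 * (if P \<omega> then 1 else 0)\<bar> \<le> (m4 + \<sigma>2\<^sup>2) * (I i k \<omega> + I i l \<omega> + I j k \<omega> + I j l \<omega>)"
    if w: "\<omega> \<in> space M" for \<omega>
  proof (cases "coalesce (jumps \<omega>) i k \<or> coalesce (jumps \<omega>) i l \<or> coalesce (jumps \<omega>) j k \<or> coalesce (jumps \<omega>) j l")
    case True
    then have "1 \<le> I i k \<omega> + I i l \<omega> + I j k \<omega> + I j l \<omega>" using w by (auto simp: I_def)
    then have A: "(m4 + \<sigma>2\<^sup>2) * 1 \<le> (m4 + \<sigma>2\<^sup>2) * (I i k \<omega> + I i l \<omega> + I j k \<omega> + I j l \<omega>)"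
      using m4_nonneg by (intro mult_left_mono) auto
    have "\<bar>h \<omega> - \<sigma>2\<^sup>2 * (if P \<omega> then 1 else 0)\<bar> \<le> m4 + \<sigma>2\<^sup>2"
      using Z4 unfolding hZ by (intro order.trans[OF abs_triangle_ineq4 add_mono]) auto
    from order.trans[OF this A[unfolded mult_1_right]] show ?thesis .
  next
    case False
    then have "{name (jumps \<omega>) i, name (jumps \<omega>) j} \<inter> {name (jumps \<omega>) k, name (jumps \<omega>) l} = {}"
      by (auto simp: name_eq_iff)
    from Z_groups_independent[OF this] have "h \<omega> = \<sigma>2\<^sup>2 * (if P \<omega> then 1 else 0)"
      unfolding hZ by (auto simp: Z_covariance name_eq_iff P_def power2_eq_square)
    then show ?thesis using m4_nonneg by (simp add: I_def)
  qed
  have hm: "integrable M h"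
  proof (rule integrable_const_bound[of _ m4])
    show "AE \<omega> in M. norm (h \<omega>) \<le> m4" using Z4 unfolding hZ by simp
    interpret D: prob_space colour_law by (rule prob_space_colour_law)
    have "(\<lambda>y. y i * y j * (y k * y l)) \<in> borel_measurable colour_space" by measurable
    from measurable_compose[OF painted_measurable this]
    have "(\<lambda>p. painted (fst p) (snd p) i * painted (fst p) (snd p) j * (painted (fst p) (snd p) k * painted (fst p) (snd p) l))
      \<in> borel_measurable (jump_space \<Otimes>\<^sub>M colour_law)"
      by (simp add: measurable_cong_sets[OF sets_pair_measure_cong[OF refl sets_colour_law] refl])
    then have "(\<lambda>r. \<integral>z. painted r z i * painted r z j * (painted r z k * painted r z l) \<partial>colour_law) \<in> borel_measurable jump_space"
      by (intro D.borel_measurable_lebesgue_integral) (simp add: case_prod_beta')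
    from measurable_compose[OF jumps_measurable this] show "h \<in> borel_measurable M"
      by (simp add: h_def[abs_def])
  qed
  have Pint: "integrable M (\<lambda>\<omega>. if P \<omega> then 1 else 0 :: real)"
    by (intro integrable_const_bound[of _ 1]) auto
  have "prob {\<omega> \<in> space M. P \<omega>} = (\<integral>\<omega>. (if P \<omega> then 1 else 0) \<partial>M)"
  proof -
    have "(\<integral>\<omega>. (if P \<omega> then 1 else 0) \<partial>M) = (\<integral>\<omega>. indicator {\<omega> \<in> space M. P \<omega>} \<omega> \<partial>M)"
      by (intro Bochner_Integration.integral_cong) (auto split: split_indicator)
    moreover have "{\<omega> \<in> space M. P \<omega>} \<inter> space M = {\<omega> \<in> space M. P \<omega>}" by auto
    ultimately show ?thesis using Bochner_Integration.integral_indicator[of M "{\<omega> \<in> space M. P \<omega>}"] by metis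
  qed
  then have "\<bar>(\<integral>\<omega>. h \<omega> \<partial>M) - \<sigma>2\<^sup>2 * prob {\<omega> \<in> space M. P \<omega>}\<bar> = \<bar>\<integral>\<omega>. h \<omega> - \<sigma>2\<^sup>2 * (if P \<omega> then 1 else 0) \<partial>M\<bar>"
    using hm Pint by simp
  also have "\<dots> \<le> (\<integral>\<omega>. (m4 + \<sigma>2\<^sup>2) * (I i k \<omega> + I i l \<omega> + I j k \<omega> + I j l \<omega>) \<partial>M)"
    using hm Pint Iint pw by (intro order.trans[OF integral_abs_bound integral_mono]) auto
  also have "\<dots> = (m4 + \<sigma>2\<^sup>2) * (coalesce_prob i k + coalesce_prob i l + coalesce_prob j k + coalesce_prob j l)"
  proof -
    have "(\<integral>\<omega>. I x y \<omega> \<partial>M) = coalesce_prob x y" for x y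
      by (simp add: I_def coalesce_prob_def Int_absorb2)
    then show ?thesis using Iint by simp
  qed
  finally show ?thesis unfolding E P_def .
qed

text \<open>
  Given the graph, the expectation \<open>H j\<close> of \<open>G * Y j\<close> depends for \<open>j < k\<close> only on the partition of the
  vertices to the left of \<open>k\<close>, hence only on the jumps to the left of \<open>k\<close>. As \<open>k\<close> has the colour of
  \<open>k - R k\<close>, integrating out the independent jump \<open>R k\<close> gives the claim.
\<close>

theorem urn_identity:
  fixes G :: "(int \<Rightarrow> real) \<Rightarrow> complex"
  assumes m [measurable]: "G \<in> borel_measurable colour_space" and bd: "\<And>y. cmod (G y) \<le> 1"
    and dep: "\<And>y y'. (\<And>i. i < k \<Longrightarrow> y i = y' i) \<Longrightarrow> G y = G y'"
  shows "(\<integral>\<omega>. G (process \<omega>) * complex_of_real (Y k \<omega>) \<partial>M)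
    = (\<integral>m. (\<integral>\<omega>. G (process \<omega>) * complex_of_real (Y (k - int m) \<omega>) \<partial>M) \<partial>measure_pmf \<mu>)"
proof -
  interpret D: prob_space colour_law by (rule prob_space_colour_law)
  have int: "integrable M (\<lambda>\<omega>. G (process \<omega>) * complex_of_real (Y j \<omega>))" for j
    using Y_integrable(1)[of j]
  proof (rule Bochner_Integration.integrable_bound)
    show "AE \<omega> in M. norm (G (process \<omega>) * complex_of_real (Y j \<omega>)) \<le> norm (Y j \<omega>)"
      using bd by (intro AE_I2) (simp add: norm_mult mult_left_le_one_le)
  qed measurable
  define H where "H j r = (\<integral>z. G (painted r z) * complex_of_real (painted r z j) \<partial>colour_law)" for j r
  have Hm: "H j \<in> borel_measurable jump_space" for j
  proof -
    have "(\<lambda>y. G y * complex_of_real (y j)) \<in> borel_measurable colour_space" by measurable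
    from measurable_compose[OF painted_measurable this]
    have "(\<lambda>p. G (painted (fst p) (snd p)) * complex_of_real (painted (fst p) (snd p) j)) \<in> borel_measurable (jump_space \<Otimes>\<^sub>M colour_law)"
      by (simp add: measurable_cong_sets[OF sets_pair_measure_cong[OF refl sets_colour_law] refl])
    then show ?thesis
      unfolding H_def[abs_def] by (intro D.borel_measurable_lebesgue_integral) (simp add: case_prod_beta')
  qed
  have EH: "(\<integral>\<omega>. G (process \<omega>) * complex_of_real (Y j \<omega>) \<partial>M) = (\<integral>\<omega>. H j (jumps \<omega>) \<partial>M)" for j
    unfolding H_def using integral_process[of "\<lambda>y. G y * complex_of_real (y j)"] int[of j]
    by (simp add: process_def)
  have Hint: "integrable M (\<lambda>\<omega>. H j (jumps \<omega>))" for j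
  proof (rule integrable_const_bound)
    show "AE \<omega> in M. norm (H j (jumps \<omega>)) \<le> (\<integral>\<omega>. \<bar>Z 0 \<omega>\<bar> \<partial>M)"
    proof (rule AE_I2)
      fix \<omega>
      define n where "n = name (jumps \<omega>)"
      have "distr colour_law borel (\<lambda>z. z (n j)) = \<nu>" by (rule colour_law_component)
      then have zi: "integrable colour_law (\<lambda>z. z (n j))"
        using moment_transfer[of "\<lambda>z. z (n j)" colour_law 1] by simp
      have "norm (H j (jumps \<omega>)) \<le> (\<integral>z. norm (G (painted (jumps \<omega>) z) * complex_of_real (painted (jumps \<omega>) z j)) \<partial>colour_law)"
        unfolding H_def by (rule integral_norm_bound)
      also have "\<dots> \<le> (\<integral>z. \<bar>z (n j)\<bar> \<partial>colour_law)"
      proof (rule integral_mono')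
        show "integrable colour_law (\<lambda>z. \<bar>z (n j)\<bar>)" using zi by simp
        show "norm (G (painted (jumps \<omega>) z) * complex_of_real (painted (jumps \<omega>) z j)) \<le> \<bar>z (n j)\<bar>" for z
          using bd by (simp add: norm_mult painted_def n_def mult_left_le_one_le)
      qed simp
      also have "\<dots> = (\<integral>x. \<bar>x\<bar> \<partial>distr colour_law borel (\<lambda>z. z (n j)))"
        by (subst integral_distr) auto
      also have "\<dots> = (\<integral>x. \<bar>x\<bar> \<partial>distr M borel (Z 0))" by (simp only: colour_law_component Z_distr)
      also have "\<dots> = (\<integral>\<omega>. \<bar>Z 0 \<omega>\<bar> \<partial>M)" by (subst integral_distr) auto
      finally show "norm (H j (jumps \<omega>)) \<le> (\<integral>\<omega>. \<bar>Z 0 \<omega>\<bar> \<partial>M)" .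
    qed
    show "(\<lambda>\<omega>. H j (jumps \<omega>)) \<in> borel_measurable M" using Hm by measurable
  qed
  have Hcut: "H j (cut k r) = H j r" if "j < k" for j r
    unfolding H_def painted_def
  proof (rule colour_integral_cong[where A="{..<k}" and \<Phi>="\<lambda>y. G y * complex_of_real (y j)"])
    show "(\<lambda>y. G y * complex_of_real (y j)) \<in> borel_measurable colour_space" by measurable
    show "G y * complex_of_real (y j) = G y' * complex_of_real (y' j)"
      if "\<And>i. i \<in> {..<k} \<Longrightarrow> y i = y' i" for y y'
      using that \<open>j < k\<close> dep[of y y'] by auto
    fix i i' assume i: "i \<in> {..<k}" "i' \<in> {..<k}"
    have "meet_above a (cut k r) i i' \<longleftrightarrow> meet_above a r i i'" for a
      using i by (intro meet_above_cong) (auto simp: cut_def)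
    then show "name (cut k r) i = name (cut k r) i' \<longleftrightarrow> name r i = name r i'"
      unfolding name_eq_iff coalesce_iff_meet_above by simp
  qed
  have Hstep: "H k r = H (k - int (r k)) r" for r
  proof -
    have "coalesce r k (jump r k)"
      unfolding coalesce_def using ancestral_line_unfold[of r k] ancestral_line_self[of "jump r k" r] by auto
    then have "name r k = name r (k - int (r k))" unfolding name_eq_iff jump_def .
    then show ?thesis by (simp add: H_def painted_def)
  qed
  define \<Phi> where "\<Phi> m r = H (k - int m) r" for m r
  have ae: "AE \<omega> in M. H k (jumps \<omega>) = \<Phi> (R k \<omega>) (cut k (jumps \<omega>))"
    using AE_R_pos[of k] by eventually_elim (simp add: \<Phi>_def Hcut Hstep[of "jumps _"] jumps_def)
  have m2: "case_prod \<Phi> \<in> borel_measurable (count_space UNIV \<Otimes>\<^sub>M jump_space)"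
    by (rule measurable_pair_measure_countable1) (auto simp: \<Phi>_def Hm)
  have "(\<lambda>\<omega>. (R k \<omega>, cut k (jumps \<omega>))) \<in> measurable M (count_space UNIV \<Otimes>\<^sub>M jump_space)"
    by (intro measurable_Pair R_measurable measurable_compose[OF jumps_measurable cut_measurable])
  from measurable_compose[OF this m2] have m3: "(\<lambda>\<omega>. \<Phi> (R k \<omega>) (cut k (jumps \<omega>))) \<in> borel_measurable M" by simp
  have m4: "(\<lambda>\<omega>. H k (jumps \<omega>)) \<in> borel_measurable M" using Hm by measurable
  have "(\<integral>\<omega>. H k (jumps \<omega>) \<partial>M) = (\<integral>\<omega>. \<Phi> (R k \<omega>) (cut k (jumps \<omega>)) \<partial>M)"
    by (rule integral_cong_AE[OF m4 m3 ae])
  also have "\<dots> = (\<integral>m. (\<integral>\<omega>. \<Phi> m (cut k (jumps \<omega>)) \<partial>M) \<partial>measure_pmf \<mu>)"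
  proof (rule integral_over_jump)
    show "\<Phi> m \<in> borel_measurable jump_space" for m by (simp add: \<Phi>_def[abs_def] Hm)
    show "integrable M (\<lambda>\<omega>. \<Phi> (R k \<omega>) (cut k (jumps \<omega>)))"
      using integrable_cong_AE[OF m4 m3 ae] Hint by simp
  qed
  also have "\<dots> = (\<integral>m. (\<integral>\<omega>. H (k - int m) (jumps \<omega>) \<partial>M) \<partial>measure_pmf \<mu>)"
  proof (rule integral_cong_AE)
    show "AE m in measure_pmf \<mu>. (\<integral>\<omega>. \<Phi> m (cut k (jumps \<omega>)) \<partial>M) = (\<integral>\<omega>. H (k - int m) (jumps \<omega>) \<partial>M)"
      using AE_pmf_pos by eventually_elim (simp add: \<Phi>_def Hcut)
  qed simp_all
  finally show ?thesis unfolding EH .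
qed

end

context coloured_graph
begin

section \<open>Innovations\<close>

definition prediction :: "int \<Rightarrow> 'a \<Rightarrow> real" where
  "prediction k \<omega> = (\<integral>m. Y (k - int m) \<omega> \<partial>measure_pmf \<mu>)"

text \<open>
  The prediction as a function of the colours, so that functions of past innovations are seen to be
  functions of past colours.
\<close>

definition prediction_fun :: "int \<Rightarrow> (int \<Rightarrow> real) \<Rightarrow> real" where
  "prediction_fun k y = (\<integral>m. y (k - int m) \<partial>measure_pmf \<mu>)"

definition innovation :: "int \<Rightarrow> 'a \<Rightarrow> real" where
  "innovation k \<omega> = Y k \<omega> - prediction k \<omega>"

text \<open>
  The variance of an innovation, by \<open>innovation_orthogonal\<close> below.
\<close>

definition \<kappa> :: real where "\<kappa> = \<sigma>2 / overlap \<mu> 0"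

lemma kappa_pos: "0 < \<kappa>"
  unfolding \<kappa>_def using sigma2_pos overlap_0_ge_1 by (intro divide_pos_pos) auto

lemma Y_covariance': "(\<integral>\<omega>. Y i \<omega> * Y j \<omega> \<partial>M) = \<kappa> * overlap \<mu> (i - j)"
  by (simp add: Y_covariance coalesce_prob_eq \<kappa>_def)

lemma prediction_fun_measurable [measurable]: "prediction_fun k \<in> borel_measurable colour_space"
proof -
  have "(\<lambda>p. snd p (k - int (fst p))) \<in> borel_measurable (count_space (UNIV :: nat set) \<Otimes>\<^sub>M colour_space)"
    by (rule measurable_pair_measure_countable1) auto
  then have "(\<lambda>p. snd p (k - int (fst p))) \<in> borel_measurable (measure_pmf \<mu> \<Otimes>\<^sub>M colour_space)"
    by (simp add: measurable_cong_sets[OF sets_pair_measure_cong[OF sets_measure_pmf_count_space refl] refl])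
  from measurable_compose[OF measurable_pair_swap' this]
  have "(\<lambda>(y, m). y (k - int m)) \<in> borel_measurable (colour_space \<Otimes>\<^sub>M measure_pmf \<mu>)"
    by (simp add: case_prod_beta')
  then show ?thesis
    unfolding prediction_fun_def[abs_def] by (rule measure_pmf.borel_measurable_lebesgue_integral)
qed

lemma prediction_eq: "prediction k \<omega> = prediction_fun k (process \<omega>)"
  by (simp add: prediction_def prediction_fun_def process_def)

lemma prediction_measurable [measurable]: "prediction k \<in> borel_measurable M"
  unfolding prediction_eq[abs_def] by measurable

lemma innovation_measurable [measurable]: "innovation k \<in> borel_measurable M"
  unfolding innovation_def[abs_def] by measurable

lemma pair_sigma: "pair_sigma_finite (measure_pmf \<mu>) M"
  by (intro pair_sigma_finite.intro) unfold_locales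

lemma shifted_measurable:
  fixes f :: "nat \<Rightarrow> 'a \<Rightarrow> 'c::{banach, second_countable_topology}"
  assumes "\<And>m. f m \<in> borel_measurable M"
  shows "case_prod f \<in> borel_measurable (measure_pmf \<mu> \<Otimes>\<^sub>M M)"
proof -
  have "case_prod f \<in> borel_measurable (count_space UNIV \<Otimes>\<^sub>M M)"
    by (rule measurable_pair_measure_countable1) (auto simp: assms)
  then show ?thesis
    by (simp add: measurable_cong_sets[OF sets_pair_measure_cong[OF sets_measure_pmf_count_space refl] refl])
qed

lemma shifted_fubini:
  fixes f :: "nat \<Rightarrow> 'a \<Rightarrow> 'c::{banach, second_countable_topology}"
  assumes m: "\<And>m. f m \<in> borel_measurable M" and i: "\<And>m. integrable M (f m)"
    and b: "\<And>m. (\<integral>\<omega>. norm (f m \<omega>) \<partial>M) \<le> B"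
  shows "AE \<omega> in M. integrable (measure_pmf \<mu>) (\<lambda>m. f m \<omega>)"
    "integrable M (\<lambda>\<omega>. \<integral>m. f m \<omega> \<partial>measure_pmf \<mu>)"
    "(\<integral>\<omega>. (\<integral>m. f m \<omega> \<partial>measure_pmf \<mu>) \<partial>M) = (\<integral>m. (\<integral>\<omega>. f m \<omega> \<partial>M) \<partial>measure_pmf \<mu>)"
proof -
  interpret pair_sigma_finite "measure_pmf \<mu>" M by (rule pair_sigma)
  have int: "integrable (measure_pmf \<mu> \<Otimes>\<^sub>M M) (case_prod f)"
  proof (rule Fubini_integrable[OF shifted_measurable[OF m]])
    show "integrable (measure_pmf \<mu>) (\<lambda>m. \<integral>\<omega>. norm (case_prod f (m, \<omega>)) \<partial>M)"
      using b by (intro measure_pmf.integrable_const_bound[of _ B]) auto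
  qed (simp add: i)
  show "AE \<omega> in M. integrable (measure_pmf \<mu>) (\<lambda>m. f m \<omega>)" by (rule AE_integrable_snd[OF int])
  show "integrable M (\<lambda>\<omega>. \<integral>m. f m \<omega> \<partial>measure_pmf \<mu>)" by (rule integrable_snd[OF int])
  show "(\<integral>\<omega>. (\<integral>m. f m \<omega> \<partial>measure_pmf \<mu>) \<partial>M) = (\<integral>m. (\<integral>\<omega>. f m \<omega> \<partial>M) \<partial>measure_pmf \<mu>)"
    by (rule Fubini_integral[OF int])
qed

lemma AE_Y4: "AE \<omega> in M. integrable (measure_pmf \<mu>) (\<lambda>m. Y (k - int m) \<omega> ^ 4)"
  and integrable_Y4_avg: "integrable M (\<lambda>\<omega>. \<integral>m. Y (k - int m) \<omega> ^ 4 \<partial>measure_pmf \<mu>)"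
  and Y4_avg: "(\<integral>\<omega>. (\<integral>m. Y (k - int m) \<omega> ^ 4 \<partial>measure_pmf \<mu>) \<partial>M) = m4"
  using shifted_fubini[of "\<lambda>m \<omega>. Y (k - int m) \<omega> ^ 4" m4] by (simp_all add: Y_integrable Y_4)

lemma prediction_4: "integrable M (\<lambda>\<omega>. prediction k \<omega> ^ 4)" "(\<integral>\<omega>. prediction k \<omega> ^ 4 \<partial>M) \<le> m4"
proof -
  have ae: "AE \<omega> in M. prediction k \<omega> ^ 4 \<le> (\<integral>m. Y (k - int m) \<omega> ^ 4 \<partial>measure_pmf \<mu>)"
    using AE_Y4[of k] by eventually_elim (simp add: prediction_def measure_pmf.fourth_moment_inequalities(4))
  show i: "integrable M (\<lambda>\<omega>. prediction k \<omega> ^ 4)"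
  proof (rule Bochner_Integration.integrable_bound[OF integrable_Y4_avg[of k]])
    show "AE \<omega> in M. norm (prediction k \<omega> ^ 4) \<le> norm (\<integral>m. Y (k - int m) \<omega> ^ 4 \<partial>measure_pmf \<mu>)"
      using ae by eventually_elim simp
  qed measurable
  show "(\<integral>\<omega>. prediction k \<omega> ^ 4 \<partial>M) \<le> m4"
    using integral_mono_AE[OF i integrable_Y4_avg[of k] ae] by (simp add: Y4_avg)
qed

lemma prediction_2: "integrable M (\<lambda>\<omega>. (prediction k \<omega>)\<^sup>2)" "integrable M (prediction k)"
  using fourth_moment_inequalities[OF prediction_measurable prediction_4(1)] by auto

lemma fourth_power_diff_le: "(x - y) ^ 4 \<le> 8 * (x ^ 4 + y ^ 4 :: real)"
proof -
  have h: "(a - b)\<^sup>2 \<le> 2 * (a\<^sup>2 + b\<^sup>2)" for a b :: real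
    using zero_le_power2[of "a + b"] by (simp add: power2_eq_square algebra_simps)
  have h': "(a + b)\<^sup>2 \<le> 2 * (a\<^sup>2 + b\<^sup>2)" for a b :: real using h[of a "- b"] by simp
  have "((x - y)\<^sup>2)\<^sup>2 \<le> (2 * (x\<^sup>2 + y\<^sup>2))\<^sup>2" using h by (intro power_mono) auto
  also have "\<dots> = 4 * (x\<^sup>2 + y\<^sup>2)\<^sup>2" by (simp only: power_mult_distrib) simp
  also have "\<dots> \<le> 4 * (2 * ((x\<^sup>2)\<^sup>2 + (y\<^sup>2)\<^sup>2))" using h'[of "x\<^sup>2" "y\<^sup>2"] by simp
  finally show ?thesis by (simp flip: power_mult)
qed

lemma innovation_4: "integrable M (\<lambda>\<omega>. innovation k \<omega> ^ 4)" "(\<integral>\<omega>. innovation k \<omega> ^ 4 \<partial>M) \<le> 16 * m4"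
proof -
  have b: "integrable M (\<lambda>\<omega>. 8 * (Y k \<omega> ^ 4 + prediction k \<omega> ^ 4))"
    using Y_integrable prediction_4 by simp
  show i: "integrable M (\<lambda>\<omega>. innovation k \<omega> ^ 4)"
    by (rule Bochner_Integration.integrable_bound[OF b]) (use fourth_power_diff_le in \<open>auto simp: innovation_def\<close>)
  have "(\<integral>\<omega>. innovation k \<omega> ^ 4 \<partial>M) \<le> (\<integral>\<omega>. 8 * (Y k \<omega> ^ 4 + prediction k \<omega> ^ 4) \<partial>M)"
    using i b fourth_power_diff_le by (intro integral_mono) (auto simp: innovation_def)
  also have "\<dots> = 8 * (m4 + (\<integral>\<omega>. prediction k \<omega> ^ 4 \<partial>M))"
    using Y_integrable prediction_4 by (simp add: Y_4)
  also have "\<dots> \<le> 16 * m4" using prediction_4(2)[of k] by simp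
  finally show "(\<integral>\<omega>. innovation k \<omega> ^ 4 \<partial>M) \<le> 16 * m4" .
qed

lemma innovation_2: "integrable M (\<lambda>\<omega>. (innovation k \<omega>)\<^sup>2)" "integrable M (innovation k)"
  using fourth_moment_inequalities[OF innovation_measurable innovation_4(1)] by auto

lemma prediction_fubini:
  fixes g :: "'a \<Rightarrow> complex"
  assumes [measurable]: "g \<in> borel_measurable M" and g2: "integrable M (\<lambda>\<omega>. (cmod (g \<omega>))\<^sup>2)"
  shows "(\<integral>\<omega>. g \<omega> * complex_of_real (prediction k \<omega>) \<partial>M) = (\<integral>m. (\<integral>\<omega>. g \<omega> * complex_of_real (Y (k - int m) \<omega>) \<partial>M) \<partial>measure_pmf \<mu>)"
proof -
  have b: "integrable M (\<lambda>\<omega>. (cmod (g \<omega>))\<^sup>2 + (Y j \<omega>)\<^sup>2)" for j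
    using g2 Y_integrable by simp
  have le: "cmod (g \<omega> * complex_of_real (Y j \<omega>)) \<le> (cmod (g \<omega>))\<^sup>2 + (Y j \<omega>)\<^sup>2" for \<omega> j
    using abs_mult_le_squares[of "cmod (g \<omega>)" "Y j \<omega>"] by (simp add: norm_mult abs_mult)
  have i: "integrable M (\<lambda>\<omega>. g \<omega> * complex_of_real (Y j \<omega>))" for j
    by (rule Bochner_Integration.integrable_bound[OF b[of j]]) (use le[of _ j] in \<open>auto intro: order.trans[OF _ abs_ge_self]\<close>)
  have "(\<integral>\<omega>. cmod (g \<omega> * complex_of_real (Y j \<omega>)) \<partial>M) \<le> (\<integral>\<omega>. (cmod (g \<omega>))\<^sup>2 \<partial>M) + \<sigma>2" for j
  proof -
    have "(\<integral>\<omega>. cmod (g \<omega> * complex_of_real (Y j \<omega>)) \<partial>M) \<le> (\<integral>\<omega>. (cmod (g \<omega>))\<^sup>2 + (Y j \<omega>)\<^sup>2 \<partial>M)"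
      using le b[of j] integrable_norm[OF i[of j]] by (intro integral_mono) auto
    then show ?thesis using g2 by (simp add: Y_integrable Y_sq)
  qed
  then have "(\<integral>\<omega>. (\<integral>m. g \<omega> * complex_of_real (Y (k - int m) \<omega>) \<partial>measure_pmf \<mu>) \<partial>M)
     = (\<integral>m. (\<integral>\<omega>. g \<omega> * complex_of_real (Y (k - int m) \<omega>) \<partial>M) \<partial>measure_pmf \<mu>)"
    by (intro shifted_fubini(3)[where B="(\<integral>\<omega>. (cmod (g \<omega>))\<^sup>2 \<partial>M) + \<sigma>2"] i) auto
  then show ?thesis by (simp add: prediction_def)
qed

lemma prediction_fubini_real:
  assumes [measurable]: "g \<in> borel_measurable M" and g2: "integrable M (\<lambda>\<omega>. (g \<omega>)\<^sup>2)"
  shows "(\<integral>\<omega>. prediction k \<omega> * g \<omega> \<partial>M) = (\<integral>m. (\<integral>\<omega>. Y (k - int m) \<omega> * g \<omega> \<partial>M) \<partial>measure_pmf \<mu>)"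
proof -
  have "complex_of_real (\<integral>\<omega>. prediction k \<omega> * g \<omega> \<partial>M) = (\<integral>\<omega>. complex_of_real (g \<omega>) * complex_of_real (prediction k \<omega>) \<partial>M)"
    by (simp add: mult.commute flip: integral_complex_of_real)
  also have "\<dots> = (\<integral>m. (\<integral>\<omega>. complex_of_real (g \<omega>) * complex_of_real (Y (k - int m) \<omega>) \<partial>M) \<partial>measure_pmf \<mu>)"
    using g2 by (intro prediction_fubini) auto
  also have "\<dots> = complex_of_real (\<integral>m. (\<integral>\<omega>. Y (k - int m) \<omega> * g \<omega> \<partial>M) \<partial>measure_pmf \<mu>)"
    by (simp add: mult.commute flip: integral_complex_of_real)
  finally show ?thesis by (simp only: of_real_eq_iff)
qed

text \<open>
  The covariance \<open>\<kappa> * overlap\<close> satisfies the equation of the prediction up to the defect in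
  \<open>overlap_recursion\<close>. Divided by \<open>\<kappa>\<close>, these are the coefficients of \<open>Y j\<close> in its expansion
  into innovations.
\<close>

lemma innovation_Y: "(\<integral>\<omega>. innovation k \<omega> * Y j \<omega> \<partial>M) = \<kappa> * renewal_int \<mu> (j - k)"
proof -
  have i: "integrable M (\<lambda>\<omega>. prediction k \<omega> * Y j \<omega>)"
    by (intro integrable_mult2 prediction_2 Y_integrable) auto
  have "(\<integral>\<omega>. prediction k \<omega> * Y j \<omega> \<partial>M) = (\<integral>m. \<kappa> * overlap \<mu> (k - j - int m) \<partial>measure_pmf \<mu>)"
    by (subst prediction_fubini_real) (auto simp only: Y_integrable Y_measurable Y_covariance' cancel_ab_semigroup_add_class.diff_right_commute[of k _ j])
  also have "\<dots> = \<kappa> * (overlap \<mu> (k - j) - renewal_int \<mu> (j - k))"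
    using overlap_recursion[of "k - j"] by simp
  finally have "(\<integral>\<omega>. prediction k \<omega> * Y j \<omega> \<partial>M) = \<kappa> * (overlap \<mu> (k - j) - renewal_int \<mu> (j - k))" .
  then show ?thesis
    unfolding innovation_def using i integrable_YY[of k j]
    by (simp add: left_diff_distrib Y_covariance' right_diff_distrib)
qed

lemma innovation_orthogonal: "(\<integral>\<omega>. innovation k \<omega> * innovation j \<omega> \<partial>M) = (if j = k then \<kappa> else 0)"
proof -
  have i: "integrable M (\<lambda>\<omega>. prediction j \<omega> * innovation k \<omega>)" "integrable M (\<lambda>\<omega>. innovation k \<omega> * Y j \<omega>)"
    by (intro integrable_mult2 prediction_2 innovation_2 Y_integrable; simp)+
  have "(\<integral>\<omega>. prediction j \<omega> * innovation k \<omega> \<partial>M) = (\<integral>m. \<kappa> * renewal_int \<mu> (j - k - int m) \<partial>measure_pmf \<mu>)"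
    by (subst prediction_fubini_real)
      (auto simp only: innovation_2 innovation_measurable innovation_Y mult.commute[of "Y _ _"] cancel_ab_semigroup_add_class.diff_right_commute[of j _ k])
  also have "\<dots> = \<kappa> * (renewal_int \<mu> (j - k) - (if j = k then 1 else 0))"
    using renewal_int_recursion[of "j - k"] by simp
  finally have p: "(\<integral>\<omega>. prediction j \<omega> * innovation k \<omega> \<partial>M) = \<kappa> * (renewal_int \<mu> (j - k) - (if j = k then 1 else 0))" .
  have "(\<integral>\<omega>. innovation k \<omega> * innovation j \<omega> \<partial>M) = (\<integral>\<omega>. innovation k \<omega> * Y j \<omega> - prediction j \<omega> * innovation k \<omega> \<partial>M)"
    by (intro Bochner_Integration.integral_cong refl) (simp add: innovation_def[of j] algebra_simps)
  also have "\<dots> = \<kappa> * renewal_int \<mu> (j - k) - \<kappa> * (renewal_int \<mu> (j - k) - (if j = k then 1 else 0))"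
    using i p innovation_Y by simp
  finally show ?thesis by (simp add: algebra_simps)
qed

lemma innovation_martingale:
  assumes "finite J" "J \<subseteq> {..<k}"
  shows "(\<integral>\<omega>. iexp (\<Sum>j\<in>J. c j * innovation j \<omega>) * innovation k \<omega> \<partial>M) = 0"
proof -
  define G where "G y = iexp (\<Sum>j\<in>J. c j * (y j - prediction_fun j y))" for y
  have Gm [measurable]: "G \<in> borel_measurable colour_space" unfolding G_def by measurable
  have Gp: "G (process \<omega>) = iexp (\<Sum>j\<in>J. c j * innovation j \<omega>)" for \<omega>
    by (simp add: G_def innovation_def prediction_eq process_def)
  have dep: "G y = G y'" if "\<And>i. i < k \<Longrightarrow> y i = y' i" for y y'
  proof -
    have "prediction_fun j y = prediction_fun j y'" if "j \<in> J" for j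
      unfolding prediction_fun_def using that assms(2) \<open>\<And>i. i < k \<Longrightarrow> y i = y' i\<close>
      by (intro Bochner_Integration.integral_cong refl) fastforce
    then show ?thesis unfolding G_def using that assms(2)
      by (intro arg_cong[where f="\<lambda>x. iexp x"] sum.cong refl) auto
  qed
  have i1: "integrable M (\<lambda>\<omega>. G (process \<omega>) * complex_of_real (Y k \<omega>))"
    by (rule Bochner_Integration.integrable_bound[OF Y_integrable(1)[of k]]) (auto simp: norm_mult G_def)
  have i2: "integrable M (\<lambda>\<omega>. G (process \<omega>) * complex_of_real (prediction k \<omega>))"
    by (rule Bochner_Integration.integrable_bound[OF prediction_2(2)[of k]]) (auto simp: norm_mult G_def)
  have "(\<integral>\<omega>. G (process \<omega>) * complex_of_real (Y k \<omega>) \<partial>M)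
     = (\<integral>m. (\<integral>\<omega>. G (process \<omega>) * complex_of_real (Y (k - int m) \<omega>) \<partial>M) \<partial>measure_pmf \<mu>)"
    by (rule urn_identity[OF Gm _ dep]) (simp_all add: G_def)
  also have "\<dots> = (\<integral>\<omega>. G (process \<omega>) * complex_of_real (prediction k \<omega>) \<partial>M)"
    by (rule prediction_fubini[symmetric]) (auto simp: G_def)
  finally have "(\<integral>\<omega>. G (process \<omega>) * complex_of_real (innovation k \<omega>) \<partial>M) = 0"
    unfolding innovation_def using i1 i2 by (simp add: right_diff_distrib)
  then show ?thesis by (simp add: Gp)
qed

section \<open>Ergodicity of the squared innovations\<close>

text \<open>
  The first event is decided by the jumps up to \<open>max i j\<close>, the second by the jumps from \<open>b\<close> on.
\<close>

lemma meet_above_independent: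
  assumes "max i j < b"
  shows "prob {\<omega> \<in> space M. meet_above a (jumps \<omega>) i j \<and> meet_above b (jumps \<omega>) k l}
    = meet_prob a i j * meet_prob b k l"
proof -
  define ext where "ext B f n = (if n \<in> B then f n else 0)" for B :: "int set" and f :: "int \<Rightarrow> nat" and n
  define B1 where "B1 = {..max i j}"
  define B2 where "B2 = {b..}"
  define S where "S B = PiM B (\<lambda>_. count_space (UNIV :: nat set))" for B :: "int set"
  have ext: "ext B \<in> measurable (S B) jump_space" for B
  proof (rule measurable_PiM_single')
    fix n show "(\<lambda>f. ext B f n) \<in> measurable (S B) (count_space UNIV)"
      unfolding ext_def S_def by (cases "n \<in> B") auto
  qed auto
  define X where "X B \<omega> = restrict (\<lambda>i. R i \<omega>) B" for B \<omega>
  have ind: "indep_var (S B1) (X B1) (S B2) (X B2)"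
    unfolding S_def X_def[abs_def] by (rule indep_var_restrict[OF R_indep]) (use assms in \<open>auto simp: B1_def B2_def\<close>)
  have eq1: "meet_above a (ext B1 (X B1 \<omega>)) i j \<longleftrightarrow> meet_above a (jumps \<omega>) i j" for \<omega>
    by (intro meet_above_cong) (auto simp: ext_def X_def B1_def jumps_def)
  have eq2: "meet_above b (ext B2 (X B2 \<omega>)) k l \<longleftrightarrow> meet_above b (jumps \<omega>) k l" for \<omega>
    by (intro meet_above_cong) (auto simp: ext_def X_def B2_def jumps_def)
  define U1 where "U1 = {f \<in> space (S B1). meet_above a (ext B1 f) i j}"
  define U2 where "U2 = {f \<in> space (S B2). meet_above b (ext B2 f) k l}"
  have U: "U1 \<in> sets (S B1)" "U2 \<in> sets (S B2)"
    unfolding U1_def U2_def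
    using measurable_compose[OF ext measurable_meet_above[of a i j]] measurable_compose[OF ext measurable_meet_above[of b k l]]
    by (simp_all add: pred_def)
  have Xs: "X B \<omega> \<in> space (S B)" for B \<omega> by (auto simp: X_def S_def space_PiM)
  have v: "X B1 -` U1 \<inter> space M = {\<omega> \<in> space M. meet_above a (jumps \<omega>) i j}"
    "X B2 -` U2 \<inter> space M = {\<omega> \<in> space M. meet_above b (jumps \<omega>) k l}"
    "(\<lambda>x. (X B1 x, X B2 x)) -` (U1 \<times> U2) \<inter> space M = {\<omega> \<in> space M. meet_above a (jumps \<omega>) i j \<and> meet_above b (jumps \<omega>) k l}"
    using Xs by (auto simp: U1_def U2_def eq1 eq2)
  show ?thesis using indep_varD[OF ind U] unfolding v meet_prob_def .
qed

text \<open>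
  Meeting within distance \<open>h\<close> is a local event, independent for the two pairs, and has nearly the
  probability of coalescence.
\<close>

lemma coalesce_prob_joint:
  assumes "max (i + p) (i + q) < j - int h"
  shows "\<bar>prob {\<omega> \<in> space M. coalesce (jumps \<omega>) (i + p) (i + q) \<and> coalesce (jumps \<omega>) (j + p) (j + q)} - (coalesce_prob p q)\<^sup>2\<bar>
    \<le> 4 * (coalesce_prob p q - meet_prob (- int h) p q)"
proof -
  define \<rho> where "\<rho> = coalesce_prob p q"
  define t where "t = meet_prob (- int h) p q"
  have cs: "coalesce_prob (x + p) (x + q) = \<rho>" for x
    by (simp add: \<rho>_def coalesce_prob_eq)
  have ts: "meet_prob (x - int h) (x + p) (x + q) = t" for x
    using meet_prob_shift[of "- int h" x p q] by (simp add: t_def add.commute)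
  define E where "E x = {\<omega> \<in> space M. coalesce (jumps \<omega>) (x + p) (x + q)}" for x
  define A where "A x = {\<omega> \<in> space M. meet_above (x - int h) (jumps \<omega>) (x + p) (x + q)}" for x
  have [measurable]: "E x \<in> events" "A x \<in> events" for x unfolding E_def A_def by measurable
  have AE': "A x \<subseteq> E x" for x by (auto simp: A_def E_def coalesce_def meet_above_def)
  have pE: "prob (E x) = \<rho>" "prob (A x) = t" for x
    using cs[of x] ts[of x] by (simp_all add: E_def A_def coalesce_prob_def meet_prob_def)
  have D: "prob (E x - A x) = \<rho> - t" for x
    using finite_measure_Diff[OF _ _ AE', of x] pE by simp
  have pAA: "prob (A i \<inter> A j) = t\<^sup>2"
  proof -
    have "A i \<inter> A j = {\<omega> \<in> space M. meet_above (i - int h) (jumps \<omega>) (i + p) (i + q) \<and> meet_above (j - int h) (jumps \<omega>) (j + p) (j + q)}"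
      by (auto simp: A_def)
    then show ?thesis using meet_above_independent[OF assms, of "i - int h" "j + p" "j + q"] ts by (simp add: power2_eq_square)
  qed
  have "prob (E i \<inter> E j) \<le> prob ((A i \<inter> A j) \<union> ((E i - A i) \<union> (E j - A j)))"
    by (intro finite_measure_mono) auto
  also have "\<dots> \<le> prob (A i \<inter> A j) + (prob (E i - A i) + prob (E j - A j))"
    by (intro order.trans[OF measure_Un_le] add_left_mono measure_Un_le) auto
  finally have up: "prob (E i \<inter> E j) \<le> t\<^sup>2 + 2 * (\<rho> - t)" by (simp add: pAA D)
  have lo: "t\<^sup>2 \<le> prob (E i \<inter> E j)"
    unfolding pAA[symmetric] using AE' by (intro finite_measure_mono) auto
  have t: "0 \<le> t" "t \<le> \<rho>" "\<rho> \<le> 1"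
    using finite_measure_mono[OF AE', of 0] pE by (auto simp: t_def meet_prob_bounds \<rho>_def coalesce_prob_bounds)
  have "\<rho>\<^sup>2 - t\<^sup>2 = (\<rho> + t) * (\<rho> - t)" by (simp add: power2_eq_square algebra_simps)
  also have "\<dots> \<le> 2 * (\<rho> - t)" using t by (intro mult_right_mono) auto
  finally have "\<rho>\<^sup>2 - t\<^sup>2 \<le> 2 * (\<rho> - t)" .
  moreover have "t\<^sup>2 \<le> \<rho>\<^sup>2" using t by (intro power_mono) auto
  ultimately have fin: "\<bar>prob (E i \<inter> E j) - \<rho>\<^sup>2\<bar> \<le> 4 * (\<rho> - t)" using up lo t by linarith
  have eq: "{\<omega> \<in> space M. coalesce (jumps \<omega>) (i + p) (i + q) \<and> coalesce (jumps \<omega>) (j + p) (j + q)} = E i \<inter> E j"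
    by (auto simp: E_def)
  show ?thesis using fin unfolding eq \<rho>_def t_def .
qed

definition pair_product :: "int \<Rightarrow> int \<Rightarrow> int \<Rightarrow> 'a \<Rightarrow> real" where
  "pair_product p q i \<omega> = Y (i + p) \<omega> * Y (i + q) \<omega>"

lemma coalesce_prob_small:
  assumes "0 < e" obtains n where "\<And>x y. int n \<le> \<bar>x - y\<bar> \<Longrightarrow> coalesce_prob x y \<le> e"
proof -
  obtain n where n: "\<And>m. n \<le> m \<Longrightarrow> overlap \<mu> (int m) < e"
    using order_tendstoD(2)[OF overlap_tendsto_0 assms] by (auto simp: eventually_sequentially)
  show ?thesis
  proof
    fix x y :: int assume "int n \<le> \<bar>x - y\<bar>"
    then have "overlap \<mu> (int (nat \<bar>x - y\<bar>)) < e" by (intro n) auto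
    moreover have "overlap \<mu> (int (nat \<bar>x - y\<bar>)) = overlap \<mu> (x - y)"
      using overlap_uminus[of "x - y"] by (cases "0 \<le> x - y") auto
    ultimately show "coalesce_prob x y \<le> e" using coalesce_prob_le_overlap[of x y] by simp
  qed
qed

lemma pair_product_decorrelates:
  assumes "0 < e"
  obtains n where "\<And>i j. int n \<le> \<bar>i - j\<bar> \<Longrightarrow>
    \<bar>(\<integral>\<omega>. pair_product p q i \<omega> * pair_product p q j \<omega> \<partial>M) - (\<sigma>2 * coalesce_prob p q)\<^sup>2\<bar> \<le> e"
proof -
  define C where "C = m4 + \<sigma>2\<^sup>2"
  have C: "0 < C" unfolding C_def using m4_nonneg sigma2_pos by (intro add_nonneg_pos) auto
  obtain n1 where n1: "\<And>x y. int n1 \<le> \<bar>x - y\<bar> \<Longrightarrow> coalesce_prob x y \<le> e / (8 * C)"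
    using coalesce_prob_small[of "e / (8 * C)"] assms C by (metis divide_pos_pos zero_less_mult_iff zero_less_numeral)
  have "\<forall>\<^sub>F h in sequentially. coalesce_prob p q - e / (8 * C) < meet_prob (- int h) p q"
    using assms C by (intro order_tendstoD(1)[OF meet_prob_tendsto]) auto
  then obtain h where h: "coalesce_prob p q - meet_prob (- int h) p q \<le> e / (8 * C)"
    by (auto simp: eventually_sequentially) (metis less_imp_le diff_less_eq add.commute order_refl)
  define n where "n = n1 + h + nat \<bar>p\<bar> + nat \<bar>q\<bar> + 1"
  have main: "\<bar>(\<integral>\<omega>. pair_product p q i \<omega> * pair_product p q j \<omega> \<partial>M) - (\<sigma>2 * coalesce_prob p q)\<^sup>2\<bar> \<le> e"
    if "i + int n \<le> j" for i j
  proof -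
    define P where "P = prob {\<omega> \<in> space M. coalesce (jumps \<omega>) (i + p) (i + q) \<and> coalesce (jumps \<omega>) (j + p) (j + q)}"
    have "\<bar>(\<integral>\<omega>. pair_product p q i \<omega> * pair_product p q j \<omega> \<partial>M) - \<sigma>2\<^sup>2 * P\<bar>
        \<le> C * (coalesce_prob (i + p) (j + p) + coalesce_prob (i + p) (j + q) + coalesce_prob (i + q) (j + p) + coalesce_prob (i + q) (j + q))"
      unfolding pair_product_def P_def C_def by (rule fourfold_correlation)
    also have "\<dots> \<le> C * (e / (8 * C) + e / (8 * C) + e / (8 * C) + e / (8 * C))"
      using C that by (intro mult_left_mono add_mono n1) (auto simp: n_def)
    also have "\<dots> = e / 2" using C by simp
    finally have 1: "\<bar>(\<integral>\<omega>. pair_product p q i \<omega> * pair_product p q j \<omega> \<partial>M) - \<sigma>2\<^sup>2 * P\<bar> \<le> e / 2" .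
    have "\<bar>P - (coalesce_prob p q)\<^sup>2\<bar> \<le> 4 * (coalesce_prob p q - meet_prob (- int h) p q)"
      unfolding P_def using that by (intro coalesce_prob_joint) (auto simp: n_def)
    also have "\<dots> \<le> 4 * (e / (8 * C))" using h by simp
    finally have "\<sigma>2\<^sup>2 * \<bar>P - (coalesce_prob p q)\<^sup>2\<bar> \<le> C * (4 * (e / (8 * C)))"
      using m4_nonneg C by (intro mult_mono) (auto simp: C_def)
    also have "\<dots> = e / 2" using C by simp
    finally have 2: "\<bar>\<sigma>2\<^sup>2 * P - (\<sigma>2 * coalesce_prob p q)\<^sup>2\<bar> \<le> e / 2"
      by (simp add: power_mult_distrib abs_mult flip: right_diff_distrib)
    show ?thesis using 1 2 by linarith
  qed
  show ?thesis
  proof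
    fix i j :: int assume "int n \<le> \<bar>i - j\<bar>"
    then consider "i + int n \<le> j" | "j + int n \<le> i" by linarith
    then show "\<bar>(\<integral>\<omega>. pair_product p q i \<omega> * pair_product p q j \<omega> \<partial>M) - (\<sigma>2 * coalesce_prob p q)\<^sup>2\<bar> \<le> e"
      using main[of i j] main[of j i] by cases (simp_all add: mult.commute)
  qed
qed

lemma pair_product_measurable [measurable]: "pair_product p q i \<in> borel_measurable M"
  unfolding pair_product_def[abs_def] by measurable

lemma pair_product_integrable: "integrable M (pair_product p q i)"
  "integrable M (\<lambda>\<omega>. pair_product p q i \<omega> * pair_product p q j \<omega>)"
  unfolding pair_product_def[abs_def] by (rule integrable_YY integrable_YYYY)+

lemma pair_product_mean: "(\<integral>\<omega>. pair_product p q i \<omega> \<partial>M) = \<sigma>2 * coalesce_prob p q"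
  by (simp add: pair_product_def Y_covariance coalesce_prob_eq)

lemma pair_product_corr_le: "\<bar>\<integral>\<omega>. pair_product p q i \<omega> * pair_product p q j \<omega> \<partial>M\<bar> \<le> m4"
proof -
  have "\<bar>\<integral>\<omega>. pair_product p q i \<omega> * pair_product p q j \<omega> \<partial>M\<bar>
     \<le> (\<integral>\<omega>. (Y (i + p) \<omega> ^ 4 + Y (i + q) \<omega> ^ 4 + Y (j + p) \<omega> ^ 4 + Y (j + q) \<omega> ^ 4) / 4 \<partial>M)"
    using pair_product_integrable abs_mult4_le unfolding pair_product_def
    by (intro order.trans[OF integral_abs_bound integral_mono]) (auto simp: Y_integrable integrable_YYYY)
  also have "\<dots> = m4" by (simp add: Y_integrable Y_4)
  finally show ?thesis .
qed

text \<open>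
  Expanding the square of the sum, pairs of indices at distance at least \<open>n\<close> contribute little by
  \<open>pair_product_decorrelates\<close>, and the close pairs are only about \<open>2 * n * l\<close> many.
\<close>

lemma pair_product_ergodic:
  assumes "0 < e"
  shows "\<forall>\<^sub>F l in sequentially. \<forall>k. (\<integral>\<omega>. \<bar>\<Sum>r<l. pair_product p q (k + int r) \<omega> - \<sigma>2 * coalesce_prob p q\<bar> \<partial>M) \<le> e * real l"
proof -
  define c where "c = \<sigma>2 * coalesce_prob p q"
  define V where "V i j = (\<integral>\<omega>. pair_product p q i \<omega> * pair_product p q j \<omega> \<partial>M) - c\<^sup>2" for i j
  have "0 < e\<^sup>2 / 2" using assms by simp
  from pair_product_decorrelates[OF this, of p q] obtain n where
    "\<And>i j. int n \<le> \<bar>i - j\<bar> \<Longrightarrow> \<bar>(\<integral>\<omega>. pair_product p q i \<omega> * pair_product p q j \<omega> \<partial>M) - (\<sigma>2 * coalesce_prob p q)\<^sup>2\<bar> \<le> e\<^sup>2 / 2"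
    by blast
  then have n: "\<And>i j. int n \<le> \<bar>i - j\<bar> \<Longrightarrow> \<bar>V i j\<bar> \<le> e\<^sup>2 / 2"
    unfolding V_def c_def .
  define B where "B = m4 + c\<^sup>2"
  have B: "0 \<le> B" "\<bar>V i j\<bar> \<le> B" for i j
    using m4_nonneg pair_product_corr_le[of p q i j] zero_le_power2[of c] unfolding B_def V_def
    by linarith+
  have "\<forall>\<^sub>F l in sequentially. 2 * (2 * real n + 1) * B / e\<^sup>2 \<le> real l"
    using filterlim_real_sequentially by (simp add: filterlim_at_top)
  then show ?thesis
    using eventually_gt_at_top[of 0]
  proof eventually_elim
    case (elim l)
    show ?case
    proof
      fix k
      define X where "X \<omega> = (\<Sum>r<l. pair_product p q (k + int r) \<omega> - c)" for \<omega>
      have [measurable]: "X \<in> borel_measurable M" unfolding X_def by measurable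
      have sq: "(X \<omega>)\<^sup>2 = (\<Sum>r<l. \<Sum>s<l. pair_product p q (k + int r) \<omega> * pair_product p q (k + int s) \<omega>
          - c * pair_product p q (k + int r) \<omega> - c * pair_product p q (k + int s) \<omega> + c\<^sup>2)" for \<omega>
        unfolding X_def power2_eq_square sum_product by (simp add: algebra_simps)
      have iX: "integrable M (\<lambda>\<omega>. (X \<omega>)\<^sup>2)"
        unfolding sq using pair_product_integrable by simp
      have "(\<integral>\<omega>. (X \<omega>)\<^sup>2 \<partial>M) = (\<Sum>r<l. \<Sum>s<l. V (k + int r) (k + int s))"
        unfolding sq using pair_product_integrable
        by (simp add: pair_product_mean c_def[symmetric] prob_space V_def power2_eq_square)
      also have "\<dots> \<le> (\<Sum>r<l. (2 * real n + 1) * B + real l * (e\<^sup>2 / 2))"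
      proof (rule sum_mono)
        fix r assume "r \<in> {..<l}"
        define N where "N = {s \<in> {..<l}. \<bar>int r - int s\<bar> < int n}"
        have "N \<subseteq> {r - n..r + n}" by (auto simp: N_def)
        then have "card N \<le> card {r - n..r + n}" by (intro card_mono) auto
        also have "\<dots> \<le> 2 * n + 1" by simp
        finally have cN: "real (card N) \<le> 2 * real n + 1" by linarith
        have "(\<Sum>s<l. V (k + int r) (k + int s)) \<le> (\<Sum>s<l. (if s \<in> N then B else 0) + e\<^sup>2 / 2)"
        proof (rule sum_mono)
          fix s assume s: "s \<in> {..<l}"
          show "V (k + int r) (k + int s) \<le> (if s \<in> N then B else 0) + e\<^sup>2 / 2"
          proof (cases "s \<in> N")
            case True
            then show ?thesis using B(2)[of "k + int r" "k + int s"] by (simp add: add_increasing2 abs_le_iff)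
          next
            case False
            then have "int n \<le> \<bar>(k + int r) - (k + int s)\<bar>" using s by (auto simp: N_def)
            then show ?thesis using n[of "k + int r" "k + int s"] False by (simp add: abs_le_iff)
          qed
        qed
        also have "\<dots> = real (card N) * B + real l * (e\<^sup>2 / 2)"
          by (simp add: sum.distrib N_def flip: sum.inter_filter)
        also have "\<dots> \<le> (2 * real n + 1) * B + real l * (e\<^sup>2 / 2)"
          using cN B(1) by (intro add_mono mult_right_mono) auto
        finally show "(\<Sum>s<l. V (k + int r) (k + int s)) \<le> (2 * real n + 1) * B + real l * (e\<^sup>2 / 2)" .
      qed
      also have "\<dots> = real l * ((2 * real n + 1) * B + real l * (e\<^sup>2 / 2))" by simp
      also have "\<dots> \<le> real l * (real l * e\<^sup>2 / 2 + real l * (e\<^sup>2 / 2))"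
      proof -
        have "(2 * real n + 1) * B \<le> real l * e\<^sup>2 / 2" using elim(1) assms by (simp add: field_simps)
        then show ?thesis by (intro mult_left_mono add_right_mono) auto
      qed
      also have "\<dots> = (e * real l)\<^sup>2" by (simp add: power2_eq_square)
      finally have "(expectation (\<lambda>\<omega>. \<bar>X \<omega>\<bar>))\<^sup>2 \<le> (e * real l)\<^sup>2"
        using second_moment_inequalities(2)[OF _ iX] by simp
      then have "expectation (\<lambda>\<omega>. \<bar>X \<omega>\<bar>) \<le> e * real l"
        by (rule power2_le_imp_le) (use assms in simp)
      then show "(\<integral>\<omega>. \<bar>\<Sum>r<l. pair_product p q (k + int r) \<omega> - \<sigma>2 * coalesce_prob p q\<bar> \<partial>M) \<le> e * real l"
        by (simp add: X_def c_def)
    qed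
  qed
qed

definition truncated_weight :: "nat \<Rightarrow> real" where
  "truncated_weight m = (if m = 0 then 1 else - pmf \<mu> m)"

text \<open>
  Only finitely many colours enter, so that the square is a finite combination of pair products.
\<close>

definition truncated_innovation :: "nat \<Rightarrow> int \<Rightarrow> 'a \<Rightarrow> real" where
  "truncated_innovation K k \<omega> = (\<Sum>m\<le>K. truncated_weight m * Y (k - int m) \<omega>)"

lemma truncated_weight_le: "\<bar>truncated_weight m\<bar> \<le> 1"
  by (simp add: truncated_weight_def pmf_le_1)

lemma truncated_innovation_measurable [measurable]: "truncated_innovation K k \<in> borel_measurable M"
  unfolding truncated_innovation_def[abs_def] by measurable

text \<open>
  The remainder is an average over the jumps longer than \<open>K\<close>; apply Jensen's inequality.
\<close>

lemma truncation_remainder: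
  "AE \<omega> in M. (innovation k \<omega> - truncated_innovation K k \<omega>)\<^sup>2
     \<le> (\<integral>m. indicator {Suc K..} m * (Y (k - int m) \<omega>)\<^sup>2 \<partial>measure_pmf \<mu>)"
  using AE_Y4[of k]
proof eventually_elim
  case (elim \<omega>)
  define f where "f m = Y (k - int m) \<omega>" for m
  define g where "g m = indicator {Suc K..} m * f m" for m
  have f4: "integrable (measure_pmf \<mu>) (\<lambda>m. f m ^ 4)" using elim by (simp add: f_def)
  have g4: "integrable (measure_pmf \<mu>) (\<lambda>m. g m ^ 4)"
    by (rule Bochner_Integration.integrable_bound[OF f4]) (auto simp: g_def split: split_indicator)
  note f = measure_pmf.fourth_moment_inequalities[OF _ f4, simplified] and g = measure_pmf.fourth_moment_inequalities[OF _ g4, simplified]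
  have h: "(\<integral>m. f m - g m \<partial>measure_pmf \<mu>) = (\<Sum>m\<in>{..K}. (f m - g m) * pmf \<mu> m)"
  proof (rule integral_measure_pmf_real)
    fix m assume "f m - g m \<noteq> 0"
    then show "m \<in> {..K}" by (cases "Suc K \<le> m") (auto simp: g_def)
  qed simp
  have "prediction k \<omega> = (\<integral>m. f m - g m \<partial>measure_pmf \<mu>) + (\<integral>m. g m \<partial>measure_pmf \<mu>)"
    using f(1) g(1) by (simp add: prediction_def f_def[abs_def])
  also have "(\<integral>m. f m - g m \<partial>measure_pmf \<mu>) = (\<Sum>m\<le>K. pmf \<mu> m * f m)"
    unfolding h by (intro sum.cong refl) (auto simp: g_def)
  also have "(\<Sum>m\<le>K. pmf \<mu> m * f m) = Y k \<omega> - truncated_innovation K k \<omega>"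
  proof -
    have "{..K} = insert 0 {1..K}" by auto
    then show ?thesis
      by (simp add: truncated_innovation_def truncated_weight_def f_def sum_negf)
  qed
  finally have "innovation k \<omega> - truncated_innovation K k \<omega> = - (\<integral>m. g m \<partial>measure_pmf \<mu>)"
    by (simp add: innovation_def)
  then have "(innovation k \<omega> - truncated_innovation K k \<omega>)\<^sup>2 \<le> (\<integral>m. (g m)\<^sup>2 \<partial>measure_pmf \<mu>)"
    using g(3) by simp
  also have "(\<lambda>m. (g m)\<^sup>2) = (\<lambda>m. indicator {Suc K..} m * (f m)\<^sup>2)"
    by (auto simp: g_def fun_eq_iff power_mult_distrib split: split_indicator)
  finally show ?case by (simp add: f_def)
qed

lemma truncated_innovation_2: "integrable M (\<lambda>\<omega>. (truncated_innovation K k \<omega>)\<^sup>2)"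
proof -
  have "(\<lambda>\<omega>. (truncated_innovation K k \<omega>)\<^sup>2)
     = (\<lambda>\<omega>. \<Sum>m\<le>K. \<Sum>m'\<le>K. truncated_weight m * truncated_weight m' * (Y (k - int m) \<omega> * Y (k - int m') \<omega>))"
    by (simp add: truncated_innovation_def power2_eq_square sum_product fun_eq_iff mult_ac)
  then show ?thesis using integrable_YY by simp
qed

lemma integrable_truncation_diff_sq:
  "integrable M (\<lambda>\<omega>. (innovation k \<omega> - truncated_innovation K k \<omega>)\<^sup>2)"
proof (rule Bochner_Integration.integrable_bound[where f="\<lambda>\<omega>. 2 * ((innovation k \<omega>)\<^sup>2 + (truncated_innovation K k \<omega>)\<^sup>2)"])
  show "integrable M (\<lambda>\<omega>. 2 * ((innovation k \<omega>)\<^sup>2 + (truncated_innovation K k \<omega>)\<^sup>2))"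
    using innovation_2 truncated_innovation_2 by simp
  have "(x - y)\<^sup>2 \<le> 2 * (x\<^sup>2 + y\<^sup>2)" for x y :: real
    using zero_le_power2[of "x + y"] by (simp add: power2_eq_square algebra_simps)
  then show "AE \<omega> in M. norm ((innovation k \<omega> - truncated_innovation K k \<omega>)\<^sup>2)
      \<le> norm (2 * ((innovation k \<omega>)\<^sup>2 + (truncated_innovation K k \<omega>)\<^sup>2))" by simp
qed measurable

lemma truncation_error_sq:
  "(\<integral>\<omega>. (innovation k \<omega> - truncated_innovation K k \<omega>)\<^sup>2 \<partial>M) \<le> \<sigma>2 * tail (real (Suc K))"
proof -
  have i: "integrable M (\<lambda>\<omega>. indicator {Suc K..} m * (Y (k - int m) \<omega>)\<^sup>2)" for m
    using Y_integrable by simp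
  have b: "(\<integral>\<omega>. norm (indicator {Suc K..} m * (Y (k - int m) \<omega>)\<^sup>2) \<partial>M) \<le> \<sigma>2" for m
    using sigma2_pos by (auto simp: Y_sq split: split_indicator)
  note F = shifted_fubini[of "\<lambda>m \<omega>. indicator {Suc K..} m * (Y (k - int m) \<omega>)\<^sup>2", OF _ i b]
  have "(\<integral>\<omega>. (innovation k \<omega> - truncated_innovation K k \<omega>)\<^sup>2 \<partial>M)
     \<le> (\<integral>\<omega>. (\<integral>m. indicator {Suc K..} m * (Y (k - int m) \<omega>)\<^sup>2 \<partial>measure_pmf \<mu>) \<partial>M)"
    using F(2) by (intro integral_mono_AE integrable_truncation_diff_sq truncation_remainder) simp
  also have "\<dots> = (\<integral>m. (\<integral>\<omega>. indicator {Suc K..} m * (Y (k - int m) \<omega>)\<^sup>2 \<partial>M) \<partial>measure_pmf \<mu>)"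
    by (rule F(3)) simp
  also have "\<dots> = (\<integral>m. indicator {Suc K..} m * \<sigma>2 \<partial>measure_pmf \<mu>)" by (simp add: Y_sq)
  also have "\<dots> = \<sigma>2 * tail (real (Suc K))" unfolding tail_of_nat by simp
  finally show ?thesis .
qed

lemma square_difference_le:
  fixes x y \<delta> :: real
  assumes "0 < \<delta>"
  shows "\<bar>x\<^sup>2 - y\<^sup>2\<bar> \<le> \<delta> * x\<^sup>2 + (1 + 1 / \<delta>) * (x - y)\<^sup>2"
proof -
  define e where "e = x - y"
  have "x\<^sup>2 - y\<^sup>2 = 2 * x * e - e\<^sup>2" by (simp add: e_def power2_eq_square algebra_simps)
  then have "\<bar>x\<^sup>2 - y\<^sup>2\<bar> \<le> 2 * \<bar>x\<bar> * \<bar>e\<bar> + e\<^sup>2"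
    using abs_triangle_ineq4[of "2 * x * e" "e\<^sup>2"] by (simp add: abs_mult)
  moreover have "2 * (sqrt \<delta> * \<bar>x\<bar>) * (\<bar>e\<bar> / sqrt \<delta>) \<le> (sqrt \<delta> * \<bar>x\<bar>)\<^sup>2 + (\<bar>e\<bar> / sqrt \<delta>)\<^sup>2"
    by (rule sum_squares_bound)
  moreover have "2 * (sqrt \<delta> * \<bar>x\<bar>) * (\<bar>e\<bar> / sqrt \<delta>) = 2 * \<bar>x\<bar> * \<bar>e\<bar>" using assms by simp
  moreover have "(sqrt \<delta> * \<bar>x\<bar>)\<^sup>2 + (\<bar>e\<bar> / sqrt \<delta>)\<^sup>2 = \<delta> * x\<^sup>2 + e\<^sup>2 / \<delta>"
    using assms by (simp add: power_mult_distrib power_divide)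
  ultimately have "\<bar>x\<^sup>2 - y\<^sup>2\<bar> \<le> \<delta> * x\<^sup>2 + e\<^sup>2 / \<delta> + e\<^sup>2" by linarith
  then show ?thesis by (simp add: e_def[symmetric] distrib_right)
qed

definition truncated_variance :: "nat \<Rightarrow> real" where
  "truncated_variance K = (\<Sum>m\<le>K. \<Sum>m'\<le>K. truncated_weight m * truncated_weight m' * (\<sigma>2 * coalesce_prob (- int m) (- int m')))"

lemma truncated_innovation_sq:
  "(truncated_innovation K k \<omega>)\<^sup>2
    = (\<Sum>m\<le>K. \<Sum>m'\<le>K. truncated_weight m * truncated_weight m' * pair_product (- int m) (- int m') k \<omega>)"
  by (simp add: truncated_innovation_def pair_product_def power2_eq_square sum_product mult_ac)

lemma truncated_innovation_variance: "(\<integral>\<omega>. (truncated_innovation K k \<omega>)\<^sup>2 \<partial>M) = truncated_variance K"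
  unfolding truncated_innovation_sq truncated_variance_def
  using pair_product_integrable by (simp add: pair_product_mean)

lemma innovation_sq: "(\<integral>\<omega>. (innovation k \<omega>)\<^sup>2 \<partial>M) = \<kappa>"
  using innovation_orthogonal[of k k] by (simp add: power2_eq_square)

lemma truncation_error_abs:
  assumes "0 < e"
  obtains K where "\<And>k. (\<integral>\<omega>. \<bar>(innovation k \<omega>)\<^sup>2 - (truncated_innovation K k \<omega>)\<^sup>2\<bar> \<partial>M) \<le> e"
    "\<bar>truncated_variance K - \<kappa>\<bar> \<le> e"
proof -
  define \<delta> where "\<delta> = e / (2 * \<kappa>)"
  have \<delta>: "0 < \<delta>" "\<delta> * \<kappa> = e / 2" using assms kappa_pos by (auto simp: \<delta>_def)
  have "(\<lambda>K. (1 + 1 / \<delta>) * (\<sigma>2 * tail (real (Suc K)))) \<longlonglongrightarrow> (1 + 1 / \<delta>) * (\<sigma>2 * 0)"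
    by (intro tendsto_mult_left LIMSEQ_Suc tail_tendsto_0)
  then have "\<forall>\<^sub>F K in sequentially. (1 + 1 / \<delta>) * (\<sigma>2 * tail (real (Suc K))) < e / 2"
    using assms by (intro order_tendstoD) auto
  then obtain K where K: "(1 + 1 / \<delta>) * (\<sigma>2 * tail (real (Suc K))) < e / 2"
    by (auto simp: eventually_sequentially)
  have int: "integrable M (\<lambda>\<omega>. \<bar>(innovation k \<omega>)\<^sup>2 - (truncated_innovation K k \<omega>)\<^sup>2\<bar>)" for k
    using innovation_2 truncated_innovation_2 by simp
  have main: "(\<integral>\<omega>. \<bar>(innovation k \<omega>)\<^sup>2 - (truncated_innovation K k \<omega>)\<^sup>2\<bar> \<partial>M) \<le> e" for k
  proof -
    have "(\<integral>\<omega>. \<bar>(innovation k \<omega>)\<^sup>2 - (truncated_innovation K k \<omega>)\<^sup>2\<bar> \<partial>M)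
       \<le> (\<integral>\<omega>. \<delta> * (innovation k \<omega>)\<^sup>2 + (1 + 1 / \<delta>) * (innovation k \<omega> - truncated_innovation K k \<omega>)\<^sup>2 \<partial>M)"
      using int innovation_2 integrable_truncation_diff_sq square_difference_le[OF \<delta>(1)]
      by (intro integral_mono) auto
    also have "\<dots> = \<delta> * \<kappa> + (1 + 1 / \<delta>) * (\<integral>\<omega>. (innovation k \<omega> - truncated_innovation K k \<omega>)\<^sup>2 \<partial>M)"
      using innovation_2 integrable_truncation_diff_sq by (simp add: innovation_sq)
    also have "\<dots> \<le> \<delta> * \<kappa> + (1 + 1 / \<delta>) * (\<sigma>2 * tail (real (Suc K)))"
      using \<delta> by (intro add_left_mono mult_left_mono truncation_error_sq) auto
    also have "\<dots> \<le> e" using K \<delta>(2) by linarith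
    finally show ?thesis .
  qed
  moreover have "\<bar>truncated_variance K - \<kappa>\<bar> \<le> e"
  proof -
    have "truncated_variance K - \<kappa> = - (\<integral>\<omega>. (innovation 0 \<omega>)\<^sup>2 - (truncated_innovation K 0 \<omega>)\<^sup>2 \<partial>M)"
      using innovation_2 truncated_innovation_2 by (simp add: innovation_sq truncated_innovation_variance)
    also have "\<bar>\<dots>\<bar> \<le> (\<integral>\<omega>. \<bar>(innovation 0 \<omega>)\<^sup>2 - (truncated_innovation K 0 \<omega>)\<^sup>2\<bar> \<partial>M)"
      by (simp add: integral_abs_bound)
    finally show ?thesis using main[of 0] by linarith
  qed
  ultimately show ?thesis by (rule that)
qed

lemma truncated_ergodic:
  assumes "0 < e"
  shows "\<forall>\<^sub>F l in sequentially. \<forall>k. (\<integral>\<omega>. \<bar>\<Sum>r<l. (truncated_innovation K (k + int r) \<omega>)\<^sup>2 - truncated_variance K\<bar> \<partial>M) \<le> e * real l"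
proof -
  define I where "I = {..K} \<times> {..K}"
  define e' where "e' = e / real (card I)"
  have "finite I" "I \<noteq> {}" by (auto simp: I_def)
  then have cI: "0 < real (card I)" by (simp add: card_gt_0_iff)
  then have e': "0 < e'" "real (card I) * e' = e" using assms by (auto simp: e'_def)
  define X where "X z k l \<omega> = (\<Sum>r<l. pair_product (- int (fst z)) (- int (snd z)) (k + int r) \<omega>
      - \<sigma>2 * coalesce_prob (- int (fst z)) (- int (snd z)))" for z k l \<omega>
  have Xi: "integrable M (X z k l)" for z k l
    unfolding X_def using pair_product_integrable by simp
  have "\<forall>\<^sub>F l in sequentially. \<forall>z\<in>I. \<forall>k. (\<integral>\<omega>. \<bar>X z k l \<omega>\<bar> \<partial>M) \<le> e' * real l"
    unfolding X_def using pair_product_ergodic[OF e'(1)] by (intro eventually_ball_finite) (auto simp: I_def)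
  then show ?thesis
  proof eventually_elim
    case (elim l)
    show ?case
    proof
      fix k
      have eq: "(\<Sum>r<l. (truncated_innovation K (k + int r) \<omega>)\<^sup>2 - truncated_variance K)
         = (\<Sum>z\<in>I. truncated_weight (fst z) * truncated_weight (snd z) * X z k l \<omega>)" for \<omega>
      proof -
        have "(truncated_innovation K (k + int r) \<omega>)\<^sup>2 - truncated_variance K
          = (\<Sum>z\<in>I. truncated_weight (fst z) * truncated_weight (snd z) *
              (pair_product (- int (fst z)) (- int (snd z)) (k + int r) \<omega> - \<sigma>2 * coalesce_prob (- int (fst z)) (- int (snd z))))" for r
          unfolding truncated_innovation_sq truncated_variance_def I_def
          by (simp add: sum.cartesian_product case_prod_beta sum_subtractf right_diff_distrib)
        then show ?thesis unfolding X_def sum_distrib_left by (simp add: sum.swap[of _ "{..<l}"])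
      qed
      have "(\<integral>\<omega>. \<bar>\<Sum>r<l. (truncated_innovation K (k + int r) \<omega>)\<^sup>2 - truncated_variance K\<bar> \<partial>M)
         \<le> (\<integral>\<omega>. (\<Sum>z\<in>I. \<bar>X z k l \<omega>\<bar>) \<partial>M)"
      proof (rule integral_mono)
        show "integrable M (\<lambda>\<omega>. \<bar>\<Sum>r<l. (truncated_innovation K (k + int r) \<omega>)\<^sup>2 - truncated_variance K\<bar>)"
          using truncated_innovation_2 by simp
        show "integrable M (\<lambda>\<omega>. \<Sum>z\<in>I. \<bar>X z k l \<omega>\<bar>)" using Xi by simp
        fix \<omega>
        have "\<bar>truncated_weight (fst z) * truncated_weight (snd z) * X z k l \<omega>\<bar> \<le> 1 * 1 * \<bar>X z k l \<omega>\<bar>" for z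
          unfolding abs_mult by (intro mult_mono truncated_weight_le) auto
        then show "\<bar>\<Sum>r<l. (truncated_innovation K (k + int r) \<omega>)\<^sup>2 - truncated_variance K\<bar> \<le> (\<Sum>z\<in>I. \<bar>X z k l \<omega>\<bar>)"
          unfolding eq by (intro order.trans[OF sum_abs] sum_mono) simp
      qed
      also have "\<dots> = (\<Sum>z\<in>I. \<integral>\<omega>. \<bar>X z k l \<omega>\<bar> \<partial>M)" using Xi by simp
      also have "\<dots> \<le> (\<Sum>z\<in>I. e' * real l)" using elim by (intro sum_mono) auto
      also have "\<dots> = e * real l" by (simp add: e'(2)[symmetric])
      finally show "(\<integral>\<omega>. \<bar>\<Sum>r<l. (truncated_innovation K (k + int r) \<omega>)\<^sup>2 - truncated_variance K\<bar> \<partial>M) \<le> e * real l" .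
    qed
  qed
qed

lemma innovation_sq_ergodic:
  assumes "0 < e"
  shows "\<forall>\<^sub>F l in sequentially. \<forall>k. (\<integral>\<omega>. \<bar>\<Sum>r<l. (innovation (k + int r) \<omega>)\<^sup>2 - \<kappa>\<bar> \<partial>M) \<le> e * real l"
proof -
  have "0 < e / 3" using assms by simp
  from truncation_error_abs[OF this] obtain K where
    K: "\<And>k. (\<integral>\<omega>. \<bar>(innovation k \<omega>)\<^sup>2 - (truncated_innovation K k \<omega>)\<^sup>2\<bar> \<partial>M) \<le> e / 3"
      "\<bar>truncated_variance K - \<kappa>\<bar> \<le> e / 3" by blast
  show ?thesis
    using truncated_ergodic[OF \<open>0 < e / 3\<close>, of K]
  proof eventually_elim
    case (elim l)
    show ?case
    proof
      fix k
      define a where "a r \<omega> = \<bar>(innovation (k + int r) \<omega>)\<^sup>2 - (truncated_innovation K (k + int r) \<omega>)\<^sup>2\<bar>" for r \<omega>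
      define b where "b \<omega> = \<bar>\<Sum>r<l. (truncated_innovation K (k + int r) \<omega>)\<^sup>2 - truncated_variance K\<bar>" for \<omega>
      have ai: "integrable M (a r)" for r unfolding a_def using innovation_2 truncated_innovation_2 by simp
      have bi: "integrable M b" unfolding b_def using truncated_innovation_2 by simp
      have pw: "\<bar>\<Sum>r<l. (innovation (k + int r) \<omega>)\<^sup>2 - \<kappa>\<bar> \<le> (\<Sum>r<l. a r \<omega>) + b \<omega> + real l * (e / 3)" for \<omega>
      proof -
        have "(\<Sum>r<l. (innovation (k + int r) \<omega>)\<^sup>2 - \<kappa>)
          = (\<Sum>r<l. (innovation (k + int r) \<omega>)\<^sup>2 - (truncated_innovation K (k + int r) \<omega>)\<^sup>2)
            + (\<Sum>r<l. (truncated_innovation K (k + int r) \<omega>)\<^sup>2 - truncated_variance K) + real l * (truncated_variance K - \<kappa>)"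
          by (simp add: sum_subtractf algebra_simps)
        moreover have "\<bar>\<Sum>r<l. (innovation (k + int r) \<omega>)\<^sup>2 - (truncated_innovation K (k + int r) \<omega>)\<^sup>2\<bar> \<le> (\<Sum>r<l. a r \<omega>)"
          unfolding a_def by (rule sum_abs)
        moreover have "\<bar>real l * (truncated_variance K - \<kappa>)\<bar> \<le> real l * (e / 3)"
          unfolding abs_mult using K(2) by (intro mult_mono) auto
        ultimately show ?thesis unfolding b_def by linarith
      qed
      have "(\<integral>\<omega>. \<bar>\<Sum>r<l. (innovation (k + int r) \<omega>)\<^sup>2 - \<kappa>\<bar> \<partial>M) \<le> (\<integral>\<omega>. (\<Sum>r<l. a r \<omega>) + b \<omega> + real l * (e / 3) \<partial>M)"
        using ai bi innovation_2 pw by (intro integral_mono) auto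
      also have "\<dots> = (\<Sum>r<l. \<integral>\<omega>. a r \<omega> \<partial>M) + (\<integral>\<omega>. b \<omega> \<partial>M) + real l * (e / 3)"
        using ai bi by (simp add: prob_space)
      also have "\<dots> \<le> (\<Sum>r<l. e / 3) + e / 3 * real l + real l * (e / 3)"
        using K(1) elim unfolding a_def b_def by (intro add_mono sum_mono) auto
      also have "\<dots> = e * real l" by simp
      finally show "(\<integral>\<omega>. \<bar>\<Sum>r<l. (innovation (k + int r) \<omega>)\<^sup>2 - \<kappa>\<bar> \<partial>M) \<le> e * real l" .
    qed
  qed
qed

text \<open>
  The supremum over the position \<open>k\<close> stands in for stationarity.
\<close>

definition ergodic_rate :: "nat \<Rightarrow> real" where
  "ergodic_rate l = (SUP k. (\<integral>\<omega>. \<bar>\<Sum>r<l. (innovation (k + int r) \<omega>)\<^sup>2 - \<kappa>\<bar> \<partial>M) / real l)"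

lemma ergodic_average_le: "(\<integral>\<omega>. \<bar>\<Sum>r<l. (innovation (k + int r) \<omega>)\<^sup>2 - \<kappa>\<bar> \<partial>M) \<le> real l * (2 * \<kappa>)"
proof -
  have "(\<integral>\<omega>. \<bar>\<Sum>r<l. (innovation (k + int r) \<omega>)\<^sup>2 - \<kappa>\<bar> \<partial>M) \<le> (\<integral>\<omega>. (\<Sum>r<l. (innovation (k + int r) \<omega>)\<^sup>2 + \<kappa>) \<partial>M)"
    using innovation_2 kappa_pos
    by (intro integral_mono order.trans[OF sum_abs] sum_mono) (auto simp: abs_le_iff)
  also have "\<dots> = real l * (2 * \<kappa>)"
    using innovation_2 by (simp add: innovation_sq prob_space)
  finally show ?thesis .
qed

sublocale CLT: ergodic_martingale_differences M innovation \<kappa> "16 * m4" ergodic_rate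
proof
  show "expectation (\<lambda>\<omega>. (innovation k \<omega>)\<^sup>2) = \<kappa>" for k by (rule innovation_sq)
  show "(\<integral>\<omega>. iexp (\<Sum>j\<in>J. c j * innovation j \<omega>) * innovation k \<omega> \<partial>M) = 0"
    if "finite J" "J \<subseteq> {..<k}" for k J c using that by (rule innovation_martingale)
  have bdd: "bdd_above (range (\<lambda>k. (\<integral>\<omega>. \<bar>\<Sum>r<l. (innovation (k + int r) \<omega>)\<^sup>2 - \<kappa>\<bar> \<partial>M) / real l))" for l
    using ergodic_average_le[where l=l] kappa_pos by (intro bdd_aboveI2[of _ _ "2 * \<kappa>"]) (simp add: divide_le_eq mult.commute)
  show "expectation (\<lambda>\<omega>. \<bar>\<Sum>r<l. (innovation (k + int r) \<omega>)\<^sup>2 - \<kappa>\<bar>) \<le> real l * ergodic_rate l" for k l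
  proof (cases "l = 0")
    case False
    have "(\<integral>\<omega>. \<bar>\<Sum>r<l. (innovation (k + int r) \<omega>)\<^sup>2 - \<kappa>\<bar> \<partial>M) / real l \<le> ergodic_rate l"
      unfolding ergodic_rate_def by (rule cSUP_upper[OF _ bdd]) simp
    then show ?thesis using False by (simp add: divide_le_eq mult.commute)
  qed simp
  show "ergodic_rate \<longlonglongrightarrow> 0"
  proof (rule LIMSEQ_I)
    fix e :: real assume "0 < e"
    then have "0 < e / 2" by simp
    have "\<forall>\<^sub>F l in sequentially. norm (ergodic_rate l - 0) < e"
      using innovation_sq_ergodic[OF \<open>0 < e / 2\<close>] eventually_gt_at_top[of 0]
    proof eventually_elim
      case (elim l)
      have "ergodic_rate l \<le> e / 2"
        unfolding ergodic_rate_def using elim by (intro cSUP_least) (auto simp: divide_le_eq mult.commute)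
      moreover have "0 \<le> (\<integral>\<omega>. \<bar>\<Sum>r<l. (innovation (0 + int r) \<omega>)\<^sup>2 - \<kappa>\<bar> \<partial>M) / real l" by simp
      then have "0 \<le> ergodic_rate l"
        unfolding ergodic_rate_def by (rule order.trans[OF _ cSUP_upper[OF _ bdd]]) simp
      ultimately show ?case using \<open>0 < e\<close> by simp
    qed
    then show "\<exists>no. \<forall>l\<ge>no. norm (ergodic_rate l - 0) < e" by (simp add: eventually_sequentially)
  qed
qed (use innovation_4 in auto)

section \<open>Moving averages and covariances of partial sums\<close>

abbreviation "u \<equiv> renewal_int \<mu>"

lemma shifted_overlap_sums: "(\<lambda>l. u (int l - int a) * u (int l - int b)) sums overlap \<mu> (int a - int b)"
proof -
  have "(\<lambda>k. renewal \<mu> k * u (int k + (int a - int b))) sums overlap \<mu> (int a - int b)"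
    unfolding overlap_def by (rule summable_sums[OF summable_overlap])
  then have "(\<lambda>k. u (int (k + a) - int a) * u (int (k + a) - int b)) sums overlap \<mu> (int a - int b)"
    by (simp add: algebra_simps)
  then show ?thesis by (subst (asm) sums_zero_iff_shift) auto
qed

definition moving_average_coeff :: "(nat \<Rightarrow> real) \<Rightarrow> nat \<Rightarrow> int \<Rightarrow> real" where
  "moving_average_coeff a N k = (\<Sum>j=1..N. a j * u (int j - k))"

definition combination :: "(nat \<Rightarrow> real) \<Rightarrow> nat \<Rightarrow> 'a \<Rightarrow> real" where
  "combination a N \<omega> = (\<Sum>j=1..N. a j * Y (int j) \<omega>)"

definition gram :: "(nat \<Rightarrow> real) \<Rightarrow> nat \<Rightarrow> real" where
  "gram a N = (\<Sum>i=1..N. \<Sum>j=1..N. a i * a j * overlap \<mu> (int i - int j))"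

lemma moving_average_coeff_zero: "int N < k \<Longrightarrow> moving_average_coeff a N k = 0"
  unfolding moving_average_coeff_def by (intro sum.neutral) auto

lemma moving_average_coeff_sums: "(\<lambda>l. (moving_average_coeff a N (int N - int l))\<^sup>2) sums gram a N"
proof -
  have "(\<lambda>l. u (int i - (int N - int l)) * u (int j - (int N - int l))) sums overlap \<mu> (int i - int j)"
    if "i \<in> {1..N}" "j \<in> {1..N}" for i j
  proof -
    have "u (int i - (int N - int l)) = u (int l - int (N - i))" "u (int j - (int N - int l)) = u (int l - int (N - j))" for l
      using that by (auto simp: algebra_simps)
    moreover have "overlap \<mu> (int i - int j) = overlap \<mu> (int (N - i) - int (N - j))"
      using that overlap_uminus[of "int i - int j"] by simp
    ultimately show ?thesis using shifted_overlap_sums[of "N - i" "N - j"] by simp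
  qed
  then have "(\<lambda>l. \<Sum>i=1..N. \<Sum>j=1..N. a i * a j * (u (int i - (int N - int l)) * u (int j - (int N - int l)))) sums gram a N"
    unfolding gram_def by (intro sums_sum sums_mult) auto
  then show ?thesis
    by (simp add: moving_average_coeff_def power2_eq_square sum_product mult_ac)
qed

lemma moving_average_energy_tendsto:
  "(\<lambda>h. \<Sum>k=- int h..int N. (moving_average_coeff a N k)\<^sup>2) \<longlonglongrightarrow> gram a N"
proof -
  have "(\<Sum>k=- int h..int N. (moving_average_coeff a N k)\<^sup>2) = (\<Sum>l<Suc (h + N). (moving_average_coeff a N (int N - int l))\<^sup>2)" for h
    by (rule sum.reindex_bij_witness[of _ "\<lambda>l. int N - int l" "\<lambda>k. nat (int N - k)"]) auto
  moreover have "(\<lambda>h. \<Sum>l<h + Suc N. (moving_average_coeff a N (int N - int l))\<^sup>2) \<longlonglongrightarrow> gram a N"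
    using moving_average_coeff_sums[of a N] unfolding sums_def by (rule LIMSEQ_ignore_initial_segment)
  ultimately show ?thesis by simp
qed

lemma moving_average_coeff_tendsto_0: "(\<lambda>h. (moving_average_coeff a N (- int h))\<^sup>2) \<longlonglongrightarrow> 0"
proof -
  have "(\<lambda>l. (moving_average_coeff a N (int N - int (l + N)))\<^sup>2) \<longlonglongrightarrow> 0"
    using LIMSEQ_ignore_initial_segment[OF summable_LIMSEQ_zero[OF sums_summable[OF moving_average_coeff_sums[of a N]]]] .
  then show ?thesis by simp
qed

lemma combination_measurable [measurable]: "combination a N \<in> borel_measurable M"
  unfolding combination_def[abs_def] by measurable

lemma combination_sq: "(\<integral>\<omega>. (combination a N \<omega>)\<^sup>2 \<partial>M) = \<kappa> * gram a N" "integrable M (\<lambda>\<omega>. (combination a N \<omega>)\<^sup>2)"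
proof -
  have eq: "(combination a N \<omega>)\<^sup>2 = (\<Sum>i=1..N. \<Sum>j=1..N. a i * a j * (Y (int i) \<omega> * Y (int j) \<omega>))" for \<omega>
    by (simp add: combination_def power2_eq_square sum_product mult_ac)
  show "integrable M (\<lambda>\<omega>. (combination a N \<omega>)\<^sup>2)" unfolding eq using integrable_YY by simp
  show "(\<integral>\<omega>. (combination a N \<omega>)\<^sup>2 \<partial>M) = \<kappa> * gram a N"
    unfolding eq gram_def using integrable_YY by (simp add: Y_covariance' sum_distrib_left mult_ac)
qed

lemma integrable_innovation_Y: "integrable M (\<lambda>\<omega>. innovation k \<omega> * Y j \<omega>)"
  by (intro integrable_mult2 innovation_2 Y_integrable) auto

lemma integrable_innovations: "integrable M (\<lambda>\<omega>. innovation k \<omega> * innovation j \<omega>)"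
  by (intro integrable_mult2 innovation_2) auto

text \<open>
  The identity behind Bessel's inequality: by \<open>innovation_Y\<close> the \<open>b k\<close> are the coefficients of the
  combination with respect to the orthogonal innovations. As their squares sum to the Gram value
  (\<open>moving_average_energy_tendsto\<close>), the expansion converges in mean square.
\<close>

lemma combination_approximation:
  fixes F :: "int set" and a :: "nat \<Rightarrow> real" and N :: nat
  assumes "finite F"
  defines "b \<equiv> moving_average_coeff a N"
  shows "(\<integral>\<omega>. (combination a N \<omega> - (\<Sum>k\<in>F. b k * innovation k \<omega>))\<^sup>2 \<partial>M) = \<kappa> * (gram a N - (\<Sum>k\<in>F. (b k)\<^sup>2))"
    "integrable M (\<lambda>\<omega>. (combination a N \<omega> - (\<Sum>k\<in>F. b k * innovation k \<omega>))\<^sup>2)"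
proof -
  define c2 where "c2 \<omega> = (\<Sum>k\<in>F. \<Sum>j=1..N. b k * a j * (innovation k \<omega> * Y (int j) \<omega>))" for \<omega>
  define c3 where "c3 \<omega> = (\<Sum>k\<in>F. \<Sum>l\<in>F. b k * b l * (innovation k \<omega> * innovation l \<omega>))" for \<omega>
  have eq: "(combination a N \<omega> - (\<Sum>k\<in>F. b k * innovation k \<omega>))\<^sup>2 = (combination a N \<omega>)\<^sup>2 - 2 * c2 \<omega> + c3 \<omega>" for \<omega>
  proof -
    have "c2 \<omega> = (\<Sum>k\<in>F. b k * innovation k \<omega>) * combination a N \<omega>"
      unfolding c2_def combination_def sum_product by (simp add: mult_ac)
    moreover have "c3 \<omega> = (\<Sum>k\<in>F. b k * innovation k \<omega>)\<^sup>2"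
      unfolding c3_def power2_eq_square sum_product by (simp add: mult_ac)
    ultimately show ?thesis by (simp add: power2_diff algebra_simps)
  qed
  have i2: "integrable M c2" unfolding c2_def using integrable_innovation_Y by simp
  have i3: "integrable M c3" unfolding c3_def using integrable_innovations by simp
  show "integrable M (\<lambda>\<omega>. (combination a N \<omega> - (\<Sum>k\<in>F. b k * innovation k \<omega>))\<^sup>2)"
    unfolding eq using combination_sq i2 i3 by simp
  have "(\<integral>\<omega>. c2 \<omega> \<partial>M) = (\<Sum>k\<in>F. \<Sum>j=1..N. b k * a j * (\<kappa> * u (int j - k)))"
    unfolding c2_def using integrable_innovation_Y by (simp add: innovation_Y)
  also have "\<dots> = \<kappa> * (\<Sum>k\<in>F. (b k)\<^sup>2)"
    unfolding power2_eq_square sum_distrib_left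
    by (intro sum.cong refl) (subst (2) b_def, simp add: moving_average_coeff_def sum_distrib_left mult_ac)
  finally have e2: "(\<integral>\<omega>. c2 \<omega> \<partial>M) = \<kappa> * (\<Sum>k\<in>F. (b k)\<^sup>2)" .
  have "(\<integral>\<omega>. c3 \<omega> \<partial>M) = (\<Sum>k\<in>F. \<Sum>l\<in>F. b k * b l * (if l = k then \<kappa> else 0))"
    unfolding c3_def using integrable_innovations by (simp add: innovation_orthogonal)
  also have "\<dots> = \<kappa> * (\<Sum>k\<in>F. (b k)\<^sup>2)"
    using assms(1) by (simp add: if_distrib sum.delta power2_eq_square sum_distrib_left mult_ac cong: if_cong)
  finally have e3: "(\<integral>\<omega>. c3 \<omega> \<partial>M) = \<kappa> * (\<Sum>k\<in>F. (b k)\<^sup>2)" .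
  show "(\<integral>\<omega>. (combination a N \<omega> - (\<Sum>k\<in>F. b k * innovation k \<omega>))\<^sup>2 \<partial>M) = \<kappa> * (gram a N - (\<Sum>k\<in>F. (b k)\<^sup>2))"
    unfolding eq using combination_sq i2 i3 e2 e3 by (simp add: algebra_simps)
qed

lemma sum_renewal_sq_le:
  assumes "finite F" shows "(\<Sum>k\<in>F. (u (x - k))\<^sup>2) \<le> overlap \<mu> 0"
proof -
  have "(\<Sum>k\<in>F. (u (x - k))\<^sup>2) = (\<Sum>k\<in>F \<inter> {..x}. (u (x - k))\<^sup>2)"
    using assms by (intro sum.mono_neutral_right) (auto simp: renewal_int_def split: if_splits)
  also have "\<dots> = (\<Sum>l\<in>(\<lambda>k. nat (x - k)) ` (F \<inter> {..x}). renewal \<mu> l * u (int l + 0))"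
    by (subst sum.reindex) (auto simp: inj_on_def renewal_int_def power2_eq_square intro!: sum.cong)
  also have "\<dots> \<le> overlap \<mu> 0"
    unfolding overlap_def using assms
    by (intro sum_le_suminf summable_overlap) (auto intro: overlap_term_nonneg)
  finally show ?thesis .
qed

definition psum :: "nat \<Rightarrow> 'a \<Rightarrow> real" where "psum n \<omega> = partial_sum Y n \<omega>"

lemma psum_eq: "psum n \<omega> = combination (\<lambda>_. 1) n \<omega>"
  by (simp add: psum_def partial_sum_def combination_def)

lemma psum_measurable [measurable]: "psum n \<in> borel_measurable M"
  unfolding psum_eq[abs_def] by measurable

definition V :: "nat \<Rightarrow> real" where "V n = (\<integral>\<omega>. (psum n \<omega>)\<^sup>2 \<partial>M)"

lemma psum_2: "integrable M (\<lambda>\<omega>. (psum n \<omega>)\<^sup>2)" "integrable M (psum n)"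
  unfolding psum_eq[abs_def] using combination_sq(2) second_moment_inequalities(1)[OF combination_measurable combination_sq(2)] by auto

lemma V_eq: "V n = \<kappa> * window_energy \<mu> n"
proof -
  have "(\<lambda>l. (window_sum \<mu> n l)\<^sup>2) sums gram (\<lambda>_. 1) n"
  proof -
    have "moving_average_coeff (\<lambda>_. 1) n (int n - int l) = window_sum \<mu> n l" for l
      unfolding moving_average_coeff_def window_sum_def
      by (rule sum.reindex_bij_witness[of _ "\<lambda>j. n - j" "\<lambda>j. n - j"]) (auto simp: algebra_simps)
    then show ?thesis using moving_average_coeff_sums[of "\<lambda>_. 1" n] by simp
  qed
  then have "window_energy \<mu> n = gram (\<lambda>_. 1) n" by (simp add: window_energy_def sums_iff)
  then show ?thesis by (simp add: V_def psum_eq combination_sq)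
qed

lemma V_nonneg: "0 \<le> V n"
  by (simp add: V_def)

lemma psum_increment_sq: "a \<le> b \<Longrightarrow> (\<integral>\<omega>. (psum b \<omega> - psum a \<omega>)\<^sup>2 \<partial>M) = V (b - a)"
proof -
  assume "a \<le> b"
  have d: "psum b \<omega> - psum a \<omega> = (\<Sum>i=1..b-a. Y (int (i + a)) \<omega>)" for \<omega>
  proof -
    have "{1..b} = {1..a} \<union> {a+1..b}" using \<open>a \<le> b\<close> by auto
    then have "psum b \<omega> = psum a \<omega> + (\<Sum>i=a+1..b. Y (int i) \<omega>)"
      unfolding psum_def partial_sum_def by (simp add: sum.union_disjoint)
    moreover have "(\<Sum>i=a+1..b. Y (int i) \<omega>) = (\<Sum>i=1..b-a. Y (int (i + a)) \<omega>)"
      using \<open>a \<le> b\<close> by (intro sum.reindex_bij_witness[of _ "\<lambda>i. i + a" "\<lambda>i. i - a"]) auto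
    ultimately show ?thesis by simp
  qed
  have "(\<integral>\<omega>. (psum b \<omega> - psum a \<omega>)\<^sup>2 \<partial>M) = (\<integral>\<omega>. (\<Sum>i=1..b-a. \<Sum>j=1..b-a. Y (int (i + a)) \<omega> * Y (int (j + a)) \<omega>) \<partial>M)"
    unfolding d by (simp add: power2_eq_square sum_product)
  also have "\<dots> = (\<Sum>i=1..b-a. \<Sum>j=1..b-a. \<kappa> * overlap \<mu> (int i - int j))"
    using integrable_YY by (simp add: Y_covariance')
  also have "\<dots> = V (b - a)"
    by (simp add: V_def psum_eq combination_sq gram_def sum_distrib_left)
  finally show ?thesis .
qed

definition int_dist :: "nat \<Rightarrow> nat \<Rightarrow> nat" where "int_dist a b = (a - b) + (b - a)"

lemma integrable_psum_mult: "integrable M (\<lambda>\<omega>. psum a \<omega> * psum b \<omega>)"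
  by (intro integrable_mult2 psum_2) auto

lemma psum_covariance: "(\<integral>\<omega>. psum a \<omega> * psum b \<omega> \<partial>M) = (V a + V b - V (int_dist a b)) / 2"
proof -
  have "(\<integral>\<omega>. (psum b \<omega> - psum a \<omega>)\<^sup>2 \<partial>M) = V a + V b - 2 * (\<integral>\<omega>. psum a \<omega> * psum b \<omega> \<partial>M)"
  proof -
    have "(psum b \<omega> - psum a \<omega>)\<^sup>2 = (psum a \<omega>)\<^sup>2 + (psum b \<omega>)\<^sup>2 - 2 * (psum a \<omega> * psum b \<omega>)" for \<omega>
      by (simp add: power2_diff algebra_simps)
    then show ?thesis using psum_2 integrable_psum_mult[of a b] by (simp add: V_def)
  qed
  moreover have "(\<integral>\<omega>. (psum b \<omega> - psum a \<omega>)\<^sup>2 \<partial>M) = V (int_dist a b)"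
  proof (cases "a \<le> b")
    case True
    then show ?thesis by (simp add: psum_increment_sq int_dist_def)
  next
    case False
    have "(\<integral>\<omega>. (psum b \<omega> - psum a \<omega>)\<^sup>2 \<partial>M) = (\<integral>\<omega>. (psum a \<omega> - psum b \<omega>)\<^sup>2 \<partial>M)"
      by (simp add: power2_commute)
    then show ?thesis using False by (simp add: psum_increment_sq int_dist_def)
  qed
  ultimately show ?thesis by simp
qed

definition sd :: "nat \<Rightarrow> real" where "sd n = sqrt (V n)"

lemma sd_sq: "(sd n)\<^sup>2 = V n" by (simp add: sd_def V_nonneg)
lemma sd_nonneg: "0 \<le> sd n" by (simp add: sd_def V_nonneg)

lemma V_ratio:
  assumes "(\<lambda>n. real (m n) / real n) \<longlonglongrightarrow> \<tau>" "0 \<le> \<tau>"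
  shows "(\<lambda>n. V (m n) / V n) \<longlonglongrightarrow> \<tau> powr (1 + 2 * \<alpha>)"
  using window_energy_ratio[OF assms] kappa_pos by (simp add: V_eq)

lemma V_at_top: "filterlim V at_top sequentially"
  unfolding V_eq[abs_def]
  by (rule filterlim_tendsto_pos_mult_at_top[OF tendsto_const kappa_pos window_energy_at_top])

lemma inverse_V: "(\<lambda>n. 1 / V n) \<longlonglongrightarrow> 0"
  using tendsto_inverse_0_at_top[OF V_at_top] by (simp add: divide_inverse)

text \<open>
  The exponent is \<open>2 * H\<close> for \<open>H = 1 / 2 + \<alpha>\<close>.
\<close>

definition fbm_cov :: "real \<Rightarrow> real \<Rightarrow> real" where
  "fbm_cov s t = (s powr (1 + 2 * \<alpha>) + t powr (1 + 2 * \<alpha>) - \<bar>t - s\<bar> powr (1 + 2 * \<alpha>)) / 2"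

lemma psum_covariance_limit:
  assumes m: "(\<lambda>n. real (m n) / real n) \<longlonglongrightarrow> s" "0 \<le> s"
    and m': "(\<lambda>n. real (m' n) / real n) \<longlonglongrightarrow> t" "0 \<le> t"
  shows "(\<lambda>n. (\<integral>\<omega>. psum (m n) \<omega> * psum (m' n) \<omega> \<partial>M) / V n) \<longlonglongrightarrow> fbm_cov s t"
proof -
  have "(\<lambda>n. \<bar>real (m' n) / real n - real (m n) / real n\<bar>) \<longlonglongrightarrow> \<bar>t - s\<bar>"
    by (intro tendsto_intros m m')
  moreover have "\<bar>real (m' n) / real n - real (m n) / real n\<bar> = real (int_dist (m n) (m' n)) / real n" for n
  proof -
    have "\<bar>real (m' n) - real (m n)\<bar> = real (int_dist (m n) (m' n))"
      by (cases "m n \<le> m' n") (auto simp: int_dist_def of_nat_diff)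
    then show ?thesis by (simp flip: diff_divide_distrib add: abs_divide)
  qed
  ultimately have "(\<lambda>n. real (int_dist (m n) (m' n)) / real n) \<longlonglongrightarrow> \<bar>t - s\<bar>" by simp
  then have "(\<lambda>n. (V (m n) / V n + V (m' n) / V n - V (int_dist (m n) (m' n)) / V n) / 2) \<longlonglongrightarrow> fbm_cov s t"
    unfolding fbm_cov_def by (intro tendsto_intros V_ratio m m') auto
  then show ?thesis by (simp add: psum_covariance add_divide_distrib diff_divide_distrib mult.commute)
qed

lemma sum_power2_le: "finite I \<Longrightarrow> (\<Sum>i\<in>I. f i)\<^sup>2 \<le> real (card I) * (\<Sum>i\<in>I. (f i)\<^sup>2)" for f :: "'i \<Rightarrow> real"
  using sum_squared_le_sum_of_squares[of f I] by (cases "I = {}") (auto simp: mult.commute)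

text \<open>
  The combination is a moving average of innovations, to which \<open>central_limit\<close> applies. Consecutive
  weights differ by \<open>c i / sd n\<close> times differences of two renewal probabilities, whose squares are
  summable; the square variation is thus of order \<open>1 / V n\<close>.
\<close>

theorem combination_characteristic_function:
  fixes c :: "'i::finite \<Rightarrow> real" and m :: "'i \<Rightarrow> nat \<Rightarrow> nat" and \<tau> :: "'i \<Rightarrow> real"
  assumes m: "\<And>i. (\<lambda>n. real (m i n) / real n) \<longlonglongrightarrow> \<tau> i" "\<And>i. 0 \<le> \<tau> i"
  shows "(\<lambda>n. \<integral>\<omega>. iexp (\<Sum>i\<in>UNIV. c i * psum (m i n) \<omega> / sd n) \<partial>M)
    \<longlonglongrightarrow> complex_of_real (exp (- (\<Sum>i\<in>UNIV. \<Sum>j\<in>UNIV. c i * c j * fbm_cov (\<tau> i) (\<tau> j)) / 2))"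
proof -
  define v where "v = (\<Sum>i\<in>UNIV. \<Sum>j\<in>UNIV. c i * c j * fbm_cov (\<tau> i) (\<tau> j))"
  define N where "N n = Max (range (\<lambda>i. m i n))" for n
  have mN: "m i n \<le> N n" for i n unfolding N_def by (intro Max_ge) auto
  define a where "a n j = (\<Sum>i\<in>UNIV. if j \<le> m i n then c i / sd n else 0)" for n and j :: nat
  define Tn where "Tn n \<omega> = (\<Sum>i\<in>UNIV. c i * psum (m i n) \<omega> / sd n)" for n \<omega>
  define b where "b n = moving_average_coeff (a n) (N n)" for n
  have restr: "(\<Sum>j=1..N n. (if j \<le> m i n then x else 0) * y j) = x * (\<Sum>j=1..m i n. y j)" for n i x and y :: "nat \<Rightarrow> real"
  proof -
    have "(\<Sum>j=1..N n. (if j \<le> m i n then x else 0) * y j) = (\<Sum>j=1..m i n. x * y j)"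
      using mN[of i n] by (intro sum.mono_neutral_cong_right) auto
    then show ?thesis by (simp add: sum_distrib_left)
  qed
  have T_eq: "Tn n \<omega> = combination (a n) (N n) \<omega>" for n \<omega>
    unfolding combination_def a_def sum_distrib_right
    by (subst sum.swap) (simp add: restr[simplified] Tn_def psum_def partial_sum_def)
  have b_eq: "b n k = (\<Sum>i\<in>UNIV. c i / sd n * (\<Sum>j=1..m i n. u (int j - k)))" for n k
    unfolding b_def moving_average_coeff_def a_def sum_distrib_right
    by (subst sum.swap) (simp add: restr[simplified])
  have var: "(\<lambda>n. \<kappa> * gram (a n) (N n)) \<longlonglongrightarrow> v"
  proof -
    have "(\<lambda>n. \<Sum>i\<in>UNIV. \<Sum>j\<in>UNIV. c i * c j * ((\<integral>\<omega>. psum (m i n) \<omega> * psum (m j n) \<omega> \<partial>M) / V n)) \<longlonglongrightarrow> v"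
      unfolding v_def by (intro tendsto_sum tendsto_mult_left psum_covariance_limit m)
    moreover have "(\<Sum>i\<in>UNIV. \<Sum>j\<in>UNIV. c i * c j * ((\<integral>\<omega>. psum (m i n) \<omega> * psum (m j n) \<omega> \<partial>M) / V n)) = \<kappa> * gram (a n) (N n)" for n
    proof -
      have "\<kappa> * gram (a n) (N n) = (\<integral>\<omega>. (Tn n \<omega>)\<^sup>2 \<partial>M)" unfolding T_eq combination_sq ..
      also have "\<dots> = (\<integral>\<omega>. (\<Sum>i\<in>UNIV. \<Sum>j\<in>UNIV. c i * c j / V n * (psum (m i n) \<omega> * psum (m j n) \<omega>)) \<partial>M)"
        unfolding Tn_def power2_eq_square sum_product
        by (simp add: mult_ac flip: sd_sq power2_eq_square)
      finally show ?thesis using integrable_psum_mult by simp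
    qed
    ultimately show ?thesis by simp
  qed
  \<comment> \<open>The expansion is cut at \<open>- h\<close>; the second condition bounds the jump of the weights at the cut.\<close>
  have "\<exists>h. \<kappa> * (gram (a n) (N n) - (\<Sum>k=- int h..int (N n). (b n k)\<^sup>2)) \<le> 1 / real (Suc n) \<and> (b n (- int h))\<^sup>2 \<le> 1 / real (Suc n)" for n
  proof -
    have "(\<lambda>h. \<kappa> * (gram (a n) (N n) - (\<Sum>k=- int h..int (N n). (b n k)\<^sup>2))) \<longlonglongrightarrow> \<kappa> * (gram (a n) (N n) - gram (a n) (N n))"
      unfolding b_def by (intro tendsto_intros moving_average_energy_tendsto)
    then have "\<forall>\<^sub>F h in sequentially. \<kappa> * (gram (a n) (N n) - (\<Sum>k=- int h..int (N n). (b n k)\<^sup>2)) < 1 / real (Suc n)"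
      by (rule order_tendstoD) simp
    moreover have "\<forall>\<^sub>F h in sequentially. (b n (- int h))\<^sup>2 < 1 / real (Suc n)"
      unfolding b_def by (rule order_tendstoD[OF moving_average_coeff_tendsto_0]) simp
    ultimately have "\<forall>\<^sub>F h in sequentially. \<kappa> * (gram (a n) (N n) - (\<Sum>k=- int h..int (N n). (b n k)\<^sup>2)) \<le> 1 / real (Suc n) \<and> (b n (- int h))\<^sup>2 \<le> 1 / real (Suc n)"
      by eventually_elim simp
    then show ?thesis by (rule eventually_happens'[OF sequentially_bot])
  qed
  then obtain h where h: "\<And>n. \<kappa> * (gram (a n) (N n) - (\<Sum>k=- int (h n)..int (N n). (b n k)\<^sup>2)) \<le> 1 / real (Suc n)"
      "\<And>n. (b n (- int (h n)))\<^sup>2 \<le> 1 / real (Suc n)" by metis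
  define lo where "lo n = - int (h n)" for n
  define hi where "hi n = int (N n)" for n
  define b' where "b' n k = (if k \<in> {lo n..hi n} then b n k else 0)" for n k
  have inv: "(\<lambda>n. 1 / real (Suc n)) \<longlonglongrightarrow> 0" by (rule lim_1_over_n[THEN LIMSEQ_Suc])
  define err where "err n = \<kappa> * (gram (a n) (N n) - (\<Sum>k=lo n..hi n. (b n k)\<^sup>2))" for n
  define Xn where "Xn n \<omega> = (\<Sum>k=lo n..hi n. b n k * innovation k \<omega>)" for n \<omega>
  have errE: "err n = (\<integral>\<omega>. (Tn n \<omega> - Xn n \<omega>)\<^sup>2 \<partial>M)" and erri: "integrable M (\<lambda>\<omega>. (Tn n \<omega> - Xn n \<omega>)\<^sup>2)" for n
    using combination_approximation[of "{lo n..hi n}" "a n" "N n"] unfolding err_def T_eq b_def Xn_def by simp_all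
  have err0: "0 \<le> err n" for n unfolding errE by simp
  have err: "err \<longlonglongrightarrow> 0"
    using h(1) err0 by (intro tendsto_sandwich[OF _ _ tendsto_const inv]) (auto simp: err_def lo_def hi_def)
  have clt: "(\<lambda>n. \<integral>\<omega>. iexp (\<Sum>k=lo n..hi n. b' n k * innovation k \<omega>) \<partial>M) \<longlonglongrightarrow> complex_of_real (exp (- v / 2))"
  proof (rule CLT.central_limit)
    show "lo n \<le> hi n" for n by (simp add: lo_def hi_def)
    show "b' n k = 0" if "k \<notin> {lo n..hi n}" for n k using that by (auto simp: b'_def)
    show "0 < \<kappa>" by (rule kappa_pos)
    have "(\<lambda>n. \<kappa> * gram (a n) (N n) - err n) \<longlonglongrightarrow> v - 0" by (intro tendsto_diff var err)
    moreover have "\<kappa> * gram (a n) (N n) - err n = \<kappa> * (\<Sum>k=lo n..hi n. (b' n k)\<^sup>2)" for n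
      by (simp add: err_def b'_def algebra_simps)
    ultimately show "(\<lambda>n. \<kappa> * (\<Sum>k=lo n..hi n. (b' n k)\<^sup>2)) \<longlonglongrightarrow> v" by simp
    define C where "C = real CARD('i) * (\<Sum>i\<in>UNIV. (c i)\<^sup>2 * (4 * overlap \<mu> 0))"
    have bound: "(\<Sum>k=lo n-1..hi n. (b' n (k + 1) - b' n k)\<^sup>2) \<le> 1 / real (Suc n) + C * (1 / V n)" for n
    proof -
      have diff: "b n (k + 1) - b n k = (\<Sum>i\<in>UNIV. c i / sd n * (u (- k) - u (int (m i n) - k)))" for k
      proof -
        have tele: "(\<Sum>j=1..p. u (int j - (k + 1))) - (\<Sum>j=1..p. u (int j - k)) = u (- k) - u (int p - k)" for p
          by (induction p) (auto simp: algebra_simps)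
        have "b n (k + 1) - b n k = (\<Sum>i\<in>UNIV. c i / sd n * (\<Sum>j=1..m i n. u (int j - (k + 1))) - c i / sd n * (\<Sum>j=1..m i n. u (int j - k)))"
          unfolding b_eq by (rule sum_subtractf[symmetric])
        then show ?thesis by (simp only: right_diff_distrib[symmetric] tele)
      qed
      have sq: "(b n (k + 1) - b n k)\<^sup>2 \<le> real CARD('i) * (\<Sum>i\<in>UNIV. (c i)\<^sup>2 / V n * (2 * (u (0 - k))\<^sup>2 + 2 * (u (int (m i n) - k))\<^sup>2))" for k
      proof -
        have "(b n (k + 1) - b n k)\<^sup>2 \<le> real CARD('i) * (\<Sum>i\<in>UNIV. (c i / sd n * (u (- k) - u (int (m i n) - k)))\<^sup>2)"
          unfolding diff by (rule sum_power2_le) simp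
        also have "\<dots> \<le> real CARD('i) * (\<Sum>i\<in>UNIV. (c i)\<^sup>2 / V n * (2 * (u (0 - k))\<^sup>2 + 2 * (u (int (m i n) - k))\<^sup>2))"
        proof (intro mult_left_mono sum_mono)
          fix i
          have "(x - y)\<^sup>2 \<le> 2 * x\<^sup>2 + 2 * y\<^sup>2" for x y :: real
            using zero_le_power2[of "x + y"] by (simp add: power2_eq_square algebra_simps)
          then have "(c i)\<^sup>2 / V n * (u (- k) - u (int (m i n) - k))\<^sup>2 \<le> (c i)\<^sup>2 / V n * (2 * (u (- k))\<^sup>2 + 2 * (u (int (m i n) - k))\<^sup>2)"
            using V_nonneg by (intro mult_left_mono) auto
          then show "(c i / sd n * (u (- k) - u (int (m i n) - k)))\<^sup>2 \<le> (c i)\<^sup>2 / V n * (2 * (u (0 - k))\<^sup>2 + 2 * (u (int (m i n) - k))\<^sup>2)"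
            by (simp add: power_mult_distrib power_divide sd_sq)
        qed simp
        finally show ?thesis .
      qed
      have bz: "b n (hi n + 1) = 0" unfolding b_def hi_def by (rule moving_average_coeff_zero) simp
      have split: "{lo n - 1..hi n} = insert (lo n - 1) {lo n..hi n}" by (auto simp: lo_def hi_def)
      have "(\<Sum>k=lo n-1..hi n. (b' n (k + 1) - b' n k)\<^sup>2) = (b n (lo n))\<^sup>2 + (\<Sum>k=lo n..hi n. (b n (k + 1) - b n k)\<^sup>2)"
      proof -
        have "b' n (k + 1) - b' n k = b n (k + 1) - b n k" if "k \<in> {lo n..hi n}" for k
          using that bz by (cases "k = hi n") (auto simp: b'_def)
        moreover have "b' n (lo n - 1 + 1) - b' n (lo n - 1) = b n (lo n)" by (simp add: b'_def lo_def hi_def)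
        ultimately show ?thesis unfolding split by simp
      qed
      also have "(b n (lo n))\<^sup>2 \<le> 1 / real (Suc n)" unfolding lo_def by (rule h(2))
      also have "(\<Sum>k=lo n..hi n. (b n (k + 1) - b n k)\<^sup>2)
          \<le> (\<Sum>k=lo n..hi n. real CARD('i) * (\<Sum>i\<in>UNIV. (c i)\<^sup>2 / V n * (2 * (u (0 - k))\<^sup>2 + 2 * (u (int (m i n) - k))\<^sup>2)))"
        by (intro sum_mono sq)
      also have "\<dots> = real CARD('i) * (\<Sum>i\<in>UNIV. (c i)\<^sup>2 / V n * (2 * (\<Sum>k=lo n..hi n. (u (0 - k))\<^sup>2) + 2 * (\<Sum>k=lo n..hi n. (u (int (m i n) - k))\<^sup>2)))"
        unfolding sum_distrib_left[symmetric]
        by (subst sum.swap) (simp add: sum_distrib_left sum.distrib distrib_left)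
      also have "\<dots> \<le> real CARD('i) * (\<Sum>i\<in>UNIV. (c i)\<^sup>2 / V n * (2 * overlap \<mu> 0 + 2 * overlap \<mu> 0))"
        using V_nonneg by (intro mult_left_mono sum_mono add_mono sum_renewal_sq_le) auto
      also have "\<dots> = C * (1 / V n)" by (simp add: C_def sum_distrib_right sum_distrib_left sum_divide_distrib mult_ac)
      finally show ?thesis by simp
    qed
    have lim: "(\<lambda>n. 1 / real (Suc n) + C * (1 / V n)) \<longlonglongrightarrow> 0"
      using tendsto_add[OF inv tendsto_mult_left[OF inverse_V, of C]] by simp
    show "(\<lambda>n. \<Sum>k=lo n-1..hi n. (b' n (k + 1) - b' n k)\<^sup>2) \<longlonglongrightarrow> 0"
      by (rule tendsto_sandwich[OF always_eventually always_eventually tendsto_const lim])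
        (use bound in \<open>auto intro: sum_nonneg\<close>)
  qed
  have b'b: "(\<Sum>k=lo n..hi n. b' n k * innovation k \<omega>) = Xn n \<omega>" for n \<omega>
    by (simp add: Xn_def b'_def)
  have mT [measurable]: "Tn n \<in> borel_measurable M" for n unfolding Tn_def by measurable
  have mU [measurable]: "Xn n \<in> borel_measurable M" for n unfolding Xn_def by measurable
  have close: "cmod ((\<integral>\<omega>. iexp (Tn n \<omega>) \<partial>M) - (\<integral>\<omega>. iexp (Xn n \<omega>) \<partial>M)) \<le> sqrt (err n)" for n
  proof -
    have d: "integrable M (\<lambda>\<omega>. Tn n \<omega> - Xn n \<omega>)" "(\<integral>\<omega>. \<bar>Tn n \<omega> - Xn n \<omega>\<bar> \<partial>M)\<^sup>2 \<le> err n"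
      using second_moment_inequalities[OF _ erri] unfolding errE by auto
    have "cmod ((\<integral>\<omega>. iexp (Tn n \<omega>) \<partial>M) - (\<integral>\<omega>. iexp (Xn n \<omega>) \<partial>M)) \<le> (\<integral>\<omega>. \<bar>Tn n \<omega> - Xn n \<omega>\<bar> \<partial>M)"
      using d(1) by (intro characteristic_difference_le) auto
    also have "\<dots> \<le> sqrt (err n)" using d(2) by (rule real_le_rsqrt)
    finally show ?thesis .
  qed
  have "(\<lambda>n. (\<integral>\<omega>. iexp (Tn n \<omega>) \<partial>M) - (\<integral>\<omega>. iexp (Xn n \<omega>) \<partial>M)) \<longlonglongrightarrow> 0"
    by (rule Lim_null_comparison[OF always_eventually tendsto_real_sqrt[OF err, simplified]]) (use close in auto)
  from Lim_transform[OF clt[unfolded b'b] this] show ?thesis unfolding Tn_def v_def .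
qed

end

section \<open>Convergence of the finite-dimensional distributions\<close>

lemma measurable_vec_lambda:
  fixes X :: "'n::finite \<Rightarrow> 'a \<Rightarrow> real"
  assumes "\<And>i. X i \<in> borel_measurable M"
  shows "(\<lambda>\<omega>. \<chi> i. X i \<omega>) \<in> borel_measurable M"
  by (rule borel_measurable_euclidean_space[THEN iffD2])
    (use assms in \<open>auto simp: Basis_vec_def inner_axis\<close>)

lemma integral_cos_iexp:
  assumes "prob_space M" and [measurable]: "X \<in> borel_measurable M"
  shows "(\<integral>\<omega>. cos (X \<omega> + \<phi>) \<partial>M) = Re (cis \<phi> * (\<integral>\<omega>. iexp (X \<omega>) \<partial>M))"
proof -
  interpret prob_space M by fact
  have i: "integrable M (\<lambda>\<omega>. cis \<phi> * iexp (X \<omega>))"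
    by (intro integrable_mult_right integrable_const_bound[of _ 1]) auto
  have "cos (x + \<phi>) = Re (cis \<phi> * iexp x)" for x
    by (simp add: cos_add flip: cis_conv_exp)
  then have "(\<integral>\<omega>. cos (X \<omega> + \<phi>) \<partial>M) = (\<integral>\<omega>. Re (cis \<phi> * iexp (X \<omega>)) \<partial>M)" by (simp only:)
  also have "\<dots> = Re (\<integral>\<omega>. cis \<phi> * iexp (X \<omega>) \<partial>M)" by (rule integral_Re[OF i])
  finally show ?thesis by (simp only: integral_mult_right_zero)
qed

lemma gaussian_rv_moments:
  assumes "gaussian_rv N W"
  shows "integrable N W" "integrable N (\<lambda>\<omega>. (W \<omega>)\<^sup>2)"
    "(\<integral>\<omega>. W \<omega> \<partial>N) = 0 \<Longrightarrow> (\<integral>\<omega>. iexp (W \<omega>) \<partial>N) = complex_of_real (exp (- (\<integral>\<omega>. (W \<omega>)\<^sup>2 \<partial>N) / 2))"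
proof -
  define S where "S = std_normal_distribution"
  interpret S: real_distribution S unfolding S_def by (rule real_dist_normal_dist)
  obtain m s where [measurable]: "W \<in> borel_measurable N"
    and d: "distr N borel W = distr S borel (\<lambda>x. m + s * x)"
    using assms unfolding gaussian_rv_def S_def by blast
  have tr: "(\<integral>\<omega>. f (W \<omega>) \<partial>N) = (\<integral>x. f (m + s * x) \<partial>S)"
    "integrable N (\<lambda>\<omega>. f (W \<omega>)) = integrable S (\<lambda>x. f (m + s * x))"
    if [measurable]: "f \<in> borel_measurable borel" for f :: "real \<Rightarrow> 'z :: {banach, second_countable_topology}"
  proof -
    have "(\<integral>\<omega>. f (W \<omega>) \<partial>N) = (\<integral>x. f x \<partial>distr N borel W)" by (simp add: integral_distr)
    also have "\<dots> = (\<integral>x. f (m + s * x) \<partial>S)" unfolding d by (simp add: integral_distr)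
    finally show "(\<integral>\<omega>. f (W \<omega>) \<partial>N) = (\<integral>x. f (m + s * x) \<partial>S)" .
    have "integrable N (\<lambda>\<omega>. f (W \<omega>)) = integrable (distr N borel W) f" by (simp add: integrable_distr_eq)
    also have "\<dots> = integrable S (\<lambda>x. f (m + s * x))" unfolding d by (simp add: integrable_distr_eq)
    finally show "integrable N (\<lambda>\<omega>. f (W \<omega>)) = integrable S (\<lambda>x. f (m + s * x))" .
  qed
  have i1: "integrable S (\<lambda>x. x)" and i2: "integrable S (\<lambda>x. x\<^sup>2)"
    using integrable_std_normal_distribution_moment[of 1, folded S_def] integrable_std_normal_distribution_moment[of 2, folded S_def] by simp_all
  have e1: "(\<integral>x. x \<partial>S) = 0" and e2: "(\<integral>x. x\<^sup>2 \<partial>S) = 1"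
    using integral_std_normal_distribution_moment_odd[of 1, folded S_def] std_normal_distribution_even_moments(1)[of 1, folded S_def]
    by (simp_all add: fact_numeral)
  have sq: "(m + s * x)\<^sup>2 = m\<^sup>2 + 2 * m * s * x + s\<^sup>2 * x\<^sup>2" for x
    by (simp add: power2_sum power_mult_distrib)
  have l1: "integrable S (\<lambda>x. m + s * x)"
    by (intro Bochner_Integration.integrable_add integrable_mult_right i1 S.integrable_const)
  have l2: "integrable S (\<lambda>x. (m + s * x)\<^sup>2)"
    unfolding sq by (intro Bochner_Integration.integrable_add integrable_mult_right i1 i2 S.integrable_const)
  show "integrable N W" by (rule tr(2)[of "\<lambda>x. x", THEN iffD2]) (use l1 in auto)
  show "integrable N (\<lambda>\<omega>. (W \<omega>)\<^sup>2)" by (rule tr(2)[of "\<lambda>x. x\<^sup>2", THEN iffD2]) (use l2 in auto)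
  assume "(\<integral>\<omega>. W \<omega> \<partial>N) = 0"
  moreover have "(\<integral>\<omega>. W \<omega> \<partial>N) = (\<integral>x. m + s * x \<partial>S)" by (rule tr(1)[of "\<lambda>x. x"]) simp
  moreover have "(\<integral>x. m + s * x \<partial>S) = m"
    using i1 S.prob_space by (subst Bochner_Integration.integral_add) (auto simp: e1)
  ultimately have "m = 0" by simp
  have "(\<integral>\<omega>. (W \<omega>)\<^sup>2 \<partial>N) = (\<integral>x. (m + s * x)\<^sup>2 \<partial>S)" by (rule tr(1)[of "\<lambda>x. x\<^sup>2"]) simp
  then have v: "(\<integral>\<omega>. (W \<omega>)\<^sup>2 \<partial>N) = s\<^sup>2" by (simp add: \<open>m = 0\<close> power_mult_distrib e2)
  have "(\<integral>\<omega>. iexp (W \<omega>) \<partial>N) = char S s"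
    unfolding char_def by (subst tr(1)) (auto simp: \<open>m = 0\<close>)
  then show "(\<integral>\<omega>. iexp (W \<omega>) \<partial>N) = complex_of_real (exp (- (\<integral>\<omega>. (W \<omega>)\<^sup>2 \<partial>N) / 2))"
    unfolding v S_def char_std_normal_distribution .
qed

context coloured_graph
begin

abbreviation rescaled :: "nat \<Rightarrow> real \<Rightarrow> 'a \<Rightarrow> real" where
  "rescaled \<equiv> rescaled_process M (vertex_colour rep R Z)"

lemma std_dev_sum_eq: "std_dev_sum M (vertex_colour rep R Z) n = sd n"
proof -
  have p: "partial_sum (vertex_colour rep R Z) n = psum n"
    by (auto simp: psum_def partial_sum_def Y_def)
  have "expectation (psum n) = 0"
    unfolding psum_def partial_sum_def by (simp add: Y_integrable Y_mean)
  then show ?thesis unfolding std_dev_sum_def p sd_def V_def by simp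
qed

lemma rescaled_process_eq:
  assumes "0 \<le> t"
  shows "rescaled n t \<omega>
    = (psum (nat \<lfloor>real n * t\<rfloor>) \<omega> + frac (real n * t) * Y (int (Suc (nat \<lfloor>real n * t\<rfloor>))) \<omega>) / sd n"
proof -
  have p: "partial_sum (vertex_colour rep R Z) k \<omega> = psum k \<omega>" for k
    by (simp add: psum_def partial_sum_def Y_def)
  have s: "psum (Suc k) \<omega> = psum k \<omega> + Y (int (Suc k)) \<omega>" for k
    by (simp add: psum_def partial_sum_def)
  show ?thesis
    unfolding rescaled_process_def Let_def std_dev_sum_eq p s by (simp add: algebra_simps)
qed

lemma rescaled_process_measurable:
  assumes "0 \<le> t" shows "rescaled n t \<in> borel_measurable M"
  unfolding rescaled_process_eq[OF assms, abs_def] by measurable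

lemma floor_ratio:
  assumes "0 \<le> t" shows "(\<lambda>n. real (nat \<lfloor>real n * t\<rfloor>) / real n) \<longlonglongrightarrow> t"
proof (rule tendsto_sandwich[OF _ _ _ tendsto_const])
  show "(\<lambda>n. t - 1 / real n) \<longlonglongrightarrow> t"
    using tendsto_diff[OF tendsto_const lim_1_over_n, of t] by simp
  have "real n * t - 1 \<le> real (nat \<lfloor>real n * t\<rfloor>)" "real (nat \<lfloor>real n * t\<rfloor>) \<le> real n * t" for n
    using mult_nonneg_nonneg[OF of_nat_0_le_iff assms, of n] by linarith+
  then show "\<forall>\<^sub>F n in sequentially. t - 1 / real n \<le> real (nat \<lfloor>real n * t\<rfloor>) / real n"
    "\<forall>\<^sub>F n in sequentially. real (nat \<lfloor>real n * t\<rfloor>) / real n \<le> t"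
    by (auto intro!: eventually_sequentiallyI[of 1] simp: field_simps)
qed

lemma inverse_sd: "(\<lambda>n. 1 / sd n) \<longlonglongrightarrow> 0"
  using tendsto_real_sqrt[OF inverse_V] by (simp add: sd_def real_sqrt_divide)

text \<open>
  Interpolation between grid points moves the process by at most one colour divided by \<open>sd n\<close>.
\<close>

lemma rescaled_characteristic_function:
  fixes u t :: "'i::finite \<Rightarrow> real"
  assumes t: "\<And>i. 0 \<le> t i"
  shows "(\<lambda>n. \<integral>\<omega>. iexp (\<Sum>i\<in>UNIV. u i * rescaled n (t i) \<omega>) \<partial>M)
    \<longlonglongrightarrow> complex_of_real (exp (- (\<Sum>i\<in>UNIV. \<Sum>j\<in>UNIV. u i * u j * fbm_cov (t i) (t j)) / 2))"
proof -
  define m where "m i n = nat \<lfloor>real n * t i\<rfloor>" for i n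
  define W where "W n \<omega> = (\<Sum>i\<in>UNIV. u i * rescaled n (t i) \<omega>)" for n \<omega>
  define W' where "W' n \<omega> = (\<Sum>i\<in>UNIV. u i * psum (m i n) \<omega> / sd n)" for n \<omega>
  define y where "y = (\<integral>x. \<bar>x\<bar> \<partial>\<nu>)"
  have [measurable]: "W n \<in> borel_measurable M" "W' n \<in> borel_measurable M" for n
    unfolding W_def[abs_def] W'_def[abs_def] using rescaled_process_measurable[OF t] by auto
  have lim: "(\<lambda>n. \<integral>\<omega>. iexp (W' n \<omega>) \<partial>M) \<longlonglongrightarrow> complex_of_real (exp (- (\<Sum>i\<in>UNIV. \<Sum>j\<in>UNIV. u i * u j * fbm_cov (t i) (t j)) / 2))"
    unfolding W'_def m_def by (rule combination_characteristic_function[OF floor_ratio[OF t] t])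
  have d: "W n \<omega> - W' n \<omega> = (\<Sum>i\<in>UNIV. u i * frac (real n * t i) / sd n * Y (int (Suc (m i n))) \<omega>)" for n \<omega>
    unfolding W_def W'_def rescaled_process_eq[OF t] m_def[symmetric]
    by (simp add: add_divide_distrib distrib_left sum.distrib mult.assoc)
  have int: "integrable M (\<lambda>\<omega>. \<bar>W n \<omega> - W' n \<omega>\<bar>)" for n
    unfolding d using Y_integrable(1) by simp
  have EY: "(\<integral>\<omega>. \<bar>Y k \<omega>\<bar> \<partial>M) = y" for k
    unfolding y_def distr_Y[of k, symmetric] by (simp add: integral_distr)
  have "(\<integral>\<omega>. \<bar>W n \<omega> - W' n \<omega>\<bar> \<partial>M) \<le> (\<Sum>i\<in>UNIV. \<bar>u i\<bar>) * y * (1 / sd n)" for n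
  proof -
    have "(\<integral>\<omega>. \<bar>W n \<omega> - W' n \<omega>\<bar> \<partial>M) \<le> (\<integral>\<omega>. (\<Sum>i\<in>UNIV. \<bar>u i\<bar> / sd n * \<bar>Y (int (Suc (m i n))) \<omega>\<bar>) \<partial>M)"
    proof (rule integral_mono[OF int])
      show "integrable M (\<lambda>\<omega>. \<Sum>i\<in>UNIV. \<bar>u i\<bar> / sd n * \<bar>Y (int (Suc (m i n))) \<omega>\<bar>)"
        using Y_integrable(1) by simp
      fix \<omega>
      have "\<bar>u i * frac (real n * t i) / sd n * Y (int (Suc (m i n))) \<omega>\<bar> \<le> \<bar>u i\<bar> / sd n * \<bar>Y (int (Suc (m i n))) \<omega>\<bar>" for i
      proof -
        have "\<bar>u i\<bar> * frac (real n * t i) \<le> \<bar>u i\<bar> * 1"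
          using frac_lt_1[of "real n * t i"] by (intro mult_left_mono) auto
        note le = this
        show ?thesis
          unfolding abs_mult abs_divide using divide_right_mono[OF le sd_nonneg[of n]] sd_nonneg[of n]
          by (intro mult_right_mono) auto
      qed
      then show "\<bar>W n \<omega> - W' n \<omega>\<bar> \<le> (\<Sum>i\<in>UNIV. \<bar>u i\<bar> / sd n * \<bar>Y (int (Suc (m i n))) \<omega>\<bar>)"
        unfolding d by (intro order.trans[OF sum_abs sum_mono])
    qed
    also have "\<dots> = (\<Sum>i\<in>UNIV. \<bar>u i\<bar>) * y * (1 / sd n)"
      using Y_integrable(1) by (simp add: EY sum_distrib_right sum_divide_distrib)
    finally show ?thesis .
  qed
  note L1 = this
  have "(\<lambda>n. (\<integral>\<omega>. iexp (W n \<omega>) \<partial>M) - (\<integral>\<omega>. iexp (W' n \<omega>) \<partial>M)) \<longlonglongrightarrow> 0"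
  proof (rule Lim_null_comparison[OF always_eventually])
    show "(\<lambda>n. (\<Sum>i\<in>UNIV. \<bar>u i\<bar>) * y * (1 / sd n)) \<longlonglongrightarrow> 0"
      using tendsto_mult_left[OF inverse_sd, of "(\<Sum>i\<in>UNIV. \<bar>u i\<bar>) * y"] by simp
    show "\<forall>n. cmod ((\<integral>\<omega>. iexp (W n \<omega>) \<partial>M) - (\<integral>\<omega>. iexp (W' n \<omega>) \<partial>M)) \<le> (\<Sum>i\<in>UNIV. \<bar>u i\<bar>) * y * (1 / sd n)"
      by (intro allI order.trans[OF characteristic_difference_le[OF _ _ int] L1]) auto
  qed
  from Lim_transform[OF lim this] show ?thesis unfolding W_def .
qed

lemma rescaled_second_moment:
  assumes "0 \<le> t"
  shows "integrable M (\<lambda>\<omega>. (rescaled n t \<omega>)\<^sup>2)"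
    "\<exists>B. \<forall>n. (\<integral>\<omega>. (rescaled n t \<omega>)\<^sup>2 \<partial>M) \<le> B"
proof -
  define X where "X n = rescaled n t" for n
  define m where "m n = nat \<lfloor>real n * t\<rfloor>" for n
  define b where "b n \<omega> = (2 * (psum (m n) \<omega>)\<^sup>2 + 2 * (Y (int (Suc (m n))) \<omega>)\<^sup>2) / V n" for n \<omega>
  have [measurable]: "X n \<in> borel_measurable M" for n unfolding X_def by (rule rescaled_process_measurable[OF assms])
  have le: "(X n \<omega>)\<^sup>2 \<le> b n \<omega>" for n \<omega>
  proof -
    define f y where "f = frac (real n * t)" and "y = Y (int (Suc (m n))) \<omega>"
    have "f\<^sup>2 \<le> 1" unfolding f_def using frac_lt_1[of "real n * t"] frac_ge_0[of "real n * t"] by (simp add: power_le_one)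
    then have "(f * y)\<^sup>2 \<le> y\<^sup>2" using mult_right_mono[of "f\<^sup>2" 1 "y\<^sup>2"] by (simp add: power_mult_distrib)
    moreover have "(x + z)\<^sup>2 \<le> 2 * x\<^sup>2 + 2 * z\<^sup>2" for x z :: real
      using zero_le_power2[of "x - z"] by (simp add: power2_eq_square algebra_simps)
    ultimately have "(psum (m n) \<omega> + f * y)\<^sup>2 \<le> 2 * (psum (m n) \<omega>)\<^sup>2 + 2 * y\<^sup>2"
      by (smt (verit, best))
    then show ?thesis
      unfolding X_def rescaled_process_eq[OF assms] power_divide sd_sq b_def m_def[symmetric] f_def y_def
      using V_nonneg by (rule divide_right_mono)
  qed
  have bi: "integrable M (b n)" for n unfolding b_def using psum_2 Y_integrable by simp
  have i: "integrable M (\<lambda>\<omega>. (X n \<omega>)\<^sup>2)" for n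
    by (rule Bochner_Integration.integrable_bound[OF bi[of n]]) (use le in \<open>auto intro!: order.trans[OF le abs_ge_self]\<close>)
  then show "integrable M (\<lambda>\<omega>. (rescaled n t \<omega>)\<^sup>2)" unfolding X_def .
  have "(\<integral>\<omega>. b n \<omega> \<partial>M) = 2 * (V (m n) / V n) + 2 * \<sigma>2 * (1 / V n)" for n
    unfolding b_def using psum_2 Y_integrable Y_moments(2)[of 2]
    by (simp add: V_def[symmetric] \<sigma>2_def add_divide_distrib)
  moreover have "(\<lambda>n. 2 * (V (m n) / V n) + 2 * \<sigma>2 * (1 / V n)) \<longlonglongrightarrow> 2 * t powr (1 + 2 * \<alpha>) + 2 * \<sigma>2 * 0"
    unfolding m_def by (intro tendsto_add tendsto_mult_left V_ratio floor_ratio inverse_V assms)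
  ultimately have "(\<lambda>n. \<integral>\<omega>. b n \<omega> \<partial>M) \<longlonglongrightarrow> 2 * t powr (1 + 2 * \<alpha>) + 2 * \<sigma>2 * 0" by simp
  then have "Bseq (\<lambda>n. \<integral>\<omega>. b n \<omega> \<partial>M)" by (rule convergent_imp_Bseq[OF convergentI])
  then obtain K where K: "\<And>n. \<bar>\<integral>\<omega>. b n \<omega> \<partial>M\<bar> \<le> K" by (auto simp: Bseq_def)
  have "(\<integral>\<omega>. (X n \<omega>)\<^sup>2 \<partial>M) \<le> K" for n
    using integral_mono[OF i bi le, of n] K[of n] by linarith
  then show "\<exists>B. \<forall>n. (\<integral>\<omega>. (rescaled n t \<omega>)\<^sup>2 \<partial>M) \<le> B" unfolding X_def by blast
qed

theorem finite_dimensional_convergence: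
  fixes t :: "real ^ 'n" and N :: "'b measure"
  assumes fbm: "fractional_brownian_motion (1 / 2 + \<alpha>) N B" and t: "\<And>i. 0 \<le> t $ i"
  shows "weak_convergence
    (\<lambda>n. distr M borel (\<lambda>\<omega>. \<chi> i. rescaled n (t $ i) \<omega>))
    (distr N borel (\<lambda>\<omega>. \<chi> i. B (t $ i) \<omega>))"
proof -
  define X :: "nat \<Rightarrow> 'a \<Rightarrow> real ^ 'n" where "X n \<omega> = (\<chi> i. rescaled n (t $ i) \<omega>)" for n \<omega>
  define G :: "'b \<Rightarrow> real ^ 'n" where "G \<omega> = (\<chi> i. B (t $ i) \<omega>)" for \<omega>
  have N: "prob_space N" and gp: "gaussian_process N {0..} B"
    and mean: "\<And>s. 0 \<le> s \<Longrightarrow> (\<integral>\<omega>. B s \<omega> \<partial>N) = 0"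
    and cov: "\<And>s r. 0 \<le> s \<Longrightarrow> 0 \<le> r \<Longrightarrow> (\<integral>\<omega>. B s \<omega> * B r \<omega> \<partial>N) = fbm_cov s r"
    using fbm by (auto simp: fractional_brownian_motion_def fbm_cov_def)
  interpret N: prob_space N by (rule N)
  have gauss: "gaussian_rv N (B s)" if "0 \<le> s" for s
    using gp[unfolded gaussian_process_def, rule_format, of "{s}" "\<lambda>_. 1"] that by simp
  note Bs [measurable] = gauss[OF t, unfolded gaussian_rv_def, THEN conjunct1]
  note B2 = gaussian_rv_moments(1,2)[OF gauss[OF t]]
  have Xm [measurable]: "X n \<in> borel_measurable M" for n
    unfolding X_def[abs_def] using rescaled_process_measurable[OF t] by (intro measurable_vec_lambda)
  have Gm [measurable]: "G \<in> borel_measurable N"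
    unfolding G_def[abs_def] by (intro measurable_vec_lambda) measurable
  have normX: "(norm (X n \<omega>))\<^sup>2 = (\<Sum>i\<in>UNIV. (rescaled n (t $ i) \<omega>)\<^sup>2)" for n \<omega>
    by (simp add: X_def norm_vec_def L2_set_def sum_nonneg)
  have normG: "(norm (G \<omega>))\<^sup>2 = (\<Sum>i\<in>UNIV. (B (t $ i) \<omega>)\<^sup>2)" for \<omega>
    by (simp add: G_def norm_vec_def L2_set_def sum_nonneg)
  obtain K where K: "\<And>i n. (\<integral>\<omega>. (rescaled n (t $ i) \<omega>)\<^sup>2 \<partial>M) \<le> K i"
    using rescaled_second_moment(2)[OF t] by metis
  define C where "C = max (\<Sum>i\<in>UNIV. K i) (\<integral>\<omega>. (norm (G \<omega>))\<^sup>2 \<partial>N)"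
  have "weak_convergence (\<lambda>n. distr M borel (X n)) (distr N borel G)"
  proof (rule weak_convergence_trigonometric[where B = C])
    show "integrable M (\<lambda>\<omega>. (norm (X n \<omega>))\<^sup>2)" for n
      unfolding normX using rescaled_second_moment(1)[OF t] by simp
    show "(\<integral>\<omega>. (norm (X n \<omega>))\<^sup>2 \<partial>M) \<le> C" for n
    proof -
      have "(\<integral>\<omega>. (norm (X n \<omega>))\<^sup>2 \<partial>M) \<le> (\<Sum>i\<in>UNIV. K i)"
        unfolding normX using rescaled_second_moment(1)[OF t] K by (simp add: sum_mono)
      then show ?thesis unfolding C_def by simp
    qed
    show "integrable N (\<lambda>\<omega>. (norm (G \<omega>))\<^sup>2)" unfolding normG using B2 by simp
    show "(\<integral>\<omega>. (norm (G \<omega>))\<^sup>2 \<partial>N) \<le> C" unfolding C_def by simp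
    fix w :: "real ^ 'n" and \<phi> :: real
    define v where "v = (\<Sum>i\<in>UNIV. \<Sum>j\<in>UNIV. w $ i * w $ j * fbm_cov (t $ i) (t $ j))"
    have wX: "w \<bullet> X n \<omega> = (\<Sum>i\<in>UNIV. w $ i * rescaled n (t $ i) \<omega>)" for n \<omega>
      by (simp add: X_def inner_vec_def)
    have wG: "w \<bullet> G \<omega> = (\<Sum>i\<in>UNIV. w $ i * B (t $ i) \<omega>)" for \<omega>
      by (simp add: G_def inner_vec_def)
    have iBB: "integrable N (\<lambda>\<omega>. B (t $ i) \<omega> * B (t $ j) \<omega>)" for i j
      by (rule Bochner_Integration.integrable_bound[where f="\<lambda>\<omega>. (B (t $ i) \<omega>)\<^sup>2 + (B (t $ j) \<omega>)\<^sup>2"])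
        (use B2 abs_mult_le_squares in auto)
    have "gaussian_rv N (\<lambda>\<omega>. w \<bullet> G \<omega>)"
    proof -
      \<comment> \<open>Gaussian processes are described by sets of times, so coefficients of repeated times are added up.\<close>
      have "(\<Sum>s\<in>range (($) t). (\<Sum>i | t $ i = s. w $ i) * B s \<omega>) = w \<bullet> G \<omega>" for \<omega>
      proof -
        have "(\<Sum>i\<in>UNIV. w $ i * B (t $ i) \<omega>) = (\<Sum>s\<in>range (($) t). \<Sum>i | t $ i = s. w $ i * B (t $ i) \<omega>)"
          by (rule sum.image_gen[of UNIV _ "($) t", simplified])
        then show ?thesis unfolding wG by (simp add: sum_distrib_right)
      qed
      then show ?thesis
        using gp[unfolded gaussian_process_def, rule_format, of "range (($) t)" "\<lambda>s. \<Sum>i | t $ i = s. w $ i"] t by auto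
    qed
    moreover have "(\<integral>\<omega>. w \<bullet> G \<omega> \<partial>N) = 0"
      unfolding wG using B2 mean[OF t] by simp
    moreover have "(\<integral>\<omega>. (w \<bullet> G \<omega>)\<^sup>2 \<partial>N) = v"
    proof -
      have "(w \<bullet> G \<omega>)\<^sup>2 = (\<Sum>i\<in>UNIV. \<Sum>j\<in>UNIV. w $ i * w $ j * (B (t $ i) \<omega> * B (t $ j) \<omega>))" for \<omega>
        unfolding wG power2_eq_square sum_product by (simp add: mult_ac)
      then show ?thesis using iBB cov[OF t t] by (simp add: v_def)
    qed
    ultimately have "(\<integral>\<omega>. iexp (w \<bullet> G \<omega>) \<partial>N) = complex_of_real (exp (- v / 2))"
      using gaussian_rv_moments(3)[of N "\<lambda>\<omega>. w \<bullet> G \<omega>"] by simp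
    moreover have "(\<lambda>n. \<integral>\<omega>. iexp (w \<bullet> X n \<omega>) \<partial>M) \<longlonglongrightarrow> complex_of_real (exp (- v / 2))"
      unfolding wX v_def by (rule rescaled_characteristic_function[OF t])
    ultimately have "(\<lambda>n. Re (cis \<phi> * (\<integral>\<omega>. iexp (w \<bullet> X n \<omega>) \<partial>M))) \<longlonglongrightarrow> Re (cis \<phi> * (\<integral>\<omega>. iexp (w \<bullet> G \<omega>) \<partial>N))"
      by (intro tendsto_Re tendsto_mult_left) simp
    then show "(\<lambda>n. \<integral>\<omega>. cos (w \<bullet> X n \<omega> + \<phi>) \<partial>M) \<longlonglongrightarrow> (\<integral>\<omega>. cos (w \<bullet> G \<omega> + \<phi>) \<partial>N)"
      by (simp add: integral_cos_iexp prob_space_axioms N)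
  qed (fact prob_space_axioms N Xm Gm)+
  then show ?thesis unfolding X_def[abs_def] G_def[abs_def] .
qed

end

lemma centred_sign_moments:
  assumes P: "prob_space P" and Ym: "Y \<in> borel_measurable P"
    and p: "0 < p" "p < 1" and \<xi>: "\<xi> \<in> borel_measurable P"
    and plus: "measure P {\<omega> \<in> space P. \<xi> \<omega> = 1} = p"
    and minus: "measure P {\<omega> \<in> space P. \<xi> \<omega> = - 1} = 1 - p"
    and Y: "\<And>\<omega>. \<omega> \<in> space P \<Longrightarrow> Y \<omega> = \<xi> \<omega> - (2 * p - 1)"
  shows "integrable P (\<lambda>\<omega>. Y \<omega> ^ 4)" "(\<integral>\<omega>. Y \<omega> \<partial>P) = 0" "0 < (\<integral>\<omega>. (Y \<omega>)\<^sup>2 \<partial>P)"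
proof -
  interpret prob_space P by (rule P)
  define A where "A = {\<omega> \<in> space P. \<xi> \<omega> = 1}"
  define A' where "A' = {\<omega> \<in> space P. \<xi> \<omega> = - 1}"
  have \<xi>m [measurable]: "\<xi> \<in> borel_measurable P" by (rule \<xi>)
  have [measurable]: "A \<in> sets P" "A' \<in> sets P" unfolding A_def A'_def by measurable
  have iA: "integrable P (\<lambda>\<omega>. indicator A \<omega> :: real)" "integrable P (\<lambda>\<omega>. indicator A' \<omega> :: real)"
    by (intro integrable_real_indicator; simp add: less_top[symmetric])+
  have "prob (A \<union> A') = prob A + prob A'" by (rule finite_measure_Union) (auto simp: A_def A'_def)
  then have "prob (A \<union> A') = 1" using plus minus by (simp add: A_def A'_def)
  then have "AE \<omega> in P. \<omega> \<in> A \<union> A'" by (subst (asm) prob_eq_1) auto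
  then have *: "AE \<omega> in P. f (Y \<omega>) = f (2 - 2 * p) * indicator A \<omega> + f (- 2 * p) * indicator A' \<omega>" for f :: "real \<Rightarrow> real"
    by eventually_elim (auto simp: Y A_def A'_def indicator_def)
  have ints: "(\<integral>\<omega>. f (Y \<omega>) \<partial>P) = f (2 - 2 * p) * p + f (- 2 * p) * (1 - p)" "integrable P (\<lambda>\<omega>. f (Y \<omega>))"
    if [measurable]: "f \<in> borel_measurable borel" for f :: "real \<Rightarrow> real"
  proof -
    have "(\<integral>\<omega>. f (Y \<omega>) \<partial>P) = (\<integral>\<omega>. f (2 - 2 * p) * indicator A \<omega> + f (- 2 * p) * indicator A' \<omega> \<partial>P)"
      using Ym *[of f] by (intro integral_cong_AE) auto
    then show "(\<integral>\<omega>. f (Y \<omega>) \<partial>P) = f (2 - 2 * p) * p + f (- 2 * p) * (1 - p)"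
      using plus minus iA by (simp add: A_def[symmetric] A'_def[symmetric])
    have "integrable P (\<lambda>\<omega>. f (2 - 2 * p) * indicator A \<omega> + f (- 2 * p) * indicator A' \<omega>)" using iA by simp
    then show "integrable P (\<lambda>\<omega>. f (Y \<omega>))"
      using Ym *[of f] by (subst integrable_cong_AE) auto
  qed
  show "integrable P (\<lambda>\<omega>. Y \<omega> ^ 4)" by (rule ints(2)) simp
  show "(\<integral>\<omega>. Y \<omega> \<partial>P) = 0" using ints(1)[of "\<lambda>x. x"] by (simp add: algebra_simps)
  have "0 < (2 - 2 * p)\<^sup>2 * p" using p by simp
  moreover have "0 \<le> 4 * p\<^sup>2 * (1 - p)" using p by simp
  moreover have "(\<integral>\<omega>. (Y \<omega>)\<^sup>2 \<partial>P) = (2 - 2 * p)\<^sup>2 * p + 4 * p\<^sup>2 * (1 - p)"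
    using ints(1)[of "\<lambda>x. x\<^sup>2"] by simp
  ultimately show "0 < (\<integral>\<omega>. (Y \<omega>)\<^sup>2 \<partial>P)" by linarith
qed

lemma second_moment_pos:
  fixes Y :: "'c \<Rightarrow> real"
  assumes "Y \<in> borel_measurable P" and i: "integrable P (\<lambda>\<omega>. (Y \<omega>)\<^sup>2)" and pos: "0 < (\<integral>\<omega>. Y \<omega> ^ 4 \<partial>P)"
  shows "0 < (\<integral>\<omega>. (Y \<omega>)\<^sup>2 \<partial>P)"
proof (rule ccontr)
  assume "\<not> ?thesis"
  then have "(\<integral>\<omega>. (Y \<omega>)\<^sup>2 \<partial>P) = 0" by (simp add: not_less antisym)
  then have "AE \<omega> in P. (Y \<omega>)\<^sup>2 = 0" using integral_nonneg_eq_0_iff_AE[OF i] by simp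
  then have "AE \<omega> in P. Y \<omega> ^ 4 = 0" by eventually_elim simp
  then have "(\<integral>\<omega>. Y \<omega> ^ 4 \<partial>P) = 0" by (rule integral_eq_zero_AE)
  then show False using pos by simp
qed

theorem corollary1p2:
  fixes \<alpha> :: real and L :: "real \<Rightarrow> real" and \<mu> :: "nat pmf"
    and P :: "'c measure" and Y :: "'c \<Rightarrow> real"
    and M :: "'a measure" and R :: "int \<Rightarrow> 'a \<Rightarrow> nat" and Z :: "int \<Rightarrow> 'a \<Rightarrow> real"
    and rep :: "int set \<Rightarrow> int"
    and N :: "'b measure" and B :: "real \<Rightarrow> 'b \<Rightarrow> real"
    and t :: "real ^ 'n"
  assumes "0 < \<alpha>" and "\<alpha> < 1 / 2"
    and "\<And>x. 0 < L x" and "slowly_varying L"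
    and "0 \<notin> set_pmf \<mu>"
    and "(\<lambda>n. measure_pmf.prob \<mu> {n..}) \<sim>[sequentially] (\<lambda>n. real n powr (- \<alpha>) * L (real n))"
    and "Gcd {n. 0 < pmf \<mu> n} = 1"
    and "prob_space P" and "Y \<in> borel_measurable P"
    and "(\<exists>p \<xi>. 0 < p \<and> p < 1 \<and> \<xi> \<in> borel_measurable P \<and>
            measure P {\<omega> \<in> space P. \<xi> \<omega> = 1} = p \<and>
            measure P {\<omega> \<in> space P. \<xi> \<omega> = - 1} = 1 - p \<and>
            (\<forall>\<omega>\<in>space P. Y \<omega> = \<xi> \<omega> - (2 * p - 1)))
       \<or> (renewal_weight \<mu> \<sim>[sequentially]
              (\<lambda>n. 1 / (Gamma \<alpha> * Gamma (1 - \<alpha>)) * (real n powr (\<alpha> - 1) / L (real n))) \<and>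
            integrable P (\<lambda>\<omega>. Y \<omega> ^ 4) \<and>
            prob_space.expectation P Y = 0 \<and>
            0 < prob_space.expectation P (\<lambda>\<omega>. Y \<omega> ^ 4))"
    and "component_naming rep"
    and "is_coloured_graph M \<mu> (distr P borel Y) R Z"
    and "fractional_brownian_motion (1 / 2 + \<alpha>) N B"
    and "\<And>i. 0 \<le> t $ i"
  shows "weak_convergence
    (\<lambda>n. distr M borel
      (\<lambda>\<omega>. \<chi> i. rescaled_process M (vertex_colour rep R Z) n (t $ i) \<omega>))
    (distr N borel (\<lambda>\<omega>. \<chi> i. B (t $ i) \<omega>))"
proof -
  note P = assms(8) and Ym = assms(9)
  interpret P: prob_space P by (rule P)
  have Y4: "integrable P (\<lambda>\<omega>. Y \<omega> ^ 4)" and EY: "(\<integral>\<omega>. Y \<omega> \<partial>P) = 0" and EY2: "0 < (\<integral>\<omega>. (Y \<omega>)\<^sup>2 \<partial>P)"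
  proof -
    have "integrable P (\<lambda>\<omega>. Y \<omega> ^ 4) \<and> (\<integral>\<omega>. Y \<omega> \<partial>P) = 0 \<and> 0 < (\<integral>\<omega>. (Y \<omega>)\<^sup>2 \<partial>P)"
      using assms(10)
    proof (elim disjE exE conjE)
      fix p \<xi> assume "0 < p" "p < 1" "\<xi> \<in> borel_measurable P"
        "measure P {\<omega> \<in> space P. \<xi> \<omega> = 1} = p" "measure P {\<omega> \<in> space P. \<xi> \<omega> = - 1} = 1 - p"
        "\<forall>\<omega>\<in>space P. Y \<omega> = \<xi> \<omega> - (2 * p - 1)"
      then show ?thesis using centred_sign_moments[OF P Ym] by blast
    next
      assume Y: "integrable P (\<lambda>\<omega>. Y \<omega> ^ 4)" "(\<integral>\<omega>. Y \<omega> \<partial>P) = 0" "0 < (\<integral>\<omega>. Y \<omega> ^ 4 \<partial>P)"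
      have "integrable P (\<lambda>\<omega>. (Y \<omega>)\<^sup>2)"
        by (rule P.square_integrable_imp_integrable) (use Y(1) Ym in simp_all)
      then show ?thesis using Y second_moment_pos[OF Ym _ Y(3)] by blast
    qed
    then show "integrable P (\<lambda>\<omega>. Y \<omega> ^ 4)" "(\<integral>\<omega>. Y \<omega> \<partial>P) = 0" "0 < (\<integral>\<omega>. (Y \<omega>)\<^sup>2 \<partial>P)" by auto
  qed
  interpret M: prob_space M using assms(12) by (simp add: is_coloured_graph_def)
  interpret coloured_graph \<mu> \<alpha> L M R Z "distr P borel Y" rep
  proof unfold_locales
    show "integrable (distr P borel Y) (\<lambda>x. x ^ 4)" using Ym Y4 by (simp add: integrable_distr_eq)
    show "(\<integral>x. x \<partial>distr P borel Y) = 0" using Ym EY by (simp add: integral_distr)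
    show "0 < (\<integral>x. x\<^sup>2 \<partial>distr P borel Y)" using Ym EY2 by (simp add: integral_distr)
  qed (use assms(1-7) assms(11,12) in \<open>auto simp: is_coloured_graph_def\<close>)
  show ?thesis by (rule finite_dimensional_convergence[OF assms(13,14)])
qed

end
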